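(* Let $v \in S_n$ and let $I$ be any hypercube decomposition of the lower interval $[e,v]\subset S_n$ (where $e$ is the identity). Then \[ q^{\ell(e,v)}P_{e,v}(q^{-1})-P_{e,v}(q) = N_{e,v,I} + Q_{e,v,I}, \] where \[ N_{e,v,I}=\sum_{x\in I\setminus\{e\}} R_{e,x}(q)\,P_{x,v}(q),\qquad Q_{e,v,I}= -q^{\ell(e,v)} \sum_{\varnothing \neq Y\subseteq \mathcal{Y}_e} (q^{-1}-1)^{|Y|} P_{\theta_e(Y),v}(q^{-1}). \]
   Context: $S_n$ is the symmetric group with simple reflections $s_i=(i\;i+1)$, length function $\ell$, and reflections the transpositions. The Bruhat graph $\Gamma$ has vertex set $S_n$ and a directed edge $x\to y$ (labelled by $yx^{-1}$) whenever $yx^{-1}$ is a reflection and $\ell(x)<\ell(y)$. Bruhat order is given by $x\le y$ iff there is a directed path from $x$ to $y$ in $\Gamma$. For $u\le v$, $[u,v]$ is the Bruhat interval, $\Gamma(u,v)$ the induced subgraph of $\Gamma$ on $[u,v]$, and $\ell(u,v)=\ell(v)-\ell(u)$. An $m$-hypercube in $\Gamma(u,v)$ is a subgraph isomorphic to the (upward directed) Hasse diagram of the Boolean lattice of subsets of an $m$-element set; it is spanned by the set of endpoints of the edges leaving its bottom vertex. A diamond is a $2$-hypercube. A subset $I\subseteq[u,v]$ is diamond-closed if whenever $I$ contains three vertices of a diamond in $\Gamma(u,v)$ it contains the fourth. For $I\subseteq[u,v]$ and $x\in I$ let $\mathcal{Y}_x=\{y\in[u,v]\setminus I : x\to y\}$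 and let $\mathcal{A}_x$ be the set of antichains (in Bruhat order, including $\varnothing$) contained in $\mathcal{Y}_x$. There is a hypercube cluster at $x$ (relative to $I$) if for every $Y\in\mathcal{A}_x$ there is a unique hypercube in $\Gamma(u,v)$ with bottom vertex $x$ spanned by $Y$; then $\theta_x(Y)$ denotes its top vertex, and for an arbitrary subset $Y\subseteq\mathcal{Y}_x$, $\theta_x(Y)$ is defined as $\theta_x$ of the set of maximal elements of $Y$. A hypercube decomposition of $[u,v]$ is a subset $I\subseteq[u,v]$ such that $I=[u,z]$ for some $z\in[u,v]$, $I$ is diamond-closed, and there is a hypercube cluster at every $x\in I$ relative to $I$. The Kazhdan–Lusztig $R$-polynomials $R_{u,v}\in\mathbb{Z}[q]$ are defined by: $R_{u,v}=0$ if $u\not\le v$; $R_{u,u}=1$; and if $u<v$ and $s$ is a simple reflection with $sv<v$, then $R_{u,v}=R_{su,sv}$ if $su<u$ and $R_{u,v}=(q-1)R_{u,sv}+qR_{su,sv}$ if $su>u$. The Kazhdan–Lusztig polynomials $P_{u,v}$ are the unique polynomials with $P_{u,v}=0$ if $u\not\le v$, $P_{u,u}=1$, and for $u<v$: $\deg P_{u,v}<\ell(u,v)/2$ and $q^{\ell(u,v)}P_{u,v}(q^{-1})-P_{u,v}(q)=\sum_{x\in(u,v]}R_{u,x}P_{x,v}$. *)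

theory Defs
  imports "HOL-Combinatorics.Permutations" "HOL-Computational_Algebra.Polynomial_Factorial"
begin

section \<open>The symmetric group and its Bruhat order\<close>

type_synonym perm = "nat \<Rightarrow> nat"

abbreviation Sym :: "nat \<Rightarrow> perm set" where
  "Sym n \<equiv> {w. w permutes {1..n}}"

definition simple_reflections :: "nat \<Rightarrow> perm set" where
  "simple_reflections n = {transpose i (i + 1) | i. i \<in> {1..<n}}"

definition reflections :: "nat \<Rightarrow> perm set" where
  "reflections n = {transpose a b | a b. a \<in> {1..n} \<and> b \<in> {1..n} \<and> a \<noteq> b}"

text \<open>Coxeter length: the least number of factors in an expression of \<open>w\<close> as a product of
  simple reflections (the list records their indices).\<close>

definition len :: "nat \<Rightarrow> perm \<Rightarrow> nat" where
  "len n w = (LEAST k. \<exists>is. length is = k \<and> set is \<subseteq> {1..<n} \<and> apply_adj_transps is = w)"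

text \<open>Only used for \<open>u \<le> v\<close>, where the subtraction does not truncate.\<close>

definition len2 :: "nat \<Rightarrow> perm \<Rightarrow> perm \<Rightarrow> nat" where
  "len2 n u v = len n v - len n u"

definition bruhat_graph :: "nat \<Rightarrow> perm rel" where
  "bruhat_graph n =
     {(x, y). x \<in> Sym n \<and> y \<in> Sym n \<and> y \<circ> inv x \<in> reflections n \<and> len n x < len n y}"

definition bruhat_le :: "nat \<Rightarrow> perm \<Rightarrow> perm \<Rightarrow> bool" where
  "bruhat_le n x y \<longleftrightarrow> x \<in> Sym n \<and> y \<in> Sym n \<and> (x, y) \<in> (bruhat_graph n)\<^sup>*"

definition bruhat_less :: "nat \<Rightarrow> perm \<Rightarrow> perm \<Rightarrow> bool" where
  "bruhat_less n x y \<longleftrightarrow> bruhat_le n x y \<and> x \<noteq> y"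

definition bruhat_interval :: "nat \<Rightarrow> perm \<Rightarrow> perm \<Rightarrow> perm set" where
  "bruhat_interval n u v = {x. bruhat_le n u x \<and> bruhat_le n x v}"

text \<open>The edge set of the induced subgraph \<open>\<Gamma>(u,v)\<close>; its vertex set is \<open>bruhat_interval n u v\<close>.\<close>

definition interval_graph :: "nat \<Rightarrow> perm \<Rightarrow> perm \<Rightarrow> perm rel" where
  "interval_graph n u v =
     bruhat_graph n \<inter> (bruhat_interval n u v \<times> bruhat_interval n u v)"


section \<open>Hypercubes\<close>

text \<open>A digraph is a pair of a vertex set and an edge set.  The map \<open>f\<close> is an isomorphism from
  the upward directed Hasse diagram of the Boolean lattice of subsets of \<open>{..<m}\<close> onto the
  digraph \<open>H\<close>.\<close>

definition cube_iso :: "nat \<Rightarrow> (nat set \<Rightarrow> 'a) \<Rightarrow> 'a set \<times> 'a rel \<Rightarrow> bool" where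
  "cube_iso m f H \<longleftrightarrow>
     bij_betw f (Pow {..<m}) (fst H) \<and>
     snd H = {(f X, f (insert a X)) | X a. X \<subseteq> {..<m} \<and> a \<in> {..<m} - X}"

text \<open>Subgraphs are not required to be induced.\<close>

definition hypercube_in :: "nat \<Rightarrow> perm \<Rightarrow> perm \<Rightarrow> nat \<Rightarrow> perm set \<times> perm rel \<Rightarrow> bool" where
  "hypercube_in n u v m H \<longleftrightarrow>
     fst H \<subseteq> bruhat_interval n u v \<and> snd H \<subseteq> interval_graph n u v \<and> (\<exists>f. cube_iso m f H)"

abbreviation diamond_in :: "nat \<Rightarrow> perm \<Rightarrow> perm \<Rightarrow> perm set \<times> perm rel \<Rightarrow> bool" where
  "diamond_in n u v \<equiv> hypercube_in n u v 2"

text \<open>\<open>H\<close> is a hypercube of some dimension in \<open>\<Gamma>(u,v)\<close> with bottom vertex \<open>x\<close> and top vertex \<open>t\<close>,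
  spanned by \<open>Y\<close>, the set of endpoints of the edges of \<open>H\<close> leaving \<open>x\<close>.\<close>

definition spanned_hypercube ::
    "nat \<Rightarrow> perm \<Rightarrow> perm \<Rightarrow> perm \<Rightarrow> perm set \<Rightarrow> perm \<Rightarrow> perm set \<times> perm rel \<Rightarrow> bool" where
  "spanned_hypercube n u v x Y t H \<longleftrightarrow>
     (\<exists>m f. hypercube_in n u v m H \<and> cube_iso m f H \<and>
            f {} = x \<and> f {..<m} = t \<and> Y = {y. (x, y) \<in> snd H})"

definition diamond_closed :: "nat \<Rightarrow> perm \<Rightarrow> perm \<Rightarrow> perm set \<Rightarrow> bool" where
  "diamond_closed n u v I \<longleftrightarrow>
     (\<forall>H. diamond_in n u v H \<and> card (fst H \<inter> I) \<ge> 3 \<longrightarrow> fst H \<subseteq> I)"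

definition outside_nbrs :: "nat \<Rightarrow> perm \<Rightarrow> perm \<Rightarrow> perm set \<Rightarrow> perm \<Rightarrow> perm set" where
  "outside_nbrs n u v I x = {y \<in> bruhat_interval n u v - I. (x, y) \<in> bruhat_graph n}"

definition bruhat_antichain :: "nat \<Rightarrow> perm set \<Rightarrow> bool" where
  "bruhat_antichain n Y \<longleftrightarrow> (\<forall>y\<in>Y. \<forall>y'\<in>Y. bruhat_le n y y' \<longrightarrow> y = y')"

definition bruhat_maximal :: "nat \<Rightarrow> perm set \<Rightarrow> perm set" where
  "bruhat_maximal n Y = {y \<in> Y. \<not> (\<exists>y'\<in>Y. bruhat_less n y y')}"

definition hypercube_cluster :: "nat \<Rightarrow> perm \<Rightarrow> perm \<Rightarrow> perm set \<Rightarrow> perm \<Rightarrow> bool" where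
  "hypercube_cluster n u v I x \<longleftrightarrow>
     (\<forall>Y. Y \<subseteq> outside_nbrs n u v I x \<and> bruhat_antichain n Y \<longrightarrow>
          (\<exists>!H. \<exists>t. spanned_hypercube n u v x Y t H))"

text \<open>\<open>\<theta>\<^sub>x(Y)\<close> for an arbitrary subset \<open>Y\<close> of the neighbours of \<open>x\<close> outside \<open>I\<close>; if \<open>Y\<close> is an
  antichain then \<open>bruhat_maximal n Y = Y\<close>.\<close>

definition cluster_top :: "nat \<Rightarrow> perm \<Rightarrow> perm \<Rightarrow> perm \<Rightarrow> perm set \<Rightarrow> perm" where
  "cluster_top n u v x Y = (THE t. \<exists>H. spanned_hypercube n u v x (bruhat_maximal n Y) t H)"

definition hypercube_decomposition :: "nat \<Rightarrow> perm \<Rightarrow> perm \<Rightarrow> perm set \<Rightarrow> bool" where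
  "hypercube_decomposition n u v I \<longleftrightarrow>
     I \<subseteq> bruhat_interval n u v \<and>
     (\<exists>z\<in>bruhat_interval n u v. I = bruhat_interval n u z) \<and>
     diamond_closed n u v I \<and>
     (\<forall>x\<in>I. hypercube_cluster n u v I x)"


section \<open>Kazhdan--Lusztig polynomials\<close>

text \<open>Identities involving \<open>q\<^sup>-\<^sup>1\<close> are stated in the field of fractions of \<open>\<int>[q]\<close>.\<close>

abbreviation qvar :: "int poly fract" where
  "qvar \<equiv> to_fract [:0, 1:]"

definition eval_at :: "int poly \<Rightarrow> 'a::comm_ring_1 \<Rightarrow> 'a" where
  "eval_at p x = poly (map_poly of_int p) x"

text \<open>The first condition also fixes the values of the family outside \<open>Sym n\<close>, so that the
  family is determined as a function on all of \<open>perm\<close>.\<close>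

definition is_R_family :: "nat \<Rightarrow> (perm \<Rightarrow> perm \<Rightarrow> int poly) \<Rightarrow> bool" where
  "is_R_family n R \<longleftrightarrow>
     (\<forall>u v. \<not> bruhat_le n u v \<longrightarrow> R u v = 0) \<and>
     (\<forall>u\<in>Sym n. R u u = 1) \<and>
     (\<forall>u v. \<forall>s\<in>simple_reflections n.
        bruhat_less n u v \<and> bruhat_less n (s \<circ> v) v \<longrightarrow>
          (bruhat_less n (s \<circ> u) u \<longrightarrow> R u v = R (s \<circ> u) (s \<circ> v)) \<and>
          (bruhat_less n u (s \<circ> u) \<longrightarrow>
             R u v = ([:0, 1:] - 1) * R u (s \<circ> v) + [:0, 1:] * R (s \<circ> u) (s \<circ> v)))"

definition R_poly :: "nat \<Rightarrow> perm \<Rightarrow> perm \<Rightarrow> int poly" where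
  "R_poly n = (THE R. is_R_family n R)"

definition is_KL_family :: "nat \<Rightarrow> (perm \<Rightarrow> perm \<Rightarrow> int poly) \<Rightarrow> bool" where
  "is_KL_family n P \<longleftrightarrow>
     (\<forall>u v. \<not> bruhat_le n u v \<longrightarrow> P u v = 0) \<and>
     (\<forall>u\<in>Sym n. P u u = 1) \<and>
     (\<forall>u v. bruhat_less n u v \<longrightarrow>
        2 * degree (P u v) < len2 n u v \<and>
        qvar ^ len2 n u v * eval_at (P u v) (inverse qvar) - eval_at (P u v) qvar =
          (\<Sum>x | bruhat_less n u x \<and> bruhat_le n x v.
             eval_at (R_poly n u x) qvar * eval_at (P x v) qvar))"

definition KL_poly :: "nat \<Rightarrow> perm \<Rightarrow> perm \<Rightarrow> int poly" where
  "KL_poly n = (THE P. is_KL_family n P)"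

definition N_term :: "nat \<Rightarrow> perm \<Rightarrow> perm \<Rightarrow> perm set \<Rightarrow> int poly fract" where
  "N_term n u v I = (\<Sum>x \<in> I - {u}. eval_at (R_poly n u x) qvar * eval_at (KL_poly n x v) qvar)"

definition Q_term :: "nat \<Rightarrow> perm \<Rightarrow> perm \<Rightarrow> perm set \<Rightarrow> int poly fract" where
  "Q_term n u v I =
     - (qvar ^ len2 n u v) *
       (\<Sum>Y | Y \<noteq> {} \<and> Y \<subseteq> outside_nbrs n u v I u.
          (inverse qvar - 1) ^ card Y *
          eval_at (KL_poly n (cluster_top n u v u Y) v) (inverse qvar))"

end

theory Submission
  imports Defs
begin

text \<open>By the defining relation of the Kazhdan--Lusztig polynomials at \<open>e\<close> and at every \<open>\<theta>\<^sub>e(Y)\<close>, the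
  theorem reduces to \<open>\<Sum>\<^sub>Y (q\<^sup>-\<^sup>1 - 1)\<^bsup>|Y|\<^esup> q\<^bsup>\<ell>(\<theta>(Y))\<^esup> R\<^bsub>\<theta>(Y),w\<^esub> = 0\<close> for every
  \<open>w \<le> v\<close> outside \<open>I\<close>, where \<open>Y\<close> ranges over all subsets of \<open>\<Y>\<^sub>e\<close>.  The hypercube clusters force a
  rigid shape: there is a set \<open>D\<close> of indices such that \<open>I\<close> consists of the \<open>x \<le> v\<close> with
  \<open>s\<^sub>j \<nleq> x\<close> for \<open>j \<in> D\<close>, every reflection in \<open>\<Y>\<^sub>e\<close> is \<open>(m j+1)\<close> or \<open>(j m)\<close> for exactly one \<open>j \<in> D\<close>,
  and \<open>\<theta>\<^sub>e(Y)\<close> is a product of the maximal reflections of \<open>Y\<close> in a definite order.  The sum over \<open>Y\<close>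
  is then the trace of \<open>T\<^sub>w\<close> times a product, over \<open>j \<in> D\<close>, of Jucys--Murphy-like elements of the
  Hecke algebra, and these traces are computed by induction on \<open>D\<close> from the factorization of \<open>w\<close> along
  parabolic subgroups: they vanish as soon as \<open>s\<^sub>j \<le> w\<close> for some \<open>j \<in> D\<close>.\<close>

text \<open>The weights come from inverting generators. With \<open>U\<close> the inverse of
  \<open>T\<close>, a product \<open>U k ... U a U a ... U k\<close> expands at an increasing
  argument over all subsets of positions, with weight \<open>q^-1 - 1\<close> per element; since
  \<open>1 + (q^-1 - 1) = q^-1\<close>, the inner elements of a subset only rescale the term of the
  outermost one. This is why \<open>\<theta>\<close> of an arbitrary subset sees only maximal
  elements. Each index of \<open>D\<close> contributes a hook of reflections whose two legs share
  the corner \<open>(j j+1)\<close>. Joining the legs costs a factor \<open>T j T j\<close>, and the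
  conditional expectation onto the algebra of \<open>T j\<close> yields the inverse of this factor
  up to \<open>q\<close>, which lets traces split. The obstacle is that \<open>w\<close> must factor
  along two parabolic subgroups sharing the letters \<open>j\<close> and \<open>j+1\<close>, and
  that hooks of different indices may share an end letter, so that their order matters. Here the
  geometry enters: diamonds over the identity exclude chains of outside reflections and fix the
  order, and three-dimensional cubes at other vertices of \<open>I\<close> exclude long arcs over
  \<open>j\<close> and overlapping hooks.\<close>

abbreviation adj :: "nat \<Rightarrow> nat \<Rightarrow> nat" where
  "adj i \<equiv> transpose i (Suc i)"

section \<open>Inversions, length and the edges of the Bruhat graph\<close>

definition ninv :: "nat \<Rightarrow> perm \<Rightarrow> nat" where
  "ninv n w = card {(i, j). 1 \<le> i \<and> i < j \<and> j \<le> n \<and> w j < w i}"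

lemma finite_invs: "finite {(i, j). 1 \<le> i \<and> i < j \<and> j \<le> n \<and> (w :: perm) j < w i}"
  by (rule finite_subset[of _ "{1..n} \<times> {1..n}"]) auto

lemma finite_invs' [simp]: "finite {(i, j). Suc 0 \<le> i \<and> i < j \<and> j \<le> n \<and> (w :: perm) j < w i}"
  using finite_invs by simp

lemma Sym_range:
  assumes "w \<in> Sym n" "1 \<le> i" "i \<le> n"
  shows "1 \<le> w i" "w i \<le> n"
  using permutes_in_image[of w "{1..n}" i] assms by simp_all

lemma Sym_fix: "w \<in> Sym n \<Longrightarrow> n < i \<Longrightarrow> w i = i" "w \<in> Sym n \<Longrightarrow> w 0 = 0"
  using permutes_not_in[of w "{1..n}"] by auto

lemma Sym_ge_1_iff: "w \<in> Sym n \<Longrightarrow> 1 \<le> w i \<longleftrightarrow> 1 \<le> i"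
  using Sym_range(1)[of w n i] Sym_fix[of w n] by (metis not_one_le_zero not_le less_one)

lemma Sym_le_iff:
  assumes "w \<in> Sym n"
  shows "w i \<le> n \<longleftrightarrow> i \<le> n"
  using Sym_range(2)[OF assms, of i] Sym_fix[of w n, OF assms] by (cases "i = 0"; cases "i \<le> n") auto

lemma Sym_bij: "w \<in> Sym n \<Longrightarrow> bij w"
  by (simp add: permutes_bij)

lemma Sym_inj: "w \<in> Sym n \<Longrightarrow> w a = w b \<longleftrightarrow> a = b"
  by (simp add: permutes_inj inj_eq)

lemma adj_Sym: "i \<in> {1..<n} \<Longrightarrow> adj i \<in> Sym n"
  by (auto intro: permutes_swap_id)

lemma transpose_Sym: "a \<in> {1..n} \<Longrightarrow> b \<in> {1..n} \<Longrightarrow> transpose a b \<in> Sym n"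
  by (auto intro: permutes_swap_id)

lemma comp_Sym: "x \<in> Sym n \<Longrightarrow> y \<in> Sym n \<Longrightarrow> x \<circ> y \<in> Sym n"
  by (simp add: permutes_compose)

lemma inv_Sym: "x \<in> Sym n \<Longrightarrow> inv x \<in> Sym n"
  by (simp add: permutes_inv)

lemma id_Sym: "id \<in> Sym n"
  by (simp add: permutes_id)

lemma adj_adj [simp]: "x \<circ> adj i \<circ> adj i = x"
  by (simp add: comp_assoc)

text \<open>Relabelling positions by \<open>adj i\<close> matches the inversions of \<open>w\<close>
  with those of \<open>w \<circ> adj i\<close>, apart from the pair \<open>(i, Suc i)\<close>
  itself.\<close>

lemma ninv_adj_up:
  assumes w: "w \<in> Sym n" and i: "i \<in> {1..<n}" and up: "w i < w (Suc i)"
  shows "ninv n (w \<circ> adj i) = Suc (ninv n w)"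
proof -
  let ?I = "\<lambda>w :: perm. {(i, j). 1 \<le> i \<and> i < j \<and> j \<le> n \<and> w j < w i}"
  let ?g = "map_prod (adj i) (adj i)"
  have "?I (w \<circ> adj i) = insert (i, Suc i) (?g ` ?I w)"
  proof (intro set_eqI iffI)
    fix ab assume "ab \<in> ?I (w \<circ> adj i)"
    then obtain a b where ab: "ab = (a, b)" "1 \<le> a" "a < b" "b \<le> n" "w (adj i b) < w (adj i a)"
      by auto
    show "ab \<in> insert (i, Suc i) (?g ` ?I w)"
    proof (cases "a = i \<and> b = Suc i")
      case False
      have "(adj i a, adj i b) \<in> ?I w"
        using ab i up False by (auto simp: transpose_def split: if_splits)
      moreover have "ab = ?g (adj i a, adj i b)" using ab by simp
      ultimately show ?thesis by blast
    qed (use ab in simp)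
  next
    fix ab assume "ab \<in> insert (i, Suc i) (?g ` ?I w)"
    then show "ab \<in> ?I (w \<circ> adj i)"
      using i up by (auto simp: transpose_def split: if_splits)
  qed
  moreover have "(i, Suc i) \<notin> ?g ` ?I w"
    using up by (auto simp: transpose_def split: if_splits)
  moreover have "inj_on ?g (?I w)"
    by (rule inj_on_subset[OF _ subset_UNIV]) (simp add: prod.inj_map)
  ultimately show ?thesis
    by (simp add: ninv_def card_image)
qed

lemma ninv_adj_down:
  assumes w: "w \<in> Sym n" and i: "i \<in> {1..<n}" and dn: "w (Suc i) < w i"
  shows "ninv n w = Suc (ninv n (w \<circ> adj i))"
  using ninv_adj_up[of "w \<circ> adj i" n i] comp_Sym[OF w adj_Sym[OF i]] i dn by simp

lemma ninv_adj_cases: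
  assumes w: "w \<in> Sym n" and i: "i \<in> {1..<n}"
  shows "w i < w (Suc i) \<and> ninv n (w \<circ> adj i) = Suc (ninv n w) \<or>
         w (Suc i) < w i \<and> ninv n w = Suc (ninv n (w \<circ> adj i))"
proof -
  have "w i \<noteq> w (Suc i)" using Sym_inj[OF w] by simp
  then show ?thesis using ninv_adj_up[OF w i] ninv_adj_down[OF w i] by linarith
qed

text \<open>Conjugation by \<open>adj (b - 1)\<close> shortens the transposition. The two outer
  factors change the count by one each and cannot both lower it, since that would need
  \<open>x b < x (b - 1) < x a\<close>; the inner step gains at least one.\<close>

lemma ninv_transpose_up:
  assumes "x \<in> Sym n" "1 \<le> a" "a < b" "b \<le> n" "x a < x b"
  shows "ninv n x < ninv n (x \<circ> transpose a b)"
  using assms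
proof (induction "b - a" arbitrary: x b rule: less_induct)
  case less
  show ?case
  proof (cases "b = Suc a")
    case True
    then show ?thesis using ninv_adj_up[of x n a] less.prems by simp
  next
    case False
    define c where "c = b - 1"
    have b: "b = Suc c" "a < c" using False less.prems by (auto simp: c_def)
    have c: "c \<in> {1..<n}" using b less.prems by auto
    let ?y = "x \<circ> adj c"
    let ?y' = "?y \<circ> transpose a c"
    have y: "?y \<in> Sym n" by (rule comp_Sym[OF less.prems(1) adj_Sym[OF c]])
    have y': "?y' \<in> Sym n" by (rule comp_Sym[OF y transpose_Sym]) (use c b less.prems in auto)
    have ya: "?y a = x a" using b by (simp add: transpose_def)
    have "ninv n ?y < ninv n ?y'"
      by (rule less.hyps) (use y b c less.prems ya in auto)
    moreover have eq: "?y' \<circ> adj c = x \<circ> transpose a b"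
      using b by (auto simp: fun_eq_iff transpose_def)
    moreover have "?y' c = x a" "?y' (Suc c) = x c"
      using b by (auto simp: transpose_def)
    moreover have "x \<in> Sym n" "x a < x (Suc c)" using less.prems b by auto
    ultimately show ?thesis
      using ninv_adj_cases[OF \<open>x \<in> Sym n\<close> c] ninv_adj_cases[OF y' c] by fastforce
  qed
qed

lemma ninv_transpose_iff:
  assumes "x \<in> Sym n" "1 \<le> a" "a < b" "b \<le> n"
  shows "ninv n x < ninv n (x \<circ> transpose a b) \<longleftrightarrow> x a < x b"
proof -
  let ?y = "x \<circ> transpose a b"
  have y: "?y \<in> Sym n" by (rule comp_Sym[OF assms(1) transpose_Sym]) (use assms in auto)
  have "?y \<circ> transpose a b = x" by (simp add: comp_assoc)
  moreover have "x a \<noteq> x b" using Sym_inj[OF assms(1)] assms by simp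
  ultimately show ?thesis
    using ninv_transpose_up[OF assms] ninv_transpose_up[OF y assms(2-4)] by fastforce
qed

lemma Sym_increasing_id:
  assumes w: "w \<in> Sym n" and up: "\<And>i. i \<in> {1..<n} \<Longrightarrow> w i < w (Suc i)"
  shows "w = id"
proof -
  have in_n: "w i \<in> {1..n}" if "i \<in> {1..n}" for i
    using permutes_in_image[of w "{1..n}" i] w that by simp
  have ge: "i \<le> w i" if "i \<le> n" "1 \<le> i" for i
    using that(2,1)
  proof (induction i rule: dec_induct)
    case base then show ?case using in_n[of 1] by auto
  next
    case (step i) then show ?case using up[of i] by auto
  qed
  have le: "w i \<le> i" if "i \<le> n" "1 \<le> i" for i
    using that
  proof (induction i rule: inc_induct)
    case base then show ?case using in_n[of n] by auto
  next
    case (step i) then show ?case using up[of i] by auto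
  qed
  show ?thesis
  proof
    fix i show "w i = id i"
    proof (cases "i \<in> {1..n}")
      case True
      then show ?thesis using ge[of i] le[of i] by auto
    next
      case False
      then show ?thesis using w permutes_not_in[of w "{1..n}" i] by simp
    qed
  qed
qed

lemma exists_descent:
  assumes "w \<in> Sym n" "w \<noteq> id"
  obtains i where "i \<in> {1..<n}" "w (Suc i) < w i"
  using Sym_increasing_id[OF assms(1)] assms Sym_inj[OF assms(1)]
  by (metis linorder_neqE_nat n_not_Suc_n)

lemma ninv_id [simp]: "ninv n id = 0"
proof -
  have "{(i, j). 1 \<le> i \<and> i < j \<and> j \<le> n \<and> id j < id i} = ({} :: (nat \<times> nat) set)" by auto
  then show ?thesis unfolding ninv_def by (simp only: card.empty)
qed

text \<open>Induction along a reduced word, stripping its last letter; it stands in for a choice of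
  reduced words in the recursions below.\<close>

lemma Sym_induct [consumes 1, case_names id descent]:
  assumes "w \<in> Sym n" and "P id"
    and "\<And>w i. w \<in> Sym n \<Longrightarrow> i \<in> {1..<n} \<Longrightarrow> w (Suc i) < w i \<Longrightarrow> P (w \<circ> adj i) \<Longrightarrow> P w"
  shows "P w"
  using assms(1)
proof (induction "ninv n w" arbitrary: w rule: less_induct)
  case less
  show ?case
  proof (cases "w = id")
    case False
    then obtain i where i: "i \<in> {1..<n}" "w (Suc i) < w i"
      using exists_descent less.prems by metis
    then have "P (w \<circ> adj i)"
      using less.hyps[of "w \<circ> adj i"] ninv_adj_down[OF less.prems i] comp_Sym[OF less.prems adj_Sym[OF i(1)]]
      by simp
    then show ?thesis using assms(3) less.prems i by blast
  qed (use assms(2) in simp)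
qed

text \<open>Stripping descents yields a word with one letter per inversion, and no word is shorter
  because a letter changes the count by only one.\<close>

lemma len_eq_ninv:
  assumes w: "w \<in> Sym n"
  shows "len n w = ninv n w"
proof -
  let ?Q = "\<lambda>k. \<exists>is. length is = k \<and> set is \<subseteq> {1..<n} \<and> apply_adj_transps is = w"
  have ex: "?Q (ninv n w)"
    using w
  proof (induction rule: Sym_induct)
    case id
    show ?case by (rule exI[of _ "[]"]) (simp only: ninv_id, simp)
  next
    case (descent w i)
    then obtain "is" where is': "length is = ninv n (w \<circ> adj i)" "set is \<subseteq> {1..<n}"
        "apply_adj_transps is = w \<circ> adj i" by blast
    then show ?case
      using descent ninv_adj_down[of w n i]
      by (intro exI[of _ "is @ [i]"]) auto
  qed
  have "ninv n (apply_adj_transps is) \<le> length is \<and> apply_adj_transps is \<in> Sym n"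
    if "set is \<subseteq> {1..<n}" for "is"
    using that
  proof (induction "is" rule: rev_induct)
    case Nil
    show ?case using id_Sym by (simp only: apply_adj_transps_Nil ninv_id) simp
  next
    case (snoc i "is")
    then have w: "apply_adj_transps is \<in> Sym n" and i: "i \<in> {1..<n}"
      and l: "ninv n (apply_adj_transps is) \<le> length is" by auto
    have eq: "apply_adj_transps (is @ [i]) = apply_adj_transps is \<circ> adj i"
      by (simp only: apply_adj_transps_snoc Suc_eq_plus1)
    have "ninv n (apply_adj_transps is \<circ> adj i) \<le> length (is @ [i])"
      using ninv_adj_cases[OF w i] l by fastforce
    then show ?case
      unfolding eq using comp_Sym[OF w adj_Sym[OF i]] by blast
  qed
  then have "ninv n w \<le> k" if "?Q k" for k
    using that by auto
  then show ?thesis unfolding len_def using ex by (intro Least_equality)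
qed

lemma transpose_conj:
  assumes "bij x"
  shows "transpose (x a) (x b) \<circ> x = x \<circ> transpose a b"
proof
  fix k show "(transpose (x a) (x b) \<circ> x) k = (x \<circ> transpose a b) k"
    using bij_is_inj[OF assms] by (auto simp: transpose_def inj_eq)
qed

lemma transpose_left:
  assumes "bij x"
  shows "transpose c d \<circ> x = x \<circ> transpose (inv x c) (inv x d)"
  using transpose_conj[OF assms, of "inv x c" "inv x d"] assms
  by (simp add: bij_is_surj surj_f_inv_f)

text \<open>The label of an edge acts on values; conjugation by \<open>x\<close> turns it into a
  transposition of positions, for which the inversion count is available.\<close>

lemma bruhat_edgeI:
  assumes x: "x \<in> Sym n" and ab: "1 \<le> a" "a < b" "b \<le> n" "x a < x b"
  shows "(x, x \<circ> transpose a b) \<in> bruhat_graph n"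
proof -
  let ?y = "x \<circ> transpose a b"
  have y: "?y \<in> Sym n" by (rule comp_Sym[OF x transpose_Sym]) (use ab in auto)
  have "?y \<circ> inv x = transpose (x a) (x b) \<circ> (x \<circ> inv x)"
    using transpose_conj[OF Sym_bij[OF x]] by (simp add: comp_assoc[symmetric])
  also have "\<dots> = transpose (x a) (x b)"
    using x by (metis comp_id mem_Collect_eq permutes_inv_o(1))
  finally have "?y \<circ> inv x = transpose (x a) (x b)" .
  moreover have "x a \<in> {1..n}" "x b \<in> {1..n}"
    using Sym_range[OF x] ab by simp_all
  moreover have "x a \<noteq> x b" using ab by simp
  ultimately have "?y \<circ> inv x \<in> reflections n"
    unfolding reflections_def by blast
  then show ?thesis
    using x y ninv_transpose_up[OF x ab] by (simp add: bruhat_graph_def len_eq_ninv)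
qed

lemma bruhat_edgeE:
  assumes "(x, y) \<in> bruhat_graph n"
  obtains a b where "x \<in> Sym n" "1 \<le> a" "a < b" "b \<le> n" "x a < x b" "y = x \<circ> transpose a b"
proof -
  from assms have x: "x \<in> Sym n" and y: "y \<in> Sym n" and r: "y \<circ> inv x \<in> reflections n"
    and l: "ninv n x < ninv n y"
    by (auto simp: bruhat_graph_def len_eq_ninv)
  from r obtain c d where cd: "c \<in> {1..n}" "d \<in> {1..n}" "c \<noteq> d" "y \<circ> inv x = transpose c d"
    by (auto simp: reflections_def)
  have "y = (y \<circ> inv x) \<circ> x"
    using x by (metis comp_assoc comp_id mem_Collect_eq permutes_inv_o(2))
  then have y': "y = x \<circ> transpose (inv x c) (inv x d)"
    using transpose_left[OF Sym_bij[OF x]] cd by simp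
  define a b where "a = min (inv x c) (inv x d)" and "b = max (inv x c) (inv x d)"
  have ne: "inv x c \<noteq> inv x d" using cd Sym_inj[OF inv_Sym[OF x]] by simp
  have "inv x c \<in> {1..n}" "inv x d \<in> {1..n}"
    using cd Sym_range[OF inv_Sym[OF x]] by simp_all
  then have ab: "1 \<le> a" "a < b" "b \<le> n" using ne by (auto simp: a_def b_def)
  have y'': "y = x \<circ> transpose a b"
    using y' by (auto simp: a_def b_def min_def max_def transpose_commute)
  have "x a < x b" using ninv_transpose_iff[OF x ab] l y'' by simp
  then show ?thesis using that x ab y'' by blast
qed

lemma bruhat_edge_less: "(x, y) \<in> bruhat_graph n \<Longrightarrow> ninv n x < ninv n y"
  by (auto simp: bruhat_graph_def len_eq_ninv)

lemma bruhat_edge_leftI: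
  assumes x: "x \<in> Sym n" and cd: "1 \<le> c" "c < d" "d \<le> n" "inv x c < inv x d"
  shows "(x, transpose c d \<circ> x) \<in> bruhat_graph n"
proof -
  have "inv x c \<in> {1..n}" "inv x d \<in> {1..n}"
    using cd Sym_range[OF inv_Sym[OF x]] by simp_all
  moreover have "x (inv x c) < x (inv x d)"
    using x cd by (simp add: permutes_inverses)
  ultimately show ?thesis
    using bruhat_edgeI[OF x, of "inv x c" "inv x d"] cd transpose_left[OF Sym_bij[OF x]] by simp
qed

lemma bruhat_edge_leftE:
  assumes "(x, y) \<in> bruhat_graph n"
  obtains c d where "x \<in> Sym n" "1 \<le> c" "c < d" "d \<le> n" "inv x c < inv x d" "y = transpose c d \<circ> x"
proof -
  from assms obtain a b where ab: "x \<in> Sym n" "1 \<le> a" "a < b" "b \<le> n" "x a < x b"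
    "y = x \<circ> transpose a b" by (rule bruhat_edgeE)
  have "x a \<in> {1..n}" "x b \<in> {1..n}" using ab Sym_range[OF ab(1)] by simp_all
  moreover have "y = transpose (x a) (x b) \<circ> x" using transpose_conj[OF Sym_bij[OF ab(1)]] ab by simp
  moreover have "inv x (x a) < inv x (x b)" using ab by (simp add: permutes_inverses)
  ultimately show ?thesis using that ab by auto
qed

section \<open>The rank criterion for Bruhat order\<close>

text \<open>The dominance rank matrix, counting points of the permutation matrix in a quadrant.
  Bruhat order becomes entrywise comparison of these matrices.\<close>

definition rk :: "perm \<Rightarrow> nat \<Rightarrow> nat \<Rightarrow> nat" where
  "rk w p q = card {k. 1 \<le> k \<and> k \<le> p \<and> q \<le> w k}"

lemma finite_rk [simp]: "finite {k. Suc 0 \<le> k \<and> k \<le> p \<and> Q k}" "finite {k. 1 \<le> k \<and> k \<le> p \<and> Q k}"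
  by (auto intro: finite_subset[of _ "{..p}"])

lemma rk_0 [simp]: "rk w 0 q = 0"
proof -
  have "{k. 1 \<le> k \<and> k \<le> 0 \<and> q \<le> w k} = {}" by auto
  then show ?thesis by (simp only: rk_def card.empty)
qed

lemma rk_edge_mono:
  assumes "1 \<le> a" "a < b" "x a < x b"
  shows "rk x p q \<le> rk (x \<circ> transpose a b) p q"
proof (cases "b \<le> p")
  case True
  let ?t = "transpose a b"
  have "{k. 1 \<le> k \<and> k \<le> p \<and> q \<le> x k} = ?t ` {k. 1 \<le> k \<and> k \<le> p \<and> q \<le> (x \<circ> ?t) k}"
  proof (intro set_eqI iffI)
    fix k assume "k \<in> {k. 1 \<le> k \<and> k \<le> p \<and> q \<le> x k}"
    then have "?t k \<in> {k. 1 \<le> k \<and> k \<le> p \<and> q \<le> (x \<circ> ?t) k}"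
      using True assms by (auto simp: transpose_def)
    then show "k \<in> ?t ` {k. 1 \<le> k \<and> k \<le> p \<and> q \<le> (x \<circ> ?t) k}"
      by (rule image_eqI[rotated]) simp
  qed (use True assms in \<open>auto simp: transpose_def\<close>)
  then show ?thesis by (simp add: rk_def card_image del: comp_apply)
next
  case False
  show ?thesis unfolding rk_def
    by (rule card_mono) (use False assms in \<open>auto simp: transpose_def\<close>)
qed

lemma bruhat_le_imp_rk_le:
  assumes "bruhat_le n x y"
  shows "rk x p q \<le> rk y p q"
proof -
  have "(x, y) \<in> (bruhat_graph n)\<^sup>*" using assms by (simp add: bruhat_le_def)
  then show ?thesis
  proof (induction rule: rtrancl_induct)
    case (step y z)
    then show ?case using rk_edge_mono by (metis bruhat_edgeE order_trans)
  qed simp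
qed

lemma ninv_le: "ninv n w \<le> n * n"
proof -
  have "ninv n w \<le> card ({1..n} \<times> {1..n})"
    unfolding ninv_def by (rule card_mono) auto
  then show ?thesis by simp
qed

text \<open>At the first position \<open>a\<close> where the two permutations differ,
  \<open>x a < y a\<close>. Exchanging \<open>x a\<close> with the first later value of
  \<open>x\<close> in the interval from \<open>x a\<close> (excluded) to \<open>y a\<close>
  (included) climbs one edge and stays below \<open>y\<close>.\<close>

lemma rk_le_step:
  assumes x: "x \<in> Sym n" and y: "y \<in> Sym n" and le: "\<And>p q. rk x p q \<le> rk y p q" and ne: "x \<noteq> y"
  obtains a b where "1 \<le> a" "a < b" "b \<le> n" "x a < x b"
    "\<And>p q. rk (x \<circ> transpose a b) p q \<le> rk y p q"
proof -
  define a where "a = (LEAST a. x a \<noteq> y a)"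
  have a: "x a \<noteq> y a" unfolding a_def by (rule LeastI_ex) (use ne in \<open>auto simp: fun_eq_iff\<close>)
  have before: "x k = y k" if "k < a" for k using that not_less_Least unfolding a_def by blast
  have an: "a \<in> {1..n}" using a permutes_not_in[of x "{1..n}" a] permutes_not_in[of y "{1..n}" a] x y by force
  have xa: "x a < y a"
  proof (rule ccontr)
    assume "\<not> ?thesis"
    then have "y a < x a" using a by simp
    then have "x a \<le> y k \<Longrightarrow> x a \<le> x k" if "k \<le> a" for k
      using before[of k] that by (cases "k = a") auto
    then have "{k. 1 \<le> k \<and> k \<le> a \<and> x a \<le> y k} \<subseteq> {k. 1 \<le> k \<and> k \<le> a \<and> x a \<le> x k}"
      by blast
    moreover have "a \<in> {k. 1 \<le> k \<and> k \<le> a \<and> x a \<le> x k}" "a \<notin> {k. 1 \<le> k \<and> k \<le> a \<and> x a \<le> y k}"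
      using an \<open>y a < x a\<close> by simp_all
    ultimately have "{k. 1 \<le> k \<and> k \<le> a \<and> x a \<le> y k} \<subset> {k. 1 \<le> k \<and> k \<le> a \<and> x a \<le> x k}"
      by blast
    then have "rk y a (x a) < rk x a (x a)" unfolding rk_def by (rule psubset_card_mono[rotated]) simp
    then show False using le[of a "x a"] by simp
  qed
  define Q where "Q = (\<lambda>b. a < b \<and> x a < x b \<and> x b \<le> y a)"
  have "x (inv x (y a)) = y a" using x by (simp add: permutes_inverses)
  moreover have "a < inv x (y a)"
    using calculation before Sym_inj[OF y] a by (metis linorder_neqE_nat)
  ultimately have exQ: "Q (inv x (y a))" using xa by (simp add: Q_def)
  define b where "b = (LEAST b. Q b)"
  have b: "a < b" "x a < x b" "x b \<le> y a"
    using LeastI[of Q, OF exQ] by (auto simp: b_def Q_def)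
  have between: "x k \<le> x a \<or> y a < x k" if "a < k" "k < b" for k
    using that not_less_Least[of k Q] unfolding b_def[symmetric] by (auto simp: Q_def)
  have yan: "y a \<le> n" using an Sym_range[OF y] by simp
  have bn: "b \<le> n"
    using b yan Sym_le_iff[OF x, of b] by simp
  \<comment> \<open>The exchange raises only ranks with \<open>a \<le> p < b\<close> and
    \<open>x a < q \<le> x b\<close>. By the choice of \<open>b\<close>, no value of
    \<open>x\<close> strictly between the positions \<open>a\<close> and \<open>b\<close> lies in
    that window. So the count splits into values above \<open>y a\<close>, compared by rank, and
    positions before \<open>a\<close>, where \<open>x\<close> and \<open>y\<close> agree.\<close>
  have "rk (x \<circ> transpose a b) p q \<le> rk y p q" for p q
  proof (cases "a \<le> p \<and> p < b \<and> x a < q \<and> q \<le> x b")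
    case True
    let ?A = "{k. 1 \<le> k \<and> k < a \<and> q \<le> y k \<and> y k \<le> y a}"
    let ?B = "\<lambda>w. {k. 1 \<le> k \<and> k \<le> p \<and> Suc (y a) \<le> w k}"
    have fA: "finite ?A" by (rule finite_subset[of _ "{..a}"]) auto
    have "{k. 1 \<le> k \<and> k \<le> p \<and> q \<le> (x \<circ> transpose a b) k} \<subseteq> insert a (?A \<union> ?B x)"
    proof
      fix k assume k: "k \<in> {k. 1 \<le> k \<and> k \<le> p \<and> q \<le> (x \<circ> transpose a b) k}"
      consider "k < a" | "k = a" | "a < k" by linarith
      then show "k \<in> insert a (?A \<union> ?B x)"
      proof cases
        case 1
        then have "transpose a b k = k" using b by (simp add: transpose_def)
        then show ?thesis using k 1 before[OF 1] by (cases "y k \<le> y a") simp_all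
      next
        case 3
        then have t: "transpose a b k = k" "k < b" using k True by (simp_all add: transpose_def)
        then have "q \<le> x k" using k by simp
        then have "y a < x k" using between[OF 3 t(2)] True by simp
        then show ?thesis using k by simp
      qed simp
    qed
    then have "rk (x \<circ> transpose a b) p q \<le> card (insert a (?A \<union> ?B x))"
      unfolding rk_def by (rule card_mono[rotated]) (use fA in simp)
    also have "\<dots> \<le> Suc (card ?A + card (?B x))"
      by (rule order_trans[OF card_insert_le_m1[of "Suc (card ?A + card (?B x))"]]) (use card_Un_le[of ?A "?B x"] in auto)
    also have "card (?B x) \<le> card (?B y)"
      using le[of p "Suc (y a)"] by (simp add: rk_def)
    also have "Suc (card ?A + card (?B y)) = card (insert a (?A \<union> ?B y))"
    proof -
      have "a \<notin> ?A \<union> ?B y" by auto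
      then have "card (insert a (?A \<union> ?B y)) = Suc (card (?A \<union> ?B y))"
        using fA by simp
      also have "card (?A \<union> ?B y) = card ?A + card (?B y)"
        by (rule card_Un_disjoint) (use fA in auto)
      finally show ?thesis by simp
    qed
    also have "insert a (?A \<union> ?B y) \<subseteq> {k. 1 \<le> k \<and> k \<le> p \<and> q \<le> y k}"
      using True an b by auto
    then have "card (insert a (?A \<union> ?B y)) \<le> rk y p q"
      unfolding rk_def by (rule card_mono[rotated]) simp
    finally show ?thesis by simp
  next
    case False
    have "rk (x \<circ> transpose a b) p q \<le> rk x p q"
    proof (cases "b \<le> p")
      case True
      then show ?thesis
        unfolding rk_def using an b
        by (intro card_inj_on_le[where f = "transpose a b"]) (auto simp: transpose_def split: if_splits)
    next
      case F2: False
      then show ?thesis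
        unfolding rk_def using False b an
        by (intro card_mono) (auto simp: transpose_def split: if_splits)
    qed
    then show ?thesis using le[of p q] by simp
  qed
  then show ?thesis using that an b bn by auto
qed

theorem bruhat_le_iff_rk:
  "bruhat_le n x y \<longleftrightarrow> x \<in> Sym n \<and> y \<in> Sym n \<and> (\<forall>p q. rk x p q \<le> rk y p q)"
proof
  assume "bruhat_le n x y"
  then show "x \<in> Sym n \<and> y \<in> Sym n \<and> (\<forall>p q. rk x p q \<le> rk y p q)"
    using bruhat_le_imp_rk_le by (auto simp: bruhat_le_def)
next
  assume r: "x \<in> Sym n \<and> y \<in> Sym n \<and> (\<forall>p q. rk x p q \<le> rk y p q)"
  then have "(x, y) \<in> (bruhat_graph n)\<^sup>*"
  proof (induction "n * n - ninv n x" arbitrary: x rule: less_induct)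
    case less
    show ?case
    proof (cases "x = y")
      case False
      then obtain a b where ab: "1 \<le> a" "a < b" "b \<le> n" "x a < x b"
          "\<And>p q. rk (x \<circ> transpose a b) p q \<le> rk y p q"
        using rk_le_step[of x n y] less.prems by blast
      let ?x = "x \<circ> transpose a b"
      have e: "(x, ?x) \<in> bruhat_graph n" using bruhat_edgeI ab less.prems by blast
      then have "?x \<in> Sym n" "ninv n x < ninv n ?x"
        using bruhat_edge_less by (auto simp: bruhat_graph_def)
      then have "(?x, y) \<in> (bruhat_graph n)\<^sup>*"
        using less.prems ab ninv_le[of n ?x] by (intro less.hyps) auto
      then show ?thesis using e by (meson converse_rtrancl_into_rtrancl)
    qed simp
  qed
  then show "bruhat_le n x y" using r by (simp add: bruhat_le_def)
qed

text \<open>Up to the constants, both ranks are complements of the same number: the points with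
  position at most \<open>p\<close> and value below \<open>q\<close>.\<close>

lemma rk_inv:
  assumes w: "w \<in> Sym n" and q: "1 \<le> q"
  shows "rk w p q + (q - 1) = p + rk (inv w) (q - 1) (Suc p)"
proof -
  have iw: "inv w (w x) = x" "w (inv w x) = x" for x
    using w by (auto simp: permutes_inverses)
  have w1: "1 \<le> w k \<longleftrightarrow> 1 \<le> k" for k
    by (rule Sym_ge_1_iff[OF w])
  have w1': "1 \<le> inv w k \<longleftrightarrow> 1 \<le> k" for k using w1[of "inv w k"] iw by simp
  let ?A = "{k. 1 \<le> k \<and> k \<le> p \<and> q \<le> w k}"
  let ?B = "{k. 1 \<le> k \<and> k \<le> p \<and> w k < q}"
  let ?B' = "{m. 1 \<le> m \<and> m \<le> q - 1 \<and> inv w m \<le> p}"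
  let ?C = "{m. 1 \<le> m \<and> m \<le> q - 1 \<and> Suc p \<le> inv w m}"
  have "card (?A \<union> ?B) = card ?A + card ?B" by (rule card_Un_disjoint) auto
  moreover have "?A \<union> ?B = {1..p}" by auto
  ultimately have 1: "card ?A + card ?B = p" by simp
  have "card (?B' \<union> ?C) = card ?B' + card ?C" by (rule card_Un_disjoint) auto
  moreover have "?B' \<union> ?C = {1..q - 1}" by auto
  ultimately have 2: "card ?B' + card ?C = q - 1" by simp
  have "w ` ?B \<subseteq> ?B'"
  proof (rule image_subsetI)
    fix k assume "k \<in> ?B"
    then have "1 \<le> k" "k \<le> p" "w k < q" by simp_all
    then show "w k \<in> ?B'" using w1[of k] iw(1)[of k] by simp
  qed
  moreover have "inv w ` ?B' \<subseteq> ?B"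
  proof (rule image_subsetI)
    fix k assume "k \<in> ?B'"
    then have "1 \<le> k" "k \<le> q - 1" "inv w k \<le> p" by simp_all
    then show "inv w k \<in> ?B" using w1'[of k] iw(2)[of k] q by simp
  qed
  ultimately have "bij_betw w ?B ?B'"
    by (intro bij_betw_byWitness[where f' = "inv w"]) (simp_all add: iw)
  then have "card ?B = card ?B'" by (rule bij_betw_same_card)
  then show ?thesis using 1 2 by (simp add: rk_def)
qed

lemma bruhat_le_inv:
  assumes "bruhat_le n x y"
  shows "bruhat_le n (inv x) (inv y)"
proof -
  have x: "x \<in> Sym n" and y: "y \<in> Sym n" and le: "\<And>p q. rk x p q \<le> rk y p q"
    using assms by (auto simp: bruhat_le_iff_rk)
  have "rk (inv x) p q \<le> rk (inv y) p q" for p q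
  proof (cases q)
    case 0
    then show ?thesis by (simp add: rk_def)
  next
    case (Suc r)
    then show ?thesis
      using rk_inv[OF x, of "Suc p" r] rk_inv[OF y, of "Suc p" r] le[of r "Suc p"] by simp
  qed
  then show ?thesis using x y inv_Sym by (auto simp: bruhat_le_iff_rk)
qed

text \<open>For \<open>p < q\<close> the number \<open>rk w p q\<close> counts the arcs \<open>k \<rightarrow> w k\<close> of
  excedances that cover the interval \<open>[p,q]\<close>; the remaining ranks are determined by the arcs of
  the inverse.\<close>

lemma bruhat_leI:
  assumes x: "x \<in> Sym n" and y: "y \<in> Sym n"
    and up: "\<And>p q. 1 \<le> p \<Longrightarrow> p < q \<Longrightarrow> q \<le> n \<Longrightarrow> rk x p q \<le> rk y p q"
    and dn: "\<And>p q. 1 \<le> p \<Longrightarrow> p < q \<Longrightarrow> q \<le> n \<Longrightarrow> rk (inv x) p q \<le> rk (inv y) p q"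
  shows "bruhat_le n x y"
proof -
  have big: "rk w p q = 0" if wn: "w \<in> Sym n" "n < q" "p < q" for w p q
  proof -
    have "w k < q" if "k \<le> p" for k
      using that Sym_le_iff[OF wn(1), of k] Sym_fix(1)[OF wn(1), of k] wn by (cases "k \<le> n") auto
    then have "{k. 1 \<le> k \<and> k \<le> p \<and> q \<le> w k} = {}" by (auto simp: not_le[symmetric])
    then show ?thesis by (simp only: rk_def card.empty)
  qed
  have up': "rk x p q \<le> rk y p q" if "p < q" for p q
    using up[of p q] big[OF x, of q p] that by (cases "n < q"; cases "p = 0") simp_all
  have dn': "rk (inv x) p q \<le> rk (inv y) p q" if "p < q" for p q
    using dn[of p q] big[OF inv_Sym[OF x], of q p] that
    by (cases "n < q"; cases "p = 0") simp_all
  have "rk x p q \<le> rk y p q" for p q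
  proof (cases "p < q")
    case False
    show ?thesis
    proof (cases q)
      case 0
      then show ?thesis by (simp add: rk_def)
    next
      case (Suc r)
      then show ?thesis
        using rk_inv[OF x, of q p] rk_inv[OF y, of q p] dn'[of r "Suc p"] False by simp
    qed
  next
    case True
    then show ?thesis by (rule up')
  qed
  then show ?thesis using x y by (simp add: bruhat_le_iff_rk)
qed

section \<open>Elementary properties of the order and the lifting property\<close>

lemma bruhat_refl: "x \<in> Sym n \<Longrightarrow> bruhat_le n x x"
  by (simp add: bruhat_le_def)

lemma bruhat_trans: "bruhat_le n x y \<Longrightarrow> bruhat_le n y z \<Longrightarrow> bruhat_le n x z"
  by (auto simp: bruhat_le_def)

lemma bruhat_edge_le: "(x, y) \<in> bruhat_graph n \<Longrightarrow> bruhat_le n x y"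
  by (auto simp: bruhat_le_def bruhat_graph_def)

lemma bruhat_le_Sym: "bruhat_le n x y \<Longrightarrow> x \<in> Sym n" "bruhat_le n x y \<Longrightarrow> y \<in> Sym n"
  by (simp_all add: bruhat_le_def)

lemma bruhat_le_ninv:
  assumes "bruhat_le n x y"
  shows "x = y \<or> ninv n x < ninv n y"
proof -
  have "(x, y) \<in> (bruhat_graph n)\<^sup>*" using assms by (simp add: bruhat_le_def)
  then show ?thesis by (induction rule: rtrancl_induct) (auto dest: bruhat_edge_less)
qed

lemma bruhat_antisym: "bruhat_le n x y \<Longrightarrow> bruhat_le n y x \<Longrightarrow> x = y"
  using bruhat_le_ninv by (metis less_asym)

lemma bruhat_less_ninv: "bruhat_less n x y \<Longrightarrow> ninv n x < ninv n y"
  using bruhat_le_ninv by (auto simp: bruhat_less_def)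

lemma bruhat_id_le: "x \<in> Sym n \<Longrightarrow> bruhat_le n id x"
proof (induction rule: Sym_induct)
  case id
  then show ?case by (rule bruhat_refl[OF id_Sym])
next
  case (descent w i)
  have "w \<circ> adj i \<in> Sym n" by (rule comp_Sym[OF descent(1) adj_Sym[OF descent(2)]])
  then have "(w \<circ> adj i, w \<circ> adj i \<circ> adj i) \<in> bruhat_graph n"
    using descent by (intro bruhat_edgeI) auto
  then show ?case using descent bruhat_edge_le bruhat_trans by (metis adj_adj)
qed

lemma bruhat_descent_le:
  assumes "w \<in> Sym n" "i \<in> {1..<n}" "w (Suc i) < w i"
  shows "bruhat_less n (w \<circ> adj i) w"
proof -
  have "w \<circ> adj i \<in> Sym n" by (rule comp_Sym[OF assms(1) adj_Sym[OF assms(2)]])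
  then have "(w \<circ> adj i, w \<circ> adj i \<circ> adj i) \<in> bruhat_graph n"
    using assms by (intro bruhat_edgeI) auto
  then show ?thesis using bruhat_edge_le bruhat_edge_less unfolding bruhat_less_def
    by (metis adj_adj less_irrefl)
qed

text \<open>Right multiplication by \<open>adj i\<close> changes only the row \<open>p = i\<close>
  of the rank matrix, and that row is controlled by the neighbouring rows.\<close>

lemma bruhat_lift:
  assumes le: "bruhat_le n u v" and i: "i \<in> {1..<n}" and v: "v i < v (Suc i)"
  shows "bruhat_le n (u \<circ> adj i) (v \<circ> adj i)"
proof -
  have u': "u \<in> Sym n" and v': "v \<in> Sym n" and r: "\<And>p q. rk u p q \<le> rk v p q"
    using le by (auto simp: bruhat_le_iff_rk)
  have same: "rk (w \<circ> adj i) p q = rk w p q" if "p \<noteq> i" for w p q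
  proof -
    have *: "rk (w \<circ> adj i) p q \<le> rk w p q" for w
      unfolding rk_def using that i
      by (intro card_inj_on_le[where f = "adj i"]) (auto simp: transpose_def split: if_splits)
    show ?thesis using *[of w] *[of "w \<circ> adj i"] by simp
  qed
  have at_i: "rk (w \<circ> adj i) i q = rk w (i - 1) q + (if q \<le> w (Suc i) then 1 else 0)" for w :: perm and q
  proof -
    have "{k. 1 \<le> k \<and> k \<le> i \<and> q \<le> (w \<circ> adj i) k} =
        {k. 1 \<le> k \<and> k \<le> i - 1 \<and> q \<le> w k} \<union> (if q \<le> w (Suc i) then {i} else {})"
      using i by (auto simp: transpose_def)
    moreover have "card ({k. 1 \<le> k \<and> k \<le> i - 1 \<and> q \<le> w k} \<union> (if q \<le> w (Suc i) then {i} else {})) =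
        card {k. 1 \<le> k \<and> k \<le> i - 1 \<and> q \<le> w k} + card (if q \<le> w (Suc i) then {i} else {})"
      using i by (intro card_Un_disjoint) auto
    ultimately show ?thesis unfolding rk_def by (simp del: comp_apply)
  qed
  have "rk (u \<circ> adj i) p q \<le> rk (v \<circ> adj i) p q" for p q
  proof (cases "p = i")
    case True
    show ?thesis
    proof (cases "q \<le> v (Suc i)")
      case True
      then show ?thesis using \<open>p = i\<close> at_i[of u q] at_i[of v q] r[of "i - 1" q] by simp
    next
      case False
      \<comment> \<open>Here \<open>q\<close> exceeds both \<open>v i\<close> and
        \<open>v (Suc i)\<close>, so the rows \<open>i - 1\<close> and \<open>Suc i\<close> of
        \<open>v\<close> agree at \<open>q\<close>, and the comparison can be made one row further
        down.\<close>
      have "rk (u \<circ> adj i) i q \<le> rk (u \<circ> adj i) (Suc i) q"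
        unfolding rk_def by (intro card_mono) auto
      also have "\<dots> = rk u (Suc i) q" by (rule same) simp
      also have "\<dots> \<le> rk v (Suc i) q" by (rule r)
      also have "\<dots> = rk v (i - 1) q"
      proof -
        have "{k. 1 \<le> k \<and> k \<le> Suc i \<and> q \<le> v k} = {k. 1 \<le> k \<and> k \<le> i - 1 \<and> q \<le> v k}"
        proof -
          have "k \<le> i - 1" if "k \<le> Suc i" "q \<le> v k" for k
          proof -
            have "k \<noteq> Suc i" "k \<noteq> i" using that False v by auto
            then show ?thesis using that by simp
          qed
          then show ?thesis by force
        qed
        then show ?thesis by (simp add: rk_def)
      qed
      also have "\<dots> = rk (v \<circ> adj i) i q" using at_i[of v q] False by simp
      finally show ?thesis using \<open>p = i\<close> by simp
    qed
  next
    case False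
    then show ?thesis using same r by simp
  qed
  then show ?thesis
    using comp_Sym[OF u' adj_Sym[OF i]] comp_Sym[OF v' adj_Sym[OF i]] by (auto simp: bruhat_le_iff_rk)
qed

section \<open>Hecke operators and \<open>R\<close>-polynomials\<close>

text \<open>Generator of the Hecke algebra with parameter \<open>q = a * b\<close> acting on functions on the symmetric
  group.  The choice \<open>(a, b) = (1, q)\<close> is the recursion of the \<open>R\<close>-polynomials; the choice \<open>(q, 1)\<close>
  is the same recursion for \<open>q\<^bsup>\<ell>(u)\<^esup> R\<^bsub>u,v\<^esub>\<close>.  The last case never occurs for permutations.\<close>

definition hop :: "'a::comm_ring_1 \<Rightarrow> 'a \<Rightarrow> nat \<Rightarrow> (perm \<Rightarrow> 'a) \<Rightarrow> perm \<Rightarrow> 'a" where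
  "hop a b i \<phi> y =
     (if y (Suc i) < y i then a * \<phi> (y \<circ> adj i)
      else if y i < y (Suc i) then (a * b - 1) * \<phi> y + b * \<phi> (y \<circ> adj i)
      else a * b * \<phi> y)"

lemma adj_adj_left [simp]: "adj i \<circ> (adj i \<circ> x) = x"
  by (simp add: comp_assoc[symmetric])

lemma hop_commute:
  assumes "Suc i < j"
  shows "hop a b i (hop a b j \<phi>) = hop a b j (hop a b i \<phi>)"
proof
  fix y :: perm
  have e: "(y \<circ> adj i) j = y j" "(y \<circ> adj i) (Suc j) = y (Suc j)"
    "(y \<circ> adj j) i = y i" "(y \<circ> adj j) (Suc i) = y (Suc i)"
    using assms by (simp_all add: transpose_def)
  have c: "y \<circ> adj j \<circ> adj i = y \<circ> adj i \<circ> adj j"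
    using assms by (auto simp: fun_eq_iff transpose_def)
  show "hop a b i (hop a b j \<phi>) y = hop a b j (hop a b i \<phi>) y"
    by (simp only: hop_def e c split: if_split) (simp add: algebra_simps)
qed

text \<open>A check over the relative orders of three consecutive values. Equal values have to be
  treated as well, because \<open>y\<close> ranges over all functions and not only over
  permutations.\<close>

lemma hop_braid:
  "hop a b i (hop a b (Suc i) (hop a b i \<phi>)) = hop a b (Suc i) (hop a b i (hop a b (Suc i) \<phi>))"
proof
  fix y :: perm
  let ?s = "adj i" and ?t = "adj (Suc i)"
  have e: "(x \<circ> ?s) i = x (Suc i)" "(x \<circ> ?s) (Suc i) = x i" "(x \<circ> ?s) (Suc (Suc i)) = x (Suc (Suc i))"
    "(x \<circ> ?t) i = x i" "(x \<circ> ?t) (Suc i) = x (Suc (Suc i))" "(x \<circ> ?t) (Suc (Suc i)) = x (Suc i)" for x :: perm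
    by (simp_all add: transpose_def)
  have c: "y \<circ> ?t \<circ> ?s \<circ> ?t = y \<circ> ?s \<circ> ?t \<circ> ?s"
    by (auto simp: fun_eq_iff transpose_def)
  consider "y i < y (Suc i)" | "y (Suc i) < y i" | "y i = y (Suc i)" by linarith
  then show "hop a b i (hop a b (Suc i) (hop a b i \<phi>)) y = hop a b (Suc i) (hop a b i (hop a b (Suc i) \<phi>)) y"
  proof cases
    case 3
    then have "y \<circ> ?s = y" by (auto simp: fun_eq_iff transpose_def)
    then have c': "y \<circ> ?t \<circ> ?s \<circ> ?t = y \<circ> ?t \<circ> ?s" using c by simp
    show ?thesis
      using 3 c' by (simp add: hop_def e algebra_simps del: comp_apply)
  next
    case 1
    show ?thesis
    proof (cases "y (Suc i) = y (Suc (Suc i)) \<or> y i = y (Suc (Suc i))")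
      case True
      then have "y \<circ> ?t = y \<or> y \<circ> ?s \<circ> ?t = y \<circ> ?s"
        by (auto simp: fun_eq_iff transpose_def)
      then show ?thesis
        using 1 c True by (auto simp add: hop_def e algebra_simps simp del: comp_apply)
    next
      case False
      then show ?thesis
        using 1 c by (auto simp add: hop_def e algebra_simps simp del: comp_apply)
    qed
  next
    case 2
    show ?thesis
    proof (cases "y (Suc i) = y (Suc (Suc i)) \<or> y i = y (Suc (Suc i))")
      case True
      then have "y \<circ> ?t = y \<or> y \<circ> ?s \<circ> ?t = y \<circ> ?s"
        by (auto simp: fun_eq_iff transpose_def)
      then show ?thesis
        using 2 c True by (auto simp add: hop_def e algebra_simps simp del: comp_apply)
    next
      case False
      then show ?thesis
        using 2 c by (auto simp add: hop_def e algebra_simps simp del: comp_apply)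
    qed
  qed
qed

text \<open>\<open>T_w\<close> along the reduced word that always removes the least descent. The
  first argument is meant to be the inversion number, which makes the recursion primitive.\<close>

primrec hopw_aux :: "nat \<Rightarrow> nat \<Rightarrow> 'a::comm_ring_1 \<Rightarrow> 'a \<Rightarrow> perm \<Rightarrow> (perm \<Rightarrow> 'a) \<Rightarrow> perm \<Rightarrow> 'a" where
  "hopw_aux 0 n a b w = id"
| "hopw_aux (Suc k) n a b w =
     (let i = (LEAST i. i \<in> {1..<n} \<and> w (Suc i) < w i) in hop a b i \<circ> hopw_aux k n a b (w \<circ> adj i))"

definition hopw :: "nat \<Rightarrow> 'a::comm_ring_1 \<Rightarrow> 'a \<Rightarrow> perm \<Rightarrow> (perm \<Rightarrow> 'a) \<Rightarrow> perm \<Rightarrow> 'a" where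
  "hopw n a b w = hopw_aux (ninv n w) n a b w"

lemma hopw_id [simp]: "hopw n a b id = id"
  by (simp only: hopw_def ninv_id hopw_aux.simps)

text \<open>Independence of the reduced word, by induction on the length. Two descents of
  \<open>w\<close> are compared after stripping the longest element of the dihedral subgroup they
  generate: \<open>far\<close> uses commutation, \<open>near\<close> the braid relation.\<close>

lemma hopw_descent:
  assumes "w \<in> Sym n" "i \<in> {1..<n}" "w (Suc i) < w i"
  shows "hopw n a b w = hop a b i \<circ> hopw n a b (w \<circ> adj i)"
  using assms
proof (induction "ninv n w" arbitrary: w i rule: less_induct)
  case less
  note w = less.prems(1)
  have step: "w \<circ> adj k \<in> Sym n" "ninv n (w \<circ> adj k) < ninv n w"
    if "w \<in> Sym n" "k \<in> {1..<n}" "w (Suc k) < w k" for w k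
    using comp_Sym[OF that(1) adj_Sym[OF that(2)]] ninv_adj_down[OF that] by auto
  have IH: "hopw n a b x = hop a b k \<circ> hopw n a b (x \<circ> adj k)"
    if "ninv n x < ninv n w" "x \<in> Sym n" "k \<in> {1..<n}" "x (Suc k) < x k" for x k
    using less.hyps that by blast
  define P where "P = (\<lambda>i. i \<in> {1..<n} \<and> w (Suc i) < w i)"
  define j where "j = (LEAST i. P i)"
  have Pi: "P i" using less.prems by (simp add: P_def)
  have Pj: "P j" unfolding j_def by (rule LeastI[of P, OF Pi])
  then have j: "j \<in> {1..<n}" "w (Suc j) < w j" by (auto simp: P_def)
  have hj: "hopw n a b w = hop a b j \<circ> hopw n a b (w \<circ> adj j)"
    by (simp only: hopw_def ninv_adj_down[OF w j] hopw_aux.simps Let_def P_def[symmetric] j_def[symmetric])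
  have far: "hop a b k \<circ> hopw n a b (w \<circ> adj k) = hop a b l \<circ> hopw n a b (w \<circ> adj l)"
    if "P k" "P l" "Suc k < l" for k l
  proof -
    have k: "k \<in> {1..<n}" "w (Suc k) < w k" and l: "l \<in> {1..<n}" "w (Suc l) < w l"
      using that by (auto simp: P_def)
    have e1: "hopw n a b (w \<circ> adj k) = hop a b l \<circ> hopw n a b (w \<circ> adj k \<circ> adj l)"
      by (rule IH) (use step[OF w k] l that in \<open>auto simp: transpose_def\<close>)
    have e2: "hopw n a b (w \<circ> adj l) = hop a b k \<circ> hopw n a b (w \<circ> adj l \<circ> adj k)"
      by (rule IH) (use step[OF w l] k that in \<open>auto simp: transpose_def\<close>)
    have e3: "w \<circ> adj l \<circ> adj k = w \<circ> adj k \<circ> adj l"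
      using that by (auto simp: fun_eq_iff transpose_def)
    show ?thesis
      unfolding e1 e2 e3 using hop_commute[OF that(3), of a b] by (auto simp only: comp_apply fun_eq_iff)
  qed
  have near: "hop a b k \<circ> hopw n a b (w \<circ> adj k) = hop a b l \<circ> hopw n a b (w \<circ> adj l)"
    if "P k" "P l" "l = Suc k" for k l
  proof -
    have k: "k \<in> {1..<n}" "w (Suc k) < w k" and l: "l \<in> {1..<n}" "w (Suc l) < w l"
      using that by (auto simp: P_def)
    have 1: "(w \<circ> adj k) (Suc l) < (w \<circ> adj k) l" "(w \<circ> adj l) (Suc k) < (w \<circ> adj l) k"
      using k l that by (auto simp: transpose_def)
    have 2: "(w \<circ> adj k \<circ> adj l) (Suc k) < (w \<circ> adj k \<circ> adj l) k"
      "(w \<circ> adj l \<circ> adj k) (Suc l) < (w \<circ> adj l \<circ> adj k) l"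
      using k l that by (auto simp: transpose_def)
    note sk = step[OF w k] and sl = step[OF w l]
    note skl = step[OF sk(1) l(1) 1(1)] and slk = step[OF sl(1) k(1) 1(2)]
    have e1: "hopw n a b (w \<circ> adj k) = hop a b l \<circ> hopw n a b (w \<circ> adj k \<circ> adj l)"
      by (rule IH[OF sk(2,1) l(1) 1(1)])
    have e2: "hopw n a b (w \<circ> adj k \<circ> adj l) = hop a b k \<circ> hopw n a b (w \<circ> adj k \<circ> adj l \<circ> adj k)"
      by (rule IH[OF _ skl(1) k(1) 2(1)]) (use skl sk in linarith)
    have e3: "hopw n a b (w \<circ> adj l) = hop a b k \<circ> hopw n a b (w \<circ> adj l \<circ> adj k)"
      by (rule IH[OF sl(2,1) k(1) 1(2)])
    have e4: "hopw n a b (w \<circ> adj l \<circ> adj k) = hop a b l \<circ> hopw n a b (w \<circ> adj l \<circ> adj k \<circ> adj l)"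
      by (rule IH[OF _ slk(1) l(1) 2(2)]) (use slk sl in linarith)
    have e5: "w \<circ> adj k \<circ> adj l \<circ> adj k = w \<circ> adj l \<circ> adj k \<circ> adj l"
      using that by (auto simp: fun_eq_iff transpose_def)
    show ?thesis
      unfolding e1 e2 e3 e4 e5 using hop_braid[of a b k] that by (auto simp only: comp_apply fun_eq_iff)
  qed
  consider "i = j" | "Suc i < j" | "j = Suc i" | "Suc j < i" | "i = Suc j" by linarith
  then have "hop a b j \<circ> hopw n a b (w \<circ> adj j) = hop a b i \<circ> hopw n a b (w \<circ> adj i)"
  proof cases
    case 2
    then show ?thesis by (rule far[OF Pi Pj, symmetric])
  next
    case 3
    then show ?thesis by (rule near[OF Pi Pj, symmetric])
  next
    case 4
    then show ?thesis by (rule far[OF Pj Pi])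
  next
    case 5
    then show ?thesis by (rule near[OF Pj Pi])
  qed simp
  with hj show ?case by (rule trans)
qed

lemma inv_comp_adj:
  assumes "bij w"
  shows "inv (w \<circ> adj i) k = adj i (inv w k)" "inv (adj i \<circ> w) k = inv w (adj i k)"
  using assms by (simp_all add: o_inv_distrib)

lemma inv_eq_iff: "bij w \<Longrightarrow> inv w a = b \<longleftrightarrow> w b = a"
  by (metis bij_inv_eq_iff)

text \<open>The last letter of a word acts outermost, so \<open>hopw\<close> reverses reduced
  products and a new letter on the left of \<open>w\<close> acts innermost.\<close>

lemma hopw_left:
  assumes "w \<in> Sym n" and j: "j \<in> {1..<n}" and "inv w j < inv w (Suc j)"
  shows "hopw n a b (adj j \<circ> w) = hopw n a b w \<circ> hop a b j"
  using assms(1,3)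
proof (induction rule: Sym_induct)
  case id
  have "hopw n a b (adj j) = hop a b j \<circ> hopw n a b (adj j \<circ> adj j)"
    by (rule hopw_descent) (use adj_Sym[OF j] j in auto)
  then show "hopw n a b (adj j \<circ> id) = hopw n a b id \<circ> hop a b j" by simp
next
  case (descent w i)
  note w = Sym_bij[OF descent(1)]
  have wi: "w \<circ> adj i \<in> Sym n" by (rule comp_Sym[OF descent(1) adj_Sym[OF descent(2)]])
  have ne: "\<not> (w i = Suc j \<and> w (Suc i) = j)"
    using descent.prems w by (metis inv_eq_iff lessI less_asym)
  then have d: "(adj j \<circ> w) (Suc i) < (adj j \<circ> w) i"
    using descent(3) by (auto simp: transpose_def)
  have ne': "\<not> (inv w j = i \<and> inv w (Suc j) = Suc i)"
    using w descent(3) by (metis inv_eq_iff less_Suc_eq not_less_eq)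
  have "inv (w \<circ> adj i) j < inv (w \<circ> adj i) (Suc j)"
    using ne' descent.prems by (auto simp: inv_comp_adj[OF w] transpose_def)
  then have IH: "hopw n a b (adj j \<circ> (w \<circ> adj i)) = hopw n a b (w \<circ> adj i) \<circ> hop a b j"
    by (rule descent.IH)
  have "hopw n a b (adj j \<circ> w) = hop a b i \<circ> hopw n a b (adj j \<circ> w \<circ> adj i)"
    by (rule hopw_descent[OF comp_Sym[OF adj_Sym[OF j] descent(1)] descent(2) d])
  also have "\<dots> = hop a b i \<circ> hopw n a b (w \<circ> adj i) \<circ> hop a b j"
    using IH by (simp only: comp_assoc)
  also have "hop a b i \<circ> hopw n a b (w \<circ> adj i) = hopw n a b w"
    by (rule hopw_descent[symmetric, OF descent(1-3)])
  finally show ?case .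
qed

text \<open>The opposite action, by multiplication on the other side; it is set to the identity off the
  bijections.\<close>

definition lop :: "'a::comm_ring_1 \<Rightarrow> 'a \<Rightarrow> nat \<Rightarrow> (perm \<Rightarrow> 'a) \<Rightarrow> perm \<Rightarrow> 'a" where
  "lop a b j \<phi> y =
     (if \<not> bij y then \<phi> y
      else if inv y (Suc j) < inv y j then a * \<phi> (adj j \<circ> y)
      else (a * b - 1) * \<phi> y + b * \<phi> (adj j \<circ> y))"

lemma bij_comp_adj_iff: "bij (y \<circ> adj i) \<longleftrightarrow> bij y"
  by (rule bij_betw_comp_iff[of "adj i" UNIV UNIV y UNIV, symmetric, OF bij_transpose])

text \<open>Left and right multiplication commute. They interfere only if
  \<open>adj j \<circ> y = y \<circ> adj i\<close>, and then both operators have the same effect at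
  \<open>y\<close> and at \<open>y \<circ> adj i\<close>; otherwise neither changes the descent seen
  by the other.\<close>

lemma hop_lop_commute: "hop a b i (lop a b j \<phi>) = lop a b j (hop a b i \<phi>)"
proof
  fix y :: perm
  show "hop a b i (lop a b j \<phi>) y = lop a b j (hop a b i \<phi>) y"
  proof (cases "bij y")
    case False
    then have F: "\<not> bij y" "\<not> bij (y \<circ> adj i)" using bij_comp_adj_iff by blast+
    have l: "lop a b j \<psi> z = \<psi> z" if "\<not> bij z" for \<psi> :: "perm \<Rightarrow> 'a" and z
      unfolding lop_def using that by (rule if_P)
    show ?thesis
      by (simp only: hop_def[of a b i "lop a b j \<phi>"] hop_def[of a b i \<phi>] l[OF F(1)] l[OF F(2)])
  next
    case y: True
    have yi: "bij (y \<circ> adj i)" using y bij_comp_adj_iff by blast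
    have inj: "y c = y d \<longleftrightarrow> c = d" for c d using y by (simp add: bij_is_inj inj_eq)
    have inji: "inv y c = inv y d \<longleftrightarrow> c = d" for c d using y by (metis bij_inv_eq_iff)
    show ?thesis
    proof (cases "adj j \<circ> y = y \<circ> adj i")
      case True
      have eq1: "y i = j \<and> y (Suc i) = Suc j \<or> y i = Suc j \<and> y (Suc i) = j"
      proof -
        have "adj j (y i) = y (Suc i)" "adj j (y (Suc i)) = y i"
          using fun_cong[OF True, of i] fun_cong[OF True, of "Suc i"] by simp_all
        moreover have "y i \<noteq> y (Suc i)" using inj by simp
        ultimately show ?thesis by (auto simp: transpose_def split: if_splits)
      qed
      have key: "lop a b j \<psi> z = hop a b i \<psi> z"
        if z: "bij z" "adj j \<circ> z = z \<circ> adj i" "z i = j \<and> z (Suc i) = Suc j \<or> z i = Suc j \<and> z (Suc i) = j"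
        for z and \<psi> :: "perm \<Rightarrow> 'a"
      proof -
        from z(3) show ?thesis
        proof
          assume e: "z i = j \<and> z (Suc i) = Suc j"
          then have "inv z j = i" "inv z (Suc j) = Suc i" using z(1) by (simp_all add: inv_eq_iff)
          then show ?thesis using e z by (simp add: lop_def hop_def del: comp_apply)
        next
          assume e: "z i = Suc j \<and> z (Suc i) = j"
          then have "inv z j = Suc i" "inv z (Suc j) = i" using z(1) by (simp_all add: inv_eq_iff)
          then show ?thesis using e z by (simp add: lop_def hop_def del: comp_apply)
        qed
      qed
      have True': "adj j \<circ> (y \<circ> adj i) = y \<circ> adj i \<circ> adj i"
        using True by (metis comp_assoc)
      have k1: "lop a b j \<psi> y = hop a b i \<psi> y" for \<psi> :: "perm \<Rightarrow> 'a"
        by (rule key[OF y True eq1])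
      have k2: "lop a b j \<psi> (y \<circ> adj i) = hop a b i \<psi> (y \<circ> adj i)" for \<psi> :: "perm \<Rightarrow> 'a"
        by (rule key[OF yi True']) (use eq1 in auto)
      show ?thesis
        unfolding k1 by (simp only: hop_def[of a b i "lop a b j \<phi>"] hop_def[of a b i "hop a b i \<phi>"] k1 k2)
    next
      case False
      have ne: "{y i, y (Suc i)} \<noteq> {j, Suc j}"
      proof
        assume "{y i, y (Suc i)} = {j, Suc j}"
        then have "y i = j \<and> y (Suc i) = Suc j \<or> y i = Suc j \<and> y (Suc i) = j"
          by (auto simp: doubleton_eq_iff)
        then have "adj j \<circ> y = y \<circ> adj i"
          using transpose_conj[OF y, of i "Suc i"] by (auto simp: transpose_commute)
        then show False using False by simp
      qed
      have o1: "(adj j \<circ> y) (Suc i) < (adj j \<circ> y) i \<longleftrightarrow> y (Suc i) < y i"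
        "(adj j \<circ> y) i < (adj j \<circ> y) (Suc i) \<longleftrightarrow> y i < y (Suc i)"
        using ne inj[of i "Suc i"] by (auto simp: transpose_def doubleton_eq_iff)
      have ne2: "\<not> (inv y j = i \<and> inv y (Suc j) = Suc i)" "\<not> (inv y j = Suc i \<and> inv y (Suc j) = i)"
        using ne y by (auto simp: inv_eq_iff doubleton_eq_iff)
      have o2: "inv (y \<circ> adj i) (Suc j) < inv (y \<circ> adj i) j \<longleftrightarrow> inv y (Suc j) < inv y j"
        using ne2 inji[of j "Suc j"] by (auto simp: inv_comp_adj[OF y] transpose_def)
      have asc: "adj j \<circ> (y \<circ> adj i) = adj j \<circ> y \<circ> adj i" by (simp only: comp_assoc)
      have yne: "y i \<noteq> y (Suc i)" using inj by simp
      then consider "y i < y (Suc i)" "\<not> y (Suc i) < y i" | "\<not> y i < y (Suc i)" "y (Suc i) < y i" by linarith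
      then show ?thesis
        by cases (simp_all only: lop_def hop_def o1 o2 asc y yi not_True_eq_False if_False if_True split: if_split,
          auto simp: algebra_simps simp del: comp_apply)
    qed
  qed
qed

text \<open>The unit of the Hecke algebra as a coefficient function; applying
  \<open>hopw n a b w\<close> to it gives the coefficients of \<open>T_w\<close>.\<close>

definition delta :: "perm \<Rightarrow> 'a::comm_ring_1" where
  "delta y = (if y = id then 1 else 0)"

lemma comp_adj_eq_id: "y \<circ> adj i = id \<longleftrightarrow> y = adj i"
  by (metis adj_adj id_comp transpose_comp_involutory)

lemma adj_comp_eq_id: "adj i \<circ> y = id \<longleftrightarrow> y = adj i"
  by (metis comp_assoc comp_id id_comp transpose_comp_involutory)

lemma adj_ne_id: "adj i \<noteq> id"
  by (simp add: transpose_eq_id_iff)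

lemma hop_delta: "hop a b i delta = lop a b i delta"
proof
  fix y :: perm
  consider "y = id" | "y = adj i" | "y \<noteq> id" "y \<noteq> adj i" by blast
  then show "hop a b i delta y = lop a b i delta y"
  proof cases
    case 3
    then show ?thesis by (simp add: hop_def lop_def delta_def comp_adj_eq_id adj_comp_eq_id)
  qed (use adj_ne_id[of i] in \<open>simp_all add: hop_def lop_def delta_def comp_adj_eq_id adj_comp_eq_id\<close>)
qed

lemma lop_at_id: "lop a b j \<phi> id = hop a b j \<phi> id"
  by (simp add: lop_def hop_def)

lemma hopw_lop_commute:
  assumes "w \<in> Sym n"
  shows "hopw n a b w (lop a b j \<phi>) = lop a b j (hopw n a b w \<phi>)"
  using assms
proof (induction rule: Sym_induct)
  case id
  show "hopw n a b id (lop a b j \<phi>) = lop a b j (hopw n a b id \<phi>)" by simp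
next
  case (descent w i)
  have "hopw n a b (w \<circ> adj i) (lop a b j \<phi>) = lop a b j (hopw n a b (w \<circ> adj i) \<phi>)"
    by (rule descent.IH)
  then show ?case by (simp add: hopw_descent[OF descent(1-3)] hop_lop_commute del: mem_Collect_eq)
qed

text \<open>The two actions agree on the unit. This converts the recursion along right descents,
  built into \<open>hopw\<close>, into the one along left descents that defines the
  \<open>R\<close>-polynomials.\<close>

lemma hopw_delta_left:
  assumes "w \<in> Sym n" "j \<in> {1..<n}" "inv w j < inv w (Suc j)"
  shows "hopw n a b (adj j \<circ> w) delta = lop a b j (hopw n a b w delta)"
  by (simp only: hopw_left[OF assms] comp_apply hop_delta hopw_lop_commute[OF assms(1)])

lemma hopw_delta_zero:
  assumes "v \<in> Sym n" "u \<in> Sym n" "\<not> bruhat_le n u v"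
  shows "hopw n a b v delta u = 0"
  using assms
proof (induction arbitrary: u rule: Sym_induct)
  case id
  have "u \<noteq> id"
  proof
    assume e: "u = id"
    from id(2) bruhat_refl[OF id_Sym, of n] show False unfolding e by (rule notE)
  qed
  then show "hopw n a b id delta u = 0" by (simp add: delta_def)
next
  case (descent v i)
  let ?u = "u \<circ> adj i" and ?v = "v \<circ> adj i"
  have u': "?u \<in> Sym n" by (rule comp_Sym[OF descent.prems(1) adj_Sym[OF descent(2)]])
  have vv: "bruhat_le n ?v v" using bruhat_descent_le[OF descent(1-3)] by (simp add: bruhat_less_def)
  have lift: "bruhat_le n (x \<circ> adj i) v" if "bruhat_le n x ?v" for x
    using bruhat_lift[OF that descent(2)] descent(3) by simp
  have n1: "\<not> bruhat_le n u ?v" using bruhat_trans[OF _ vv, of u] descent.prems(2) by blast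
  have n2: "\<not> bruhat_le n ?u ?v" using lift[of ?u] descent.prems(2) by (simp only: adj_adj simp_thms not_False_eq_True) blast
  have "hopw n a b v delta u = hop a b i (hopw n a b ?v delta) u"
    by (simp add: hopw_descent[OF descent(1-3)])
  also have "\<dots> = 0"
  proof -
    have "hopw n a b ?v delta u = 0" "hopw n a b ?v delta ?u = 0"
      using descent.IH[OF descent.prems(1) n1] descent.IH[OF u' n2] by (simp_all only: comp_def)
    then show ?thesis by (simp add: hop_def)
  qed
  finally show ?case .
qed

section \<open>Existence, uniqueness and degrees of the R-polynomials\<close>

definition Rp :: "nat \<Rightarrow> perm \<Rightarrow> perm \<Rightarrow> int poly" where
  "Rp n u v = (if u \<in> Sym n \<and> v \<in> Sym n then hopw n 1 [:0, 1:] v delta u else 0)"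

lemma Rp_zero: "\<not> bruhat_le n u v \<Longrightarrow> Rp n u v = 0"
  using hopw_delta_zero by (auto simp: Rp_def)

lemma Rp_right:
  assumes "u \<in> Sym n" "v \<in> Sym n" "i \<in> {1..<n}" "v (Suc i) < v i"
  shows "u (Suc i) < u i \<Longrightarrow> Rp n u v = Rp n (u \<circ> adj i) (v \<circ> adj i)"
    and "u i < u (Suc i) \<Longrightarrow> Rp n u v =
      ([:0, 1:] - 1) * Rp n u (v \<circ> adj i) + [:0, 1:] * Rp n (u \<circ> adj i) (v \<circ> adj i)"
  using assms comp_Sym[OF assms(1) adj_Sym[OF assms(3)]] comp_Sym[OF assms(2) adj_Sym[OF assms(3)]]
  by (simp_all add: Rp_def hopw_descent[OF assms(2-4)] hop_def)

lemma Rp_left: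
  assumes u: "u \<in> Sym n" and v: "v \<in> Sym n" and j: "j \<in> {1..<n}" and d: "inv v (Suc j) < inv v j"
  shows "inv u (Suc j) < inv u j \<Longrightarrow> Rp n u v = Rp n (adj j \<circ> u) (adj j \<circ> v)"
    and "inv u j < inv u (Suc j) \<Longrightarrow> Rp n u v =
      ([:0, 1:] - 1) * Rp n u (adj j \<circ> v) + [:0, 1:] * Rp n (adj j \<circ> u) (adj j \<circ> v)"
proof -
  let ?w = "adj j \<circ> v"
  have w: "?w \<in> Sym n" by (rule comp_Sym[OF adj_Sym[OF j] v])
  have u': "adj j \<circ> u \<in> Sym n" by (rule comp_Sym[OF adj_Sym[OF j] u])
  have "inv ?w j < inv ?w (Suc j)" using d by (simp add: inv_comp_adj[OF Sym_bij[OF v]])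
  from hopw_delta_left[OF w j this, of 1 "[:0, 1:] :: int poly"]
  have "hopw n 1 [:0, 1 :: int:] v delta = lop 1 [:0, 1:] j (hopw n 1 [:0, 1:] ?w delta)"
    unfolding adj_adj_left .
  then have eq: "Rp n u v = lop 1 [:0, 1:] j (hopw n 1 [:0, 1:] ?w delta) u"
    using u v by (simp only: Rp_def simp_thms if_True)
  show "inv u (Suc j) < inv u j \<Longrightarrow> Rp n u v = Rp n (adj j \<circ> u) (adj j \<circ> v)"
    "inv u j < inv u (Suc j) \<Longrightarrow> Rp n u v =
      ([:0, 1:] - 1) * Rp n u (adj j \<circ> v) + [:0, 1:] * Rp n (adj j \<circ> u) (adj j \<circ> v)"
    using u w u' Sym_bij[OF u] unfolding eq by (simp_all add: Rp_def lop_def del: comp_apply)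
qed

lemma bruhat_less_adj_left:
  assumes u: "u \<in> Sym n" and j: "j \<in> {1..<n}"
  shows "bruhat_less n (adj j \<circ> u) u \<longleftrightarrow> inv u (Suc j) < inv u j"
    and "bruhat_less n u (adj j \<circ> u) \<longleftrightarrow> inv u j < inv u (Suc j)"
proof -
  have ne: "inv u (Suc j) \<noteq> inv u j" using Sym_inj[OF inv_Sym[OF u]] by simp
  have up: "bruhat_less n x (adj j \<circ> x)" if "x \<in> Sym n" "inv x j < inv x (Suc j)" for x
  proof -
    have "(x, adj j \<circ> x) \<in> bruhat_graph n" by (rule bruhat_edge_leftI) (use that j in auto)
    then show ?thesis using bruhat_edge_le bruhat_edge_less by (fastforce simp: bruhat_less_def)
  qed
  have dn: "bruhat_less n (adj j \<circ> u) u" if "inv u (Suc j) < inv u j"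
  proof -
    have "bruhat_less n (adj j \<circ> u) (adj j \<circ> (adj j \<circ> u))"
      by (rule up) (use that u j comp_Sym[OF adj_Sym[OF j] u] in \<open>auto simp: inv_comp_adj[OF Sym_bij[OF u]]\<close>)
    then show ?thesis unfolding adj_adj_left .
  qed
  have excl: "\<not> (bruhat_less n (adj j \<circ> u) u \<and> bruhat_less n u (adj j \<circ> u))"
    using bruhat_less_ninv less_asym by blast
  consider "inv u j < inv u (Suc j)" | "inv u (Suc j) < inv u j" using ne by linarith
  then have "(bruhat_less n (adj j \<circ> u) u \<longleftrightarrow> inv u (Suc j) < inv u j) \<and>
    (bruhat_less n u (adj j \<circ> u) \<longleftrightarrow> inv u j < inv u (Suc j))"
  proof cases
    case 1
    then show ?thesis using up[OF u 1] excl less_asym by blast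
  next
    case 2
    then show ?thesis using dn[OF 2] excl less_asym by blast
  qed
  then show "bruhat_less n (adj j \<circ> u) u \<longleftrightarrow> inv u (Suc j) < inv u j"
    "bruhat_less n u (adj j \<circ> u) \<longleftrightarrow> inv u j < inv u (Suc j)" by blast+
qed

lemma Rp_family: "is_R_family n (Rp n)"
  unfolding is_R_family_def
proof (intro conjI allI impI ballI)
  fix u v assume "\<not> bruhat_le n u v"
  then show "Rp n u v = 0" by (rule Rp_zero)
next
  fix u assume "u \<in> Sym n"
  then show "Rp n u u = 1"
  proof (induction rule: Sym_induct)
    case id
    show "Rp n id id = 1" using id_Sym by (simp only: Rp_def delta_def hopw_id id_apply) simp
  next
    case (descent w i)
    have "Rp n (w \<circ> adj i) (w \<circ> adj i) = 1" by (rule descent.IH)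
    then show ?case using Rp_right(1)[OF descent(1) descent(1-3) descent(3)] by simp
  qed
next
  fix u v s
  assume s: "s \<in> simple_reflections n" and uv: "bruhat_less n u v \<and> bruhat_less n (s \<circ> v) v"
  obtain j where j: "j \<in> {1..<n}" "s = adj j" using s by (auto simp: simple_reflections_def)
  have u: "u \<in> Sym n" and v: "v \<in> Sym n" using uv by (auto simp: bruhat_less_def bruhat_le_def)
  have d: "inv v (Suc j) < inv v j" using uv j bruhat_less_adj_left(1)[OF v j(1)] by simp
  show "bruhat_less n (s \<circ> u) u \<Longrightarrow> Rp n u v = Rp n (s \<circ> u) (s \<circ> v)"
    using Rp_left(1)[OF u v j(1) d] bruhat_less_adj_left(1)[OF u j(1)] j by simp
  show "bruhat_less n u (s \<circ> u) \<Longrightarrow>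
      Rp n u v = ([:0, 1:] - 1) * Rp n u (s \<circ> v) + [:0, 1:] * Rp n (s \<circ> u) (s \<circ> v)"
    using Rp_left(2)[OF u v j(1) d] bruhat_less_adj_left(2)[OF u j(1)] j by simp
qed

lemma R_family_unique:
  assumes R: "is_R_family n R" and R': "is_R_family n R'"
  shows "R = R'"
proof -
  have eq: "R u v = R' u v" if "v \<in> Sym n" "u \<in> Sym n" for u v
    using that
  proof (induction "ninv n v" arbitrary: u v rule: less_induct)
    case less
    show ?case
    proof (cases "bruhat_le n u v \<and> u \<noteq> v")
      case False
      then show ?thesis using R R' less.prems by (auto simp: is_R_family_def)
    next
      case True
      have v: "v \<in> Sym n" and u: "u \<in> Sym n" using less.prems by auto
      have "v \<noteq> id" using True bruhat_antisym bruhat_id_le less.prems by blast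
      then have "inv v \<noteq> id" using Sym_bij[OF v] by (metis bij_id inv_id inv_inv_eq)
      then obtain j where j: "j \<in> {1..<n}" "inv v (Suc j) < inv v j"
        using exists_descent[OF inv_Sym[OF v]] by metis
      let ?s = "adj j"
      have s: "?s \<in> simple_reflections n" using j by (auto simp: simple_reflections_def)
      have sv: "bruhat_less n (?s \<circ> v) v" using bruhat_less_adj_left(1)[OF v j(1)] j by simp
      have svn: "?s \<circ> v \<in> Sym n" "?s \<circ> u \<in> Sym n" using comp_Sym[OF adj_Sym[OF j(1)]] u v by blast+
      have lt: "ninv n (?s \<circ> v) < ninv n v" using sv by (rule bruhat_less_ninv)
      have uv: "bruhat_less n u v" using True by (simp add: bruhat_less_def)
      have IH: "R x (?s \<circ> v) = R' x (?s \<circ> v)" if "x \<in> Sym n" for x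
        using less.hyps[OF lt svn(1) that] .
      have cases: "bruhat_less n (?s \<circ> u) u \<or> bruhat_less n u (?s \<circ> u)"
        using bruhat_less_adj_left[OF u j(1)] Sym_inj[OF inv_Sym[OF u], of j "Suc j"] by auto
      have rec: "(bruhat_less n (?s \<circ> u) u \<longrightarrow> F u v = F (?s \<circ> u) (?s \<circ> v)) \<and>
          (bruhat_less n u (?s \<circ> u) \<longrightarrow>
             F u v = ([:0, 1:] - 1) * F u (?s \<circ> v) + [:0, 1:] * F (?s \<circ> u) (?s \<circ> v))"
        if "is_R_family n F" for F
        using that s uv sv unfolding is_R_family_def by blast
      show ?thesis using rec[OF R] rec[OF R'] cases IH[OF u] IH[OF svn(2)] by auto
    qed
  qed
  show ?thesis
  proof (intro ext)
    fix u v show "R u v = R' u v"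
    proof (cases "bruhat_le n u v")
      case True
      then show ?thesis using eq bruhat_le_Sym by blast
    next
      case False
      then show ?thesis using R R' by (simp add: is_R_family_def)
    qed
  qed
qed

lemma R_poly_eq: "R_poly n = Rp n"
  unfolding R_poly_def using Rp_family R_family_unique by blast

lemma Rp_self: "u \<in> Sym n \<Longrightarrow> Rp n u u = 1"
  using Rp_family[of n] by (simp add: is_R_family_def)

lemma degree_Rp:
  assumes "v \<in> Sym n" "bruhat_le n u v"
  shows "degree (Rp n u v) + ninv n u \<le> ninv n v"
  using assms
proof (induction arbitrary: u rule: Sym_induct)
  case id
  then have "u = id" using bruhat_antisym bruhat_id_le bruhat_le_Sym by blast
  then show "degree (Rp n u id) + ninv n u \<le> ninv n id"
    by (simp only: Rp_self[OF id_Sym] ninv_id) simp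
next
  case (descent v i)
  let ?u = "u \<circ> adj i" and ?v = "v \<circ> adj i"
  have u: "u \<in> Sym n" using descent.prems bruhat_le_Sym by blast
  have u': "?u \<in> Sym n" by (rule comp_Sym[OF u adj_Sym[OF descent(2)]])
  have lv: "ninv n v = Suc (ninv n ?v)" by (rule ninv_adj_down[OF descent(1-3)])
  have IH: "degree (Rp n x ?v) + ninv n x \<le> ninv n ?v \<or> Rp n x ?v = 0" for x
    using descent.IH Rp_zero by blast
  consider "u (Suc i) < u i" "ninv n u = Suc (ninv n ?u)" | "u i < u (Suc i)" "ninv n ?u = Suc (ninv n u)"
    using ninv_adj_cases[OF u descent(2)] by blast
  then show ?case
  proof cases
    case 1
    have "Rp n u v = Rp n ?u ?v" by (rule Rp_right(1)[OF u descent(1-3) 1(1)])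
    then show ?thesis using IH[of ?u] 1 lv bruhat_le_ninv[OF descent.prems] by auto
  next
    case 2
    have eq: "Rp n u v = ([:0, 1:] - 1) * Rp n u ?v + [:0, 1:] * Rp n ?u ?v"
      by (rule Rp_right(2)[OF u descent(1-3) 2(1)])
    have ul: "ninv n u \<le> ninv n v" using bruhat_le_ninv[OF descent.prems] by auto
    have d1: "degree (([:0, 1:] - 1) * Rp n u ?v) \<le> ninv n v - ninv n u"
    proof (cases "Rp n u ?v = 0")
      case False
      have "degree ([:0, 1:] - 1 :: int poly) \<le> 1" by (rule degree_diff_le) auto
      then show ?thesis using degree_mult_le[of "[:0, 1:] - 1" "Rp n u ?v"] IH[of u] False lv by auto
    qed simp
    have d2: "degree ([:0, 1:] * Rp n ?u ?v) \<le> ninv n v - ninv n u"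
    proof (cases "Rp n ?u ?v = 0")
      case False
      then show ?thesis using degree_mult_le[of "[:0, 1:]" "Rp n ?u ?v"] IH[of ?u] 2 lv by auto
    qed simp
    show ?thesis using degree_add_le[OF d1 d2] eq ul by simp
  qed
qed

section \<open>Orthogonality of the R-polynomials\<close>

lemma sum_Sym_pairs:
  fixes f :: "perm \<Rightarrow> 'a::comm_monoid_add"
  assumes i: "i \<in> {1..<n}"
  shows "(\<Sum>w\<in>Sym n. f w) = (\<Sum>w | w \<in> Sym n \<and> w i < w (Suc i). f w + f (w \<circ> adj i))"
proof -
  let ?U = "{w. w \<in> Sym n \<and> w i < w (Suc i)}" and ?D = "{w. w \<in> Sym n \<and> w (Suc i) < w i}"
  have fin: "finite (Sym n)" by (simp add: finite_permutations)
  have "Sym n = ?U \<union> ?D"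
  proof (intro set_eqI iffI)
    fix w assume w: "w \<in> Sym n"
    then have "w i \<noteq> w (Suc i)" using Sym_inj[OF w] by simp
    then show "w \<in> ?U \<union> ?D" using w by auto
  qed auto
  from arg_cong[OF this, of "sum f"] have "(\<Sum>w\<in>Sym n. f w) = (\<Sum>w\<in>?U \<union> ?D. f w)" .
  also have "\<dots> = (\<Sum>w\<in>?U. f w) + (\<Sum>w\<in>?D. f w)"
    by (rule sum.union_disjoint) (use fin in auto)
  also have "(\<Sum>w\<in>?D. f w) = (\<Sum>w\<in>?U. f (w \<circ> adj i))"
  proof (rule sum.reindex_bij_witness[where i = "\<lambda>w. w \<circ> adj i" and j = "\<lambda>w. w \<circ> adj i"])
    fix w assume w: "w \<in> ?D"
    show "w \<circ> adj i \<in> ?U" using w comp_Sym[OF _ adj_Sym[OF i], of w] by simp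
  next
    fix w assume w: "w \<in> ?U"
    show "w \<circ> adj i \<in> ?D" using w comp_Sym[OF _ adj_Sym[OF i], of w] by simp
  qed simp_all
  finally show ?thesis by (simp only: sum.distrib)
qed

text \<open>Induction on \<open>y\<close> along a right descent \<open>i\<close>. Pairing
  \<open>w\<close> with \<open>w \<circ> adj i\<close> and applying the recursion to both factors
  turns the signed sum for \<open>y\<close> into signed sums for
  \<open>y \<circ> adj i\<close>.\<close>

lemma R_orthogonality:
  assumes "y \<in> Sym n" "x \<in> Sym n"
  shows "(\<Sum>w\<in>Sym n. (- 1) ^ ninv n w * Rp n x w * Rp n w y) = (if x = y then (- 1) ^ ninv n x else 0)"
  using assms
proof (induction arbitrary: x rule: Sym_induct)
  case id
  have "Rp n w id = (if w = id then 1 else 0)" if "w \<in> Sym n" for w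
    using that id_Sym by (simp only: Rp_def delta_def hopw_id id_apply simp_thms if_True)
  then have "(\<Sum>w\<in>Sym n. (- 1) ^ ninv n w * Rp n x w * Rp n w id)
      = (\<Sum>w\<in>Sym n. if w = id then (- 1) ^ ninv n w * Rp n x w else 0)"
    by (intro sum.cong) auto
  also have "\<dots> = Rp n x id"
    using id_Sym by (simp add: finite_permutations permutes_id)
  also have "\<dots> = (if x = id then (- 1) ^ ninv n x else 0)"
    using id id_Sym by (cases "x = id") (simp_all only: Rp_def delta_def hopw_id id_apply simp_thms if_True if_False ninv_id power_0)
  finally show "(\<Sum>w\<in>Sym n. (- 1) ^ ninv n w * Rp n x w * Rp n w id) = (if x = id then (- 1) ^ ninv n x else 0)" .
next
  case (descent y i)
  let ?q = "[:0, 1:] :: int poly" and ?y = "y \<circ> adj i" and ?x = "x \<circ> adj i"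
  let ?S = "\<lambda>x y. \<Sum>w\<in>Sym n. (- 1) ^ ninv n w * Rp n x w * Rp n w y"
  let ?U = "{w. w \<in> Sym n \<and> w i < w (Suc i)}"
  let ?pair = "\<lambda>x y w. (- 1) ^ ninv n w * (Rp n x w * Rp n w y - Rp n x (w \<circ> adj i) * Rp n (w \<circ> adj i) y)"
  note i = descent(2)
  have x: "x \<in> Sym n" by (rule descent.prems)
  have x': "?x \<in> Sym n" and y': "?y \<in> Sym n"
    using comp_Sym[OF x adj_Sym[OF i]] comp_Sym[OF descent(1) adj_Sym[OF i]] by auto
  have S: "?S x y = (\<Sum>w\<in>?U. ?pair x y w)" for x y
    unfolding sum_Sym_pairs[OF i]
    by (rule sum.cong) (use ninv_adj_up[OF _ i] in \<open>auto simp: algebra_simps\<close>)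
  have Uw: "w \<in> Sym n" "w \<circ> adj i \<in> Sym n" "w i < w (Suc i)" if "w \<in> ?U" for w
    using that comp_Sym[OF _ adj_Sym[OF i], of w] by auto
  have wy: "Rp n w y = (?q - 1) * Rp n w ?y + ?q * Rp n (w \<circ> adj i) ?y" "Rp n (w \<circ> adj i) y = Rp n w ?y"
    if "w \<in> ?U" for w
    using Rp_right(2)[of w n y i] Rp_right(1)[of "w \<circ> adj i" n y i] Uw[OF that] descent(1-3) by simp_all
  have ne: "y \<noteq> x'" if "x' i < x' (Suc i)" for x' using that descent(3) by auto
  consider "x (Suc i) < x i" | "x i < x (Suc i)"
    using Sym_inj[OF x, of i "Suc i"] by force
  then show ?case
  proof cases
    case 1
    have xw: "Rp n x (w \<circ> adj i) = Rp n ?x w" "Rp n ?x (w \<circ> adj i) = (?q - 1) * Rp n ?x w + ?q * Rp n x w"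
      if "w \<in> ?U" for w
      using Rp_right(1)[of x n "w \<circ> adj i" i] Rp_right(2)[of ?x n "w \<circ> adj i" i] Uw[OF that] x x' i 1 by simp_all
    have "?S x y = (\<Sum>w\<in>?U. (?q - 1) * ?pair x ?y w - ?pair ?x ?y w)"
      unfolding S by (rule sum.cong[OF refl]) (simp only: wy xw, simp add: algebra_simps)
    also have "\<dots> = (?q - 1) * ?S x ?y - ?S ?x ?y"
      unfolding S by (simp only: sum_subtractf sum_distrib_left)
    also have "?S x ?y = 0"
    proof -
      have "x \<noteq> ?y" using 1 descent(3) by auto
      moreover have "?S x ?y = (if x = ?y then (- 1) ^ ninv n x else 0)" by (rule descent.IH[OF x])
      ultimately show ?thesis by (simp only: if_False)
    qed
    also have "?S ?x ?y = (if ?x = ?y then (- 1) ^ ninv n ?x else 0)" by (rule descent.IH[OF x'])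
    also have "?x = ?y \<longleftrightarrow> x = y" by (metis adj_adj)
    finally have "?S x y = (?q - 1) * 0 - (if x = y then (- 1) ^ ninv n ?x else 0)" .
    then show ?thesis using ninv_adj_down[OF x i 1] by (cases "x = y") simp_all
  next
    case 2
    have xw: "Rp n x (w \<circ> adj i) = (?q - 1) * Rp n x w + ?q * Rp n ?x w" "Rp n ?x (w \<circ> adj i) = Rp n x w"
      if "w \<in> ?U" for w
      using Rp_right(2)[of x n "w \<circ> adj i" i] Rp_right(1)[of ?x n "w \<circ> adj i" i] Uw[OF that] x x' i 2 by simp_all
    have "?S x y = (\<Sum>w\<in>?U. - ?q * ?pair ?x ?y w)"
      unfolding S by (rule sum.cong[OF refl]) (simp only: wy xw, simp add: algebra_simps)
    also have "\<dots> = - ?q * ?S ?x ?y"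
      unfolding S by (simp only: sum_distrib_left)
    also have "?S ?x ?y = 0"
    proof -
      have "?x \<noteq> ?y" using 2 descent(3) by (metis adj_adj less_asym)
      moreover have "?S ?x ?y = (if ?x = ?y then (- 1) ^ ninv n ?x else 0)" by (rule descent.IH[OF x'])
      ultimately show ?thesis by (simp only: if_False)
    qed
    finally show ?thesis using ne[OF 2] by auto
  qed
qed

section \<open>Existence and uniqueness of the Kazhdan--Lusztig polynomials\<close>

lemma qvar_nz [simp]: "qvar \<noteq> 0"
  by simp

lemma eval_at_pCons [simp]: "eval_at (pCons a p) x = of_int a + x * eval_at p x"
  by (simp add: eval_at_def map_poly_pCons)

lemma eval_at_0 [simp]: "eval_at 0 x = 0"
  by (simp add: eval_at_def)

lemma eval_at_1 [simp]: "eval_at 1 x = 1"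
  by (simp add: one_pCons eval_at_pCons)

lemma eval_at_add [simp]: "eval_at (p + r) x = eval_at p x + eval_at r x"
proof (induction p arbitrary: r)
  case (pCons a p)
  then show ?case by (cases r) (simp add: eval_at_pCons algebra_simps)
qed simp

lemma eval_at_smult: "eval_at (smult a p) x = of_int a * eval_at p x"
  by (induction p) (simp_all add: eval_at_pCons algebra_simps)

lemma eval_at_mult [simp]: "eval_at (p * r) x = eval_at p x * eval_at r x"
  by (induction p) (simp_all add: eval_at_pCons eval_at_smult algebra_simps)

lemma eval_at_minus [simp]: "eval_at (- p) x = - eval_at p x"
  using eval_at_add[of p "- p" x] by (simp add: eq_neg_iff_add_eq_0 add.commute)

lemma eval_at_diff [simp]: "eval_at (p - r) x = eval_at p x - eval_at r x"
  using eval_at_add[of p "- r" x] by simp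

lemma eval_at_sum: "eval_at (sum f A) x = (\<Sum>a\<in>A. eval_at (f a) x)"
  by (induction A rule: infinite_finite_induct) simp_all

lemma eval_at_power [simp]: "eval_at (p ^ k) x = eval_at p x ^ k"
  by (induction k) simp_all

lemma to_fract_of_int: "to_fract [:a:] = of_int a"
proof -
  have nat: "to_fract [:int m:] = of_nat m" for m
  proof (induction m)
    case (Suc m)
    have "[:int (Suc m):] = 1 + [:int m:]" by (simp add: one_pCons)
    then show ?case using Suc by (simp only: to_fract_add to_fract_1 of_nat_Suc)
  qed simp
  show ?thesis
  proof (cases a rule: int_cases2)
    case (nonneg m)
    then show ?thesis using nat by simp
  next
    case (nonpos m)
    have "[:a:] = - [:int m:]" using nonpos by simp
    then show ?thesis using nat nonpos by (simp only: to_fract_uminus of_int_minus of_int_of_nat_eq)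
  qed
qed

lemma eval_at_qvar: "eval_at p qvar = to_fract p"
proof (induction p)
  case (pCons a p)
  have "pCons a p = [:a:] + [:0, 1:] * p" by simp
  then have "to_fract (pCons a p) = to_fract [:a:] + qvar * to_fract p"
    by (simp only: to_fract_add to_fract_mult)
  then show ?case using pCons by (simp add: eval_at_pCons to_fract_of_int)
qed simp

lemma eval_at_qvar_inj: "eval_at p qvar = eval_at r qvar \<longleftrightarrow> p = r"
  by (simp add: eval_at_qvar)

lemma eval_at_altdef:
  assumes "degree p \<le> l"
  shows "eval_at p x = (\<Sum>i\<le>l. of_int (coeff p i) * x ^ i)"
proof -
  have d: "degree (map_poly of_int p :: 'a poly) \<le> l"
    by (rule degree_le) (use assms in \<open>auto simp: coeff_map_poly coeff_eq_0\<close>)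
  have "eval_at p x = (\<Sum>i\<le>degree (map_poly of_int p :: 'a poly). of_int (coeff p i) * x ^ i)"
    by (simp add: eval_at_def poly_altdef coeff_map_poly)
  also have "\<dots> = (\<Sum>i\<le>l. of_int (coeff p i) * x ^ i)"
  proof (rule sum.mono_neutral_left)
    show "\<forall>i\<in>{..l} - {..degree (map_poly of_int p :: 'a poly)}. of_int (coeff p i) * x ^ i = 0"
    proof
      fix i assume "i \<in> {..l} - {..degree (map_poly of_int p :: 'a poly)}"
      then have "coeff (map_poly of_int p :: 'a poly) i = 0" by (intro coeff_eq_0) auto
      then show "of_int (coeff p i) * x ^ i = 0" by (simp add: coeff_map_poly)
    qed
  qed (use d in auto)
  finally show ?thesis .
qed

text \<open>The polynomial \<open>q^l p(q^-1)\<close>; it moves identities over the field of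
  fractions back to coefficients.\<close>

definition revp :: "nat \<Rightarrow> int poly \<Rightarrow> int poly" where
  "revp l p = (\<Sum>k\<le>l. monom (coeff p (l - k)) k)"

lemma coeff_revp: "coeff (revp l p) k = (if k \<le> l then coeff p (l - k) else 0)"
proof -
  have "coeff (revp l p) k = (\<Sum>j\<le>l. if j = k then coeff p (l - j) else 0)"
    by (simp add: revp_def coeff_sum)
  then show ?thesis by simp
qed

lemma eval_at_monom: "eval_at (monom c k) x = of_int c * x ^ k"
  by (simp add: eval_at_def map_poly_monom poly_monom)

lemma eval_at_inverse:
  assumes "degree p \<le> l"
  shows "qvar ^ l * eval_at p (inverse qvar) = eval_at (revp l p) qvar"
proof -
  have "qvar ^ l * eval_at p (inverse qvar) = (\<Sum>i\<le>l. of_int (coeff p i) * qvar ^ (l - i))"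
    unfolding eval_at_altdef[OF assms] sum_distrib_left
  proof (rule sum.cong[OF refl])
    fix i assume "i \<in> {..l}"
    then have "qvar ^ l = qvar ^ (l - i) * qvar ^ i" by (simp flip: power_add)
    then show "qvar ^ l * (of_int (coeff p i) * inverse qvar ^ i) = of_int (coeff p i) * qvar ^ (l - i)"
      by (simp add: power_inverse)
  qed
  also have "\<dots> = (\<Sum>k\<le>l. of_int (coeff p (l - k)) * qvar ^ k)"
    by (rule sum.reindex_bij_witness[where i = "\<lambda>k. l - k" and j = "\<lambda>k. l - k"]) auto
  also have "\<dots> = eval_at (revp l p) qvar"
    by (simp only: revp_def eval_at_sum eval_at_monom)
  finally show ?thesis .
qed

text \<open>An antisymmetric \<open>F\<close> consists of a lower half and the negated mirror image
  of it; minus the lower half solves the equation. A middle coefficient equals its own negative and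
  hence vanishes.\<close>

lemma antisymmetric_solution:
  assumes l: "0 < l" and d: "degree F \<le> l"
    and anti: "qvar ^ l * eval_at F (inverse qvar) = - eval_at F qvar"
  shows "\<exists>p. 2 * degree p < l \<and> qvar ^ l * eval_at p (inverse qvar) - eval_at p qvar = eval_at F qvar"
proof -
  define p where "p = (\<Sum>k | 2 * k < l. monom (- coeff F k) k)"
  have fin: "finite {k. 2 * k < l}" by (rule finite_subset[of _ "{..l}"]) auto
  have cp: "coeff p k = (if 2 * k < l then - coeff F k else 0)" for k
  proof -
    have "coeff p k = (\<Sum>j | 2 * j < l. if j = k then - coeff F j else 0)"
      by (simp add: p_def coeff_sum)
    then show ?thesis using fin by simp
  qed
  have dp: "2 * degree p < l"
  proof (cases "p = 0")
    case False
    then have "coeff p (degree p) \<noteq> 0" by simp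
    then show ?thesis unfolding cp by (auto split: if_splits)
  qed (use l in simp)
  have "eval_at (revp l F) qvar = eval_at (- F) qvar"
    using anti eval_at_inverse[OF d] by simp
  then have "revp l F = - F" by (simp only: eval_at_qvar_inj)
  then have cF: "coeff (revp l F) k = - coeff F k" for k by simp
  have "revp l p - p = F"
  proof (rule poly_eqI)
    fix k
    have "l - k = k" if "2 * k = l" using that by simp
    then show "coeff (revp l p - p) k = coeff F k"
      using cF[of k] coeff_eq_0[of F k] d
      by (cases "2 * k = l") (auto simp: coeff_revp cp split: if_splits)
  qed
  then have "qvar ^ l * eval_at p (inverse qvar) - eval_at p qvar = eval_at F qvar"
    using eval_at_inverse[of p l] dp by (simp flip: eval_at_diff)
  then show ?thesis using dp by blast
qed

text \<open>Reversal moves all terms below the middle degree strictly above it, so a fixed point of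
  that degree has no terms.\<close>

lemma symmetric_zero:
  assumes d: "2 * degree p < l" and sym: "qvar ^ l * eval_at p (inverse qvar) = eval_at p qvar"
  shows "p = 0"
proof -
  have "revp l p = p" using sym eval_at_inverse[of p l] d by (simp add: eval_at_qvar_inj)
  then have c: "coeff (revp l p) k = coeff p k" for k by simp
  show ?thesis
  proof (rule poly_eqI)
    fix k
    show "coeff p k = coeff 0 k"
      using c[of k] coeff_eq_0[of p k] coeff_eq_0[of p "l - k"] d
      by (cases "2 * k < l") (auto simp: coeff_revp split: if_splits)
  qed
qed

lemma R_bar_aux:
  fixes e :: "'a::comm_ring_1"
  shows "e * (q * Q) * ((r - 1) * a + r * b) = (q * r) * (e * Q * a) - q * (e * Q * a) - (q * r) * (- e * Q * b)"
  by (simp add: algebra_simps)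

text \<open>The bar symmetry of \<open>R\<close>, with signs and powers of \<open>q\<close>
  distributed over both sides so that no length difference has to be formed.\<close>

lemma R_bar:
  assumes "v \<in> Sym n" "u \<in> Sym n"
  shows "(- 1) ^ ninv n u * qvar ^ ninv n v * eval_at (Rp n u v) (inverse qvar)
       = (- 1) ^ ninv n v * qvar ^ ninv n u * eval_at (Rp n u v) qvar"
  using assms
proof (induction arbitrary: u rule: Sym_induct)
  case id
  have "Rp n u id = (if u = id then 1 else 0)"
    using id id_Sym by (simp only: Rp_def delta_def hopw_id id_apply simp_thms if_True)
  then show "(- 1) ^ ninv n u * qvar ^ ninv n id * eval_at (Rp n u id) (inverse qvar)
       = (- 1) ^ ninv n id * qvar ^ ninv n u * eval_at (Rp n u id) qvar"
    by (cases "u = id") (simp_all only: if_True if_False ninv_id eval_at_0 eval_at_1, simp_all)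
next
  case (descent v i)
  let ?u = "u \<circ> adj i" and ?v = "v \<circ> adj i"
  note u = descent.prems and i = descent(2)
  have u': "?u \<in> Sym n" by (rule comp_Sym[OF u adj_Sym[OF i]])
  have lv: "ninv n v = Suc (ninv n ?v)" by (rule ninv_adj_down[OF descent(1-3)])
  have IH: "(- 1) ^ ninv n x * qvar ^ ninv n ?v * eval_at (Rp n x ?v) (inverse qvar)
       = (- 1) ^ ninv n ?v * qvar ^ ninv n x * eval_at (Rp n x ?v) qvar" if "x \<in> Sym n" for x
    by (rule descent.IH[OF that])
  consider "u (Suc i) < u i" "ninv n u = Suc (ninv n ?u)" | "u i < u (Suc i)" "ninv n ?u = Suc (ninv n u)"
    using ninv_adj_cases[OF u i] by blast
  then show ?case
  proof cases
    case 1
    have eq: "Rp n u v = Rp n ?u ?v" by (rule Rp_right(1)[OF u descent(1-3) 1(1)])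
    show ?thesis unfolding eq 1(2) lv using IH[OF u'] by (simp add: algebra_simps)
  next
    case 2
    have eq: "Rp n u v = ([:0, 1:] - 1) * Rp n u ?v + [:0, 1:] * Rp n ?u ?v"
      by (rule Rp_right(2)[OF u descent(1-3) 2(1)])
    let ?a = "eval_at (Rp n u ?v) (inverse qvar)" and ?b = "eval_at (Rp n ?u ?v) (inverse qvar)"
    let ?a' = "eval_at (Rp n u ?v) qvar" and ?b' = "eval_at (Rp n ?u ?v) qvar"
    let ?e = "(- 1) ^ ninv n u :: int poly fract" and ?f = "(- 1) ^ ninv n ?v :: int poly fract"
    let ?Q = "qvar ^ ninv n ?v" and ?U = "qvar ^ ninv n u"
    have A: "?e * ?Q * ?a = ?f * ?U * ?a'" by (rule IH[OF u])
    have B: "- ?e * ?Q * ?b = ?f * (qvar * ?U) * ?b'" using IH[OF u'] 2(2) by simp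
    have "?e * qvar ^ ninv n v * eval_at (Rp n u v) (inverse qvar) =
        ?e * (qvar * ?Q) * ((inverse qvar - 1) * ?a + inverse qvar * ?b)"
      unfolding eq lv by simp
    also have "\<dots> = (qvar * inverse qvar) * (?e * ?Q * ?a) - qvar * (?e * ?Q * ?a) - (qvar * inverse qvar) * (- ?e * ?Q * ?b)"
      by (rule R_bar_aux)
    also have "\<dots> = - ?f * ?U * ((qvar - 1) * ?a' + qvar * ?b')"
      unfolding A B by (simp add: algebra_simps)
    also have "\<dots> = (- 1) ^ ninv n v * ?U * eval_at (Rp n u v) qvar"
      unfolding eq lv by simp
    finally show ?thesis .
  qed
qed

lemma finite_Sym: "finite (Sym n)"
  by (simp add: finite_permutations)

lemma finite_bruhat: "finite {x. bruhat_less n u x \<and> bruhat_le n x v}"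
  by (rule finite_subset[OF _ finite_Sym[of n]]) (auto simp: bruhat_le_def)

text \<open>The upper element is fixed, and the condition involves \<open>P\<close> only at
  \<open>u\<close> and above it; a column can therefore be built downwards.\<close>

definition KLrel :: "nat \<Rightarrow> perm \<Rightarrow> (perm \<Rightarrow> int poly) \<Rightarrow> perm \<Rightarrow> bool" where
  "KLrel n v P u \<longleftrightarrow>
     2 * degree (P u) < len2 n u v \<and>
     qvar ^ len2 n u v * eval_at (P u) (inverse qvar) - eval_at (P u) qvar =
       (\<Sum>x | bruhat_less n u x \<and> bruhat_le n x v. eval_at (Rp n u x) qvar * eval_at (P x) qvar)"

lemma len2_eq: "bruhat_le n u v \<Longrightarrow> len2 n u v = ninv n v - ninv n u"
  using bruhat_le_Sym[of n u v] by (simp add: len2_def len_eq_ninv)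

text \<open>The right-hand side \<open>F\<close> is antisymmetric, so the halving argument applies.
  To see this, insert the bar symmetry of \<open>R\<close> and the relations already known above
  \<open>u\<close>; this gives a double sum over \<open>x \<le> y\<close>, and orthogonality
  collapses its inner sum over \<open>x\<close>.\<close>

lemma KLrel_step:
  assumes uv: "bruhat_less n u v" and Pv: "P v = 1"
    and above: "\<And>x. bruhat_less n u x \<Longrightarrow> bruhat_less n x v \<Longrightarrow> KLrel n v P x"
  shows "\<exists>p. 2 * degree p < len2 n u v \<and>
     qvar ^ len2 n u v * eval_at p (inverse qvar) - eval_at p qvar =
       (\<Sum>x | bruhat_less n u x \<and> bruhat_le n x v. eval_at (Rp n u x) qvar * eval_at (P x) qvar)"
proof -
  let ?X = "{x. bruhat_less n u x \<and> bruhat_le n x v}"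
  let ?l = "ninv n"
  define F where "F = (\<Sum>x\<in>?X. Rp n u x * P x)"
  have u: "u \<in> Sym n" and v: "v \<in> Sym n" and ule: "bruhat_le n u v"
    using uv bruhat_le_Sym by (auto simp: bruhat_less_def)
  have luv: "?l u < ?l v" using uv by (rule bruhat_less_ninv)
  have l2: "len2 n u v = ?l v - ?l u" by (rule len2_eq[OF ule])
  have xS: "x \<in> Sym n" "?l u < ?l x" "?l x \<le> ?l v" if "x \<in> ?X" for x
    using that bruhat_le_Sym bruhat_less_ninv[of n u x] bruhat_le_ninv[of n x v] by auto
  have relv: "qvar ^ ?l v * eval_at (P x) (inverse qvar) =
      qvar ^ ?l x * (\<Sum>y | bruhat_le n x y \<and> bruhat_le n y v. eval_at (Rp n x y) qvar * eval_at (P y) qvar)"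
    and degP: "degree (P x) + ?l x \<le> ?l v" if x: "x \<in> ?X" for x
  proof -
    note xs = xS[OF x]
    have xv: "bruhat_le n x v" using x by simp
    have split: "{y. bruhat_le n x y \<and> bruhat_le n y v} = insert x {y. bruhat_less n x y \<and> bruhat_le n y v}"
      using xv bruhat_refl[OF xs(1)] by (auto simp: bruhat_less_def)
    have sum: "(\<Sum>y | bruhat_le n x y \<and> bruhat_le n y v. eval_at (Rp n x y) qvar * eval_at (P y) qvar) =
        eval_at (P x) qvar + (\<Sum>y | bruhat_less n x y \<and> bruhat_le n y v. eval_at (Rp n x y) qvar * eval_at (P y) qvar)"
      unfolding split by (subst sum.insert) (use finite_bruhat in \<open>auto simp: bruhat_less_def Rp_self[OF xs(1)]\<close>)
    show "qvar ^ ?l v * eval_at (P x) (inverse qvar) =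
      qvar ^ ?l x * (\<Sum>y | bruhat_le n x y \<and> bruhat_le n y v. eval_at (Rp n x y) qvar * eval_at (P y) qvar)"
      "degree (P x) + ?l x \<le> ?l v"
    proof -
      have "qvar ^ ?l v * eval_at (P x) (inverse qvar) =
        qvar ^ ?l x * (\<Sum>y | bruhat_le n x y \<and> bruhat_le n y v. eval_at (Rp n x y) qvar * eval_at (P y) qvar)
        \<and> degree (P x) + ?l x \<le> ?l v"
      proof (cases "x = v")
        case True
        have "(\<Sum>y | bruhat_less n v y \<and> bruhat_le n y v. eval_at (Rp n v y) qvar * eval_at (P y) qvar) = 0"
          by (rule sum.neutral) (use bruhat_antisym in \<open>auto simp: bruhat_less_def\<close>)
        then show ?thesis using sum Pv True by simp
      next
        case False
        then have xv': "bruhat_less n x v" using xv by (simp add: bruhat_less_def)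
        have rel: "KLrel n v P x" using above x xv' by simp
        have l: "len2 n x v = ?l v - ?l x" by (rule len2_eq[OF xv])
        have "qvar ^ (?l v - ?l x) * eval_at (P x) (inverse qvar) =
            (\<Sum>y | bruhat_le n x y \<and> bruhat_le n y v. eval_at (Rp n x y) qvar * eval_at (P y) qvar)"
          using rel unfolding KLrel_def l sum by (simp add: diff_eq_eq add.commute)
        moreover have "qvar ^ ?l v = qvar ^ ?l x * qvar ^ (?l v - ?l x)"
          using xs by (simp flip: power_add)
        moreover have "degree (P x) + ?l x \<le> ?l v"
          using conjunct1[OF rel[unfolded KLrel_def l]] by arith
        ultimately show ?thesis by (simp add: mult.assoc)
      qed
      then show "qvar ^ ?l v * eval_at (P x) (inverse qvar) =
        qvar ^ ?l x * (\<Sum>y | bruhat_le n x y \<and> bruhat_le n y v. eval_at (Rp n x y) qvar * eval_at (P y) qvar)"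
        "degree (P x) + ?l x \<le> ?l v" by blast+
    qed
  qed
  have dF: "degree F \<le> ?l v - ?l u"
    unfolding F_def
  proof (rule degree_sum_le)
    show "finite ?X" by (rule finite_bruhat)
    fix x assume x: "x \<in> ?X"
    then have ux: "bruhat_le n u x" by (simp add: bruhat_less_def)
    show "degree (Rp n u x * P x) \<le> ?l v - ?l u"
      using degree_mult_le[of "Rp n u x" "P x"] degree_Rp[OF xS(1)[OF x] ux] degP[OF x] by linarith
  qed
  have Y: "(\<Sum>x\<in>?X. \<Sum>y | bruhat_le n x y \<and> bruhat_le n y v. g x y) = (\<Sum>y\<in>?X. \<Sum>x | x \<in> ?X \<and> bruhat_le n x y. g x y)"
    for g :: "perm \<Rightarrow> perm \<Rightarrow> int poly fract"
  proof -
    have "(\<Sum>x\<in>?X. \<Sum>y | bruhat_le n x y \<and> bruhat_le n y v. g x y) = (\<Sum>x\<in>?X. \<Sum>y | y \<in> ?X \<and> bruhat_le n x y. g x y)"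
    proof (rule sum.cong[OF refl])
      fix x assume x: "x \<in> ?X"
      have "bruhat_less n u y" if "bruhat_le n x y" for y
        using x that bruhat_trans[of n u x y] bruhat_antisym[of n u x] by (auto simp: bruhat_less_def)
      then have "{y. bruhat_le n x y \<and> bruhat_le n y v} = {y. y \<in> ?X \<and> bruhat_le n x y}"
        by blast
      then show "(\<Sum>y | bruhat_le n x y \<and> bruhat_le n y v. g x y) = (\<Sum>y | y \<in> ?X \<and> bruhat_le n x y. g x y)"
        by simp
    qed
    also have "\<dots> = (\<Sum>y\<in>?X. \<Sum>x | x \<in> ?X \<and> bruhat_le n x y. g x y)"
      by (rule sum.swap_restrict[OF finite_bruhat finite_bruhat])
    finally show ?thesis .
  qed
  \<comment> \<open>Orthogonality between \<open>u\<close> and \<open>y\<close>, with the term of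
    \<open>u\<close> itself moved to the other side.\<close>
  have inner: "(\<Sum>x | x \<in> ?X \<and> bruhat_le n x y. (- 1) ^ ?l x * eval_at (Rp n u x) qvar * eval_at (Rp n x y) qvar)
      = - ((- 1) ^ ?l u * eval_at (Rp n u y) qvar)" if y: "y \<in> ?X" for y
  proof -
    let ?g = "\<lambda>w. (- 1) ^ ?l w * Rp n u w * Rp n w y"
    have uy: "u \<noteq> y" "bruhat_le n u y" using y by (auto simp: bruhat_less_def)
    have yS: "y \<in> Sym n" using xS[OF y] by simp
    have sub: "insert u {x \<in> ?X. bruhat_le n x y} \<subseteq> Sym n" using u xS by blast
    have "0 = (\<Sum>w\<in>Sym n. ?g w)"
      using R_orthogonality[OF yS u] uy by simp
    also have "\<dots> = (\<Sum>w\<in>insert u {x \<in> ?X. bruhat_le n x y}. ?g w)"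
    proof (rule sum.mono_neutral_right[OF finite_Sym sub])
      show "\<forall>w\<in>Sym n - insert u {x \<in> ?X. bruhat_le n x y}. ?g w = 0"
      proof
        fix w assume w: "w \<in> Sym n - insert u {x \<in> ?X. bruhat_le n x y}"
        have "bruhat_le n w v" if "bruhat_le n w y" using bruhat_trans[OF that, of v] y by blast
        then have "\<not> (bruhat_le n u w \<and> bruhat_le n w y)"
          using w unfolding bruhat_less_def by blast
        then show "?g w = 0" using Rp_zero[of n u w] Rp_zero[of n w y] by (cases "bruhat_le n u w") simp_all
      qed
    qed
    also have "\<dots> = ?g u + (\<Sum>w | w \<in> ?X \<and> bruhat_le n w y. ?g w)"
      using uy by (subst sum.insert) (auto simp: bruhat_less_def intro: finite_subset[OF _ finite_bruhat[of n u v]])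
    finally have "(\<Sum>w | w \<in> ?X \<and> bruhat_le n w y. ?g w) = - ((- 1) ^ ?l u * Rp n u y)"
      using Rp_self[OF u] by (simp add: eq_neg_iff_add_eq_0 add.commute)
    from arg_cong[OF this, of "\<lambda>p. eval_at p qvar"] show ?thesis
      by (simp add: eval_at_sum)
  qed
  let ?e = "(- 1) ^ ?l u :: int poly fract"
  have ee: "?e * ?e = 1" by (simp flip: power_add mult_2 add: power_mult)
  have "qvar ^ ?l v * eval_at F (inverse qvar)
      = (\<Sum>x\<in>?X. eval_at (Rp n u x) (inverse qvar) * (qvar ^ ?l v * eval_at (P x) (inverse qvar)))"
    by (simp add: F_def eval_at_sum sum_distrib_left mult.left_commute)
  also have "\<dots> = (\<Sum>x\<in>?X. qvar ^ ?l u * ?e * (\<Sum>y | bruhat_le n x y \<and> bruhat_le n y v.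
      (- 1) ^ ?l x * eval_at (Rp n u x) qvar * eval_at (Rp n x y) qvar * eval_at (P y) qvar))"
  proof (rule sum.cong[OF refl])
    fix x assume x: "x \<in> ?X"
    have "?e * qvar ^ ?l x * eval_at (Rp n u x) (inverse qvar) =
        (- 1) ^ ?l x * qvar ^ ?l u * eval_at (Rp n u x) qvar"
      by (rule R_bar[OF xS(1)[OF x] u])
    then have "?e * (?e * qvar ^ ?l x * eval_at (Rp n u x) (inverse qvar)) =
        ?e * ((- 1) ^ ?l x * qvar ^ ?l u * eval_at (Rp n u x) qvar)" by simp
    then have "(?e * ?e) * (qvar ^ ?l x * eval_at (Rp n u x) (inverse qvar)) =
        ?e * ((- 1) ^ ?l x * qvar ^ ?l u * eval_at (Rp n u x) qvar)"
      by (simp only: mult.assoc)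
    then have b: "qvar ^ ?l x * eval_at (Rp n u x) (inverse qvar) =
        ?e * (- 1) ^ ?l x * qvar ^ ?l u * eval_at (Rp n u x) qvar"
      unfolding ee by (simp add: mult.assoc)
    let ?S = "\<Sum>y | bruhat_le n x y \<and> bruhat_le n y v. eval_at (Rp n x y) qvar * eval_at (P y) qvar"
    have "eval_at (Rp n u x) (inverse qvar) * (qvar ^ ?l v * eval_at (P x) (inverse qvar))
        = (qvar ^ ?l x * eval_at (Rp n u x) (inverse qvar)) * ?S"
      unfolding relv[OF x] by (simp add: algebra_simps)
    also have "\<dots> = qvar ^ ?l u * ?e * ((- 1) ^ ?l x * eval_at (Rp n u x) qvar * ?S)"
      unfolding b by (simp add: algebra_simps)
    finally show "eval_at (Rp n u x) (inverse qvar) * (qvar ^ ?l v * eval_at (P x) (inverse qvar)) =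
        qvar ^ ?l u * ?e * (\<Sum>y | bruhat_le n x y \<and> bruhat_le n y v.
      (- 1) ^ ?l x * eval_at (Rp n u x) qvar * eval_at (Rp n x y) qvar * eval_at (P y) qvar)"
      by (simp add: sum_distrib_left mult.assoc)
  qed
  also have "\<dots> = qvar ^ ?l u * ?e * (\<Sum>y\<in>?X. \<Sum>x | x \<in> ?X \<and> bruhat_le n x y.
      (- 1) ^ ?l x * eval_at (Rp n u x) qvar * eval_at (Rp n x y) qvar * eval_at (P y) qvar)"
    unfolding sum_distrib_left[symmetric] Y by simp
  also have "\<dots> = qvar ^ ?l u * ?e * (\<Sum>y\<in>?X. - (?e * eval_at (Rp n u y) qvar) * eval_at (P y) qvar)"
  proof (rule arg_cong[where f = "\<lambda>z. qvar ^ ?l u * ?e * z"], rule sum.cong[OF refl])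
    fix y assume y: "y \<in> ?X"
    show "(\<Sum>x | x \<in> ?X \<and> bruhat_le n x y.
      (- 1) ^ ?l x * eval_at (Rp n u x) qvar * eval_at (Rp n x y) qvar * eval_at (P y) qvar) =
      - (?e * eval_at (Rp n u y) qvar) * eval_at (P y) qvar"
      unfolding sum_distrib_right[symmetric] inner[OF y] by simp
  qed
  also have "\<dots> = - (?e * ?e) * (qvar ^ ?l u * (\<Sum>y\<in>?X. eval_at (Rp n u y) qvar * eval_at (P y) qvar))"
    by (simp add: sum_distrib_left sum_negf algebra_simps)
  also have "\<dots> = - (qvar ^ ?l u * eval_at F qvar)"
    unfolding ee by (simp add: F_def eval_at_sum)
  finally have main: "qvar ^ ?l v * eval_at F (inverse qvar) = qvar ^ ?l u * (- eval_at F qvar)" by simp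
  have "qvar ^ ?l v = qvar ^ ?l u * qvar ^ (?l v - ?l u)" using luv by (simp flip: power_add)
  then have "qvar ^ ?l u * (qvar ^ (?l v - ?l u) * eval_at F (inverse qvar)) = qvar ^ ?l u * (- eval_at F qvar)"
    using main by (simp only: mult.assoc)
  then have anti: "qvar ^ (?l v - ?l u) * eval_at F (inverse qvar) = - eval_at F qvar"
    by (metis mult_left_cancel power_not_zero qvar_nz)
  have "0 < ?l v - ?l u" using luv by simp
  from antisymmetric_solution[OF this dF anti] show ?thesis
    unfolding l2 by (simp add: F_def eval_at_sum)
qed

text \<open>Stage \<open>k\<close> covers the elements of colength at most \<open>k\<close> below
  \<open>v\<close>. The next stage changes entries of colength \<open>Suc k\<close> only, and no
  relation of smaller colength refers to these.\<close>

lemma KL_exists_column: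
  assumes v: "v \<in> Sym n"
  shows "\<exists>P. P v = 1 \<and> (\<forall>u. \<not> bruhat_le n u v \<longrightarrow> P u = 0) \<and> (\<forall>u. bruhat_less n u v \<longrightarrow> KLrel n v P u)"
proof -
  have "\<exists>P. P v = 1 \<and> (\<forall>u. \<not> bruhat_le n u v \<longrightarrow> P u = 0) \<and>
      (\<forall>u. bruhat_less n u v \<and> ninv n v \<le> ninv n u + k \<longrightarrow> KLrel n v P u)" for k
  proof (induction k)
    case 0
    have "\<not> (bruhat_less n u v \<and> ninv n v \<le> ninv n u)" for u
      using bruhat_less_ninv[of n u v] by auto
    then show ?case
      by (intro exI[of _ "\<lambda>u. if u = v then 1 else 0"]) (use bruhat_refl[OF v] in auto)
  next
    case (Suc k)
    then obtain P where P: "P v = 1" "\<And>u. \<not> bruhat_le n u v \<Longrightarrow> P u = 0"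
      "\<And>u. bruhat_less n u v \<Longrightarrow> ninv n v \<le> ninv n u + k \<Longrightarrow> KLrel n v P u" by blast
    define new where "new = (\<lambda>u. bruhat_less n u v \<and> ninv n v = ninv n u + Suc k)"
    define good where "good = (\<lambda>u p. 2 * degree p < len2 n u v \<and>
     qvar ^ len2 n u v * eval_at p (inverse qvar) - eval_at p qvar =
       (\<Sum>x | bruhat_less n u x \<and> bruhat_le n x v. eval_at (Rp n u x) qvar * eval_at (P x) qvar))"
    have ex: "\<exists>p. good u p" if "new u" for u
      unfolding good_def
    proof (rule KLrel_step[where P = P])
      show "bruhat_less n u v" using that by (simp add: new_def)
      show "P v = 1" by (rule P(1))
      fix x assume "bruhat_less n u x" "bruhat_less n x v"
      then show "KLrel n v P x" using P(3)[of x] bruhat_less_ninv[of n u x] that by (simp add: new_def)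
    qed
    define P' where "P' = (\<lambda>u. if new u then SOME p. good u p else P u)"
    have old: "P' x = P x" if "\<not> new x" for x using that by (simp add: P'_def)
    have eqabove: "P' x = P x" if "ninv n v \<le> ninv n u + Suc k" "bruhat_less n u x" for u x
      by (rule old) (use that bruhat_less_ninv[OF that(2)] in \<open>auto simp: new_def\<close>)
    have rel: "KLrel n v P' u" if u: "bruhat_less n u v" "ninv n v \<le> ninv n u + Suc k" for u
    proof -
      have sum: "(\<Sum>x | bruhat_less n u x \<and> bruhat_le n x v. eval_at (Rp n u x) qvar * eval_at (P' x) qvar)
          = (\<Sum>x | bruhat_less n u x \<and> bruhat_le n x v. eval_at (Rp n u x) qvar * eval_at (P x) qvar)"
        by (rule sum.cong[OF refl]) (use eqabove[OF u(2)] in auto)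
      show ?thesis
      proof (cases "new u")
        case True
        then have "good u (P' u)" using someI_ex[OF ex[OF True]] by (simp add: P'_def)
        then show ?thesis unfolding KLrel_def sum good_def .
      next
        case False
        then have "KLrel n v P u" using P(3) u by (auto simp: new_def)
        then show ?thesis unfolding KLrel_def sum old[OF False] .
      qed
    qed
    have "\<not> new v" by (simp add: new_def)
    then have "P' v = 1" using old P(1) by simp
    moreover have "P' u = 0" if "\<not> bruhat_le n u v" for u
      using that P(2) old[of u] by (auto simp: new_def bruhat_less_def)
    ultimately show ?case using rel by blast
  qed
  from this[of "ninv n v"] show ?thesis by auto
qed

lemma is_KL_family_iff:
  "is_KL_family n P \<longleftrightarrow>
     (\<forall>u v. \<not> bruhat_le n u v \<longrightarrow> P u v = 0) \<and> (\<forall>u\<in>Sym n. P u u = 1) \<and>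
     (\<forall>u v. bruhat_less n u v \<longrightarrow> KLrel n v (\<lambda>x. P x v) u)"
  by (simp add: is_KL_family_def KLrel_def R_poly_eq)

lemma KL_family_exists: "\<exists>P. is_KL_family n P"
proof -
  have "\<forall>v. \<exists>P. v \<in> Sym n \<longrightarrow> P v = 1 \<and> (\<forall>u. \<not> bruhat_le n u v \<longrightarrow> P u = 0) \<and> (\<forall>u. bruhat_less n u v \<longrightarrow> KLrel n v P u)"
    using KL_exists_column by blast
  from choice[OF this] obtain P where P: "\<And>v. v \<in> Sym n \<Longrightarrow>
      P v v = 1 \<and> (\<forall>u. \<not> bruhat_le n u v \<longrightarrow> P v u = 0) \<and> (\<forall>u. bruhat_less n u v \<longrightarrow> KLrel n v (P v) u)" by blast
  define P' where "P' = (\<lambda>u v. if v \<in> Sym n then P v u else 0)"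
  have "is_KL_family n P'"
    unfolding is_KL_family_iff
  proof (intro conjI allI impI ballI)
    fix u v assume "\<not> bruhat_le n u v"
    then show "P' u v = 0" using P by (simp add: P'_def)
  next
    fix u assume "u \<in> Sym n"
    then show "P' u u = 1" using P by (simp add: P'_def)
  next
    fix u v assume uv: "bruhat_less n u v"
    then have v: "v \<in> Sym n" using bruhat_le_Sym by (auto simp: bruhat_less_def)
    then have "(\<lambda>x. P' x v) = P v" by (simp add: P'_def)
    then show "KLrel n v (\<lambda>x. P' x v) u" using P[OF v] uv by simp
  qed
  then show ?thesis by blast
qed

lemma KL_family_unique:
  assumes P: "is_KL_family n P" and P': "is_KL_family n P'"
  shows "P = P'"
proof (intro ext)
  fix u v
  show "P u v = P' u v"
  proof (induction "ninv n v - ninv n u" arbitrary: u rule: less_induct)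
    case less
    show ?case
    proof (cases "bruhat_less n u v")
      case False
      then show ?thesis using P P' bruhat_le_Sym[of n u v] by (cases "bruhat_le n u v") (auto simp: is_KL_family_def bruhat_less_def)
    next
      case True
      have IH: "P x v = P' x v" if "bruhat_less n u x" "bruhat_le n x v" for x
        by (rule less) (use bruhat_less_ninv[OF that(1)] bruhat_less_ninv[OF True] in linarith)
      have r: "KLrel n v (\<lambda>x. P x v) u" "KLrel n v (\<lambda>x. P' x v) u"
        using P P' True by (auto simp: is_KL_family_iff)
      have sum: "(\<Sum>x | bruhat_less n u x \<and> bruhat_le n x v. eval_at (Rp n u x) qvar * eval_at (P x v) qvar)
          = (\<Sum>x | bruhat_less n u x \<and> bruhat_le n x v. eval_at (Rp n u x) qvar * eval_at (P' x v) qvar)"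
        by (rule sum.cong[OF refl]) (use IH in auto)
      have d: "2 * degree (P u v - P' u v) < len2 n u v"
        using r degree_diff_le_max[of "P u v" "P' u v"] unfolding KLrel_def by linarith
      have "qvar ^ len2 n u v * eval_at (P u v) (inverse qvar) - eval_at (P u v) qvar =
          qvar ^ len2 n u v * eval_at (P' u v) (inverse qvar) - eval_at (P' u v) qvar"
        using r sum by (simp add: KLrel_def)
      then have "qvar ^ len2 n u v * eval_at (P u v - P' u v) (inverse qvar) = eval_at (P u v - P' u v) qvar"
        by (simp add: algebra_simps)
      from symmetric_zero[OF d this] show ?thesis by simp
    qed
  qed
qed

lemma KL_poly_family: "is_KL_family n (KL_poly n)"
  unfolding KL_poly_def using KL_family_exists KL_family_unique by (metis theI')

text \<open>The term \<open>x = u\<close> is absorbed into the sum and the relation is multiplied by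
  \<open>q^l(u)\<close>; in this form it also covers \<open>u = v\<close>.\<close>

lemma KL_bar:
  assumes uv: "bruhat_le n u v"
  shows "qvar ^ ninv n v * eval_at (KL_poly n u v) (inverse qvar) =
    qvar ^ ninv n u * (\<Sum>x | bruhat_le n u x \<and> bruhat_le n x v. eval_at (Rp n u x) qvar * eval_at (KL_poly n x v) qvar)"
proof -
  have u: "u \<in> Sym n" and v: "v \<in> Sym n" using uv bruhat_le_Sym by auto
  have split: "{y. bruhat_le n u y \<and> bruhat_le n y v} = insert u {y. bruhat_less n u y \<and> bruhat_le n y v}"
    using uv bruhat_refl[OF u] by (auto simp: bruhat_less_def)
  have sum: "(\<Sum>y | bruhat_le n u y \<and> bruhat_le n y v. eval_at (Rp n u y) qvar * eval_at (KL_poly n y v) qvar) =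
      eval_at (KL_poly n u v) qvar +
      (\<Sum>y | bruhat_less n u y \<and> bruhat_le n y v. eval_at (Rp n u y) qvar * eval_at (KL_poly n y v) qvar)"
    unfolding split by (subst sum.insert) (use finite_bruhat in \<open>auto simp: bruhat_less_def Rp_self[OF u]\<close>)
  show ?thesis
  proof (cases "u = v")
    case True
    have "(\<Sum>y | bruhat_less n v y \<and> bruhat_le n y v. eval_at (Rp n v y) qvar * eval_at (KL_poly n y v) qvar) = 0"
      by (rule sum.neutral) (use bruhat_antisym in \<open>auto simp: bruhat_less_def\<close>)
    moreover have "KL_poly n v v = 1" using KL_poly_family v unfolding is_KL_family_def by blast
    ultimately show ?thesis using sum True by simp
  next
    case False
    then have "bruhat_less n u v" using uv by (simp add: bruhat_less_def)
    then have rel: "KLrel n v (\<lambda>x. KL_poly n x v) u" using KL_poly_family[of n] by (simp add: is_KL_family_iff)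
    have l: "len2 n u v = ninv n v - ninv n u" by (rule len2_eq[OF uv])
    have "qvar ^ (ninv n v - ninv n u) * eval_at (KL_poly n u v) (inverse qvar) =
        (\<Sum>y | bruhat_le n u y \<and> bruhat_le n y v. eval_at (Rp n u y) qvar * eval_at (KL_poly n y v) qvar)"
      using rel unfolding KLrel_def l sum by (simp add: diff_eq_eq add.commute)
    moreover have "qvar ^ ninv n v = qvar ^ ninv n u * qvar ^ (ninv n v - ninv n u)"
      using bruhat_le_ninv[OF uv] by (auto simp flip: power_add)
    ultimately show ?thesis by (simp add: mult.assoc)
  qed
qed

section \<open>Hecke operators over the field of fractions and their trace\<close>

type_synonym hop = "(perm \<Rightarrow> int poly fract) \<Rightarrow> perm \<Rightarrow> int poly fract"

abbreviation T :: "nat \<Rightarrow> hop" where "T \<equiv> hop qvar 1"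

abbreviation cq :: "int poly fract" where "cq \<equiv> inverse qvar - 1"

text \<open>The inverse of \<open>T i\<close>, read off from
  \<open>T^2 = (q - 1) T + q\<close>.\<close>

definition U :: "nat \<Rightarrow> hop" where
  "U i \<phi> y = inverse qvar * (T i \<phi> y - (qvar - 1) * \<phi> y)"

lemma T_up: "y i < y (Suc i) \<Longrightarrow> T i \<phi> y = (qvar - 1) * \<phi> y + \<phi> (y \<circ> adj i)"
  and T_down: "y (Suc i) < y i \<Longrightarrow> T i \<phi> y = qvar * \<phi> (y \<circ> adj i)"
  by (simp_all add: hop_def)

lemma U_up: "y i < y (Suc i) \<Longrightarrow> U i \<phi> y = inverse qvar * \<phi> (y \<circ> adj i)"
  and U_down: "y (Suc i) < y i \<Longrightarrow> U i \<phi> y = \<phi> (y \<circ> adj i) + cq * \<phi> y"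
  by (simp_all add: U_def T_up T_down field_simps)

lemma T_quadratic: "T i (T i \<phi>) y = (qvar - 1) * T i \<phi> y + qvar * \<phi> y"
proof -
  have e: "(y \<circ> adj i) i = y (Suc i)" "(y \<circ> adj i) (Suc i) = y i" by simp_all
  consider "y i < y (Suc i)" | "y (Suc i) < y i" | "y i = y (Suc i)" by linarith
  then show ?thesis
    by cases (simp_all add: hop_def e algebra_simps del: comp_apply)
qed

lemma T_lin: "T i (\<lambda>y. c * \<phi> y + d * \<psi> y) = (\<lambda>y. c * T i \<phi> y + d * T i \<psi> y)"
  by (rule ext) (simp add: hop_def algebra_simps)

lemma U_lin: "U i (\<lambda>y. c * \<phi> y + d * \<psi> y) = (\<lambda>y. c * U i \<phi> y + d * U i \<psi> y)"
  by (rule ext) (simp add: U_def T_lin algebra_simps)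

lemma U_eq: "U i \<phi> = (\<lambda>y. inverse qvar * T i \<phi> y + (- inverse qvar * (qvar - 1)) * \<phi> y)"
  by (rule ext) (simp add: U_def algebra_simps)

lemma T_U [simp]: "T i (U i \<phi>) = \<phi>"
  by (rule ext) (simp only: U_eq T_lin T_quadratic, simp add: field_simps)

lemma U_T [simp]: "U i (T i \<phi>) = \<phi>"
  by (rule ext) (simp add: U_def T_quadratic)

lemma T_commute: "Suc i < j \<or> Suc j < i \<Longrightarrow> T i (T j \<phi>) = T j (T i \<phi>)"
  using hop_commute by metis

lemma TU_commute:
  assumes "Suc i < j \<or> Suc j < i"
  shows "T i (U j \<phi>) = U j (T i \<phi>)"
  unfolding U_eq[of j \<phi>] U_eq[of j "T i \<phi>"] T_lin using T_commute[OF assms] by simp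

lemma U_commute:
  assumes "Suc i < j \<or> Suc j < i"
  shows "U i (U j \<phi>) = U j (U i \<phi>)"
proof -
  have "T i (U j (U i \<phi>)) = U j \<phi>" by (simp add: TU_commute[OF assms])
  then have "U i (T i (U j (U i \<phi>))) = U i (U j \<phi>)" by simp
  then show ?thesis by simp
qed

lemma T_braid: "T i (T (Suc i) (T i \<phi>)) = T (Suc i) (T i (T (Suc i) \<phi>))"
  by (rule hop_braid)

text \<open>A mixed braid relation, obtained by multiplying the braid relation of the
  \<open>T\<close> with inverses from both sides.\<close>

lemma TUU: "T i (U (Suc i) (U i \<phi>)) = U (Suc i) (U i (T (Suc i) \<phi>))"
proof -
  have "T i (T (Suc i) (T i (U (Suc i) (U i \<phi>)))) = T (Suc i) \<phi>"
    by (simp add: T_braid)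
  then have "U (Suc i) (U i (T i (T (Suc i) (T i (U (Suc i) (U i \<phi>)))))) = U (Suc i) (U i (T (Suc i) \<phi>))"
    by simp
  then show ?thesis by simp
qed

lemma TUU': "T (Suc i) (U i (U (Suc i) \<phi>)) = U i (U (Suc i) (T i \<phi>))"
proof -
  have "T (Suc i) (T i (T (Suc i) (U i (U (Suc i) \<phi>)))) = T i \<phi>"
    by (simp flip: T_braid)
  then have "U i (U (Suc i) (T (Suc i) (T i (T (Suc i) (U i (U (Suc i) \<phi>)))))) = U i (U (Suc i) (T i \<phi>))"
    by simp
  then show ?thesis by simp
qed

text \<open>Words in the generators and their inverses. The index set \<open>S\<close> is recorded
  because it decides commutation, support and factorization of traces.\<close>

inductive_set mon :: "nat set \<Rightarrow> hop set" for S :: "nat set" where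
  mon_id: "id \<in> mon S"
| mon_T': "i \<in> S \<Longrightarrow> \<Phi> \<in> mon S \<Longrightarrow> T i \<circ> \<Phi> \<in> mon S"
| mon_U': "i \<in> S \<Longrightarrow> \<Phi> \<in> mon S \<Longrightarrow> U i \<circ> \<Phi> \<in> mon S"

lemma mon_comp: "\<Phi> \<in> mon S \<Longrightarrow> \<Psi> \<in> mon S \<Longrightarrow> \<Phi> \<circ> \<Psi> \<in> mon S"
proof (induction rule: mon.induct)
  case mon_id
  then show ?case by simp
next
  case (mon_T' i \<Phi>)
  then have "T i \<circ> (\<Phi> \<circ> \<Psi>) \<in> mon S" by (intro mon.mon_T') (simp_all add: comp_def)
  then show ?case by (simp add: comp_def)
next
  case (mon_U' i \<Phi>)
  then have "U i \<circ> (\<Phi> \<circ> \<Psi>) \<in> mon S" by (intro mon.mon_U') (simp_all add: comp_def)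
  then show ?case by (simp add: comp_def)
qed

lemma mon_T: "i \<in> S \<Longrightarrow> T i \<in> mon S"
  using mon_T'[OF _ mon_id, of i S] by simp

lemma mon_U: "i \<in> S \<Longrightarrow> U i \<in> mon S"
  using mon_U'[OF _ mon_id, of i S] by simp

lemma mon_mono:
  assumes "\<Phi> \<in> mon S" "S \<subseteq> S'"
  shows "\<Phi> \<in> mon S'"
  using assms(1)
proof (induction rule: mon.induct)
  case mon_id
  show "id \<in> mon S'" by (rule mon.mon_id)
next
  case (mon_T' i \<Phi>)
  show "T i \<circ> \<Phi> \<in> mon S'" using mon_T' assms(2) by (intro mon.mon_T') auto
next
  case (mon_U' i \<Phi>)
  show "U i \<circ> \<Phi> \<in> mon S'" using mon_U' assms(2) by (intro mon.mon_U') auto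
qed

lemma mon_lin:
  assumes "\<Phi> \<in> mon S"
  shows "\<Phi> (\<lambda>y. c * \<phi> y + d * \<psi> y) = (\<lambda>y. c * \<Phi> \<phi> y + d * \<Phi> \<psi> y)"
  using assms by (induction rule: mon.induct) (simp_all add: T_lin U_lin)

lemma mon_scale:
  assumes "\<Phi> \<in> mon S"
  shows "\<Phi> (\<lambda>y. c * \<phi> y) = (\<lambda>y. c * \<Phi> \<phi> y)"
  using mon_lin[OF assms, of c \<phi> 0 \<phi>] by simp

lemma U_lop_commute: "U i (lop qvar 1 j \<phi>) = lop qvar 1 j (U i \<phi>)"
  by (rule ext) (simp add: U_def hop_lop_commute, simp add: lop_def U_def algebra_simps)

lemma mon_lop:
  assumes "\<Phi> \<in> mon S"
  shows "\<Phi> (lop qvar 1 j \<phi>) = lop qvar 1 j (\<Phi> \<phi>)"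
  using assms by (induction rule: mon.induct) (simp_all add: hop_lop_commute U_lop_commute)

lemma mon_commute:
  assumes "\<Phi> \<in> mon S" "\<Psi> \<in> mon S'" and far: "\<And>s t. s \<in> S \<Longrightarrow> t \<in> S' \<Longrightarrow> Suc s < t \<or> Suc t < s"
  shows "\<Phi> (\<Psi> \<phi>) = \<Psi> (\<Phi> \<phi>)"
proof -
  have 1: "T s (\<Psi> \<phi>) = \<Psi> (T s \<phi>) \<and> U s (\<Psi> \<phi>) = \<Psi> (U s \<phi>)" if s: "s \<in> S" for s \<phi>
    using assms(2)
  proof (induction arbitrary: \<phi> rule: mon.induct)
    case (mon_T' t \<Psi>)
    have f: "Suc s < t \<or> Suc t < s" using far s mon_T' by blast
    then have f': "Suc t < s \<or> Suc s < t" by blast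
    show ?case using mon_T' by (simp add: T_commute[OF f] TU_commute[OF f', symmetric])
  next
    case (mon_U' t \<Psi>)
    have f: "Suc s < t \<or> Suc t < s" using far s mon_U' by blast
    show ?case using mon_U' by (simp add: TU_commute[OF f] U_commute[OF f])
  qed simp
  show ?thesis
    using assms(1) by (induction arbitrary: \<phi> rule: mon.induct) (simp_all add: 1)
qed

section \<open>The canonical trace\<close>

definition tr :: "hop \<Rightarrow> int poly fract" where
  "tr \<Phi> = \<Phi> delta id"

text \<open>On \<open>delta\<close> the innermost \<open>T i\<close> can be exchanged for the
  opposite action, which passes through \<open>\<Phi>\<close>; at \<open>id\<close> it becomes
  \<open>T i\<close> again.\<close>

lemma tr_T_comm:
  assumes "\<Phi> \<in> mon S"
  shows "tr (\<Phi> \<circ> T i) = tr (T i \<circ> \<Phi>)"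
  by (simp add: tr_def hop_delta mon_lop[OF assms] lop_at_id)

lemma tr_U_comm:
  assumes "\<Phi> \<in> mon S"
  shows "tr (\<Phi> \<circ> U i) = tr (U i \<circ> \<Phi>)"
proof -
  have "\<Phi> (U i delta) id = inverse qvar * \<Phi> (T i delta) id + (- inverse qvar * (qvar - 1)) * \<Phi> delta id"
    unfolding U_eq mon_lin[OF assms] ..
  also have "\<Phi> (T i delta) id = T i (\<Phi> delta) id"
    using tr_T_comm[OF assms, of i] by (simp add: tr_def)
  finally have A: "\<Phi> (U i delta) id = inverse qvar * T i (\<Phi> delta) id + (- inverse qvar * (qvar - 1)) * \<Phi> delta id" .
  have B: "U i (\<Phi> delta) id = inverse qvar * T i (\<Phi> delta) id + (- inverse qvar * (qvar - 1)) * \<Phi> delta id"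
    by (simp only: U_eq)
  show ?thesis by (simp only: tr_def comp_apply A B)
qed

lemma tr_comm:
  assumes "\<Phi> \<in> mon S" "\<Psi> \<in> mon S'"
  shows "tr (\<Phi> \<circ> \<Psi>) = tr (\<Psi> \<circ> \<Phi>)"
proof -
  \<comment> \<open>The first operator must remain arbitrary, since each generator split off from
    \<open>\<Psi>\<close> is moved into it.\<close>
  have "\<forall>\<Phi>. \<Phi> \<in> mon UNIV \<longrightarrow> tr (\<Phi> \<circ> \<Psi>) = tr (\<Psi> \<circ> \<Phi>)"
    using mon_mono[OF assms(2) subset_UNIV]
  proof (induction rule: mon.induct)
    case mon_id
    then show ?case by simp
  next
    case (mon_T' i \<Psi>)
    show "\<forall>\<Phi>. \<Phi> \<in> mon UNIV \<longrightarrow> tr (\<Phi> \<circ> (T i \<circ> \<Psi>)) = tr (T i \<circ> \<Psi> \<circ> \<Phi>)"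
    proof (intro allI impI)
      fix \<Phi> :: hop assume \<Phi>: "\<Phi> \<in> mon UNIV"
      have "\<Phi> \<circ> T i \<in> mon UNIV" by (rule mon_comp[OF \<Phi> mon_T]) simp
      then have "tr (\<Phi> \<circ> T i \<circ> \<Psi>) = tr (\<Psi> \<circ> (\<Phi> \<circ> T i))" using mon_T'.IH by blast
      also have "\<dots> = tr (T i \<circ> (\<Psi> \<circ> \<Phi>))"
        using tr_T_comm[OF mon_comp[OF mon_T'.hyps(2) \<Phi>], of i] by (simp only: comp_assoc)
      finally show "tr (\<Phi> \<circ> (T i \<circ> \<Psi>)) = tr (T i \<circ> \<Psi> \<circ> \<Phi>)" by (simp only: comp_assoc)
    qed
  next
    case (mon_U' i \<Psi>)
    show "\<forall>\<Phi>. \<Phi> \<in> mon UNIV \<longrightarrow> tr (\<Phi> \<circ> (U i \<circ> \<Psi>)) = tr (U i \<circ> \<Psi> \<circ> \<Phi>)"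
    proof (intro allI impI)
      fix \<Phi> :: hop assume \<Phi>: "\<Phi> \<in> mon UNIV"
      have "\<Phi> \<circ> U i \<in> mon UNIV" by (rule mon_comp[OF \<Phi> mon_U]) simp
      then have "tr (\<Phi> \<circ> U i \<circ> \<Psi>) = tr (\<Psi> \<circ> (\<Phi> \<circ> U i))" using mon_U'.IH by blast
      also have "\<dots> = tr (U i \<circ> (\<Psi> \<circ> \<Phi>))"
        using tr_U_comm[OF mon_comp[OF mon_U'.hyps(2) \<Phi>], of i] by (simp only: comp_assoc)
      finally show "tr (\<Phi> \<circ> (U i \<circ> \<Psi>)) = tr (U i \<circ> \<Psi> \<circ> \<Phi>)" by (simp only: comp_assoc)
    qed
  qed
  then show ?thesis using mon_mono[OF assms(1) subset_UNIV] by blast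
qed

section \<open>Supports in parabolic subgroups and conditional expectation\<close>

lemma permutes_comp_adj_iff:
  assumes "i \<in> {a..<b}"
  shows "y \<circ> adj i permutes {a..b} \<longleftrightarrow> y permutes {a..b}"
proof -
  have s: "adj i permutes {a..b}" using assms by (intro permutes_swap_id) auto
  have "y \<circ> adj i \<circ> adj i permutes {a..b}" if "y \<circ> adj i permutes {a..b}"
    by (rule permutes_compose[OF s that])
  then show ?thesis using permutes_compose[OF s, of y] unfolding adj_adj by blast
qed

definition supp_on :: "nat set \<Rightarrow> (perm \<Rightarrow> int poly fract) \<Rightarrow> bool" where
  "supp_on A \<phi> \<longleftrightarrow> (\<forall>y. \<phi> y \<noteq> 0 \<longrightarrow> y permutes A)"

lemma supp_onD: "supp_on A \<phi> \<Longrightarrow> \<not> y permutes A \<Longrightarrow> \<phi> y = 0"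
  by (auto simp: supp_on_def)

lemma supp_delta: "supp_on A delta"
  by (simp add: supp_on_def delta_def permutes_id)

lemma T_supp:
  assumes "i \<in> {a..<b}" "supp_on {a..b} \<phi>"
  shows "supp_on {a..b} (T i \<phi>)" "supp_on {a..b} (U i \<phi>)"
proof -
  have *: "T i \<phi> y = 0 \<and> \<phi> y = 0" if "\<not> y permutes {a..b}" for y
    using supp_onD[OF assms(2), of y] supp_onD[OF assms(2), of "y \<circ> adj i"]
      permutes_comp_adj_iff[OF assms(1), of y] that by (simp add: hop_def)
  have "y permutes {a..b}" if "T i \<phi> y \<noteq> 0 \<or> U i \<phi> y \<noteq> 0" for y
    using *[of y] that by (cases "y permutes {a..b}") (simp_all add: U_def)
  then show "supp_on {a..b} (T i \<phi>)" "supp_on {a..b} (U i \<phi>)"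
    unfolding supp_on_def by blast+
qed

lemma mon_supp:
  assumes "\<Phi> \<in> mon {a..<b}" "supp_on {a..b} \<phi>"
  shows "supp_on {a..b} (\<Phi> \<phi>)"
  using assms by (induction rule: mon.induct) (auto intro: T_supp)

text \<open>Right multiplication by the generators involved never leaves the parabolic subgroup, so
  values outside of it cannot enter.\<close>

lemma mon_local:
  assumes "\<Phi> \<in> mon {a..<b}" and eq: "\<And>y. y permutes {a..b} \<Longrightarrow> \<phi> y = \<psi> y" and y: "y permutes {a..b}"
  shows "\<Phi> \<phi> y = \<Phi> \<psi> y"
  using assms(1) y
proof (induction arbitrary: y rule: mon.induct)
  case mon_id
  then show ?case using eq by simp
next
  case (mon_T' i \<Phi>)
  then have "y \<circ> adj i permutes {a..b}" using permutes_comp_adj_iff by blast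
  then have e: "\<Phi> \<phi> (y \<circ> adj i) = \<Phi> \<psi> (y \<circ> adj i)" by (rule mon_T'.IH)
  from e mon_T'.IH[OF mon_T'.prems] show ?case by (simp add: hop_def)
next
  case (mon_U' i \<Phi>)
  then have "y \<circ> adj i permutes {a..b}" using permutes_comp_adj_iff by blast
  then have e: "\<Phi> \<phi> (y \<circ> adj i) = \<Phi> \<psi> (y \<circ> adj i)" by (rule mon_U'.IH)
  from e mon_U'.IH[OF mon_U'.prems] show ?case by (simp add: hop_def U_def)
qed

lemma permutes_Int:
  assumes "y permutes A" "y permutes B"
  shows "y permutes (A \<inter> B)"
  using assms unfolding permutes_def by blast

text \<open>The conditional expectation onto the subalgebra generated by \<open>T j\<close>: if the trace of
  \<open>T j \<circ> V\<close> vanishes, the expectation of \<open>V\<close> is \<open>tr V\<close> times \<open>q T\<^sub>j\<^sup>-\<^sup>2\<close>.\<close>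

lemma tr_expectation:
  assumes Z: "Z \<in> mon {a..<b}" and V: "V \<in> mon {c..<d}" and int: "{a..b} \<inter> {c..d} = {j, Suc j}"
    and 0: "tr (T j \<circ> V) = 0"
  shows "tr (Z \<circ> V) = qvar * tr V * tr (Z \<circ> U j \<circ> U j)"
proof -
  define v where "v = V delta"
  define w where "w = (\<lambda>y. (qvar * tr V) * U j (U j delta) y)"
  have "j \<in> {a..b} \<inter> {c..d}" "Suc j \<in> {a..b} \<inter> {c..d}" unfolding int by simp_all
  then have jr: "j \<in> {a..<b}" "j \<in> {c..<d}" by auto
  have sv: "supp_on {c..d} v" unfolding v_def by (rule mon_supp[OF V supp_delta])
  have "supp_on {c..d} (U j (U j delta))"
    by (intro T_supp supp_delta jr)
  then have sw: "supp_on {c..d} w" by (auto simp: supp_on_def w_def)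
  have vid: "v id = tr V" by (simp add: v_def tr_def)
  \<comment> \<open>The vanishing trace determines the value at \<open>adj j\<close> from the value
    at \<open>id\<close>. These are the only two permutations common to both subgroups, and
    \<open>w\<close> is the multiple of \<open>U j U j delta\<close> with the same two
    values.\<close>
  have "T j v id = 0" using 0 by (simp add: tr_def v_def)
  then have vs: "v (adj j) = (1 - qvar) * tr V"
    by (simp add: T_up vid algebra_simps add_eq_0_iff2)
  have d0: "delta (adj j) = 0" "delta id = 1" by (simp_all add: delta_def adj_ne_id)
  have u1: "U j delta id = 0" by (simp add: U_up d0)
  have u2: "U j delta (adj j) = 1" by (simp add: U_down d0)
  have wid: "w id = tr V" by (simp add: w_def U_up u2 field_simps)
  have ws: "w (adj j) = (1 - qvar) * tr V" by (simp add: w_def U_down u1 u2 field_simps)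
  have eq: "v y = w y" if y: "y permutes {a..b}" for y
  proof (cases "y permutes {c..d}")
    case True
    then have "y permutes {j, Suc j}" using permutes_Int[OF y True] int by simp
    then have "y = id \<or> y = adj j" by (simp add: permutes_doubleton_iff)
    then show ?thesis using vid vs wid ws by auto
  next
    case False
    then show ?thesis using supp_onD[OF sv False] supp_onD[OF sw False] by simp
  qed
  have "tr (Z \<circ> V) = Z v id" by (simp add: tr_def v_def)
  also have "\<dots> = Z w id" by (rule mon_local[OF Z eq permutes_id])
  also have "\<dots> = qvar * tr V * tr (Z \<circ> U j \<circ> U j)"
    unfolding w_def mon_scale[OF Z] by (simp add: tr_def)
  finally show ?thesis .
qed

section \<open>The operators of permutations\<close>

abbreviation W :: "nat \<Rightarrow> perm \<Rightarrow> hop" where "W n w \<equiv> hopw n qvar 1 w"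

lemma permutes_descent_range:
  assumes w: "w permutes {a..b}" and d: "w (Suc i) < w i"
  shows "i \<in> {a..<b}"
proof -
  have r: "w k \<in> {a..b} \<longleftrightarrow> k \<in> {a..b}" for k by (rule permutes_in_image[OF w])
  have f: "w k = k" if "k \<notin> {a..b}" for k using permutes_not_in[OF w that] .
  have "a \<le> i"
  proof (rule ccontr)
    assume "\<not> ?thesis"
    then have "w i = i" using f by simp
    moreover have "w (Suc i) \<ge> Suc i \<or> w (Suc i) \<ge> a"
      using f[of "Suc i"] r[of "Suc i"] by (cases "Suc i \<in> {a..b}") auto
    ultimately show False using d \<open>\<not> a \<le> i\<close> by linarith
  qed
  moreover have "i < b"
  proof (rule ccontr)
    assume "\<not> ?thesis"
    then have "w (Suc i) = Suc i" using f by simp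
    moreover have "w i \<le> i \<or> w i \<le> b"
      using f[of i] r[of i] by (cases "i \<in> {a..b}") auto
    ultimately show False using d \<open>\<not> i < b\<close> by linarith
  qed
  ultimately show ?thesis by simp
qed

lemma W_mon:
  assumes "w permutes {a..b}" "1 \<le> a" "b \<le> n"
  shows "W n w \<in> mon {a..<b}"
proof -
  have sub: "{a..b} \<subseteq> {1..n}" using assms by auto
  have "w \<in> Sym n" using permutes_subset[OF assms(1) sub] by simp
  then have "w permutes {a..b} \<longrightarrow> W n w \<in> mon {a..<b}"
  proof (induction rule: Sym_induct)
    case id
    show "id permutes {a..b} \<longrightarrow> W n id \<in> mon {a..<b}" using mon_id by simp
  next
    case (descent w i)
    show "w permutes {a..b} \<longrightarrow> W n w \<in> mon {a..<b}"
    proof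
      assume w: "w permutes {a..b}"
      have i: "i \<in> {a..<b}" by (rule permutes_descent_range[OF w descent(3)])
      have "w \<circ> adj i permutes {a..b}" using permutes_comp_adj_iff[OF i] w by blast
      then have "W n (w \<circ> adj i) \<in> mon {a..<b}" using descent.IH by (simp add: comp_def)
      then show "W n w \<in> mon {a..<b}"
        unfolding hopw_descent[OF descent(1-3)] by (rule mon_T'[OF i])
    qed
  qed
  then show ?thesis using assms by blast
qed

lemma Sym_induct_left [consumes 1, case_names id descent]:
  assumes "w \<in> Sym n" and "P id"
    and step: "\<And>w i. w \<in> Sym n \<Longrightarrow> i \<in> {1..<n} \<Longrightarrow> inv w (Suc i) < inv w i \<Longrightarrow> P (adj i \<circ> w) \<Longrightarrow> P w"
  shows "P w"
proof -
  have "P (inv x)" if "x \<in> Sym n" for x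
    using that
  proof (induction rule: Sym_induct)
    case id
    show "P (inv id)" using assms(2) by simp
  next
    case (descent x i)
    have x: "bij x" by (rule Sym_bij[OF descent(1)])
    have "inv (x \<circ> adj i) = adj i \<circ> inv x" using x by (simp add: o_inv_distrib)
    then have "P (adj i \<circ> inv x)" using descent.IH by (simp only: comp_def)
    then show "P (inv x)"
      by (rule step[rotated 3]) (use descent inv_Sym x in \<open>auto simp: inv_inv_eq\<close>)
  qed
  from this[of "inv w"] show ?thesis
    using inv_Sym[OF assms(1)] Sym_bij[OF assms(1)] by (simp add: inv_inv_eq)
qed

lemma Sym_mono: "m \<le> n \<Longrightarrow> w \<in> Sym m \<Longrightarrow> w \<in> Sym n"
  using permutes_subset[of w "{1..m}" "{1..n}"] by auto

lemma strict_mono_on_SucI: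
  fixes f :: "nat \<Rightarrow> nat"
  assumes "\<And>i. a \<le> i \<Longrightarrow> i < b \<Longrightarrow> f i < f (Suc i)"
  shows "strict_mono_on {a..b} f"
proof (rule strict_mono_onI)
  fix r s assume rs: "r \<in> {a..b}" "s \<in> {a..b}" "r < s"
  from rs(3) have "Suc r \<le> s" by simp
  then have "s \<le> b \<longrightarrow> f r < f s"
  proof (induction s rule: dec_induct)
    case base
    show ?case using assms[of r] rs by auto
  next
    case (step k)
    show ?case using step assms[of k] rs by fastforce
  qed
  then show "f r < f s" using rs by simp
qed

lemma inv_Sym_mem: "p \<in> Sym m \<Longrightarrow> 1 \<le> i \<Longrightarrow> i \<le> m \<Longrightarrow> inv p i \<in> {1..m}"
  using Sym_range[OF inv_Sym, of p m i] by auto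

lemma inv_inv_Sym: "w \<in> Sym n \<Longrightarrow> inv (inv w) = w"
  by (rule inv_inv_eq[OF Sym_bij])

lemma inv_comp_Sym: "x \<in> Sym n \<Longrightarrow> y \<in> Sym n \<Longrightarrow> inv (x \<circ> y) = inv y \<circ> inv x"
  by (rule o_inv_distrib[OF Sym_bij Sym_bij])

lemma Sym_inv_apply: "w \<in> Sym n \<Longrightarrow> inv w (w k) = k" "w \<in> Sym n \<Longrightarrow> w (inv w k) = k"
  by (simp_all add: permutes_inverses)

text \<open>Since \<open>inv x\<close> increases on \<open>{1..m}\<close>, \<open>x\<close> is a
  minimal coset representative: each left descent step of \<open>p\<close> is also one of
  \<open>p \<circ> x\<close>, so lengths add.\<close>

lemma W_comp:
  assumes p: "p \<in> Sym m" and m: "m \<le> n" and x: "x \<in> Sym n" and inc: "strict_mono_on {1..m} (inv x)"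
  shows "W n (p \<circ> x) = W n x \<circ> W n p"
  using p
proof (induction rule: Sym_induct_left)
  case id
  show "W n (id \<circ> x) = W n x \<circ> W n id" by simp
next
  case (descent p j)
  let ?p = "adj j \<circ> p"
  have j: "j \<in> {1..<m}" "j \<in> {1..<n}" using descent(2) m by auto
  have p: "p \<in> Sym m" by (rule descent(1))
  have p': "?p \<in> Sym m" by (rule comp_Sym[OF adj_Sym[OF j(1)] p])
  have pn: "?p \<in> Sym n" by (rule Sym_mono[OF m p'])
  have lt: "inv ?p j < inv ?p (Suc j)"
    using descent(3) inv_comp_adj(2)[OF Sym_bij[OF p]] by simp
  have IH: "W n (?p \<circ> x) = W n x \<circ> W n ?p" by (rule descent.IH)
  have 1: "W n (adj j \<circ> ?p) = W n ?p \<circ> T j" by (rule hopw_left[OF pn j(2) lt])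
  have "inv ?p j \<in> {1..m}" "inv ?p (Suc j) \<in> {1..m}"
    using inv_Sym_mem[OF p', of j] inv_Sym_mem[OF p', of "Suc j"] j(1) by simp_all
  then have "inv x (inv ?p j) < inv x (inv ?p (Suc j))"
    using inc lt by (meson strict_mono_onD)
  then have "inv (?p \<circ> x) j < inv (?p \<circ> x) (Suc j)"
    by (simp add: inv_comp_Sym[OF pn x] del: inv_comp_adj)
  from hopw_left[OF comp_Sym[OF pn x] j(2) this]
  have 2: "W n (adj j \<circ> (?p \<circ> x)) = W n (?p \<circ> x) \<circ> T j" .
  have e: "adj j \<circ> (?p \<circ> x) = p \<circ> x" "adj j \<circ> ?p = p" by (simp_all add: comp_assoc)
  show "W n (p \<circ> x) = W n x \<circ> W n p"
    using 1 2 IH unfolding e by (simp only: comp_assoc)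
qed

lemma W_comp':
  assumes p: "p \<in> Sym m" and m: "m \<le> n" and x: "x \<in> Sym n" and inc: "strict_mono_on {1..m} x"
  shows "W n (x \<circ> p) = W n p \<circ> W n x"
  using p
proof (induction rule: Sym_induct)
  case id
  show "W n (x \<circ> id) = W n id \<circ> W n x" by simp
next
  case (descent p j)
  have j: "j \<in> {1..<m}" "j \<in> {1..<n}" using descent(2) m by auto
  have p: "p \<in> Sym m" by (rule descent(1))
  have pn: "p \<in> Sym n" by (rule Sym_mono[OF m p])
  have "p j \<in> {1..m}" "p (Suc j) \<in> {1..m}"
    using Sym_range[OF p, of j] Sym_range[OF p, of "Suc j"] j(1) by simp_all
  then have lt: "(x \<circ> p) (Suc j) < (x \<circ> p) j"
    using strict_mono_onD[OF inc, of "p (Suc j)" "p j"] descent(3) by simp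
  have IH: "W n (x \<circ> (p \<circ> adj j)) = W n (p \<circ> adj j) \<circ> W n x" by (rule descent.IH)
  show "W n (x \<circ> p) = W n p \<circ> W n x"
    unfolding hopw_descent[OF comp_Sym[OF x pn] j(2) lt] hopw_descent[OF pn j(2) descent(3)]
    using IH by (simp only: comp_assoc)
qed

section \<open>Parabolic factorizations and extraction of extreme letters\<close>

lemma parabolic_decomposition:
  assumes "w \<in> Sym n" and m: "m \<le> n"
  shows "\<exists>p x. p \<in> Sym m \<and> x \<in> Sym n \<and> w = p \<circ> x \<and> strict_mono_on {1..m} (inv x)"
  using assms(1)
proof (induction "ninv n w" arbitrary: w rule: less_induct)
  case less
  note w = less.prems
  show ?case
  proof (cases "\<exists>i. 1 \<le> i \<and> i < m \<and> inv w (Suc i) < inv w i")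
    case True
    then obtain i where i: "i \<in> {1..<m}" "inv w (Suc i) < inv w i" by auto
    have i': "i \<in> {1..<n}" using i m by auto
    have w': "adj i \<circ> w \<in> Sym n" by (rule comp_Sym[OF adj_Sym[OF i'] w])
    have "bruhat_less n (adj i \<circ> w) w" using bruhat_less_adj_left(1)[OF w i'] i by simp
    then have "ninv n (adj i \<circ> w) < ninv n w" by (rule bruhat_less_ninv)
    from less.hyps[OF this w'] obtain p x where px: "p \<in> Sym m" "x \<in> Sym n" "adj i \<circ> w = p \<circ> x"
      "strict_mono_on {1..m} (inv x)" by blast
    have "w = adj i \<circ> (adj i \<circ> w)" by simp
    also have "\<dots> = (adj i \<circ> p) \<circ> x" by (simp only: px(3) comp_assoc)
    finally show ?thesis using px comp_Sym[OF adj_Sym[OF i(1)] px(1)] by blast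
  next
    case False
    have "strict_mono_on {1..m} (inv w)"
    proof (rule strict_mono_on_SucI)
      fix i assume "1 \<le> i" "i < m"
      moreover have "inv w i \<noteq> inv w (Suc i)" using Sym_inj[OF inv_Sym[OF w]] by simp
      ultimately show "inv w i < inv w (Suc i)" using False by (meson linorder_neqE_nat)
    qed
    then show ?thesis using w id_Sym by (intro exI[of _ id] exI[of _ w]) (simp only: id_comp simp_thms)
  qed
qed

text \<open>If the first \<open>k\<close> values remain within \<open>{1..m}\<close>, the minimal
  representative has to fix them: its inverse increases on \<open>{1..m}\<close>, which leaves no
  room to move the smallest unfixed letter. Two parabolic subgroups result that overlap in
  \<open>{Suc k..m}\<close>.\<close>

lemma parabolic_decomposition_left:
  assumes w: "w \<in> Sym n" and m: "m \<le> n" "k \<le> m" and small: "\<And>i. 1 \<le> i \<Longrightarrow> i \<le> k \<Longrightarrow> w i \<le> m"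
  obtains p x where "p \<in> Sym m" "x permutes {Suc k..n}" "w = p \<circ> x" "strict_mono_on {1..m} (inv x)"
proof -
  obtain p x where px: "p \<in> Sym m" "x \<in> Sym n" "w = p \<circ> x" "strict_mono_on {1..m} (inv x)"
    using parabolic_decomposition[OF w m(1)] by blast
  have fix_x: "x i = i" if "1 \<le> i" "i \<le> k" for i
    using that
  proof (induction i rule: less_induct)
    case (less i)
    have "p (x i) \<le> m" using small[OF less.prems] px(3) by simp
    then have xm: "x i \<le> m" using Sym_le_iff[OF px(1)] by simp
    have x1: "1 \<le> x i" using Sym_ge_1_iff[OF px(2)] less.prems by simp
    have "x i \<ge> i"
    proof (rule ccontr)
      assume "\<not> ?thesis"
      then have "x (x i) = x i" using less.IH[of "x i"] x1 less.prems by simp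
      then show False using Sym_inj[OF px(2)] \<open>\<not> i \<le> x i\<close> by simp
    qed
    moreover have "\<not> i < x i"
    proof
      assume lt: "i < x i"
      have "i \<in> {1..m}" "x i \<in> {1..m}" using less.prems m xm lt by auto
      then have "inv x i < inv x (x i)" using px(4) lt by (meson strict_mono_onD)
      then have lt': "inv x i < i" using Sym_inv_apply(1)[OF px(2)] by simp
      have "1 \<le> inv x i" using Sym_ge_1_iff[OF inv_Sym[OF px(2)]] less.prems by simp
      then have "x (inv x i) = inv x i" using less.IH[OF lt'] lt' less.prems by simp
      then show False using Sym_inv_apply(2)[OF px(2), of i] lt' by simp
    qed
    ultimately show ?case by simp
  qed
  have "x permutes {Suc k..n}"
    by (rule permutes_superset[of x "{1..n}"]) (use px(2) fix_x in auto)
  then show ?thesis using that px by blast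
qed

lemma parabolic_decomposition_right:
  assumes w: "w \<in> Sym n" and m: "m \<le> n" "k \<le> m" and small: "\<And>i. 1 \<le> i \<Longrightarrow> i \<le> k \<Longrightarrow> inv w i \<le> m"
  obtains p x where "p \<in> Sym m" "x permutes {Suc k..n}" "w = x \<circ> p" "strict_mono_on {1..m} x"
proof -
  obtain p x where px: "p \<in> Sym m" "x permutes {Suc k..n}" "inv w = p \<circ> x" "strict_mono_on {1..m} (inv x)"
    using parabolic_decomposition_left[OF inv_Sym[OF w] m small] .
  have "bij x" using px(2) by (rule permutes_bij)
  then have "inv (inv w) = inv x \<circ> inv p" using px Sym_bij by (simp only: o_inv_distrib)
  then have "w = inv x \<circ> inv p" using inv_inv_Sym[OF w] by simp
  then show ?thesis using that inv_Sym[OF px(1)] permutes_inv[OF px(2)] px(4) by blast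
qed

lemma Sym_shrink: "p \<in> Sym (Suc j) \<Longrightarrow> p (Suc j) = Suc j \<Longrightarrow> p \<in> Sym j"
  using permutes_superset[of p "{1..Suc j}" "{1..j}"] by (auto simp: le_Suc_eq)

lemma permutes_shrink: "q permutes {j..n} \<Longrightarrow> q j = j \<Longrightarrow> q permutes {Suc j..n}"
  by (rule permutes_superset[of q "{j..n}"]) (auto simp: not_less_eq_eq)

lemma tail_Sym: "q permutes {j..n} \<Longrightarrow> 1 \<le> j \<Longrightarrow> q \<in> Sym n"
  using permutes_subset[of q "{j..n}" "{1..n}"] by auto

text \<open>Moving the largest letter from position \<open>c\<close> to the end costs the word
  \<open>T c ... T j\<close>. It contains \<open>T j\<close> exactly once, and this single
  occurrence will be cancelled against a Jucys--Murphy factor.\<close>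

lemma W_extract_max:
  assumes "p \<in> Sym (Suc j)" "Suc j \<le> n" "p c = Suc j" "1 \<le> c" "c \<le> j"
  shows "\<exists>\<Phi> \<alpha>. \<Phi> \<in> mon {c..<j} \<and> \<alpha> \<in> Sym j \<and> W n p = \<Phi> \<circ> T j \<circ> W n \<alpha>"
  using assms
proof (induction "j - c" arbitrary: p c)
  case 0
  then have c: "c = j" by simp
  have j: "j \<in> {1..<n}" "j \<in> {1..<Suc j}" using 0 by auto
  have pn: "p \<in> Sym n" using Sym_mono[OF 0(3,2)] .
  have d: "p (Suc j) < p j"
    using Sym_range(2)[OF 0(2), of "Suc j"] Sym_inj[OF 0(2), of "Suc j" j] 0(4) c by fastforce
  have p': "p \<circ> adj j \<in> Sym (Suc j)" by (rule comp_Sym[OF 0(2) adj_Sym[OF j(2)]])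
  have "(p \<circ> adj j) (Suc j) = Suc j" using 0(4) c by simp
  from Sym_shrink[OF p' this] show ?case
    using hopw_descent[OF pn j(1) d, of qvar 1] mon_id by (intro exI[of _ id] exI[of _ "p \<circ> adj j"]) (simp only: id_comp simp_thms)
next
  case (Suc d)
  let ?p = "p \<circ> adj c"
  have c: "c \<in> {1..<n}" "c \<in> {1..<Suc j}" "c < j" using Suc by auto
  have pn: "p \<in> Sym n" using Sym_mono[OF Suc.prems(2,1)] .
  have ds: "p (Suc c) < p c"
    using Sym_range(2)[OF Suc.prems(1), of "Suc c"] Sym_inj[OF Suc.prems(1), of "Suc c" c] Suc.prems c by fastforce
  have p': "?p \<in> Sym (Suc j)" by (rule comp_Sym[OF Suc.prems(1) adj_Sym[OF c(2)]])
  have "\<exists>\<Phi> \<alpha>. \<Phi> \<in> mon {Suc c..<j} \<and> \<alpha> \<in> Sym j \<and> W n ?p = \<Phi> \<circ> T j \<circ> W n \<alpha>"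
    by (rule Suc.hyps(1)) (use Suc p' c in auto)
  then obtain \<Phi> \<alpha> where *: "\<Phi> \<in> mon {Suc c..<j}" "\<alpha> \<in> Sym j" "W n ?p = \<Phi> \<circ> T j \<circ> W n \<alpha>" by blast
  have "T c \<circ> \<Phi> \<in> mon {c..<j}"
    by (rule mon_comp[OF mon_T mon_mono[OF *(1)]]) (use c in auto)
  moreover have "W n p = (T c \<circ> \<Phi>) \<circ> T j \<circ> W n \<alpha>"
    using hopw_descent[OF pn c(1) ds, of qvar 1] *(3) by (simp only: comp_assoc)
  ultimately show ?case using *(2) by blast
qed

lemma W_extract_max':
  assumes "p \<in> Sym (Suc j)" "Suc j \<le> n" "inv p r = Suc j" "1 \<le> r" "r \<le> j"
  shows "\<exists>\<Phi> \<gamma>. \<Phi> \<in> mon {r..<j} \<and> \<gamma> \<in> Sym j \<and> W n p = W n \<gamma> \<circ> T j \<circ> \<Phi>"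
  using assms
proof (induction "j - r" arbitrary: p r)
  case 0
  then have r: "r = j" by simp
  have j: "j \<in> {1..<n}" "j \<in> {1..<Suc j}" using 0 by auto
  have pb: "bij p" by (rule Sym_bij[OF 0(2)])
  let ?p = "adj j \<circ> p"
  have p': "?p \<in> Sym (Suc j)" by (rule comp_Sym[OF adj_Sym[OF j(2)] 0(2)])
  have "p (Suc j) = j" using 0 r pb by (simp add: inv_eq_iff)
  then have "?p (Suc j) = Suc j" by simp
  then have pj: "?p \<in> Sym j" by (rule Sym_shrink[OF p'])
  have "inv p (Suc j) < inv p j"
    using Sym_range(2)[OF inv_Sym[OF 0(2)], of "Suc j"] Sym_inj[OF inv_Sym[OF 0(2)], of "Suc j" j] 0(4) r by fastforce
  then have "inv ?p j < inv ?p (Suc j)" by (simp add: inv_comp_adj(2)[OF pb])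
  from hopw_left[OF Sym_mono[OF 0(3) p'] j(1) this, of qvar 1]
  have "W n p = W n ?p \<circ> T j" by simp
  then show ?case
    using pj mon_id by (intro exI[of _ id] exI[of _ ?p]) (simp only: comp_id simp_thms)
next
  case (Suc d)
  let ?p = "adj r \<circ> p"
  have r: "r \<in> {1..<n}" "r \<in> {1..<Suc j}" "r < j" using Suc by auto
  have pb: "bij p" by (rule Sym_bij[OF Suc.prems(1)])
  have p': "?p \<in> Sym (Suc j)" by (rule comp_Sym[OF adj_Sym[OF r(2)] Suc.prems(1)])
  have "inv p (Suc r) < inv p r"
    using Sym_range(2)[OF inv_Sym[OF Suc.prems(1)], of "Suc r"] Sym_inj[OF inv_Sym[OF Suc.prems(1)], of "Suc r" r] Suc.prems r
    by fastforce
  then have "inv ?p r < inv ?p (Suc r)" by (simp add: inv_comp_adj(2)[OF pb])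
  from hopw_left[OF Sym_mono[OF Suc.prems(2) p'] r(1) this, of qvar 1]
  have Wp: "W n p = W n ?p \<circ> T r" by simp
  have "\<exists>\<Phi> \<gamma>. \<Phi> \<in> mon {Suc r..<j} \<and> \<gamma> \<in> Sym j \<and> W n ?p = W n \<gamma> \<circ> T j \<circ> \<Phi>"
    by (rule Suc.hyps(1)) (use Suc p' r in \<open>auto simp: inv_comp_adj(2)[OF pb]\<close>)
  then obtain \<Phi> \<gamma> where *: "\<Phi> \<in> mon {Suc r..<j}" "\<gamma> \<in> Sym j" "W n ?p = W n \<gamma> \<circ> T j \<circ> \<Phi>" by blast
  have "\<Phi> \<circ> T r \<in> mon {r..<j}"
    by (rule mon_comp[OF mon_mono[OF *(1)] mon_T]) (use r in auto)
  moreover have "W n p = W n \<gamma> \<circ> T j \<circ> (\<Phi> \<circ> T r)"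
    using Wp *(3) by (simp only: comp_assoc)
  ultimately show ?case using *(2) by blast
qed

text \<open>The mirror image at the lower end of a tail subgroup: the smallest letter
  \<open>j\<close> is moved back to the front.\<close>

lemma W_extract_min:
  assumes "q permutes {j..n}" "1 \<le> j" "q c = j" "j < c" "c \<le> n"
  shows "\<exists>\<Phi> \<alpha>. \<Phi> \<in> mon {Suc j..<c} \<and> \<alpha> permutes {Suc j..n} \<and> W n q = \<Phi> \<circ> T j \<circ> W n \<alpha>"
  using assms
proof (induction "c - Suc j" arbitrary: q c)
  case 0
  then have c: "c = Suc j" by simp
  have j: "j \<in> {1..<n}" "j \<in> {j..<n}" using 0 by auto
  have qn: "q \<in> Sym n" by (rule tail_Sym[OF 0(2,3)])
  have "q j \<in> {j..n}" using permutes_in_image[OF 0(2), of j] 0 by simp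
  then have d: "q (Suc j) < q j"
    using Sym_inj[OF qn, of "Suc j" j] 0(4) c by fastforce
  have q': "q \<circ> adj j permutes {j..n}" using permutes_comp_adj_iff[OF j(2)] 0(2) by blast
  have "(q \<circ> adj j) j = j" using 0(4) c by simp
  from permutes_shrink[OF q' this] show ?case
    using hopw_descent[OF qn j(1) d, of qvar 1] mon_id by (intro exI[of _ id] exI[of _ "q \<circ> adj j"]) (simp only: id_comp simp_thms)
next
  case (Suc d)
  obtain e where c: "c = Suc e" "j < e" using Suc by (cases c) auto
  let ?q = "q \<circ> adj e"
  have e: "e \<in> {1..<n}" "e \<in> {j..<n}" using Suc c by auto
  have qn: "q \<in> Sym n" by (rule tail_Sym[OF Suc.prems(1,2)])
  have "q e \<in> {j..n}" using permutes_in_image[OF Suc.prems(1), of e] e by simp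
  then have ds: "q (Suc e) < q e"
    using Sym_inj[OF qn, of "Suc e" e] Suc.prems c by fastforce
  have q': "?q permutes {j..n}" using permutes_comp_adj_iff[OF e(2)] Suc.prems(1) by blast
  have "\<exists>\<Phi> \<alpha>. \<Phi> \<in> mon {Suc j..<e} \<and> \<alpha> permutes {Suc j..n} \<and> W n ?q = \<Phi> \<circ> T j \<circ> W n \<alpha>"
    by (rule Suc.hyps(1)) (use Suc q' c in auto)
  then obtain \<Phi> \<alpha> where *: "\<Phi> \<in> mon {Suc j..<e}" "\<alpha> permutes {Suc j..n}" "W n ?q = \<Phi> \<circ> T j \<circ> W n \<alpha>" by blast
  have "T e \<circ> \<Phi> \<in> mon {Suc j..<c}"
    by (rule mon_comp[OF mon_T mon_mono[OF *(1)]]) (use c in auto)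
  moreover have "W n q = (T e \<circ> \<Phi>) \<circ> T j \<circ> W n \<alpha>"
    using hopw_descent[OF qn e(1) ds, of qvar 1] *(3) by (simp only: comp_assoc)
  ultimately show ?case using *(2) by blast
qed

lemma W_extract_min':
  assumes "q permutes {j..n}" "1 \<le> j" "inv q r = j" "j < r" "r \<le> n"
  shows "\<exists>\<Phi> \<gamma>. \<Phi> \<in> mon {Suc j..<r} \<and> \<gamma> permutes {Suc j..n} \<and> W n q = W n \<gamma> \<circ> T j \<circ> \<Phi>"
  using assms
proof (induction "r - Suc j" arbitrary: q r)
  case 0
  then have r: "r = Suc j" by simp
  have j: "j \<in> {1..<n}" "j \<in> {j..<n}" using 0 by auto
  have qn: "q \<in> Sym n" by (rule tail_Sym[OF 0(2,3)])
  have qb: "bij q" by (rule Sym_bij[OF qn])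
  let ?q = "adj j \<circ> q"
  have q': "?q permutes {j..n}" by (rule permutes_compose[OF 0(2) permutes_swap_id]) (use j in auto)
  have "q j = Suc j" using 0 r qb by (simp add: inv_eq_iff)
  then have "?q j = j" by simp
  then have qj: "?q permutes {Suc j..n}" by (rule permutes_shrink[OF q'])
  have "inv q j \<in> {j..n}" using permutes_in_image[OF permutes_inv[OF 0(2)], of j] 0 by simp
  then have "inv q (Suc j) < inv q j"
    using Sym_inj[OF inv_Sym[OF qn], of "Suc j" j] 0(4) r by fastforce
  then have "inv ?q j < inv ?q (Suc j)" by (simp add: inv_comp_adj(2)[OF qb])
  from hopw_left[OF tail_Sym[OF q' 0(3)] j(1) this, of qvar 1]
  have "W n q = W n ?q \<circ> T j" by simp
  then show ?case
    using qj mon_id by (intro exI[of _ id] exI[of _ ?q]) (simp only: comp_id simp_thms)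
next
  case (Suc d)
  obtain e where r: "r = Suc e" "j < e" using Suc by (cases r) auto
  let ?q = "adj e \<circ> q"
  have e: "e \<in> {1..<n}" "e \<in> {j..<n}" using Suc r by auto
  have qn: "q \<in> Sym n" by (rule tail_Sym[OF Suc.prems(1,2)])
  have qb: "bij q" by (rule Sym_bij[OF qn])
  have q': "?q permutes {j..n}" by (rule permutes_compose[OF Suc.prems(1) permutes_swap_id]) (use e in auto)
  have "inv q e \<in> {j..n}" using permutes_in_image[OF permutes_inv[OF Suc.prems(1)], of e] e by simp
  then have "inv q (Suc e) < inv q e"
    using Sym_inj[OF inv_Sym[OF qn], of "Suc e" e] Suc.prems r by fastforce
  then have "inv ?q e < inv ?q (Suc e)" by (simp add: inv_comp_adj(2)[OF qb])
  from hopw_left[OF tail_Sym[OF q' Suc.prems(2)] e(1) this, of qvar 1]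
  have Wq: "W n q = W n ?q \<circ> T e" by simp
  have "\<exists>\<Phi> \<gamma>. \<Phi> \<in> mon {Suc j..<e} \<and> \<gamma> permutes {Suc j..n} \<and> W n ?q = W n \<gamma> \<circ> T j \<circ> \<Phi>"
    by (rule Suc.hyps(1)) (use Suc q' r in \<open>auto simp: inv_comp_adj(2)[OF qb]\<close>)
  then obtain \<Phi> \<gamma> where *: "\<Phi> \<in> mon {Suc j..<e}" "\<gamma> permutes {Suc j..n}" "W n ?q = W n \<gamma> \<circ> T j \<circ> \<Phi>" by blast
  have "\<Phi> \<circ> T e \<in> mon {Suc j..<r}"
    by (rule mon_comp[OF mon_mono[OF *(1)] mon_T]) (use r in auto)
  moreover have "W n q = W n \<gamma> \<circ> T j \<circ> (\<Phi> \<circ> T e)"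
    using Wq *(3) by (simp only: comp_assoc)
  ultimately show ?case using *(2) by blast
qed

section \<open>Jucys--Murphy operators\<close>

text \<open>The inverse of the unnormalized Jucys--Murphy element
  \<open>T (a+d-1) ... T a T a ... T (a+d-1)\<close>; \<open>GR\<close> is the mirror image, growing
  downwards from \<open>b\<close>.\<close>

primrec GL :: "nat \<Rightarrow> nat \<Rightarrow> hop" where
  "GL a 0 = id"
| "GL a (Suc d) = U (a + d) \<circ> GL a d \<circ> U (a + d)"

primrec GR :: "nat \<Rightarrow> nat \<Rightarrow> hop" where
  "GR b 0 = id"
| "GR b (Suc d) = U (b - Suc d) \<circ> GR b d \<circ> U (b - Suc d)"

lemma GL_mon: "GL a d \<in> mon {a..<a + d}"
proof (induction d)
  case 0
  show ?case unfolding GL.simps by (rule mon_id)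
next
  case (Suc d)
  have "GL a d \<in> mon {a..<a + Suc d}" by (rule mon_mono[OF Suc]) auto
  then show ?case unfolding GL.simps by (intro mon_comp mon_U) auto
qed

lemma GR_mon: "d \<le> b \<Longrightarrow> GR b d \<in> mon {b - d..<b}"
proof (induction d)
  case 0
  show ?case unfolding GR.simps by (rule mon_id)
next
  case (Suc d)
  have "GR b d \<in> mon {b - Suc d..<b}" by (rule mon_mono[OF Suc.IH]) (use Suc.prems in auto)
  then show ?case unfolding GR.simps using Suc.prems by (intro mon_comp mon_U) auto
qed

text \<open>A Jucys--Murphy element commutes with the parabolic subalgebra of one rank less. Only
  the index just below the outermost factor requires the mixed braid relations, once on each side;
  smaller indices go by induction.\<close>

lemma GL_commute_T:
  assumes "a \<le> k" "Suc k < a + d"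
  shows "T k (GL a d \<phi>) = GL a d (T k \<phi>)"
  using assms
proof (induction d arbitrary: \<phi>)
  case 0
  then show ?case by simp
next
  case (Suc d)
  let ?i = "a + d"
  show ?case
  proof (cases "Suc k < ?i")
    case True
    then show ?thesis using Suc TU_commute[of k ?i] by simp
  next
    case False
    then have k: "?i = Suc k" using Suc.prems by simp
    then obtain e where e: "d = Suc e" "k = a + e" using Suc.prems by (cases d) auto
    have c: "T (Suc k) (GL a e \<psi>) = GL a e (T (Suc k) \<psi>)" for \<psi>
      by (rule mon_commute[OF mon_T[of "Suc k" "{Suc k}"] GL_mon[of a e]]) (use e in auto)
    have "T k (GL a (Suc d) \<phi>) = T k (U (Suc k) (U k (GL a e (U k (U (Suc k) \<phi>)))))"
      using e k by simp
    also have "\<dots> = U (Suc k) (U k (GL a e (T (Suc k) (U k (U (Suc k) \<phi>)))))"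
      by (simp add: TUU c)
    also have "\<dots> = GL a (Suc d) (T k \<phi>)"
      using e k by (simp add: TUU')
    finally show ?thesis .
  qed
qed

lemma GR_commute_T:
  assumes "b - d < k" "k < b" "d \<le> b"
  shows "T k (GR b d \<phi>) = GR b d (T k \<phi>)"
  using assms
proof (induction d arbitrary: \<phi>)
  case 0
  then show ?case by simp
next
  case (Suc d)
  let ?i = "b - Suc d"
  show ?case
  proof (cases "Suc ?i < k")
    case True
    then show ?thesis using Suc TU_commute[of k ?i] by simp
  next
    case False
    then have k: "k = Suc ?i" using Suc.prems by simp
    then obtain e where e: "d = Suc e" "b - Suc e = k" using Suc.prems by (cases d) auto
    let ?m = ?i
    have c: "T ?m (GR b e \<psi>) = GR b e (T ?m \<psi>)" for \<psi>
      by (rule mon_commute[OF mon_T[of ?m "{?m}"] GR_mon[of e b]]) (use e k Suc.prems in auto)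
    have "T k (GR b (Suc d) \<phi>) = T (Suc ?m) (U ?m (U (Suc ?m) (GR b e (U (Suc ?m) (U ?m \<phi>)))))"
      using e k by simp
    also have "\<dots> = U ?m (U (Suc ?m) (GR b e (T ?m (U (Suc ?m) (U ?m \<phi>)))))"
      by (simp only: TUU' c)
    also have "\<dots> = U ?m (U (Suc ?m) (GR b e (U (Suc ?m) (U ?m (T (Suc ?m) \<phi>)))))"
      by (simp only: TUU)
    also have "\<dots> = GR b (Suc d) (T k \<phi>)"
      using e k by simp
    finally show ?thesis .
  qed
qed

lemma mon_commute_if:
  assumes "\<Phi> \<in> mon S" and T: "\<And>k \<phi>. k \<in> S \<Longrightarrow> T k (G \<phi>) = G (T k \<phi>)"
  shows "\<Phi> (G \<phi>) = G (\<Phi> \<phi>)"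
proof -
  have U: "U k (G \<phi>) = G (U k \<phi>)" if "k \<in> S" for k \<phi>
  proof -
    have "T k (G (U k \<phi>)) = G \<phi>" using T[OF that, of "U k \<phi>"] by simp
    then have "U k (T k (G (U k \<phi>))) = U k (G \<phi>)" by simp
    then show ?thesis by simp
  qed
  show ?thesis
    using assms(1) by (induction arbitrary: \<phi> rule: mon.induct) (simp_all add: T U)
qed

lemma sum_Pow_insert:
  fixes f :: "'a set \<Rightarrow> 'b::comm_monoid_add"
  assumes "finite A" "k \<notin> A"
  shows "(\<Sum>Z\<in>Pow (insert k A). f Z) = (\<Sum>Z\<in>Pow A. f Z + f (insert k Z))"
proof -
  have "(\<Sum>Z\<in>Pow (insert k A). f Z) = (\<Sum>Z\<in>Pow A. f Z) + (\<Sum>Z\<in>insert k ` Pow A. f Z)"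
    unfolding Pow_insert by (rule sum.union_disjoint) (use assms in auto)
  also have "(\<Sum>Z\<in>insert k ` Pow A. f Z) = (\<Sum>Z\<in>Pow A. f (insert k Z))"
  proof (rule sum.reindex_cong[of "insert k"])
    show "inj_on (insert k) (Pow A)"
      by (rule inj_on_inverseI[of _ "\<lambda>Z. Z - {k}"]) (use assms(2) in auto)
  qed simp_all
  finally show ?thesis by (simp add: sum.distrib)
qed

text \<open>The value \<open>id\<close> at the empty set accounts for the constant term of the
  expansion.\<close>

definition tmin :: "nat set \<Rightarrow> nat \<Rightarrow> perm" where
  "tmin Z k = (if Z = {} then id else transpose (Min Z) k)"

definition tmax :: "nat set \<Rightarrow> nat \<Rightarrow> perm" where
  "tmax Z k = (if Z = {} then id else transpose k (Max Z))"

text \<open>The outer left \<open>U k\<close> meets an ascent and only swaps. The outer right one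
  meets a descent if no reflection has been chosen yet, and then branches with weights
  \<open>1\<close> and \<open>q^-1 - 1\<close>. Otherwise it contributes
  \<open>q^-1 = 1 + (q^-1 - 1)\<close>, split between the subsets without and with \<open>k\<close>,
  which have the same minimum.\<close>

lemma GL_eval:
  assumes "strict_mono_on {a..a + d} y"
  shows "qvar ^ d * GL a d \<psi> y = (\<Sum>Z\<in>Pow {a..<a + d}. cq ^ card Z * \<psi> (y \<circ> tmin Z (a + d)))"
  using assms
proof (induction d arbitrary: y \<psi>)
  case 0
  then show ?case by (simp add: tmin_def)
next
  case (Suc d)
  let ?k = "a + d"
  let ?y = "y \<circ> adj ?k"
  have mono: "y r < y s" if "a \<le> r" "r < s" "s \<le> Suc ?k" for r s
    using Suc.prems that by (intro strict_mono_onD[of "{a..a + Suc d}" y]) auto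
  have y': "strict_mono_on {a..a + d} ?y"
    by (rule strict_mono_onI) (auto simp: transpose_def intro: mono)
  have fin: "finite Z" if "Z \<in> Pow {a..<?k}" for Z using that finite_subset by blast
  have "qvar ^ Suc d * GL a (Suc d) \<psi> y = qvar ^ d * GL a d (U ?k \<psi>) ?y"
    using mono[of ?k "Suc ?k"] by (simp add: U_up)
  also have "\<dots> = (\<Sum>Z\<in>Pow {a..<?k}. cq ^ card Z * U ?k \<psi> (?y \<circ> tmin Z ?k))"
    by (rule Suc.IH[OF y'])
  also have "\<dots> = (\<Sum>Z\<in>Pow {a..<?k}. cq ^ card Z * \<psi> (y \<circ> tmin Z (Suc ?k))
      + cq ^ card (insert ?k Z) * \<psi> (y \<circ> tmin (insert ?k Z) (Suc ?k)))"
  proof (rule sum.cong[OF refl])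
    fix Z assume Z: "Z \<in> Pow {a..<?k}"
    have "?k \<notin> Z" using Z by auto
    then have c: "card (insert ?k Z) = Suc (card Z)" using fin[OF Z] by simp
    show "cq ^ card Z * U ?k \<psi> (?y \<circ> tmin Z ?k) = cq ^ card Z * \<psi> (y \<circ> tmin Z (Suc ?k))
      + cq ^ card (insert ?k Z) * \<psi> (y \<circ> tmin (insert ?k Z) (Suc ?k))"
    proof (cases "Z = {}")
      case True
      have "?y (Suc ?k) < ?y ?k" using mono[of ?k "Suc ?k"] by simp
      then have "U ?k \<psi> ?y = \<psi> y + cq * \<psi> ?y" by (simp only: U_down adj_adj)
      then show ?thesis using True by (simp add: tmin_def)
    next
      case False
      let ?m = "Min Z"
      have m: "?m \<in> Z" using False fin[OF Z] by simp
      then have m': "a \<le> ?m" "?m < ?k" using Z by auto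
      have mi: "Min (insert ?k Z) = ?m" using False fin[OF Z] m' by simp
      let ?z = "?y \<circ> transpose ?m ?k"
      have "?z ?k < ?z (Suc ?k)" using m' mono[of ?m ?k] by (simp add: transpose_def)
      then have "U ?k \<psi> ?z = inverse qvar * \<psi> (?z \<circ> adj ?k)" by (rule U_up)
      moreover have "?z \<circ> adj ?k = y \<circ> transpose ?m (Suc ?k)"
        using m' by (auto simp: fun_eq_iff transpose_def)
      ultimately show ?thesis using False c mi by (simp add: tmin_def algebra_simps)
    qed
  qed
  also have "\<dots> = (\<Sum>Z\<in>Pow (insert ?k {a..<?k}). cq ^ card Z * \<psi> (y \<circ> tmin Z (Suc ?k)))"
    by (rule sum_Pow_insert[symmetric]) auto
  also have "insert ?k {a..<?k} = {a..<a + Suc d}" by auto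
  finally show ?case by simp
qed

lemma GR_eval:
  assumes "strict_mono_on {b - d..b} y" "d \<le> b"
  shows "qvar ^ d * GR b d \<psi> y = (\<Sum>Z\<in>Pow {Suc (b - d)..b}. cq ^ card Z * \<psi> (y \<circ> tmax Z (b - d)))"
  using assms
proof (induction d arbitrary: y \<psi>)
  case 0
  then show ?case by (simp add: tmax_def)
next
  case (Suc d)
  let ?k = "b - Suc d"
  have k: "b - d = Suc ?k" using Suc.prems by simp
  let ?y = "y \<circ> adj ?k"
  have mono: "y r < y s" if "?k \<le> r" "r < s" "s \<le> b" for r s
    using Suc.prems(1) that by (intro strict_mono_onD[of "{b - Suc d..b}" y]) auto
  have y': "strict_mono_on {b - d..b} ?y"
    unfolding k by (rule strict_mono_onI) (auto simp: transpose_def intro: mono)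
  have fin: "finite Z" if "Z \<in> Pow {Suc (Suc ?k)..b}" for Z using that finite_subset by blast
  have "qvar ^ Suc d * GR b (Suc d) \<psi> y = qvar ^ d * GR b d (U ?k \<psi>) ?y"
    using mono[of ?k "Suc ?k"] Suc.prems by (simp add: U_up)
  also have "\<dots> = (\<Sum>Z\<in>Pow {Suc (Suc ?k)..b}. cq ^ card Z * U ?k \<psi> (?y \<circ> tmax Z (Suc ?k)))"
    using Suc.prems(2) by (intro Suc.IH[OF y', unfolded k]) simp
  also have "\<dots> = (\<Sum>Z\<in>Pow {Suc (Suc ?k)..b}. cq ^ card Z * \<psi> (y \<circ> tmax Z ?k)
      + cq ^ card (insert (Suc ?k) Z) * \<psi> (y \<circ> tmax (insert (Suc ?k) Z) ?k))"
  proof (rule sum.cong[OF refl])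
    fix Z assume Z: "Z \<in> Pow {Suc (Suc ?k)..b}"
    have "Suc ?k \<notin> Z" using Z by auto
    then have c: "card (insert (Suc ?k) Z) = Suc (card Z)" using fin[OF Z] by simp
    show "cq ^ card Z * U ?k \<psi> (?y \<circ> tmax Z (Suc ?k)) = cq ^ card Z * \<psi> (y \<circ> tmax Z ?k)
      + cq ^ card (insert (Suc ?k) Z) * \<psi> (y \<circ> tmax (insert (Suc ?k) Z) ?k)"
    proof (cases "Z = {}")
      case True
      have "?y (Suc ?k) < ?y ?k" using mono[of ?k "Suc ?k"] Suc.prems by simp
      then have "U ?k \<psi> ?y = \<psi> y + cq * \<psi> ?y" by (simp only: U_down adj_adj)
      then show ?thesis using True by (simp add: tmax_def)
    next
      case False
      let ?m = "Max Z"
      have m: "?m \<in> Z" using False fin[OF Z] by simp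
      then have m': "Suc ?k < ?m" "?m \<le> b" using Z by auto
      have mi: "Max (insert (Suc ?k) Z) = ?m" using False fin[OF Z] m' by simp
      let ?z = "?y \<circ> transpose (Suc ?k) ?m"
      have "?z ?k < ?z (Suc ?k)" using m' mono[of "Suc ?k" ?m] by (simp add: transpose_def)
      then have "U ?k \<psi> ?z = inverse qvar * \<psi> (?z \<circ> adj ?k)" by (rule U_up)
      moreover have "?z \<circ> adj ?k = y \<circ> transpose ?k ?m"
        using m' by (auto simp: fun_eq_iff transpose_def)
      ultimately show ?thesis using False c mi by (simp add: tmax_def algebra_simps)
    qed
  qed
  also have "\<dots> = (\<Sum>Z\<in>Pow (insert (Suc ?k) {Suc (Suc ?k)..b}). cq ^ card Z * \<psi> (y \<circ> tmax Z ?k))"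
    by (rule sum_Pow_insert[symmetric]) auto
  also have "insert (Suc ?k) {Suc (Suc ?k)..b} = {Suc ?k..b}" using Suc.prems by auto
  finally show ?case by simp
qed

section \<open>Vanishing of traces\<close>

text \<open>Subgroups sharing at most one letter intersect trivially, so on the first subgroup
  \<open>\<Psi> delta\<close> is a multiple of \<open>delta\<close>.\<close>

lemma tr_mult:
  assumes \<Phi>: "\<Phi> \<in> mon {a..<b}" and \<Psi>: "\<Psi> \<in> mon {c..<d}" and int: "card ({a..b} \<inter> {c..d}) \<le> 1"
  shows "tr (\<Phi> \<circ> \<Psi>) = tr \<Phi> * tr \<Psi>"
proof -
  have eq: "\<Psi> delta y = tr \<Psi> * delta y" if y: "y permutes {a..b}" for y
  proof (cases "y permutes {c..d}")
    case True
    then have "y permutes ({a..b} \<inter> {c..d})" using permutes_Int[OF y] by blast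
    moreover have "card ({a..b} \<inter> {c..d}) = 0 \<or> card ({a..b} \<inter> {c..d}) = Suc 0" using int by linarith
    then have "{a..b} \<inter> {c..d} = {} \<or> (\<exists>k. {a..b} \<inter> {c..d} = {k})"
      by (auto simp: card_Suc_eq)
    ultimately have "y = id" by (auto simp only: permutes_empty permutes_sing)
    then show ?thesis by (simp add: tr_def delta_def)
  next
    case False
    then have "y \<noteq> id" using permutes_id by blast
    then show ?thesis using supp_onD[OF mon_supp[OF \<Psi> supp_delta] False] by (simp add: delta_def)
  qed
  have "tr (\<Phi> \<circ> \<Psi>) = \<Phi> (\<lambda>y. tr \<Psi> * delta y) id"
    unfolding tr_def[of "\<Phi> \<circ> \<Psi>"] comp_apply by (rule mon_local[OF \<Phi> eq permutes_id])
  then show ?thesis unfolding mon_scale[OF \<Phi>] by (simp add: tr_def)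
qed

text \<open>By cyclicity the trace reads off, at \<open>adj j\<close>, the coefficient of an element
  of the parabolic subalgebra; \<open>adj j\<close> is not in its subgroup.\<close>

lemma tr_sandwich:
  assumes \<Phi>: "\<Phi> \<in> mon {a..<b}" and \<Psi>: "\<Psi> \<in> mon {a..<b}" and j: "j \<notin> {a..<b}"
  shows "tr (\<Phi> \<circ> U j \<circ> \<Psi>) = 0"
proof -
  have "tr (\<Phi> \<circ> (U j \<circ> \<Psi>)) = tr ((U j \<circ> \<Psi>) \<circ> \<Phi>)"
    by (rule tr_comm[OF \<Phi> mon_comp[OF mon_U[of j UNIV] mon_mono[OF \<Psi> subset_UNIV]]]) simp
  also have "\<dots> = inverse qvar * \<Psi> (\<Phi> delta) (adj j)"
    by (simp add: tr_def U_up)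
  also have "\<Psi> (\<Phi> delta) (adj j) = 0"
  proof (rule supp_onD[OF mon_supp[OF \<Psi> mon_supp[OF \<Phi> supp_delta]]])
    show "\<not> adj j permutes {a..b}"
    proof
      assume p: "adj j permutes {a..b}"
      have "j \<in> {a..b}" "Suc j \<in> {a..b}"
        using permutes_not_in[OF p, of j] permutes_not_in[OF p, of "Suc j"] by auto
      then show False using j by auto
    qed
  qed
  finally show ?thesis by (simp only: comp_assoc mult_zero_right)
qed

lemma GL_T: "a \<le> j \<Longrightarrow> GL a (Suc j - a) \<circ> T j = U j \<circ> GL a (j - a)"
  and T_GL: "a \<le> j \<Longrightarrow> T j \<circ> GL a (Suc j - a) = GL a (j - a) \<circ> U j"
  by (auto simp: Suc_diff_le fun_eq_iff)

lemma GR_T: "j < b \<Longrightarrow> GR b (b - j) \<circ> T j = U j \<circ> GR b (b - Suc j)"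
  and T_GR: "j < b \<Longrightarrow> T j \<circ> GR b (b - j) = GR b (b - Suc j) \<circ> U j"
  by (auto simp: Suc_diff_Suc[symmetric] fun_eq_iff)

lemma GL_mon': "a \<le> Suc j \<Longrightarrow> GL a (Suc j - a) \<in> mon {a..<Suc j}"
  using GL_mon[of a "Suc j - a"] by simp

lemma GL_mon'': "a \<le> j \<Longrightarrow> GL a (j - a) \<in> mon {a..<j}"
  using GL_mon[of a "j - a"] by simp

lemma GR_mon': "j \<le> b \<Longrightarrow> GR b (b - j) \<in> mon {j..<b}"
  using GR_mon[of "b - j" b] by simp

lemma GL_commute:
  assumes "\<Phi> \<in> mon {a..<j}" "a \<le> j"
  shows "\<Phi> \<circ> GL a (Suc j - a) = GL a (Suc j - a) \<circ> \<Phi>"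
proof (rule ext)
  fix \<phi>
  have "\<Phi> (GL a (Suc j - a) \<phi>) = GL a (Suc j - a) (\<Phi> \<phi>)"
    by (rule mon_commute_if[OF assms(1)], rule GL_commute_T) (use assms in auto)
  then show "(\<Phi> \<circ> GL a (Suc j - a)) \<phi> = (GL a (Suc j - a) \<circ> \<Phi>) \<phi>" by simp
qed

lemma GR_commute:
  assumes "\<Phi> \<in> mon {Suc j..<b}" "j \<le> b"
  shows "\<Phi> \<circ> GR b (b - j) = GR b (b - j) \<circ> \<Phi>"
proof (rule ext)
  fix \<phi>
  have "\<Phi> (GR b (b - j) \<phi>) = GR b (b - j) (\<Phi> \<phi>)"
    by (rule mon_commute_if[OF assms(1)], rule GR_commute_T) (use assms in auto)
  then show "(\<Phi> \<circ> GR b (b - j)) \<phi> = (GR b (b - j) \<circ> \<Phi>) \<phi>" by simp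
qed

text \<open>The single \<open>T j\<close> extracted from \<open>p\<close> cancels one outer
  \<open>U j\<close> of the Jucys--Murphy inverse, leaving a lone \<open>U j\<close> between
  operators of lower rank. The condition \<open>a \<le> c\<close> is what lets the letters extracted
  before \<open>T j\<close> commute past the inverse.\<close>

lemma GL_kill:
  assumes P: "P \<in> mon {1..<j}" and a: "1 \<le> a" and p: "p \<in> Sym (Suc j)" "Suc j \<le> n"
    and c: "p c = Suc j" "a \<le> c" "c \<le> j"
  shows "tr (P \<circ> GL a (Suc j - a) \<circ> W n p) = 0"
proof -
  let ?G = "GL a (Suc j - a)" and ?G' = "GL a (j - a)"
  have aj: "a \<le> j" using c by simp
  obtain \<Phi> \<alpha> where *: "\<Phi> \<in> mon {c..<j}" "\<alpha> \<in> Sym j" "W n p = \<Phi> \<circ> T j \<circ> W n \<alpha>"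
    using W_extract_max[OF p c(1) _ c(3)] a c by auto
  have \<Phi>: "\<Phi> \<in> mon {a..<j}" by (rule mon_mono[OF *(1)]) (use c in auto)
  have \<Phi>1: "\<Phi> \<in> mon {1..<j}" by (rule mon_mono[OF *(1)]) (use c a in auto)
  have \<alpha>: "W n \<alpha> \<in> mon {1..<j}" by (rule W_mon) (use *(2) p in auto)
  have G': "?G' \<in> mon {1..<j}" by (rule mon_mono[OF GL_mon''[OF aj]]) (use a in auto)
  have "P \<circ> ?G \<circ> W n p = P \<circ> (?G \<circ> \<Phi>) \<circ> T j \<circ> W n \<alpha>"
    unfolding *(3) by (simp only: comp_assoc)
  also have "\<dots> = P \<circ> \<Phi> \<circ> (?G \<circ> T j) \<circ> W n \<alpha>"
    unfolding GL_commute[OF \<Phi> aj, symmetric] by (simp only: comp_assoc)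
  also have "\<dots> = (P \<circ> \<Phi>) \<circ> U j \<circ> (?G' \<circ> W n \<alpha>)"
    unfolding GL_T[OF aj] by (simp only: comp_assoc)
  finally show ?thesis
    using tr_sandwich[OF mon_comp[OF P \<Phi>1] mon_comp[OF G' \<alpha>], of j] by simp
qed

text \<open>Here \<open>P\<close> separates the Jucys--Murphy inverse from \<open>W n p\<close>, so
  the extracted \<open>T j\<close> is brought to the left by cyclicity. What has to be at least
  \<open>a\<close> is now the value of \<open>p\<close> at \<open>j+1\<close> instead of the
  position of that letter.\<close>

lemma GL_kill':
  assumes P: "P \<in> mon {1..<j}" and a: "1 \<le> a" and p: "p \<in> Sym (Suc j)" "Suc j \<le> n"
    and c: "inv p c = Suc j" "a \<le> c" "c \<le> j"
  shows "tr (GL a (Suc j - a) \<circ> P \<circ> W n p) = 0"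
proof -
  let ?G = "GL a (Suc j - a)" and ?G' = "GL a (j - a)"
  have aj: "a \<le> j" using c by simp
  obtain \<Phi> \<alpha> where *: "\<Phi> \<in> mon {c..<j}" "\<alpha> \<in> Sym j" "W n p = W n \<alpha> \<circ> T j \<circ> \<Phi>"
    using W_extract_max'[OF p c(1) _ c(3)] a c by auto
  have \<Phi>: "\<Phi> \<in> mon {a..<j}" by (rule mon_mono[OF *(1)]) (use c in auto)
  have \<Phi>1: "\<Phi> \<in> mon {1..<j}" by (rule mon_mono[OF *(1)]) (use c a in auto)
  have \<alpha>: "W n \<alpha> \<in> mon {1..<j}" by (rule W_mon) (use *(2) p in auto)
  have G': "?G' \<in> mon {1..<j}" by (rule mon_mono[OF GL_mon''[OF aj]]) (use a in auto)
  have "tr (?G \<circ> P \<circ> W n p) = tr ((?G \<circ> P \<circ> W n \<alpha>) \<circ> (T j \<circ> \<Phi>))"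
    unfolding *(3) by (simp only: comp_assoc)
  also have "\<dots> = tr ((T j \<circ> \<Phi>) \<circ> (?G \<circ> P \<circ> W n \<alpha>))"
  proof (rule tr_comm)
    show "?G \<circ> P \<circ> W n \<alpha> \<in> mon UNIV"
      using mon_mono[OF GL_mon subset_UNIV] mon_mono[OF P subset_UNIV] mon_mono[OF \<alpha> subset_UNIV]
      by (intro mon_comp)
    show "T j \<circ> \<Phi> \<in> mon UNIV" using mon_mono[OF \<Phi> subset_UNIV] mon_T[of j UNIV] by (intro mon_comp) auto
  qed
  also have "(T j \<circ> \<Phi>) \<circ> (?G \<circ> P \<circ> W n \<alpha>) = T j \<circ> (\<Phi> \<circ> ?G) \<circ> P \<circ> W n \<alpha>"
    by (simp only: comp_assoc)
  also have "\<dots> = (T j \<circ> ?G) \<circ> \<Phi> \<circ> P \<circ> W n \<alpha>"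
    unfolding GL_commute[OF \<Phi> aj] by (simp only: comp_assoc)
  also have "\<dots> = ?G' \<circ> U j \<circ> (\<Phi> \<circ> P \<circ> W n \<alpha>)"
    unfolding T_GL[OF aj] by (simp only: comp_assoc)
  finally show ?thesis
    by (rule trans) (rule tr_sandwich[OF G' mon_comp[OF mon_comp[OF \<Phi>1 P] \<alpha>]], simp)
qed

lemma GR_kill:
  assumes q: "x permutes {j..n}" "1 \<le> j" and c: "x c = j" "j < c" "c \<le> b" "b \<le> n"
  shows "tr (GR b (b - j) \<circ> W n x) = 0"
proof -
  let ?G = "GR b (b - j)" and ?G' = "GR b (b - Suc j)"
  have jb: "j < b" "j \<le> b" using c by simp_all
  obtain \<Phi> \<alpha> where *: "\<Phi> \<in> mon {Suc j..<c}" "\<alpha> permutes {Suc j..n}" "W n x = \<Phi> \<circ> T j \<circ> W n \<alpha>"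
    using W_extract_min[OF q c(1,2)] c by auto
  have \<Phi>: "\<Phi> \<in> mon {Suc j..<b}" by (rule mon_mono[OF *(1)]) (use c in auto)
  have \<Phi>1: "\<Phi> \<in> mon {Suc j..<n}" by (rule mon_mono[OF *(1)]) (use c in auto)
  have \<alpha>: "W n \<alpha> \<in> mon {Suc j..<n}" by (rule W_mon) (use *(2) in auto)
  have G': "?G' \<in> mon {Suc j..<n}" by (rule mon_mono[OF GR_mon']) (use c in auto)
  have "?G \<circ> W n x = (?G \<circ> \<Phi>) \<circ> T j \<circ> W n \<alpha>"
    unfolding *(3) by (simp only: comp_assoc)
  also have "\<dots> = \<Phi> \<circ> (?G \<circ> T j) \<circ> W n \<alpha>"
    unfolding GR_commute[OF \<Phi> jb(2), symmetric] by (simp only: comp_assoc)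
  also have "\<dots> = \<Phi> \<circ> U j \<circ> (?G' \<circ> W n \<alpha>)"
    unfolding GR_T[OF jb(1)] by (simp only: comp_assoc)
  finally show ?thesis
    using tr_sandwich[OF \<Phi>1 mon_comp[OF G' \<alpha>], of j] by simp
qed

lemma GR_kill':
  assumes q: "x permutes {j..n}" "1 \<le> j" and c: "inv x c = j" "j < c" "c \<le> b" "b \<le> n"
  shows "tr (GR b (b - j) \<circ> W n x) = 0"
proof -
  let ?G = "GR b (b - j)" and ?G' = "GR b (b - Suc j)"
  have jb: "j < b" "j \<le> b" using c by simp_all
  obtain \<Phi> \<alpha> where *: "\<Phi> \<in> mon {Suc j..<c}" "\<alpha> permutes {Suc j..n}" "W n x = W n \<alpha> \<circ> T j \<circ> \<Phi>"
    using W_extract_min'[OF q c(1,2)] c by auto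
  have \<Phi>: "\<Phi> \<in> mon {Suc j..<b}" by (rule mon_mono[OF *(1)]) (use c in auto)
  have \<Phi>1: "\<Phi> \<in> mon {Suc j..<n}" by (rule mon_mono[OF *(1)]) (use c in auto)
  have \<alpha>: "W n \<alpha> \<in> mon {Suc j..<n}" by (rule W_mon) (use *(2) in auto)
  have G': "?G' \<in> mon {Suc j..<n}" by (rule mon_mono[OF GR_mon']) (use c in auto)
  have "tr (?G \<circ> W n x) = tr ((?G \<circ> W n \<alpha>) \<circ> (T j \<circ> \<Phi>))"
    unfolding *(3) by (simp only: comp_assoc)
  also have "\<dots> = tr ((T j \<circ> \<Phi>) \<circ> (?G \<circ> W n \<alpha>))"
  proof (rule tr_comm)
    show "?G \<circ> W n \<alpha> \<in> mon UNIV"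
      using mon_mono[OF GR_mon'[OF jb(2)] subset_UNIV] mon_mono[OF \<alpha> subset_UNIV]
      by (intro mon_comp)
    show "T j \<circ> \<Phi> \<in> mon UNIV" using mon_mono[OF \<Phi> subset_UNIV] mon_T[of j UNIV] by (intro mon_comp) auto
  qed
  also have "(T j \<circ> \<Phi>) \<circ> (?G \<circ> W n \<alpha>) = T j \<circ> (\<Phi> \<circ> ?G) \<circ> W n \<alpha>"
    by (simp only: comp_assoc)
  also have "\<dots> = (T j \<circ> ?G) \<circ> \<Phi> \<circ> W n \<alpha>"
    unfolding GR_commute[OF \<Phi> jb(2)] by (simp only: comp_assoc)
  also have "\<dots> = ?G' \<circ> U j \<circ> (\<Phi> \<circ> W n \<alpha>)"
    unfolding T_GR[OF jb(1)] by (simp only: comp_assoc)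
  finally show ?thesis
    by (rule trans) (rule tr_sandwich[OF G' mon_comp[OF \<Phi>1 \<alpha>]], simp)
qed

text \<open>In the expansion at \<open>id\<close>, every nonempty subset gives a transposition
  moving \<open>j+1\<close>, which lies outside the support of \<open>X delta\<close>; only the
  empty subset contributes.\<close>

lemma tr_GL:
  assumes X: "X \<in> mon {1..<j}" and a: "1 \<le> a" "a \<le> j"
  shows "qvar ^ (Suc j - a) * tr (GL a (Suc j - a) \<circ> X) = tr X"
proof -
  let ?d = "Suc j - a"
  have ad: "a + ?d = Suc j" using a by simp
  have "qvar ^ ?d * GL a ?d (X delta) id = (\<Sum>Z\<in>Pow {a..<a + ?d}. cq ^ card Z * X delta (id \<circ> tmin Z (a + ?d)))"
    by (rule GL_eval) (simp add: strict_mono_onI)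
  also have "\<dots> = (\<Sum>Z\<in>{{}}. cq ^ card Z * X delta (id \<circ> tmin Z (a + ?d)))"
  proof (rule sum.mono_neutral_right)
    show "\<forall>Z\<in>Pow {a..<a + ?d} - {{}}. cq ^ card Z * X delta (id \<circ> tmin Z (a + ?d)) = 0"
    proof
      fix Z assume Z: "Z \<in> Pow {a..<a + ?d} - {{}}"
      then have fZ: "finite Z" using finite_subset by auto
      then have "Min Z \<in> Z" using Z by simp
      then have m: "Min Z < Suc j" using Z ad by auto
      have "\<not> tmin Z (Suc j) permutes {1..j}"
      proof
        assume "tmin Z (Suc j) permutes {1..j}"
        then have "tmin Z (Suc j) (Suc j) = Suc j" by (rule permutes_not_in) simp
        then show False using Z m by (simp add: tmin_def)
      qed
      from supp_onD[OF mon_supp[OF X supp_delta] this]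
      show "cq ^ card Z * X delta (id \<circ> tmin Z (a + ?d)) = 0" unfolding ad by simp
    qed
  qed auto
  finally show ?thesis by (simp add: tr_def tmin_def)
qed

lemma tr_GR:
  assumes X: "X \<in> mon {Suc j..<n}" and b: "j < b"
  shows "qvar ^ (b - j) * tr (GR b (b - j) \<circ> X) = tr X"
proof -
  let ?d = "b - j"
  have bd: "b - ?d = j" using b by simp
  have "qvar ^ ?d * GR b ?d (X delta) id = (\<Sum>Z\<in>Pow {Suc (b - ?d)..b}. cq ^ card Z * X delta (id \<circ> tmax Z (b - ?d)))"
    by (rule GR_eval) (simp_all add: strict_mono_onI)
  also have "\<dots> = (\<Sum>Z\<in>{{}}. cq ^ card Z * X delta (id \<circ> tmax Z (b - ?d)))"
  proof (rule sum.mono_neutral_right)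
    show "\<forall>Z\<in>Pow {Suc (b - ?d)..b} - {{}}. cq ^ card Z * X delta (id \<circ> tmax Z (b - ?d)) = 0"
    proof
      fix Z assume Z: "Z \<in> Pow {Suc (b - ?d)..b} - {{}}"
      then have fZ: "finite Z" using finite_subset by auto
      then have "Max Z \<in> Z" using Z by simp
      then have m: "j < Max Z" using Z bd by auto
      have "\<not> tmax Z j permutes {Suc j..n}"
      proof
        assume "tmax Z j permutes {Suc j..n}"
        then have "tmax Z j j = j" by (rule permutes_not_in) simp
        then show False using Z m by (simp add: tmax_def)
      qed
      from supp_onD[OF mon_supp[OF X supp_delta] this]
      show "cq ^ card Z * X delta (id \<circ> tmax Z (b - ?d)) = 0" unfolding bd by simp
    qed
  qed auto
  finally show ?thesis by (simp add: tr_def tmax_def)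
qed

lemma tr_comm3:
  assumes "A \<in> mon S1" "B \<in> mon S2" "C \<in> mon S3"
  shows "tr (A \<circ> B \<circ> C) = tr (C \<circ> A \<circ> B)"
  using tr_comm[OF mon_comp[OF mon_mono[OF assms(1) subset_UNIV] mon_mono[OF assms(2) subset_UNIV]] assms(3)]
  by (simp only: comp_assoc)

lemma interval_Int: "1 \<le> j \<Longrightarrow> Suc j \<le> n \<Longrightarrow> {1..Suc j} \<inter> {j..n} = {j, Suc j}"
  "1 \<le> j \<Longrightarrow> Suc j \<le> n \<Longrightarrow> {j..n} \<inter> {1..Suc j} = {j, Suc j}"
  by auto

text \<open>The two parabolic subalgebras meet in the algebra of \<open>T j\<close>. The factor with
  vanishing trace against \<open>T j\<close> may be replaced by its expectation, a multiple of
  \<open>U j U j\<close>; this cancels \<open>T j T j\<close>, and the trace splits. The scalar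
  \<open>q\<close> is the one in the expectation.\<close>

lemma two_sided:
  assumes X: "X \<in> mon {1..<Suc j}" and M: "M \<in> mon {j..<n}" and j: "1 \<le> j" "Suc j \<le> n"
    and A: "A \<in> mon {1..<Suc j}" and B: "B \<in> mon {j..<n}"
    and or: "tr (T j \<circ> (M \<circ> B)) = 0 \<or> tr (T j \<circ> (A \<circ> X)) = 0"
  shows "tr (X \<circ> T j \<circ> T j \<circ> M \<circ> (B \<circ> A)) = qvar * tr (X \<circ> A) * tr (M \<circ> B)"
proof -
  have tj1: "T j \<in> mon {1..<Suc j}" and tj2: "T j \<in> mon {j..<n}" by (rule mon_T, use j in simp)+
  have uj1: "U j \<in> mon {1..<Suc j}" and uj2: "U j \<in> mon {j..<n}" by (rule mon_U, use j in simp)+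
  note int = interval_Int[OF j]
  have XA: "tr (X \<circ> A) = tr (A \<circ> X)" by (rule tr_comm[OF X A])
  from or show ?thesis
  proof
    assume 0: "tr (T j \<circ> (M \<circ> B)) = 0"
    let ?Z = "A \<circ> X \<circ> T j \<circ> T j"
    have Z: "?Z \<in> mon {1..<Suc j}" by (intro mon_comp A X tj1)
    have "tr (X \<circ> T j \<circ> T j \<circ> M \<circ> (B \<circ> A)) = tr ((X \<circ> T j \<circ> T j) \<circ> (M \<circ> B) \<circ> A)"
      by (simp only: comp_assoc)
    also have "\<dots> = tr (A \<circ> (X \<circ> T j \<circ> T j) \<circ> (M \<circ> B))"
      by (rule tr_comm3[OF mon_comp[OF mon_comp[OF X tj1] tj1] mon_comp[OF M B] A])
    also have "\<dots> = tr (?Z \<circ> (M \<circ> B))" by (simp only: comp_assoc)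
    also have "\<dots> = qvar * tr (M \<circ> B) * tr (?Z \<circ> U j \<circ> U j)"
      by (rule tr_expectation[OF Z mon_comp[OF M B] int(1) 0])
    also have "?Z \<circ> U j \<circ> U j = A \<circ> X" by (rule ext) simp
    finally show ?thesis by (simp only: XA mult_ac)
  next
    assume 0: "tr (T j \<circ> (A \<circ> X)) = 0"
    let ?Z = "T j \<circ> T j \<circ> M \<circ> B"
    have Z: "?Z \<in> mon {j..<n}" by (intro mon_comp M B tj2)
    have "tr (X \<circ> T j \<circ> T j \<circ> M \<circ> (B \<circ> A)) = tr (X \<circ> ?Z \<circ> A)"
      by (simp only: comp_assoc)
    also have "\<dots> = tr (A \<circ> X \<circ> ?Z)" by (rule tr_comm3[OF X Z A])
    also have "\<dots> = tr (?Z \<circ> (A \<circ> X))" by (rule tr_comm[OF mon_comp[OF A X] Z])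
    also have "\<dots> = qvar * tr (A \<circ> X) * tr (?Z \<circ> U j \<circ> U j)"
      by (rule tr_expectation[OF Z mon_comp[OF A X] int(2) 0])
    also have "tr (?Z \<circ> U j \<circ> U j) = tr ((T j \<circ> T j) \<circ> (M \<circ> B) \<circ> (U j \<circ> U j))" by (simp only: comp_assoc)
    also have "\<dots> = tr ((U j \<circ> U j) \<circ> (T j \<circ> T j) \<circ> (M \<circ> B))"
      by (rule tr_comm3[OF mon_comp[OF tj2 tj2] mon_comp[OF M B] mon_comp[OF uj2 uj2]])
    also have "(U j \<circ> U j) \<circ> (T j \<circ> T j) \<circ> (M \<circ> B) = M \<circ> B" by (rule ext) simp
    finally show ?thesis by (simp only: XA mult_ac)
  qed
qed

lemma two_sided':
  assumes X: "X \<in> mon {1..<Suc j}" and M: "M \<in> mon {j..<n}" and j: "1 \<le> j" "Suc j \<le> n"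
    and A: "A \<in> mon {1..<Suc j}" and B: "B \<in> mon {j..<n}"
    and or: "tr (T j \<circ> (B \<circ> M)) = 0 \<or> tr (T j \<circ> (X \<circ> A)) = 0"
  shows "tr (M \<circ> T j \<circ> T j \<circ> X \<circ> (A \<circ> B)) = qvar * tr (X \<circ> A) * tr (M \<circ> B)"
proof -
  have tj1: "T j \<in> mon {1..<Suc j}" and tj2: "T j \<in> mon {j..<n}" by (rule mon_T, use j in simp)+
  have uj1: "U j \<in> mon {1..<Suc j}" and uj2: "U j \<in> mon {j..<n}" by (rule mon_U, use j in simp)+
  note int = interval_Int[OF j]
  have MB: "tr (M \<circ> B) = tr (B \<circ> M)" by (rule tr_comm[OF M B])
  from or show ?thesis
  proof
    assume 0: "tr (T j \<circ> (B \<circ> M)) = 0"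
    let ?Z = "T j \<circ> T j \<circ> X \<circ> A"
    have Z: "?Z \<in> mon {1..<Suc j}" by (intro mon_comp A X tj1)
    have "tr (M \<circ> T j \<circ> T j \<circ> X \<circ> (A \<circ> B)) = tr (M \<circ> ?Z \<circ> B)"
      by (simp only: comp_assoc)
    also have "\<dots> = tr (B \<circ> M \<circ> ?Z)" by (rule tr_comm3[OF M Z B])
    also have "\<dots> = tr (?Z \<circ> (B \<circ> M))" by (rule tr_comm[OF mon_comp[OF B M] Z])
    also have "\<dots> = qvar * tr (B \<circ> M) * tr (?Z \<circ> U j \<circ> U j)"
      by (rule tr_expectation[OF Z mon_comp[OF B M] int(1) 0])
    also have "tr (?Z \<circ> U j \<circ> U j) = tr ((T j \<circ> T j) \<circ> (X \<circ> A) \<circ> (U j \<circ> U j))" by (simp only: comp_assoc)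
    also have "\<dots> = tr ((U j \<circ> U j) \<circ> (T j \<circ> T j) \<circ> (X \<circ> A))"
      by (rule tr_comm3[OF mon_comp[OF tj1 tj1] mon_comp[OF X A] mon_comp[OF uj1 uj1]])
    also have "(U j \<circ> U j) \<circ> (T j \<circ> T j) \<circ> (X \<circ> A) = X \<circ> A" by (rule ext) simp
    finally show ?thesis by (simp only: MB mult_ac)
  next
    assume 0: "tr (T j \<circ> (X \<circ> A)) = 0"
    let ?Z = "B \<circ> M \<circ> T j \<circ> T j"
    have Z: "?Z \<in> mon {j..<n}" by (intro mon_comp M B tj2)
    have "tr (M \<circ> T j \<circ> T j \<circ> X \<circ> (A \<circ> B)) = tr ((M \<circ> T j \<circ> T j) \<circ> (X \<circ> A) \<circ> B)"
      by (simp only: comp_assoc)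
    also have "\<dots> = tr (B \<circ> (M \<circ> T j \<circ> T j) \<circ> (X \<circ> A))"
      by (rule tr_comm3[OF mon_comp[OF mon_comp[OF M tj2] tj2] mon_comp[OF X A] B])
    also have "\<dots> = tr (?Z \<circ> (X \<circ> A))" by (simp only: comp_assoc)
    also have "\<dots> = qvar * tr (X \<circ> A) * tr (?Z \<circ> U j \<circ> U j)"
      by (rule tr_expectation[OF Z mon_comp[OF X A] int(2) 0])
    also have "?Z \<circ> U j \<circ> U j = B \<circ> M" by (rule ext) simp
    finally show ?thesis by (simp only: MB mult_ac)
  qed
qed

section \<open>Factors of parabolic decompositions in Bruhat order\<close>

text \<open>Both factors are reached by deleting letters from a reduced word. This is what carries
  hypotheses about elements below \<open>v\<close> from \<open>w\<close> over to its
  factors.\<close>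

lemma parabolic_factor_le:
  assumes p: "p \<in> Sym m" and m: "m \<le> n" and x: "x \<in> Sym n" and inc: "strict_mono_on {1..m} (inv x)"
  shows "bruhat_le n x (p \<circ> x)" "bruhat_le n p (p \<circ> x)"
proof -
  have pn: "p \<in> Sym n" by (rule Sym_mono[OF m p])
  show "bruhat_le n x (p \<circ> x)"
    using p
  proof (induction rule: Sym_induct_left)
    case id
    show "bruhat_le n x (id \<circ> x)" using bruhat_refl[OF x] by simp
  next
    case (descent p j)
    let ?p = "adj j \<circ> p"
    have j: "j \<in> {1..<m}" "j \<in> {1..<n}" using descent(2) m by auto
    have p: "p \<in> Sym m" by (rule descent(1))
    have p': "?p \<in> Sym m" by (rule comp_Sym[OF adj_Sym[OF j(1)] p])
    have pn: "?p \<in> Sym n" by (rule Sym_mono[OF m p'])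
    have lt: "inv ?p j < inv ?p (Suc j)"
      using descent(3) inv_comp_adj(2)[OF Sym_bij[OF p]] by simp
    have IH: "bruhat_le n x (?p \<circ> x)" by (rule descent.IH)
    have "inv ?p j \<in> {1..m}" "inv ?p (Suc j) \<in> {1..m}"
      using inv_Sym_mem[OF p', of j] inv_Sym_mem[OF p', of "Suc j"] j(1) by simp_all
    then have "inv x (inv ?p j) < inv x (inv ?p (Suc j))"
      using inc lt by (meson strict_mono_onD)
    then have "inv (?p \<circ> x) j < inv (?p \<circ> x) (Suc j)"
      by (simp add: inv_comp_Sym[OF pn x] del: inv_comp_adj)
    then have "bruhat_less n (?p \<circ> x) (adj j \<circ> (?p \<circ> x))"
      using bruhat_less_adj_left(2)[OF comp_Sym[OF pn x] j(2)] by blast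
    moreover have "adj j \<circ> (?p \<circ> x) = p \<circ> x" by (simp add: comp_assoc)
    ultimately show "bruhat_le n x (p \<circ> x)"
      using bruhat_trans[OF IH] by (simp only: bruhat_less_def)
  qed
  have "strict_mono_on {1..m} (inv x) \<longrightarrow> bruhat_le n p (p \<circ> x)"
    using x
  proof (induction rule: Sym_induct)
    case id
    show "strict_mono_on {1..m} (inv id) \<longrightarrow> bruhat_le n p (p \<circ> id)" using bruhat_refl[OF pn] by simp
  next
    case (descent x k)
    let ?x = "x \<circ> adj k"
    have xS: "x \<in> Sym n" by (rule descent(1))
    have x': "?x \<in> Sym n" by (rule comp_Sym[OF xS adj_Sym[OF descent(2)]])
    have IH: "strict_mono_on {1..m} (inv ?x) \<longrightarrow> bruhat_le n p (p \<circ> ?x)" by (rule descent.IH)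
    show "strict_mono_on {1..m} (inv x) \<longrightarrow> bruhat_le n p (p \<circ> x)"
    proof
      assume inc: "strict_mono_on {1..m} (inv x)"
      have x1: "1 \<le> x k" "1 \<le> x (Suc k)" using Sym_ge_1_iff[OF xS] descent(2) by auto
      have not: "\<not> (x k \<le> m)"
      proof
        assume le: "x k \<le> m"
        have mem: "x (Suc k) \<in> {1..m}" "x k \<in> {1..m}" using x1 le descent(3) by auto
        have "inv x (x (Suc k)) < inv x (x k)"
          by (rule strict_mono_onD[OF inc mem descent(3)])
        then show False by (simp add: Sym_inv_apply(1)[OF xS])
      qed
      then have pk: "p (x k) = x k" using Sym_fix(1)[OF p] by simp
      have lt: "p (x (Suc k)) < p (x k)"
      proof (cases "x (Suc k) \<le> m")
        case True
        then show ?thesis using Sym_le_iff[OF p, of "x (Suc k)"] not pk by simp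
      next
        case False
        then show ?thesis using Sym_fix(1)[OF p, of "x (Suc k)"] pk descent(3) by simp
      qed
      have inc': "strict_mono_on {1..m} (inv ?x)"
      proof (rule strict_mono_onI)
        fix r s assume rs: "r \<in> {1..m}" "s \<in> {1..m}" "r < s"
        have "inv x r < inv x s" by (rule strict_mono_onD[OF inc rs])
        moreover have "inv x r \<noteq> k" "inv x s \<noteq> k"
          using rs not Sym_inv_apply(2)[OF xS] by (metis atLeastAtMost_iff)+
        ultimately show "inv ?x r < inv ?x s"
          unfolding inv_comp_adj(1)[OF Sym_bij[OF xS]] by (auto simp: transpose_def)
      qed
      have "bruhat_less n (p \<circ> x \<circ> adj k) (p \<circ> x)"
        by (rule bruhat_descent_le[OF comp_Sym[OF pn xS] descent(2)]) (use lt in simp)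
      moreover have "bruhat_le n p (p \<circ> x \<circ> adj k)" using IH inc' by (simp only: comp_assoc simp_thms)
      ultimately show "bruhat_le n p (p \<circ> x)"
        using bruhat_trans by (auto simp: bruhat_less_def)
    qed
  qed
  then show "bruhat_le n p (p \<circ> x)" using inc by blast
qed

lemma parabolic_factor_le':
  assumes p: "p \<in> Sym m" and m: "m \<le> n" and x: "x \<in> Sym n" and inc: "strict_mono_on {1..m} x"
  shows "bruhat_le n x (x \<circ> p)" "bruhat_le n p (x \<circ> p)"
proof -
  have pn: "p \<in> Sym n" by (rule Sym_mono[OF m p])
  have e: "inv (inv p \<circ> inv x) = x \<circ> p"
    using inv_comp_Sym[OF inv_Sym[OF pn] inv_Sym[OF x]] inv_inv_Sym[OF pn] inv_inv_Sym[OF x] by simp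
  have inc': "strict_mono_on {1..m} (inv (inv x))" using inc inv_inv_Sym[OF x] by simp
  note * = parabolic_factor_le[OF inv_Sym[OF p] m inv_Sym[OF x] inc']
  show "bruhat_le n x (x \<circ> p)" "bruhat_le n p (x \<circ> p)"
    using bruhat_le_inv[OF *(1)] bruhat_le_inv[OF *(2)] unfolding e
    by (simp_all add: inv_inv_Sym[OF x] inv_inv_Sym[OF pn])
qed

section \<open>Adding one separating index\<close>

text \<open>Positivity of a rank: some point covers the interval from \<open>a\<close> to
  \<open>b\<close> upwards. Holding for \<open>w\<close> and for its inverse, it characterizes
  \<open>transpose a b\<close> being below \<open>w\<close> when \<open>a < b\<close>.\<close>

definition up :: "perm \<Rightarrow> nat \<Rightarrow> nat \<Rightarrow> bool" where
  "up w a b \<longleftrightarrow> (\<exists>k. 1 \<le> k \<and> k \<le> a \<and> b \<le> w k)"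

lemma upI: "1 \<le> k \<Longrightarrow> k \<le> a \<Longrightarrow> b \<le> w k \<Longrightarrow> up w a b"
  by (auto simp: up_def)

lemma not_upI:
  assumes "\<And>k. 1 \<le> k \<Longrightarrow> k \<le> j \<Longrightarrow> w k \<le> j"
  shows "\<not> up w j (Suc j)"
proof
  assume "up w j (Suc j)"
  then obtain k where "1 \<le> k" "k \<le> j" "Suc j \<le> w k" unfolding up_def by blast
  then show False using assms[of k] by simp
qed

lemma up_weaken: "up w a b \<Longrightarrow> a \<le> a' \<Longrightarrow> b' \<le> b \<Longrightarrow> up w a' b'"
  unfolding up_def by (meson order_trans)

lemma up_rk: "up w a b \<longleftrightarrow> 1 \<le> rk w a b"
proof -
  have "rk w a b = 0 \<longleftrightarrow> {k. 1 \<le> k \<and> k \<le> a \<and> b \<le> w k} = {}"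
    unfolding rk_def by (subst card_0_eq) auto
  then show ?thesis unfolding up_def by (auto simp: Suc_le_eq)
qed

lemma up_mono: "bruhat_le n u v \<Longrightarrow> up u a b \<Longrightarrow> up v a b"
  using bruhat_le_imp_rk_le[of n u v a b] by (simp add: up_rk)

lemma dn_mono: "bruhat_le n u v \<Longrightarrow> up (inv u) a b \<Longrightarrow> up (inv v) a b"
  using up_mono[OF bruhat_le_inv] by blast

text \<open>A hook of two Jucys--Murphy inverses, one for the reflections ending at
  \<open>j+1\<close> and one for those starting at \<open>j\<close>. Both contain the corner
  \<open>(j j+1)\<close>, which must count once; this is the origin of \<open>T j T j\<close>
  between them.\<close>

definition TJ :: "nat \<Rightarrow> nat \<Rightarrow> nat \<Rightarrow> hop" where
  "TJ a j b = U j \<circ> GL a (j - a) \<circ> GR b (b - Suc j) \<circ> U j"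

lemma GL_Suc: "a \<le> j \<Longrightarrow> GL a (Suc j - a) = U j \<circ> GL a (j - a) \<circ> U j"
  by (simp add: Suc_diff_le)

lemma GR_Suc: "j < b \<Longrightarrow> GR b (b - j) = U j \<circ> GR b (b - Suc j) \<circ> U j"
  by (simp add: Suc_diff_Suc[symmetric])

lemma TJ_eq1:
  assumes "a \<le> j" "j < b"
  shows "TJ a j b = GL a (Suc j - a) \<circ> T j \<circ> T j \<circ> GR b (b - j)"
  unfolding TJ_def GL_Suc[OF assms(1)] GR_Suc[OF assms(2)] by (rule ext) simp

lemma TJ_eq2:
  assumes "a \<le> j" "j < b"
  shows "TJ a j b = GR b (b - j) \<circ> T j \<circ> T j \<circ> GL a (Suc j - a)"
proof -
  have "GL a (j - a) (GR b (b - Suc j) \<phi>) = GR b (b - Suc j) (GL a (j - a) \<phi>)" for \<phi>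
    by (rule mon_commute[OF GL_mon''[OF assms(1)] GR_mon'[of "Suc j" b]]) (use assms in auto)
  then show ?thesis
    unfolding TJ_def GL_Suc[OF assms(1)] GR_Suc[OF assms(2)] by (intro ext) simp
qed

lemma TJ_eq0: "j < b \<Longrightarrow> TJ j j b = GR b (b - j)"
  unfolding TJ_def GR_Suc by simp

lemma TJ_mon: "a \<le> j \<Longrightarrow> j < b \<Longrightarrow> TJ a j b \<in> mon {a..<b}"
  unfolding TJ_def
  by (intro mon_comp mon_U mon_mono[OF GL_mon''] mon_mono[OF GR_mon'[of "Suc j" b]]) auto

text \<open>\<open>P\<close> is the operator of the indices in \<open>D\<close>, all of them below the new index \<open>j\<close>.  If the ranges
  of \<open>P\<close> and of the new factor meet in a letter (\<open>B = a\<close>), the two do not commute; \<open>rgt\<close> records their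
  order, which has to match the arcs of \<open>v\<close> as in \<open>touch\<close>.\<close>

locale step =
  fixes n :: nat and v :: perm and j a b B N :: nat and D :: "nat set" and P :: hop and rgt :: bool
  assumes j: "1 \<le> j" and D: "D \<subseteq> {1..<j}"
    and ab: "1 \<le> a" "a \<le> j" "j < b" "b \<le> n" and B: "B \<le> a"
    and P: "P \<in> mon {1..<B}"
    and IH: "\<And>w. bruhat_le n w v \<Longrightarrow>
      qvar ^ N * tr (P \<circ> W n w) = (if \<forall>i\<in>D. \<not> up w i (Suc i) then tr (W n w) else 0)"
    and A1: "\<And>c. 1 \<le> c \<Longrightarrow> c \<le> j \<Longrightarrow> up v c (Suc j) \<Longrightarrow> up (inv v) c (Suc j) \<Longrightarrow> a \<le> c"
    and A2: "\<And>c. j < c \<Longrightarrow> up v j c \<Longrightarrow> up (inv v) j c \<Longrightarrow> c \<le> b"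
    and A3: "\<not> (up v (j - 1) (j + 2) \<and> up (inv v) (j - 1) (j + 2))"
    and touch: "B < a \<or> (\<exists>i. 1 \<le> i \<and> i < a \<and>
      (if rgt then up (inv v) i (Suc j) \<and> \<not> up v i (Suc j) else up v i (Suc j) \<and> \<not> up (inv v) i (Suc j)))"
begin

abbreviation "L \<equiv> GL a (Suc j - a)"
abbreviation "M \<equiv> GR b (b - j)"
abbreviation "X \<equiv> (if rgt then P \<circ> L else L \<circ> P)"
abbreviation "opr \<equiv> (if rgt then P \<circ> TJ a j b else TJ a j b \<circ> P)"

lemma jn: "Suc j \<le> n" using ab by simp

lemma P1: "P \<in> mon {1..<j}"
  by (rule mon_mono[OF P]) (use B ab in auto)

lemma L_mon: "L \<in> mon {1..<Suc j}"
  by (rule mon_mono[OF GL_mon']) (use ab in auto)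

lemma M_mon: "M \<in> mon {j..<n}"
  by (rule mon_mono[OF GR_mon']) (use ab in auto)

lemma X_mon: "X \<in> mon {1..<Suc j}"
  using mon_comp[OF mon_mono[OF P1] L_mon] mon_comp[OF L_mon mon_mono[OF P1]] by auto

section \<open>Traces of the two legs against head and tail factors\<close>

lemma M_fix:
  assumes "x permutes {Suc j..n}"
  shows "qvar ^ (b - j) * tr (M \<circ> W n x) = tr (W n x)"
  by (rule tr_GR[OF W_mon[OF assms]]) (use ab in auto)

lemma M_move:
  assumes x: "x permutes {j..n}" and ne: "x j \<noteq> j" and le: "x j \<le> b \<or> inv x j \<le> b"
  shows "tr (M \<circ> W n x) = 0"
proof -
  have xn: "x \<in> Sym n" by (rule tail_Sym[OF x j])
  have jm: "j \<in> {j..n}" using jn by simp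
  have r: "j < x j" using permutes_in_image[OF x, of j] ne jm by auto
  have "inv x j \<noteq> j" using ne Sym_inv_apply(2)[OF xn, of j] by metis
  then have c: "j < inv x j" using permutes_in_image[OF permutes_inv[OF x], of j] jm by auto
  from le show ?thesis
  proof
    assume "x j \<le> b"
    then show ?thesis using GR_kill'[OF x j, of "x j" b] r ab Sym_inv_apply(1)[OF xn] by simp
  next
    assume "inv x j \<le> b"
    then show ?thesis using GR_kill[OF x j, of "inv x j" b] c ab Sym_inv_apply(2)[OF xn] by simp
  qed
qed

lemma X_fix:
  assumes p: "p \<in> Sym j"
  shows "qvar ^ (Suc j - a) * tr (X \<circ> W n p) = tr (P \<circ> W n p)"
proof -
  have Wp: "W n p \<in> mon {1..<j}" by (rule W_mon) (use p jn in auto)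
  show ?thesis
  proof (cases rgt)
    case True
    have "tr (P \<circ> L \<circ> W n p) = tr (W n p \<circ> (P \<circ> L))"
      by (rule tr_comm[OF mon_comp[OF mon_mono[OF P1] L_mon] Wp]) auto
    also have "\<dots> = tr ((W n p \<circ> P) \<circ> L)" by (simp only: comp_assoc)
    also have "\<dots> = tr (L \<circ> (W n p \<circ> P))"
      by (rule tr_comm[OF mon_comp[OF Wp P1] L_mon])
    finally have e: "tr (P \<circ> L \<circ> W n p) = tr (L \<circ> (W n p \<circ> P))" .
    have "qvar ^ (Suc j - a) * tr (P \<circ> L \<circ> W n p) = tr (W n p \<circ> P)"
      unfolding e by (rule tr_GL[OF mon_comp[OF Wp P1] ab(1,2)])
    then show ?thesis using True tr_comm[OF Wp P1] by simp
  next
    case False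
    then show ?thesis using tr_GL[OF mon_comp[OF P1 Wp] ab(1,2)] by (simp add: comp_assoc)
  qed
qed

text \<open>The trace can be killed through the position \<open>c\<close> of the letter
  \<open>j+1\<close> or through the value \<open>r\<close> at \<open>j+1\<close>. If
  \<open>P\<close> and \<open>L\<close> commute, both ways are open and \<open>A1\<close> supplies
  one of them; if they touch, only one is open and \<open>touch\<close> makes it succeed.\<close>

lemma X_move:
  assumes p: "p \<in> Sym (Suc j)" and ne: "p (Suc j) \<noteq> Suc j" and le: "bruhat_le n p v"
  shows "tr (X \<circ> W n p) = 0"
proof -
  define c where "c = inv p (Suc j)"
  define r where "r = p (Suc j)"
  have pc: "p c = Suc j" "inv p r = Suc j"
    using Sym_inv_apply[OF p] by (simp_all add: c_def r_def)
  have "1 \<le> r" "r \<le> Suc j" using Sym_range[OF p, of "Suc j"] by (simp_all add: r_def)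
  then have r: "1 \<le> r" "r \<le> j" using ne by (simp_all add: r_def)
  have cne: "c \<noteq> Suc j" using pc ne by metis
  have "c \<in> {1..Suc j}" using inv_Sym_mem[OF p, of "Suc j"] by (simp add: c_def)
  then have c: "1 \<le> c" "c \<le> j" using cne by auto
  have uc: "up v c (Suc j)"
    by (rule up_mono[OF le]) (use upI[of c c "Suc j" p] c pc in simp)
  have dr: "up (inv v) r (Suc j)"
    by (rule dn_mono[OF le]) (use upI[of r r "Suc j" "inv p"] r pc in simp)
  have k1: "tr (P \<circ> L \<circ> W n p) = 0" if "a \<le> c"
    by (rule GL_kill[OF P1 ab(1) p jn pc(1) that c(2)])
  have k2: "tr (L \<circ> P \<circ> W n p) = 0" if "a \<le> r"
    by (rule GL_kill'[OF P1 ab(1) p jn pc(2) that r(2)])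
  show ?thesis
  proof (cases "B < a")
    case True
    have com: "P \<circ> L = L \<circ> P"
    proof (rule ext)
      fix \<phi>
      have "P (L \<phi>) = L (P \<phi>)"
        by (rule mon_commute[OF P GL_mon']) (use ab True in auto)
      then show "(P \<circ> L) \<phi> = (L \<circ> P) \<phi>" by simp
    qed
    \<comment> \<open>Both arcs start at or before the larger of \<open>c\<close> and
      \<open>r\<close>, so \<open>A1\<close> applies there.\<close>
    have "a \<le> max c r"
      by (rule A1) (use c r uc dr up_weaken in \<open>auto intro: up_weaken[OF uc] up_weaken[OF dr]\<close>)
    then have "a \<le> c \<or> a \<le> r" by (auto simp: le_max_iff_disj)
    then have "tr (L \<circ> P \<circ> W n p) = 0" using k1 k2 com by auto
    then show ?thesis using com by simp
  next
    case False
    then obtain i where i: "1 \<le> i" "i < a" and t: "if rgt then up (inv v) i (Suc j) \<and> \<not> up v i (Suc j)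
        else up v i (Suc j) \<and> \<not> up (inv v) i (Suc j)" using touch by blast
    show ?thesis
    proof (cases rgt)
      case True
      \<comment> \<open>The arc missing at \<open>i\<close> forces \<open>c\<close> beyond
        \<open>i\<close>; the arc present at \<open>i\<close> in the inverse then also covers from
        \<open>c\<close>, and \<open>A1\<close> bounds \<open>c\<close>.\<close>
      have ic: "i < c" using t True up_weaken[OF uc, of i "Suc j"] by (meson not_less order_refl)
      then have "up (inv v) c (Suc j)" using t True up_weaken[of "inv v" i "Suc j" c] by simp
      then have "a \<le> c" using A1 c uc by blast
      then show ?thesis using k1 True by simp
    next
      case False
      have ir: "i < r" using t False up_weaken[OF dr, of i "Suc j"] by (meson not_less order_refl)
      then have "up v r (Suc j)" using t False up_weaken[of v i "Suc j" r] by simp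
      then have "a \<le> r" using A1 r dr by blast
      then show ?thesis using k2 False by simp
    qed
  qed
qed

text \<open>Both arcs reach at least the smaller endpoint, to which \<open>A2\<close>
  applies.\<close>

lemma A2_min:
  assumes "j < r" "up v j r" "j < c" "up (inv v) j c"
  shows "r \<le> b \<or> c \<le> b"
proof -
  have "min r c \<le> b"
    by (rule A2) (use assms in \<open>auto intro: up_weaken\<close>)
  then show ?thesis by (simp add: min_le_iff_disj)
qed

lemma tail_move:
  assumes x: "x permutes {j..n}" and ne: "x j \<noteq> j" and le: "bruhat_le n x v"
  shows "tr (M \<circ> W n x) = 0"
proof (rule M_move[OF x ne], rule A2_min)
  have xn: "x \<in> Sym n" by (rule tail_Sym[OF x j])
  have jm: "j \<in> {j..n}" using jn by simp
  show r: "j < x j" using permutes_in_image[OF x, of j] ne jm by auto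
  have "inv x j \<noteq> j" using ne Sym_inv_apply(2)[OF xn, of j] by metis
  then show c: "j < inv x j" using permutes_in_image[OF permutes_inv[OF x], of j] jm by auto
  show "up v j (x j)" by (rule up_mono[OF le]) (rule upI[of j], use j in auto)
  show "up (inv v) j (inv x j)" by (rule dn_mono[OF le]) (rule upI[of j], use j in auto)
qed

text \<open>When \<open>w\<close> does not cross \<open>j\<close>, its factors lie in disjoint
  parabolic subgroups. Its trace multiplies, and the hypothesis on \<open>P\<close> takes care of
  the head.\<close>

lemma product_value:
  assumes p: "p \<in> Sym j" and x: "x permutes {Suc j..n}" and pv: "bruhat_le n p v"
    and W: "W n w = W n x \<circ> W n p \<or> W n w = W n p \<circ> W n x"
    and upw: "\<And>i. i < j \<Longrightarrow> 1 \<le> i \<Longrightarrow> up w i (Suc i) \<longleftrightarrow> up p i (Suc i)"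
    and not: "\<not> up w j (Suc j)"
  shows "qvar ^ N * tr (P \<circ> W n p) * tr (W n x) = (if \<forall>i\<in>insert j D. \<not> up w i (Suc i) then tr (W n w) else 0)"
proof -
  have Wp: "W n p \<in> mon {1..<j}" by (rule W_mon) (use p jn in auto)
  have Wx: "W n x \<in> mon {Suc j..<n}" by (rule W_mon) (use x in auto)
  have "{1..j} \<inter> {Suc j..n} = {}" "{Suc j..n} \<inter> {1..j} = {}" by auto
  then have "tr (W n w) = tr (W n p) * tr (W n x)"
    using W tr_mult[OF Wp Wx] tr_mult[OF Wx Wp] by (auto simp: mult.commute)
  moreover have "(\<forall>i\<in>insert j D. \<not> up w i (Suc i)) \<longleftrightarrow> (\<forall>i\<in>D. \<not> up p i (Suc i))"
    using not upw D by fastforce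
  ultimately show ?thesis using IH[OF pv] by simp
qed

lemma up_left_factor:
  assumes x: "x permutes {j..n}" and i: "i < j"
  shows "up (p \<circ> x) i (Suc i) \<longleftrightarrow> up p i (Suc i)"
proof -
  have "x k = k" if "k \<le> i" for k using permutes_not_in[OF x, of k] that i by simp
  then show ?thesis unfolding up_def by auto
qed

lemma up_right_factor:
  assumes x: "x permutes {j..n}" and i: "i < j"
  shows "up (x \<circ> p) i (Suc i) \<longleftrightarrow> up p i (Suc i)"
proof -
  have "Suc i \<le> x l \<longleftrightarrow> Suc i \<le> l" for l
  proof (cases "l \<in> {j..n}")
    case True
    then show ?thesis using permutes_in_image[OF x, of l] i by auto
  next
    case False
    then show ?thesis using permutes_not_in[OF x False] by simp
  qed
  then show ?thesis unfolding up_def by auto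
qed

lemma kill2:
  assumes "\<Phi> \<in> mon {1..<j}" "\<Psi> \<in> mon {1..<j}"
  shows "tr (\<Phi> \<circ> L \<circ> T j \<circ> \<Psi>) = 0" "tr (\<Phi> \<circ> T j \<circ> L \<circ> \<Psi>) = 0"
proof -
  have G: "GL a (j - a) \<in> mon {1..<j}" by (rule mon_mono[OF GL_mon''[OF ab(2)]]) (use ab in auto)
  have "\<Phi> \<circ> L \<circ> T j \<circ> \<Psi> = \<Phi> \<circ> (L \<circ> T j) \<circ> \<Psi>" by (simp only: comp_assoc)
  also have "\<dots> = \<Phi> \<circ> U j \<circ> (GL a (j - a) \<circ> \<Psi>)" unfolding GL_T[OF ab(2)] by (simp only: comp_assoc)
  finally show "tr (\<Phi> \<circ> L \<circ> T j \<circ> \<Psi>) = 0" using tr_sandwich[OF assms(1) mon_comp[OF G assms(2)], of j] by simp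
  have "\<Phi> \<circ> T j \<circ> L \<circ> \<Psi> = \<Phi> \<circ> (T j \<circ> L) \<circ> \<Psi>" by (simp only: comp_assoc)
  also have "\<dots> = (\<Phi> \<circ> GL a (j - a)) \<circ> U j \<circ> \<Psi>" unfolding T_GL[OF ab(2)] by (simp only: comp_assoc)
  finally show "tr (\<Phi> \<circ> T j \<circ> L \<circ> \<Psi>) = 0" using tr_sandwich[OF mon_comp[OF assms(1) G] assms(2), of j] by simp
qed

text \<open>The exponent \<open>b - a\<close> of the hook is one less than the exponents of its two
  legs together; the missing \<open>q\<close> is the factor produced by the expectation.\<close>

lemma scalars: "qvar ^ (N + (b - a)) * (qvar * s * t) = qvar ^ N * (qvar ^ (Suc j - a) * s) * (qvar ^ (b - j) * t)"
proof -
  have "N + (b - a) + 1 = N + (Suc j - a) + (b - j)" using ab by simp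
  then have "qvar ^ (N + (b - a)) * qvar = qvar ^ N * qvar ^ (Suc j - a) * qvar ^ (b - j)"
    by (metis power_add power_one_right)
  then show ?thesis by (simp add: algebra_simps)
qed

lemma scalars': "a = j \<Longrightarrow> qvar ^ (N + (b - a)) * (s * t) = (qvar ^ N * s) * (qvar ^ (b - j) * t)"
  by (simp add: power_add algebra_simps)


section \<open>Traces of the enlarged product\<close>

lemma P_far:
  assumes "B < j" "\<Psi> \<in> mon {j..<n}"
  shows "P (\<Psi> \<phi>) = \<Psi> (P \<phi>)"
  by (rule mon_commute[OF P assms(2)]) (use assms(1) in auto)

lemma Tj_mon: "T j \<in> mon {j..<n}" "T j \<in> mon {1..<Suc j}"
  by (rule mon_T, use j jn in simp)+

lemma TTM_mon: "T j \<circ> T j \<circ> M \<in> mon {j..<n}" "M \<circ> T j \<circ> T j \<in> mon {j..<n}"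
  by (intro mon_comp Tj_mon M_mon)+

lemma opr_eq1:
  assumes "B < j"
  shows "opr = X \<circ> T j \<circ> T j \<circ> M"
proof (rule ext)
  fix \<phi>
  have "P (T j (T j (M \<phi>))) = T j (T j (M (P \<phi>)))" for \<phi>
    using P_far[OF assms TTM_mon(1), of \<phi>] by simp
  then show "opr \<phi> = (X \<circ> T j \<circ> T j \<circ> M) \<phi>"
    unfolding TJ_eq1[OF ab(2,3)] by simp
qed

lemma opr_eq2:
  assumes "B < j"
  shows "opr = M \<circ> T j \<circ> T j \<circ> X"
proof (rule ext)
  fix \<phi>
  have "P (M (T j (T j \<phi>))) = M (T j (T j (P \<phi>)))" for \<phi>
    using P_far[OF assms TTM_mon(2), of \<phi>] by simp
  then show "opr \<phi> = (M \<circ> T j \<circ> T j \<circ> X) \<phi>"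
    unfolding TJ_eq2[OF ab(2,3)] by simp
qed

lemma PT:
  assumes "B < j"
  shows "P \<circ> T j = T j \<circ> P"
proof (rule ext)
  fix \<phi> show "(P \<circ> T j) \<phi> = (T j \<circ> P) \<phi>"
    using P_far[OF assms Tj_mon(1), of \<phi>] by simp
qed

lemma W_head_mon: "p \<in> Sym j \<Longrightarrow> W n p \<in> mon {1..<j}"
  by (rule W_mon) (use jn in auto)

text \<open>Provides the vanishing hypothesis of \<open>two_sided\<close> when the head fixes
  \<open>j+1\<close>: \<open>T j\<close> cancels an outer factor of \<open>L\<close> and leaves a
  lone \<open>U j\<close>.\<close>

lemma X2a:
  assumes B: "B < j" and p: "p \<in> Sym j"
  shows "tr (T j \<circ> (W n p \<circ> X)) = 0"
proof -
  note Wp = W_head_mon[OF p]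
  have u: "\<Phi> \<in> mon {1..<Suc j}" if "\<Phi> \<in> mon {1..<j}" for \<Phi>
    by (rule mon_mono[OF that]) auto
  show ?thesis
  proof (cases rgt)
    case True
    have "tr (T j \<circ> (W n p \<circ> (P \<circ> L))) = tr (T j \<circ> (W n p \<circ> P) \<circ> L)" by (simp only: comp_assoc)
    also have "\<dots> = tr (L \<circ> T j \<circ> (W n p \<circ> P))"
      by (rule tr_comm3[OF Tj_mon(2) u[OF mon_comp[OF Wp P1]] L_mon])
    also have "\<dots> = tr (id \<circ> L \<circ> T j \<circ> (W n p \<circ> P))" by simp
    also have "\<dots> = 0" by (rule kill2(1)[OF mon_id mon_comp[OF Wp P1]])
    finally show ?thesis using True by simp
  next
    case False
    have "tr (T j \<circ> (W n p \<circ> (L \<circ> P))) = tr (T j \<circ> W n p \<circ> (L \<circ> P))" by (simp only: comp_assoc)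
    also have "\<dots> = tr ((L \<circ> P) \<circ> T j \<circ> W n p)"
      by (rule tr_comm3[OF Tj_mon(2) u[OF Wp] mon_comp[OF L_mon u[OF P1]]])
    also have "\<dots> = tr (L \<circ> (P \<circ> T j) \<circ> W n p)" by (simp only: comp_assoc)
    also have "\<dots> = tr (id \<circ> L \<circ> T j \<circ> (P \<circ> W n p))" unfolding PT[OF B] by (simp only: comp_assoc id_comp)
    also have "\<dots> = 0" by (rule kill2(1)[OF mon_id mon_comp[OF P1 Wp]])
    finally show ?thesis using False by simp
  qed
qed

lemma X2b:
  assumes B: "B < j" and p: "p \<in> Sym j"
  shows "tr (T j \<circ> (X \<circ> W n p)) = 0"
proof -
  note Wp = W_head_mon[OF p]
  show ?thesis
  proof (cases rgt)
    case True
    have "tr (T j \<circ> (P \<circ> L \<circ> W n p)) = tr ((T j \<circ> P) \<circ> L \<circ> W n p)" by (simp only: comp_assoc)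
    also have "\<dots> = tr (P \<circ> T j \<circ> L \<circ> W n p)" unfolding PT[OF B, symmetric] by (simp only: comp_assoc)
    also have "\<dots> = 0" by (rule kill2(2)[OF P1 Wp])
    finally show ?thesis using True by simp
  next
    case False
    have "tr (T j \<circ> (L \<circ> P \<circ> W n p)) = tr (id \<circ> T j \<circ> L \<circ> (P \<circ> W n p))" by (simp only: comp_assoc id_comp)
    also have "\<dots> = 0" by (rule kill2(2)[OF mon_id mon_comp[OF P1 Wp]])
    finally show ?thesis using False by simp
  qed
qed

text \<open>Without an arc over \<open>j - 1 .. j + 2\<close>, \<open>w\<close> is
  \<open>p \<circ> x\<close> with a head on \<open>1..j+1\<close> and a tail on \<open>j..n\<close>.
  These share two letters, so the trace splits by conditional expectation instead of plain
  multiplicativity.\<close>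

lemma opr_W_A1:
  assumes B: "B < j" and le: "bruhat_le n w v" and F: "\<not> up v (j - 1) (j + 2)"
  shows "qvar ^ (N + (b - a)) * tr (opr \<circ> W n w) = (if \<forall>i\<in>insert j D. \<not> up w i (Suc i) then tr (W n w) else 0)"
proof -
  have w: "w \<in> Sym n" using le bruhat_le_Sym by blast
  have jj: "Suc (j - 1) = j" "j - 1 \<le> Suc j" using j by simp_all
  have "w i \<le> Suc j" if "1 \<le> i" "i \<le> j - 1" for i
  proof (rule ccontr)
    assume "\<not> w i \<le> Suc j"
    then have "up w (j - 1) (j + 2)" using that by (intro upI[of i]) auto
    then show False using up_mono[OF le] F by blast
  qed
  from parabolic_decomposition_left[OF w jn jj(2) this]
  obtain p x where p: "p \<in> Sym (Suc j)" and x: "x permutes {j..n}" and wpx: "w = p \<circ> x"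
    and inc: "strict_mono_on {1..Suc j} (inv x)" unfolding jj(1) by blast
  have xn: "x \<in> Sym n" by (rule tail_Sym[OF x j])
  have xl: "bruhat_le n x v" and pl: "bruhat_le n p v"
    using parabolic_factor_le[OF p jn xn inc] bruhat_trans[OF _ le] unfolding wpx by blast+
  have Ww: "W n w = W n x \<circ> W n p" unfolding wpx by (rule W_comp[OF p jn xn inc])
  have incj: "inv x j < inv x (Suc j)" by (rule strict_mono_onD[OF inc]) (use j in auto)
  have jm: "j \<in> {j..n}" using jn by simp
  have cge: "j \<le> inv x j" using permutes_in_image[OF permutes_inv[OF x], of j] jm by auto
  have xge: "j \<le> x j" using permutes_in_image[OF x, of j] jm by auto
  have xneS: "x j \<noteq> Suc j"
    using incj cge Sym_inv_apply(1)[OF xn, of j] by (metis leD)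
  have big: "Suc (Suc j) \<le> x j" if "x j \<noteq> j" using that xge xneS by simp
  have Wp_mon: "W n p \<in> mon {1..<Suc j}" by (rule W_mon) (use p jn in auto)
  have Wx_mon: "W n x \<in> mon {j..<n}" by (rule W_mon) (use x j in auto)
  \<comment> \<open>If \<open>p\<close> fixes \<open>j+1\<close>, the head side vanishes. Otherwise
    \<open>T j\<close> is absorbed into the tail as \<open>adj j \<circ> x\<close>, which moves
    \<open>j\<close> within reach of \<open>M\<close>: by one step if \<open>x\<close> fixes
    \<open>j\<close>, and by \<open>A2\<close> in the other case.\<close>
  have or: "tr (T j \<circ> (M \<circ> W n x)) = 0 \<or> tr (T j \<circ> (W n p \<circ> X)) = 0"
  proof (cases "p (Suc j) = Suc j")
    case True
    then have "p \<in> Sym j" by (rule Sym_shrink[OF p])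
    then show ?thesis using X2a[OF B] by blast
  next
    case pm: False
    let ?x = "adj j \<circ> x"
    have x': "?x permutes {j..n}" by (rule permutes_compose[OF x permutes_swap_id]) (use jn in auto)
    have "tr (T j \<circ> (M \<circ> W n x)) = tr ((M \<circ> W n x) \<circ> T j)"
      by (rule tr_comm[OF Tj_mon(1) mon_comp[OF M_mon Wx_mon]])
    also have "\<dots> = tr (M \<circ> W n ?x)"
      unfolding hopw_left[OF xn _ incj] using j jn by (subst hopw_left[OF xn _ incj]) (simp_all add: comp_assoc)
    also have "\<dots> = 0"
    proof (cases "x j = j")
      case True
      then show ?thesis by (intro M_move[OF x']) (use ab in auto)
    next
      case False
      have e: "?x j = x j" using False xneS by (simp add: transpose_def)
      have e': "inv ?x j = inv x (Suc j)" by (simp add: inv_comp_adj(2)[OF Sym_bij[OF xn]])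
      have pr: "1 \<le> p (Suc j)" "p (Suc j) \<le> j"
        using Sym_range[OF p, of "Suc j"] pm by simp_all
      have "inv w (p (Suc j)) = inv x (Suc j)"
        unfolding wpx inv_comp_Sym[OF Sym_mono[OF jn p] xn] by (simp add: Sym_inv_apply(1)[OF p])
      then have "up (inv w) j (inv x (Suc j))" using pr by (intro upI[of "p (Suc j)"]) auto
      then have d: "up (inv v) j (inv x (Suc j))" by (rule dn_mono[OF le])
      have u: "up v j (x j)" by (rule up_mono[OF xl]) (rule upI[of j], use j in auto)
      have "x j \<le> b \<or> inv x (Suc j) \<le> b"
        by (rule A2_min[OF _ u _ d]) (use big[OF False] incj cge in auto)
      then show ?thesis by (intro M_move[OF x']) (use e e' False in auto)
    qed
    finally show ?thesis by blast
  qed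
  have "tr (opr \<circ> W n w) = qvar * tr (X \<circ> W n p) * tr (M \<circ> W n x)"
    unfolding opr_eq1[OF B] Ww by (rule two_sided[OF X_mon M_mon j jn Wp_mon Wx_mon or])
  then have val: "qvar ^ (N + (b - a)) * tr (opr \<circ> W n w) =
      qvar ^ N * (qvar ^ (Suc j - a) * tr (X \<circ> W n p)) * (qvar ^ (b - j) * tr (M \<circ> W n x))"
    by (simp only: scalars)
  \<comment> \<open>In the first two cases \<open>w\<close> crosses \<open>j\<close> and one of the
    two traces in \<open>val\<close> is zero; in the last case the factors act on disjoint sets of
    letters.\<close>
  consider "x j \<noteq> j" | "x j = j" "p (Suc j) \<noteq> Suc j" | "x j = j" "p (Suc j) = Suc j" by blast
  then show ?thesis
  proof cases
    case 1
    have "p (x j) = x j" using Sym_fix(1)[OF p] big[OF 1] by simp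
    then have "up w j (Suc j)" unfolding wpx using big[OF 1] j by (intro upI[of j]) auto
    then show ?thesis using val tail_move[OF x 1 xl] by simp
  next
    case 2
    define c where "c = inv p (Suc j)"
    have pc: "p c = Suc j" using Sym_inv_apply(2)[OF p] by (simp add: c_def)
    have "c \<in> {1..Suc j}" using inv_Sym_mem[OF p, of "Suc j"] by (simp add: c_def)
    moreover have "c \<noteq> Suc j" using pc 2 by metis
    ultimately have c: "1 \<le> c" "c \<le> j" by auto
    have "x c = c" using permutes_not_in[OF x, of c] c 2 by (cases "c = j") auto
    then have "up w j (Suc j)" unfolding wpx using c pc by (intro upI[of c]) auto
    then show ?thesis using val X_move[OF p 2(2) pl] by simp
  next
    case 3
    have p': "p \<in> Sym j" by (rule Sym_shrink[OF p 3(2)])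
    have x': "x permutes {Suc j..n}" by (rule permutes_shrink[OF x 3(1)])
    have "w k \<le> j" if "1 \<le> k" "k \<le> j" for k
      using permutes_not_in[OF x', of k] Sym_range(2)[OF p', of k] that unfolding wpx by simp
    then have not: "\<not> up w j (Suc j)" by (rule not_upI)
    show ?thesis
      unfolding val X_fix[OF p'] M_fix[OF x']
      by (rule product_value[OF p' x' pl disjI1[OF Ww] _ not]) (simp add: wpx up_left_factor[OF x])
  qed
qed

text \<open>The mirror case, with the head applied first: the absence of the arc in the inverse
  bounds the positions of small values instead of the values at small positions.\<close>

lemma opr_W_A2:
  assumes B: "B < j" and le: "bruhat_le n w v" and F: "\<not> up (inv v) (j - 1) (j + 2)"
  shows "qvar ^ (N + (b - a)) * tr (opr \<circ> W n w) = (if \<forall>i\<in>insert j D. \<not> up w i (Suc i) then tr (W n w) else 0)"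
proof -
  have w: "w \<in> Sym n" using le bruhat_le_Sym by blast
  have jj: "Suc (j - 1) = j" "j - 1 \<le> Suc j" using j by simp_all
  have "inv w i \<le> Suc j" if "1 \<le> i" "i \<le> j - 1" for i
  proof (rule ccontr)
    assume "\<not> inv w i \<le> Suc j"
    then have "up (inv w) (j - 1) (j + 2)" using that by (intro upI[of i]) auto
    then show False using dn_mono[OF le] F by blast
  qed
  from parabolic_decomposition_right[OF w jn jj(2) this]
  obtain p x where p: "p \<in> Sym (Suc j)" and x: "x permutes {j..n}" and wpx: "w = x \<circ> p"
    and inc: "strict_mono_on {1..Suc j} x" unfolding jj(1) by blast
  have xn: "x \<in> Sym n" by (rule tail_Sym[OF x j])
  have xl: "bruhat_le n x v" and pl: "bruhat_le n p v"
    using parabolic_factor_le'[OF p jn xn inc] bruhat_trans[OF _ le] unfolding wpx by blast+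
  have Ww: "W n w = W n p \<circ> W n x" unfolding wpx by (rule W_comp'[OF p jn xn inc])
  have incj: "x j < x (Suc j)" by (rule strict_mono_onD[OF inc]) (use j in auto)
  have jm: "j \<in> {j..n}" "Suc j \<in> {j..n}" using jn by simp_all
  have xge: "j \<le> x j" using permutes_in_image[OF x, of j] jm by auto
  have cge: "j \<le> inv x j" using permutes_in_image[OF permutes_inv[OF x], of j] jm by auto
  have Wp_mon: "W n p \<in> mon {1..<Suc j}" by (rule W_mon) (use p jn in auto)
  have Wx_mon: "W n x \<in> mon {j..<n}" by (rule W_mon) (use x j in auto)
  define c where "c = inv p (Suc j)"
  have pc: "p c = Suc j" using Sym_inv_apply(2)[OF p] by (simp add: c_def)
  have cm: "1 \<le> c" "c \<le> j" if "p (Suc j) \<noteq> Suc j"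
  proof -
    have "c \<in> {1..Suc j}" using inv_Sym_mem[OF p, of "Suc j"] by (simp add: c_def)
    moreover have "c \<noteq> Suc j" using pc that by metis
    ultimately show "1 \<le> c" "c \<le> j" by auto
  qed
  have or: "tr (T j \<circ> (W n x \<circ> M)) = 0 \<or> tr (T j \<circ> (X \<circ> W n p)) = 0"
  proof (cases "p (Suc j) = Suc j")
    case True
    then have "p \<in> Sym j" by (rule Sym_shrink[OF p])
    then show ?thesis using X2b[OF B] by blast
  next
    case pm: False
    let ?x = "x \<circ> adj j"
    have jr: "j \<in> {j..<n}" "j \<in> {1..<n}" using j jn by auto
    have x': "?x permutes {j..n}" using permutes_comp_adj_iff[OF jr(1)] x by blast
    have xn': "?x \<in> Sym n" by (rule tail_Sym[OF x' j])
    have Wx': "W n ?x = T j \<circ> W n x"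
      using hopw_descent[OF xn' jr(2), of qvar 1] incj by simp
    have "tr (T j \<circ> (W n x \<circ> M)) = tr (W n ?x \<circ> M)"
      unfolding Wx' by (simp only: comp_assoc)
    also have "\<dots> = tr (M \<circ> W n ?x)"
      unfolding Wx' by (rule tr_comm[OF mon_comp[OF Tj_mon(1) Wx_mon] M_mon])
    also have "\<dots> = 0"
    proof (cases "x j = j")
      case True
      have "inv x j = j" using True Sym_inv_apply(1)[OF xn, of j] by simp
      then have "inv ?x j = Suc j"
        unfolding inv_comp_adj(1)[OF Sym_bij[OF xn]] by simp
      moreover have "?x j \<noteq> j" using incj True by simp
      ultimately show ?thesis by (intro M_move[OF x']) (use ab in auto)
    next
      case False
      have ne: "inv x j \<noteq> Suc j" using incj xge Sym_inv_apply(2)[OF xn, of j] by (metis leD)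
      have nej: "inv x j \<noteq> j" using False Sym_inv_apply(2)[OF xn, of j] by metis
      have e: "inv ?x j = inv x j"
        unfolding inv_comp_adj(1)[OF Sym_bij[OF xn]] using ne nej by (simp add: transpose_def)
      have nej': "?x j \<noteq> j" using incj xge by simp
      have "up w j (x (Suc j))" unfolding wpx using cm[OF pm] pc by (intro upI[of c]) auto
      then have u: "up v j (x (Suc j))" by (rule up_mono[OF le])
      have d: "up (inv v) j (inv x j)" by (rule dn_mono[OF xl]) (rule upI[of j], use j in auto)
      have "x (Suc j) \<le> b \<or> inv x j \<le> b"
        by (rule A2_min[OF _ u _ d]) (use incj xge cge nej in auto)
      then have "?x j \<le> b \<or> inv ?x j \<le> b" unfolding e by simp
      then show ?thesis by (rule M_move[OF x' nej'])
    qed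
    finally show ?thesis by blast
  qed
  have "tr (opr \<circ> W n w) = qvar * tr (X \<circ> W n p) * tr (M \<circ> W n x)"
    unfolding opr_eq2[OF B] Ww by (rule two_sided'[OF X_mon M_mon j jn Wp_mon Wx_mon or])
  then have val: "qvar ^ (N + (b - a)) * tr (opr \<circ> W n w) =
      qvar ^ N * (qvar ^ (Suc j - a) * tr (X \<circ> W n p)) * (qvar ^ (b - j) * tr (M \<circ> W n x))"
    by (simp only: scalars)
  consider "p (Suc j) \<noteq> Suc j" | "x j \<noteq> j" "p (Suc j) = Suc j" | "x j = j" "p (Suc j) = Suc j" by blast
  then show ?thesis
  proof cases
    case 1
    have "up w j (Suc j)" unfolding wpx using cm[OF 1] pc incj xge by (intro upI[of c]) auto
    then show ?thesis using val X_move[OF p 1 pl] by simp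
  next
    case 2
    have p': "p \<in> Sym j" by (rule Sym_shrink[OF p 2(2)])
    have "inv p j \<in> {1..j}" using inv_Sym_mem[OF p', of j] j by simp
    moreover have "w (inv p j) = x j" unfolding wpx using Sym_inv_apply(2)[OF p] by simp
    ultimately have "up w j (Suc j)" using 2 xge by (intro upI[of "inv p j"]) auto
    then show ?thesis using val tail_move[OF x 2(1) xl] by simp
  next
    case 3
    have p': "p \<in> Sym j" by (rule Sym_shrink[OF p 3(2)])
    have x': "x permutes {Suc j..n}" by (rule permutes_shrink[OF x 3(1)])
    have "w k \<le> j" if "1 \<le> k" "k \<le> j" for k
      using permutes_not_in[OF x', of "p k"] Sym_range(2)[OF p', of k] that unfolding wpx by simp
    then have not: "\<not> up w j (Suc j)" by (rule not_upI)
    show ?thesis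
      unfolding val X_fix[OF p'] M_fix[OF x']
      by (rule product_value[OF p' x' pl disjI2[OF Ww] _ not]) (simp add: wpx up_right_factor[OF x])
  qed
qed

text \<open>The range of \<open>P\<close> now reaches \<open>j\<close>, so \<open>a = j\<close>, the
  left leg is only the corner and the hook reduces to \<open>M\<close>. Head and tail share just the
  letter \<open>j\<close>, hence traces multiply. Which side the tail stands on is dictated by
  \<open>touch\<close>, and this matches the side of the new factor.\<close>

lemma opr_W_B:
  assumes B': "B = j" and le: "bruhat_le n w v"
  shows "qvar ^ (N + (b - a)) * tr (opr \<circ> W n w) = (if \<forall>i\<in>insert j D. \<not> up w i (Suc i) then tr (W n w) else 0)"
proof -
  have w: "w \<in> Sym n" using le bruhat_le_Sym by blast
  have a: "a = j" using B B' ab by simp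
  have TJM: "TJ a j b = M" unfolding a using TJ_eq0 ab by simp
  have jj: "Suc (j - 1) = j" "j - 1 \<le> j" using j by simp_all
  have jn': "j \<le> n" using jn by simp
  have jm: "j \<in> {j..n}" using jn by simp
  have cap: "card ({1..j} \<inter> {j..n}) \<le> 1" "card ({j..n} \<inter> {1..j}) \<le> 1"
  proof -
    have "{1..j} \<inter> {j..n} = {j}" "{j..n} \<inter> {1..j} = {j}" using j jn by auto
    then show "card ({1..j} \<inter> {j..n}) \<le> 1" "card ({j..n} \<inter> {1..j}) \<le> 1" by simp_all
  qed
  obtain i where i: "1 \<le> i" "i < j" and t: "if rgt then up (inv v) i (Suc j) \<and> \<not> up v i (Suc j)
        else up v i (Suc j) \<and> \<not> up (inv v) i (Suc j)" using touch B' a by auto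
  \<comment> \<open>Arcs of both kinds over \<open>j - 1\<close> would, by \<open>A1\<close>, push
    \<open>a\<close> below \<open>j\<close>.\<close>
  have no: "\<not> (up v (j - 1) (Suc j) \<and> up (inv v) (j - 1) (Suc j))"
  proof
    assume "up v (j - 1) (Suc j) \<and> up (inv v) (j - 1) (Suc j)"
    then have "a \<le> j - 1" using A1[of "j - 1"] i by simp
    then show False using a i by simp
  qed
  have concl: ?thesis
    if p: "p \<in> Sym j" and x: "x permutes {j..n}" and xl: "bruhat_le n x v" and pl: "bruhat_le n p v"
      and Ww: "W n w = W n x \<circ> W n p \<or> W n w = W n p \<circ> W n x"
      and tr: "tr (opr \<circ> W n w) = tr (P \<circ> W n p) * tr (M \<circ> W n x)"
      and upw: "\<And>i. i < j \<Longrightarrow> 1 \<le> i \<Longrightarrow> up w i (Suc i) \<longleftrightarrow> up p i (Suc i)"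
      and upj: "up w j (Suc j) \<longleftrightarrow> x j \<noteq> j" for p x
  proof -
    have val: "qvar ^ (N + (b - a)) * tr (opr \<circ> W n w) =
        (qvar ^ N * tr (P \<circ> W n p)) * (qvar ^ (b - j) * tr (M \<circ> W n x))"
      unfolding tr by (rule scalars'[OF a])
    show ?thesis
    proof (cases "x j = j")
      case True
      have x': "x permutes {Suc j..n}" by (rule permutes_shrink[OF x True])
      show ?thesis unfolding val M_fix[OF x']
        by (rule product_value[OF p x' pl Ww upw]) (use upj True in auto)
    next
      case False
      then show ?thesis using val tail_move[OF x False xl] upj by simp
    qed
  qed
  show ?thesis
  proof (cases rgt)
    case True
    then have "up (inv v) (j - 1) (Suc j)" using t i by (auto intro: up_weaken)
    then have F: "\<not> up v (j - 1) (Suc j)" using no by blast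
    have "w k \<le> j" if "1 \<le> k" "k \<le> j - 1" for k
    proof (rule ccontr)
      assume "\<not> w k \<le> j"
      then have "up w (j - 1) (Suc j)" using that by (intro upI[of k]) auto
      then show False using up_mono[OF le] F by blast
    qed
    from parabolic_decomposition_left[OF w jn' jj(2) this]
    obtain p x where p: "p \<in> Sym j" and x: "x permutes {j..n}" and wpx: "w = p \<circ> x"
      and inc: "strict_mono_on {1..j} (inv x)" unfolding jj(1) by blast
    have xn: "x \<in> Sym n" by (rule tail_Sym[OF x j])
    have Ww: "W n w = W n x \<circ> W n p" unfolding wpx by (rule W_comp[OF p jn' xn inc])
    note Wp = W_head_mon[OF p]
    have Wx: "W n x \<in> mon {j..<n}" by (rule W_mon) (use x j in auto)
    have xge: "j \<le> x j" using permutes_in_image[OF x, of j] jm by auto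
    show ?thesis
    proof (rule concl[OF p x _ _ disjI1[OF Ww]])
      show "bruhat_le n x v" "bruhat_le n p v"
        using parabolic_factor_le[OF p jn' xn inc] bruhat_trans[OF _ le] unfolding wpx by blast+
      have "tr (P \<circ> M \<circ> (W n x \<circ> W n p)) = tr (P \<circ> (M \<circ> W n x) \<circ> W n p)" by (simp only: comp_assoc)
      also have "\<dots> = tr (W n p \<circ> P \<circ> (M \<circ> W n x))"
        by (rule tr_comm3[OF P1 mon_comp[OF M_mon Wx] Wp])
      also have "\<dots> = tr (W n p \<circ> P) * tr (M \<circ> W n x)"
        by (rule tr_mult[OF mon_comp[OF Wp P1] mon_comp[OF M_mon Wx] cap(1)])
      also have "tr (W n p \<circ> P) = tr (P \<circ> W n p)" by (rule tr_comm[OF Wp P1])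
      finally show "tr (opr \<circ> W n w) = tr (P \<circ> W n p) * tr (M \<circ> W n x)"
        unfolding TJM Ww by (simp only: True if_True)
      show "up w i (Suc i) \<longleftrightarrow> up p i (Suc i)" if "i < j" "1 \<le> i" for i
        unfolding wpx by (rule up_left_factor[OF x that(1)])
      show "up w j (Suc j) \<longleftrightarrow> x j \<noteq> j"
      proof (cases "x j = j")
        case x0: True
        have "w k \<le> j" if "1 \<le> k" "k \<le> j" for k
          using permutes_not_in[OF permutes_shrink[OF x x0], of k] Sym_range(2)[OF p, of k] that unfolding wpx by simp
        then have "\<not> up w j (Suc j)" by (rule not_upI)
        then show ?thesis using x0 by simp
      next
        case x0: False
        then have "p (x j) = x j" using Sym_fix(1)[OF p] xge by simp
        then have "up w j (Suc j)" unfolding wpx using x0 xge j by (intro upI[of j]) auto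
        then show ?thesis using x0 by simp
      qed
    qed
  next
    case False
    then have "up v (j - 1) (Suc j)" using t i by (auto intro: up_weaken)
    then have F: "\<not> up (inv v) (j - 1) (Suc j)" using no by blast
    have "inv w k \<le> j" if "1 \<le> k" "k \<le> j - 1" for k
    proof (rule ccontr)
      assume "\<not> inv w k \<le> j"
      then have "up (inv w) (j - 1) (Suc j)" using that by (intro upI[of k]) auto
      then show False using dn_mono[OF le] F by blast
    qed
    from parabolic_decomposition_right[OF w jn' jj(2) this]
    obtain p x where p: "p \<in> Sym j" and x: "x permutes {j..n}" and wpx: "w = x \<circ> p"
      and inc: "strict_mono_on {1..j} x" unfolding jj(1) by blast
    have xn: "x \<in> Sym n" by (rule tail_Sym[OF x j])
    have Ww: "W n w = W n p \<circ> W n x" unfolding wpx by (rule W_comp'[OF p jn' xn inc])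
    note Wp = W_head_mon[OF p]
    have Wx: "W n x \<in> mon {j..<n}" by (rule W_mon) (use x j in auto)
    have xge: "j \<le> x j" using permutes_in_image[OF x, of j] jm by auto
    show ?thesis
    proof (rule concl[OF p x _ _ disjI2[OF Ww]])
      show "bruhat_le n x v" "bruhat_le n p v"
        using parabolic_factor_le'[OF p jn' xn inc] bruhat_trans[OF _ le] unfolding wpx by blast+
      have "tr (M \<circ> P \<circ> (W n p \<circ> W n x)) = tr (M \<circ> (P \<circ> W n p) \<circ> W n x)" by (simp only: comp_assoc)
      also have "\<dots> = tr (W n x \<circ> M \<circ> (P \<circ> W n p))"
        by (rule tr_comm3[OF M_mon mon_comp[OF P1 Wp] Wx])
      also have "\<dots> = tr (W n x \<circ> M) * tr (P \<circ> W n p)"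
        by (rule tr_mult[OF mon_comp[OF Wx M_mon] mon_comp[OF P1 Wp] cap(2)])
      also have "tr (W n x \<circ> M) = tr (M \<circ> W n x)" by (rule tr_comm[OF Wx M_mon])
      finally show "tr (opr \<circ> W n w) = tr (P \<circ> W n p) * tr (M \<circ> W n x)"
        unfolding TJM Ww by (simp only: False if_False mult.commute)
      show "up w i (Suc i) \<longleftrightarrow> up p i (Suc i)" if "i < j" "1 \<le> i" for i
        unfolding wpx by (rule up_right_factor[OF x that(1)])
      show "up w j (Suc j) \<longleftrightarrow> x j \<noteq> j"
      proof (cases "x j = j")
        case x0: True
        have "w k \<le> j" if "1 \<le> k" "k \<le> j" for k
          using permutes_not_in[OF permutes_shrink[OF x x0], of "p k"] Sym_range(2)[OF p, of k] that unfolding wpx by simp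
        then have "\<not> up w j (Suc j)" by (rule not_upI)
        then show ?thesis using x0 by simp
      next
        case x0: False
        have "inv p j \<in> {1..j}" using inv_Sym_mem[OF p, of j] j by simp
        moreover have "w (inv p j) = x j" unfolding wpx using Sym_inv_apply(2)[OF p] by simp
        ultimately have "up w j (Suc j)" using x0 xge by (intro upI[of "inv p j"]) auto
        then show ?thesis using x0 by simp
      qed
    qed
  qed
qed

theorem step_trace:
  assumes "bruhat_le n w v"
  shows "qvar ^ (N + (b - a)) * tr (opr \<circ> W n w) = (if \<forall>i\<in>insert j D. \<not> up w i (Suc i) then tr (W n w) else 0)"
proof (cases "B < j")
  case True
  then show ?thesis using opr_W_A1[OF True assms] opr_W_A2[OF True assms] A3 by blast
next
  case False
  then have "B = j" using B ab by simp
  then show ?thesis by (rule opr_W_B[OF _ assms])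
qed

lemma opr_mon: "opr \<in> mon {1..<b}"
proof -
  have "P \<in> mon {1..<b}" by (rule mon_mono[OF P]) (use B ab in auto)
  moreover have "TJ a j b \<in> mon {1..<b}" by (rule mon_mono[OF TJ_mon]) (use ab in auto)
  ultimately show ?thesis by (auto intro: mon_comp)
qed

end

section \<open>Expansion over sets of reflections\<close>

lemma transpose_eq_iff':
  assumes "a < b" "c < (d :: nat)"
  shows "transpose a b = transpose c d \<longleftrightarrow> a = c \<and> b = d"
proof
  assume e: "transpose a b = transpose c d"
  have "transpose c d a = b" "transpose c d b = a" using e[symmetric] by simp_all
  then show "a = c \<and> b = d" using assms by (auto simp: transpose_def split: if_splits)
qed simp

text \<open>The hook of reflections expanded by \<open>TJ a j b\<close>, with the common corner of
  its two legs listed once.\<close>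

definition Cset :: "nat \<Rightarrow> nat \<Rightarrow> nat \<Rightarrow> perm set" where
  "Cset a j b = insert (adj j) ((\<lambda>m. transpose m (Suc j)) ` {a..<j} \<union> transpose j ` {j + 2..b})"

definition lft :: "nat \<Rightarrow> nat \<Rightarrow> perm set \<Rightarrow> nat set" where
  "lft a j Y = {m \<in> {a..<j}. transpose m (Suc j) \<in> Y}"

definition rgtm :: "nat \<Rightarrow> nat \<Rightarrow> perm set \<Rightarrow> nat set" where
  "rgtm j b Y = {m \<in> {j + 2..b}. transpose j m \<in> Y}"

text \<open>A closed form for the top of the cube: in the left leg the least \<open>m\<close> gives
  the maximal reflection, in the right leg the greatest, and the corner \<open>adj j\<close> is
  maximal only if it stands alone.\<close>

definition theta :: "nat \<Rightarrow> nat \<Rightarrow> nat \<Rightarrow> perm set \<Rightarrow> perm" where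
  "theta a j b Y =
     (if lft a j Y = {} \<and> rgtm j b Y = {} then (if adj j \<in> Y then adj j else id)
      else tmin (lft a j Y) (Suc j) \<circ> tmax (rgtm j b Y) j)"

lemma finite_Cset: "finite (Cset a j b)"
  by (simp add: Cset_def)

lemma theta_cong:
  assumes "Y \<inter> Cset a j b = Y' \<inter> Cset a j b"
  shows "theta a j b Y = theta a j b Y'"
proof -
  have "t \<in> Y \<longleftrightarrow> t \<in> Y'" if "t \<in> Cset a j b" for t using assms that by blast
  then have "lft a j Y = lft a j Y'" "rgtm j b Y = rgtm j b Y'" "adj j \<in> Y \<longleftrightarrow> adj j \<in> Y'"
    by (auto simp: lft_def rgtm_def Cset_def)
  then show ?thesis by (simp add: theta_def)
qed

lemma sum_Pow_Un:
  fixes f :: "'a set \<Rightarrow> 'b::comm_monoid_add"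
  assumes "A \<inter> B = {}"
  shows "(\<Sum>Y\<in>Pow (A \<union> B). f Y) = (\<Sum>Y1\<in>Pow A. \<Sum>Y2\<in>Pow B. f (Y1 \<union> Y2))"
  unfolding sum.cartesian_product
  by (rule sum.reindex_bij_witness[where i = "\<lambda>(Y1, Y2). Y1 \<union> Y2" and j = "\<lambda>Y. (Y \<inter> A, Y \<inter> B)"])
     (use assms in \<open>auto simp flip: Int_Un_distrib intro: arg_cong[where f = f]\<close>)

lemma sum_Pow_image:
  fixes f :: "'a set \<Rightarrow> 'b::comm_monoid_add"
  assumes "inj_on h S"
  shows "(\<Sum>Y\<in>Pow (h ` S). f Y) = (\<Sum>Z\<in>Pow S. f (h ` Z))"
proof -
  have "Pow (h ` S) = image h ` Pow S" by (rule image_Pow_surj[symmetric]) simp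
  moreover have "inj_on (image h) (Pow S)" using assms by (rule inj_on_image_Pow)
  ultimately show ?thesis by (simp add: sum.reindex)
qed

text \<open>The inner expansions choose subsets of the two legs; the outer right \<open>U j\<close>
  decides about the corner. If a leg is used, the corner alters only the weight, again through
  \<open>q^-1 = 1 + (q^-1 - 1)\<close>.\<close>

lemma TJ_eval:
  assumes y: "strict_mono_on {a..b} y" and a: "a \<le> j" and b: "j < b"
  shows "qvar ^ (b - a) * TJ a j b \<psi> y = (\<Sum>Y\<in>Pow (Cset a j b). cq ^ card Y * \<psi> (y \<circ> theta a j b Y))"
proof -
  let ?y = "y \<circ> adj j"
  let ?A = "{a..<j}" and ?B = "{j + 2..b}"
  let ?hA = "\<lambda>m. transpose m (Suc j)" and ?hB = "transpose j"
  have mono: "y r < y s" if "a \<le> r" "r < s" "s \<le> b" for r s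
    by (rule strict_mono_onD[OF y]) (use that in auto)
  have y1: "strict_mono_on {a..a + (j - a)} ?y"
    by (rule strict_mono_onI) (use a b in \<open>auto simp: transpose_def intro: mono\<close>)
  have e1: "a + (j - a) = j" "b - (b - Suc j) = Suc j" using a b by simp_all
  have finA: "finite Z" if "Z \<in> Pow ?A" for Z using that finite_subset by blast
  have finB: "finite Z" if "Z \<in> Pow ?B" for Z using that finite_subset by blast
  have minA: "Min Z \<in> ?A" if "Z \<in> Pow ?A" "Z \<noteq> {}" for Z
    using Min_in[OF finA[OF that(1)] that(2)] that(1) by blast
  have maxB: "Max Z \<in> ?B" if "Z \<in> Pow ?B" "Z \<noteq> {}" for Z
    using Max_in[OF finB[OF that(1)] that(2)] that(1) by blast
  have y2: "strict_mono_on {b - (b - Suc j)..b} (?y \<circ> tmin Z j)" if Z: "Z \<in> Pow ?A" for Z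
  proof (rule strict_mono_onI)
    fix r s assume rs: "r \<in> {b - (b - Suc j)..b}" "s \<in> {b - (b - Suc j)..b}" "r < s"
    have far: "tmin Z j k = k" if "Suc j \<le> k" for k
    proof (cases "Z = {}")
      case False
      then have "Min Z < j" using minA[OF Z] by simp
      then show ?thesis using that False by (simp add: tmin_def transpose_apply_other)
    qed (simp add: tmin_def)
    have "tmin Z j r = r" "tmin Z j s = s"
      using rs unfolding e1 by (auto intro!: far)
    then show "(?y \<circ> tmin Z j) r < (?y \<circ> tmin Z j) s"
      using rs a unfolding e1 by (auto simp: transpose_def intro: mono)
  qed
  define f where "f = (\<lambda>Y. cq ^ card Y * \<psi> (y \<circ> theta a j b Y))"
  have injA: "inj_on ?hA ?A" by (rule inj_onI) (auto simp: transpose_eq_iff')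
  have injB: "inj_on ?hB ?B" by (rule inj_onI) (auto simp: transpose_eq_iff')
  have disj: "?hA ` ?A \<inter> ?hB ` ?B = {}" by (auto simp: transpose_eq_iff')
  have adjn: "adj j \<notin> ?hA ` ?A \<union> ?hB ` ?B" by (auto simp: transpose_eq_iff')
  have tm: "cq ^ card Z * (cq ^ card Z' * U j \<psi> (?y \<circ> tmin Z j \<circ> tmax Z' (Suc j))) =
      f (?hA ` Z \<union> ?hB ` Z') + f (insert (adj j) (?hA ` Z \<union> ?hB ` Z'))"
    if Z: "Z \<in> Pow ?A" and Z': "Z' \<in> Pow ?B" for Z Z'
  proof -
    let ?Y = "?hA ` Z \<union> ?hB ` Z'"
    have sub: "?Y \<subseteq> ?hA ` ?A \<union> ?hB ` ?B" using Z Z' by blast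
    have l: "lft a j ?Y = Z" "lft a j (insert (adj j) ?Y) = Z"
      using Z Z' by (auto simp: lft_def transpose_eq_iff' subset_iff image_iff)
    have r: "rgtm j b ?Y = Z'" "rgtm j b (insert (adj j) ?Y) = Z'"
      using Z Z' by (auto simp: rgtm_def transpose_eq_iff' subset_iff image_iff)
    have an: "adj j \<notin> ?Y" using adjn sub by blast
    have "card ?Y = card (?hA ` Z) + card (?hB ` Z')"
      by (rule card_Un_disjoint) (use finA[OF Z] finB[OF Z'] disj Z Z' in blast)+
    also have "card (?hA ` Z) = card Z" by (rule card_image[OF inj_on_subset[OF injA]]) (use Z in auto)
    also have "card (?hB ` Z') = card Z'" by (rule card_image[OF inj_on_subset[OF injB]]) (use Z' in auto)
    finally have c: "card ?Y = card Z + card Z'" .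
    have c': "card (insert (adj j) ?Y) = Suc (card Z + card Z')"
      using an finA[OF Z] finB[OF Z'] c by simp
    show ?thesis
    proof (cases "Z = {} \<and> Z' = {}")
      case True
      have "?y (Suc j) < ?y j" using mono[of j "Suc j"] a b by simp
      then have "U j \<psi> ?y = \<psi> y + cq * \<psi> ?y" by (simp only: U_down adj_adj)
      then show ?thesis using True l r an by (simp add: f_def theta_def tmin_def tmax_def lft_def rgtm_def)
    next
      case False
      let ?z = "?y \<circ> tmin Z j \<circ> tmax Z' (Suc j)"
      have th: "theta a j b ?Y = tmin Z (Suc j) \<circ> tmax Z' j" "theta a j b (insert (adj j) ?Y) = tmin Z (Suc j) \<circ> tmax Z' j"
        using False by (simp_all only: theta_def l r if_False)
      have zz: "?z j < ?z (Suc j) \<and> ?z \<circ> adj j = y \<circ> (tmin Z (Suc j) \<circ> tmax Z' j)"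
      proof (cases "Z = {}")
        case True
        then have "Z' \<noteq> {}" using False by simp
        then have m: "j + 2 \<le> Max Z'" "Max Z' \<le> b" using maxB[OF Z'] by auto
        then show ?thesis using True \<open>Z' \<noteq> {}\<close> mono[of "Suc j" "Max Z'"] a
          by (auto simp: tmin_def tmax_def transpose_def fun_eq_iff)
      next
        case Zne: False
        then have m: "a \<le> Min Z" "Min Z < j" using minA[OF Z] by auto
        show ?thesis
        proof (cases "Z' = {}")
          case True
          then show ?thesis using Zne m mono[of "Min Z" j] b
            by (auto simp: tmin_def tmax_def transpose_def fun_eq_iff)
        next
          case False
          then have m': "j + 2 \<le> Max Z'" "Max Z' \<le> b" using maxB[OF Z'] by auto
          then show ?thesis using Zne False m mono[of "Min Z" "Max Z'"]
            by (auto simp: tmin_def tmax_def transpose_def fun_eq_iff)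
        qed
      qed
      then have "U j \<psi> ?z = inverse qvar * \<psi> (y \<circ> (tmin Z (Suc j) \<circ> tmax Z' j))"
        using U_up[of ?z j \<psi>] by metis
      then have "cq ^ card Z * (cq ^ card Z' * U j \<psi> ?z) =
          cq ^ (card Z + card Z') * (inverse qvar * \<psi> (y \<circ> (tmin Z (Suc j) \<circ> tmax Z' j)))"
        by (simp only: power_add mult.assoc)
      also have "\<dots> = f ?Y + f (insert (adj j) ?Y)"
        unfolding f_def th c c' by (simp add: algebra_simps)
      finally show ?thesis .
    qed
  qed
  have ba: "b - a = Suc ((j - a) + (b - Suc j))" using a b by simp
  have "TJ a j b \<psi> y = inverse qvar * GL a (j - a) (GR b (b - Suc j) (U j \<psi>)) ?y"
    unfolding TJ_def using mono[of j "Suc j"] a b by (simp add: U_up)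
  then have "qvar ^ (b - a) * TJ a j b \<psi> y =
      qvar ^ (b - Suc j) * (qvar ^ (j - a) * GL a (j - a) (GR b (b - Suc j) (U j \<psi>)) ?y)"
    unfolding ba by (simp add: power_add algebra_simps)
  also have "\<dots> = qvar ^ (b - Suc j) * (\<Sum>Z\<in>Pow ?A. cq ^ card Z * GR b (b - Suc j) (U j \<psi>) (?y \<circ> tmin Z j))"
    unfolding GL_eval[OF y1] e1 ..
  also have "\<dots> = (\<Sum>Z\<in>Pow ?A. cq ^ card Z * (qvar ^ (b - Suc j) * GR b (b - Suc j) (U j \<psi>) (?y \<circ> tmin Z j)))"
    by (simp only: sum_distrib_left mult.left_commute)
  also have "\<dots> = (\<Sum>Z\<in>Pow ?A. cq ^ card Z * (\<Sum>Z'\<in>Pow ?B. cq ^ card Z' * U j \<psi> (?y \<circ> tmin Z j \<circ> tmax Z' (Suc j))))"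
  proof (rule sum.cong[OF refl])
    fix Z assume Z: "Z \<in> Pow ?A"
    have "Suc (b - (b - Suc j)) = j + 2" using b by simp
    then show "cq ^ card Z * (qvar ^ (b - Suc j) * GR b (b - Suc j) (U j \<psi>) (?y \<circ> tmin Z j)) =
      cq ^ card Z * (\<Sum>Z'\<in>Pow ?B. cq ^ card Z' * U j \<psi> (?y \<circ> tmin Z j \<circ> tmax Z' (Suc j)))"
      by (subst GR_eval[OF y2[OF Z]]) (simp_all only: e1 diff_le_self)
  qed
  also have "\<dots> = (\<Sum>Z\<in>Pow ?A. \<Sum>Z'\<in>Pow ?B. f (?hA ` Z \<union> ?hB ` Z') + f (insert (adj j) (?hA ` Z \<union> ?hB ` Z')))"
    unfolding sum_distrib_left by (rule sum.cong[OF refl], rule sum.cong[OF refl]) (rule tm)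
  also have "\<dots> = (\<Sum>Y1\<in>Pow (?hA ` ?A). \<Sum>Y2\<in>Pow (?hB ` ?B). f (Y1 \<union> Y2) + f (insert (adj j) (Y1 \<union> Y2)))"
    unfolding sum_Pow_image[OF injA] sum_Pow_image[OF injB] ..
  also have "\<dots> = (\<Sum>Y\<in>Pow (?hA ` ?A \<union> ?hB ` ?B). f Y + f (insert (adj j) Y))"
    by (rule sum_Pow_Un[OF disj, symmetric])
  also have "\<dots> = (\<Sum>Y\<in>Pow (Cset a j b). f Y)"
    unfolding Cset_def by (rule sum_Pow_insert[symmetric]) (use adjn in auto)
  finally show ?thesis unfolding f_def .
qed

lemma theta_permutes:
  assumes "a \<le> j" "j < b"
  shows "theta a j b Y permutes {a..b}"
proof -
  have A: "tmin (lft a j Y) (Suc j) permutes {a..b}"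
  proof (cases "lft a j Y = {}")
    case False
    have "finite (lft a j Y)" by (simp add: lft_def)
    then have "Min (lft a j Y) \<in> lft a j Y" using False by simp
    then have "a \<le> Min (lft a j Y)" "Min (lft a j Y) < j" unfolding lft_def by simp_all
    then have "transpose (Min (lft a j Y)) (Suc j) permutes {a..b}"
      using assms by (intro permutes_swap_id) auto
    then show ?thesis using False by (simp only: tmin_def if_False)
  qed (simp add: tmin_def permutes_id)
  have B: "tmax (rgtm j b Y) j permutes {a..b}"
  proof (cases "rgtm j b Y = {}")
    case False
    have "finite (rgtm j b Y)" by (simp add: rgtm_def)
    then have "Max (rgtm j b Y) \<in> rgtm j b Y" using False by simp
    then have "j + 2 \<le> Max (rgtm j b Y)" "Max (rgtm j b Y) \<le> b" unfolding rgtm_def by simp_all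
    then have "transpose j (Max (rgtm j b Y)) permutes {a..b}"
      using assms by (intro permutes_swap_id) auto
    then show ?thesis using False by (simp only: tmax_def if_False)
  qed (simp add: tmax_def permutes_id)
  have C: "adj j permutes {a..b}" using assms by (intro permutes_swap_id) auto
  show ?thesis using permutes_compose[OF B A] C permutes_id by (simp add: theta_def)
qed

lemma Cset_permutes:
  assumes "a \<le> j" "j < b" "t \<in> Cset a j b"
  shows "t permutes {a..b}"
  using assms unfolding Cset_def by (auto intro!: permutes_swap_id)

lemma Cset_moves: "t \<in> Cset a j b \<Longrightarrow> \<not> t permutes {1..j}"
proof
  assume t: "t \<in> Cset a j b" and p: "t permutes {1..j}"
  from t obtain c d where cd: "t = transpose c d" "c \<le> j" "j < d"
    unfolding Cset_def by force
  have "t d = d" using permutes_not_in[OF p, of d] cd by simp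
  then show False using cd by simp
qed

text \<open>For each separating index \<open>j\<close> the reflections crossing \<open>j\<close> are \<open>(m, j+1)\<close> with \<open>m \<ge> la j\<close> and
  \<open>(j, m)\<close> with \<open>m \<le> rb j\<close>; \<open>rg j\<close> is the side on which the factor of \<open>j\<close> is multiplied.  Lists of
  indices are decreasing.\<close>

primrec Op :: "(nat \<Rightarrow> nat) \<Rightarrow> (nat \<Rightarrow> nat) \<Rightarrow> (nat \<Rightarrow> bool) \<Rightarrow> nat list \<Rightarrow> hop" where
  "Op la rb rg [] = id"
| "Op la rb rg (j # js) =
     (if rg j then Op la rb rg js \<circ> TJ (la j) j (rb j) else TJ (la j) j (rb j) \<circ> Op la rb rg js)"

primrec Theta :: "(nat \<Rightarrow> nat) \<Rightarrow> (nat \<Rightarrow> nat) \<Rightarrow> (nat \<Rightarrow> bool) \<Rightarrow> nat list \<Rightarrow> perm set \<Rightarrow> perm" where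
  "Theta la rb rg [] Y = id"
| "Theta la rb rg (j # js) Y =
     (if rg j then Theta la rb rg js Y \<circ> theta (la j) j (rb j) Y
      else theta (la j) j (rb j) Y \<circ> Theta la rb rg js Y)"

definition Cs :: "(nat \<Rightarrow> nat) \<Rightarrow> (nat \<Rightarrow> nat) \<Rightarrow> nat list \<Rightarrow> perm set" where
  "Cs la rb js = (\<Union>j\<in>set js. Cset (la j) j (rb j))"

text \<open>The right end of the range of the largest index. The value 0 for the empty list ensures
  that the first index touches nothing.\<close>

definition bd :: "(nat \<Rightarrow> nat) \<Rightarrow> nat list \<Rightarrow> nat" where
  "bd rb js = (case js of [] \<Rightarrow> 0 | j # _ \<Rightarrow> rb j)"

lemma bd_simps [simp]: "bd rb [] = 0" "bd rb (j # js) = rb j"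
  by (simp_all add: bd_def)

definition expo :: "(nat \<Rightarrow> nat) \<Rightarrow> (nat \<Rightarrow> nat) \<Rightarrow> nat list \<Rightarrow> nat" where
  "expo la rb js = sum_list (map (\<lambda>j. rb j - la j) js)"

lemma expo_simps [simp]: "expo la rb [] = 0" "expo la rb (j # js) = expo la rb js + (rb j - la j)"
  by (simp_all add: expo_def)

text \<open>The hypotheses of the locale \<open>step\<close>, required of every index relative to
  the rest of the list.\<close>

primrec separated :: "nat \<Rightarrow> perm \<Rightarrow> (nat \<Rightarrow> nat) \<Rightarrow> (nat \<Rightarrow> nat) \<Rightarrow> (nat \<Rightarrow> bool) \<Rightarrow> nat list \<Rightarrow> bool" where
  "separated n v la rb rg [] \<longleftrightarrow> True"
| "separated n v la rb rg (j # js) \<longleftrightarrow> separated n v la rb rg js \<and>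
     1 \<le> la j \<and> la j \<le> j \<and> j < rb j \<and> rb j \<le> n \<and> bd rb js \<le> la j \<and>
     (\<forall>c. 1 \<le> c \<longrightarrow> c \<le> j \<longrightarrow> up v c (Suc j) \<longrightarrow> up (inv v) c (Suc j) \<longrightarrow> la j \<le> c) \<and>
     (\<forall>c. j < c \<longrightarrow> up v j c \<longrightarrow> up (inv v) j c \<longrightarrow> c \<le> rb j) \<and>
     \<not> (up v (j - 1) (j + 2) \<and> up (inv v) (j - 1) (j + 2)) \<and>
     (bd rb js < la j \<or> (\<exists>i. 1 \<le> i \<and> i < la j \<and>
        (if rg j then up (inv v) i (Suc j) \<and> \<not> up v i (Suc j)
         else up v i (Suc j) \<and> \<not> up (inv v) i (Suc j))))"

section \<open>Expansion and trace of the ordered product of hooks\<close>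

context
  fixes n :: nat and v :: perm and la rb :: "nat \<Rightarrow> nat" and rg :: "nat \<Rightarrow> bool"
begin

lemma separated_range:
  "separated n v la rb rg js \<Longrightarrow> i \<in> set js \<Longrightarrow> 1 \<le> i \<and> i < bd rb js \<and> rb i \<le> bd rb js \<and> la i \<le> i \<and> i < rb i \<and> 1 \<le> la i"
  by (induction js) force+

lemma Theta_permutes:
  "separated n v la rb rg js \<Longrightarrow> Theta la rb rg js Y permutes {1..bd rb js}"
proof (induction js)
  case Nil
  show "Theta la rb rg [] Y permutes {1..bd rb []}" unfolding Theta.simps by (rule permutes_id)
next
  case (Cons j js)
  have 1: "Theta la rb rg js Y permutes {1..rb j}"
    by (rule permutes_subset[of _ "{1..bd rb js}"]) (use Cons in auto)
  have 2: "theta (la j) j (rb j) Y permutes {1..rb j}"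
    by (rule permutes_subset[OF theta_permutes]) (use Cons in auto)
  show ?case using permutes_compose[OF 1 2] permutes_compose[OF 2 1] by simp
qed

lemma Cs_permutes:
  assumes "separated n v la rb rg js" "t \<in> Cs la rb js"
  shows "t permutes {1..bd rb js}"
proof -
  obtain i where i: "i \<in> set js" "t \<in> Cset (la i) i (rb i)" using assms(2) by (auto simp: Cs_def)
  note r = separated_range[OF assms(1) i(1)]
  show ?thesis by (rule permutes_subset[OF Cset_permutes[OF _ _ i(2)]]) (use r in auto)
qed

lemma Theta_cong:
  assumes "Y \<inter> Cs la rb js = Y' \<inter> Cs la rb js"
  shows "Theta la rb rg js Y = Theta la rb rg js Y'"
  using assms
proof (induction js)
  case (Cons j js)
  have "Y \<inter> Cs la rb js = Y' \<inter> Cs la rb js" "Y \<inter> Cset (la j) j (rb j) = Y' \<inter> Cset (la j) j (rb j)"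
    using Cons.prems by (auto simp: Cs_def)
  then have "Theta la rb rg js Y = Theta la rb rg js Y'" "theta (la j) j (rb j) Y = theta (la j) j (rb j) Y'"
    using Cons.IH theta_cong by blast+
  then show "Theta la rb rg (j # js) Y = Theta la rb rg (j # js) Y'" by (simp only: Theta.simps)
qed (simp only: Theta.simps)

text \<open>Ranges of different indices share at most one end letter. After the outer factor is
  expanded the argument is still increasing on the range of the inner one, so the single expansions
  can be nested.\<close>

lemma Op_eval:
  assumes "separated n v la rb rg js" "strict_mono_on {1..bd rb js} y"
  shows "qvar ^ expo la rb js * Op la rb rg js \<psi> y =
    (\<Sum>Y\<in>Pow (Cs la rb js). cq ^ card Y * \<psi> (y \<circ> Theta la rb rg js Y))"
  using assms
proof (induction js arbitrary: y \<psi>)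
  case Nil
  then show ?case by (simp add: Cs_def)
next
  case (Cons j js)
  let ?C = "Cset (la j) j (rb j)" and ?Cs = "Cs la rb js" and ?B = "bd rb js"
  let ?th = "theta (la j) j (rb j)" and ?Th = "Theta la rb rg js"
  have s: "separated n v la rb rg js" and r: "1 \<le> la j" "la j \<le> j" "j < rb j" "?B \<le> la j"
    using Cons.prems(1) by auto
  have mono: "y c < y d" if "1 \<le> c" "c < d" "d \<le> rb j" for c d
    using Cons.prems(2) that by (intro strict_mono_onD[of "{1..rb j}" y]) auto
  have ythp: "?th Y permutes {la j..rb j}" for Y by (rule theta_permutes[OF r(2,3)])
  have yThp: "?Th Y permutes {1..?B}" for Y by (rule Theta_permutes[OF s])
  have disj: "?Cs \<inter> ?C = {}"
  proof (rule ccontr)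
    assume "\<not> ?thesis"
    then obtain t where t: "t \<in> ?Cs" "t \<in> ?C" by blast
    have "t permutes {1..j}" by (rule permutes_subset[OF Cs_permutes[OF s t(1)]]) (use r in auto)
    then show False using Cset_moves[OF t(2)] by blast
  qed
  have fin: "finite ?Cs" "finite ?C" by (simp_all add: Cs_def finite_Cset)
  have cU: "card (Y1 \<union> Y2) = card Y1 + card Y2" if "Y1 \<in> Pow ?Cs" "Y2 \<in> Pow ?C" for Y1 Y2
    by (rule card_Un_disjoint) (use that disj fin finite_subset in blast)+
  have th: "?th (Y1 \<union> Y2) = ?th Y2" if "Y1 \<in> Pow ?Cs" "Y2 \<in> Pow ?C" for Y1 Y2
    by (rule theta_cong) (use that disj in blast)
  have Th: "?Th (Y1 \<union> Y2) = ?Th Y1" if "Y1 \<in> Pow ?Cs" "Y2 \<in> Pow ?C" for Y1 Y2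
    by (rule Theta_cong) (use that disj in blast)
  have CsC: "Cs la rb (j # js) = ?Cs \<union> ?C" by (auto simp: Cs_def)
  show ?case
  proof (cases "rg j")
    case True
    have y1: "strict_mono_on {1..?B} y" by (rule strict_mono_onI) (use r mono in auto)
    \<comment> \<open>Only the common letter \<open>?B = la j\<close> can be displaced, and only
      downwards.\<close>
    have y2: "strict_mono_on {la j..rb j} (y \<circ> ?Th Y)" for Y
    proof (rule strict_mono_onI)
      fix c d assume cd: "c \<in> {la j..rb j}" "d \<in> {la j..rb j}" "c < d"
      have d: "?Th Y d = d" using permutes_not_in[OF yThp, of d Y] cd r by simp
      have "1 \<le> ?Th Y c \<and> ?Th Y c \<le> c"
      proof (cases "c \<le> ?B")
        case True
        then have "c = ?B" "c \<in> {1..?B}" using cd r by auto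
        then show ?thesis using permutes_in_image[OF yThp, of Y c] by auto
      next
        case False
        then show ?thesis using permutes_not_in[OF yThp, of c Y] cd r by simp
      qed
      then show "(y \<circ> ?Th Y) c < (y \<circ> ?Th Y) d" using mono[of "?Th Y c" d] cd d by simp
    qed
    have "qvar ^ expo la rb (j # js) * Op la rb rg (j # js) \<psi> y =
        qvar ^ (rb j - la j) * (qvar ^ expo la rb js * Op la rb rg js (TJ (la j) j (rb j) \<psi>) y)"
      using True by (simp add: power_add mult.assoc mult.left_commute)
    also have "\<dots> = (\<Sum>Y1\<in>Pow ?Cs. cq ^ card Y1 * (qvar ^ (rb j - la j) * TJ (la j) j (rb j) \<psi> (y \<circ> ?Th Y1)))"
      unfolding Cons.IH[OF s y1] by (simp only: sum_distrib_left mult.left_commute)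
    also have "\<dots> = (\<Sum>Y1\<in>Pow ?Cs. \<Sum>Y2\<in>Pow ?C. cq ^ card (Y1 \<union> Y2) * \<psi> (y \<circ> Theta la rb rg (j # js) (Y1 \<union> Y2)))"
    proof (rule sum.cong[OF refl])
      fix Y1 assume Y1: "Y1 \<in> Pow ?Cs"
      have "cq ^ card Y1 * (qvar ^ (rb j - la j) * TJ (la j) j (rb j) \<psi> (y \<circ> ?Th Y1)) =
          (\<Sum>Y2\<in>Pow ?C. cq ^ card Y1 * (cq ^ card Y2 * \<psi> (y \<circ> ?Th Y1 \<circ> ?th Y2)))"
        by (simp only: TJ_eval[OF y2 r(2,3)] sum_distrib_left)
      also have "\<dots> = (\<Sum>Y2\<in>Pow ?C. cq ^ card (Y1 \<union> Y2) * \<psi> (y \<circ> Theta la rb rg (j # js) (Y1 \<union> Y2)))"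
        by (rule sum.cong[OF refl])
          (simp only: cU[OF Y1] th[OF Y1] Th[OF Y1] Theta.simps True if_True power_add mult.assoc comp_assoc)
      finally show "cq ^ card Y1 * (qvar ^ (rb j - la j) * TJ (la j) j (rb j) \<psi> (y \<circ> ?Th Y1)) =
          (\<Sum>Y2\<in>Pow ?C. cq ^ card (Y1 \<union> Y2) * \<psi> (y \<circ> Theta la rb rg (j # js) (Y1 \<union> Y2)))" .
    qed
    finally show ?thesis unfolding CsC sum_Pow_Un[OF disj] .
  next
    case False
    have y1: "strict_mono_on {la j..rb j} y" by (rule strict_mono_onI) (use r mono in auto)
    \<comment> \<open>In this order the common letter can only move upwards.\<close>
    have y2: "strict_mono_on {1..?B} (y \<circ> ?th Y)" for Y
    proof (rule strict_mono_onI)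
      fix c d assume cd: "c \<in> {1..?B}" "d \<in> {1..?B}" "c < d"
      have c: "?th Y c = c" using permutes_not_in[OF ythp, of c Y] cd r by simp
      have "d \<le> ?th Y d \<and> ?th Y d \<le> rb j"
      proof (cases "d < la j")
        case True
        then show ?thesis using permutes_not_in[OF ythp, of d Y] r by simp
      next
        case False
        then have "d = la j" "d \<in> {la j..rb j}" using cd r by auto
        then show ?thesis using permutes_in_image[OF ythp, of Y d] by auto
      qed
      then show "(y \<circ> ?th Y) c < (y \<circ> ?th Y) d" using mono[of c "?th Y d"] cd c by simp
    qed
    have "qvar ^ expo la rb (j # js) * Op la rb rg (j # js) \<psi> y =
        qvar ^ expo la rb js * (qvar ^ (rb j - la j) * TJ (la j) j (rb j) (Op la rb rg js \<psi>) y)"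
      using False by (simp add: power_add mult.assoc)
    also have "\<dots> = (\<Sum>Y2\<in>Pow ?C. cq ^ card Y2 * (qvar ^ expo la rb js * Op la rb rg js \<psi> (y \<circ> ?th Y2)))"
      unfolding TJ_eval[OF y1 r(2,3)] by (simp only: sum_distrib_left mult.left_commute)
    also have "\<dots> = (\<Sum>Y2\<in>Pow ?C. \<Sum>Y1\<in>Pow ?Cs. cq ^ card (Y1 \<union> Y2) * \<psi> (y \<circ> Theta la rb rg (j # js) (Y1 \<union> Y2)))"
    proof (rule sum.cong[OF refl])
      fix Y2 assume Y2: "Y2 \<in> Pow ?C"
      have "cq ^ card Y2 * (qvar ^ expo la rb js * Op la rb rg js \<psi> (y \<circ> ?th Y2)) =
          (\<Sum>Y1\<in>Pow ?Cs. cq ^ card Y2 * (cq ^ card Y1 * \<psi> (y \<circ> ?th Y2 \<circ> ?Th Y1)))"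
        by (simp only: Cons.IH[OF s y2] sum_distrib_left)
      also have "\<dots> = (\<Sum>Y1\<in>Pow ?Cs. cq ^ card (Y1 \<union> Y2) * \<psi> (y \<circ> Theta la rb rg (j # js) (Y1 \<union> Y2)))"
        by (rule sum.cong[OF refl])
          (simp only: cU[OF _ Y2] th[OF _ Y2] Th[OF _ Y2] Theta.simps False if_False power_add mult.assoc mult.left_commute comp_assoc)
      finally show "cq ^ card Y2 * (qvar ^ expo la rb js * Op la rb rg js \<psi> (y \<circ> ?th Y2)) =
          (\<Sum>Y1\<in>Pow ?Cs. cq ^ card (Y1 \<union> Y2) * \<psi> (y \<circ> Theta la rb rg (j # js) (Y1 \<union> Y2)))" .
    qed
    also have "\<dots> = (\<Sum>Y1\<in>Pow ?Cs. \<Sum>Y2\<in>Pow ?C. cq ^ card (Y1 \<union> Y2) * \<psi> (y \<circ> Theta la rb rg (j # js) (Y1 \<union> Y2)))"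
      by (rule sum.swap)
    finally show ?thesis unfolding CsC sum_Pow_Un[OF disj] .
  qed
qed

lemma Op_trace:
  assumes "separated n v la rb rg js"
  shows "Op la rb rg js \<in> mon {1..<bd rb js} \<and> (\<forall>w. bruhat_le n w v \<longrightarrow>
    qvar ^ expo la rb js * tr (Op la rb rg js \<circ> W n w) =
      (if \<forall>i\<in>set js. \<not> up w i (Suc i) then tr (W n w) else 0))"
  using assms
proof (induction js)
  case Nil
  have "Op la rb rg [] \<in> mon {1..<bd rb []}" unfolding Op.simps by (rule mon_id)
  then show "Op la rb rg [] \<in> mon {1..<bd rb []} \<and> (\<forall>w. bruhat_le n w v \<longrightarrow>
    qvar ^ expo la rb [] * tr (Op la rb rg [] \<circ> W n w) =
      (if \<forall>i\<in>set []. \<not> up w i (Suc i) then tr (W n w) else 0))"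
    by (simp only: Op.simps expo_simps power_0 mult_1_left id_comp set_simps(1) ball_simps if_True simp_thms list.set(1) empty_iff)
next
  case (Cons j js)
  have s: "separated n v la rb rg js" using Cons.prems by simp
  note IH = Cons.IH[OF s]
  interpret step n v j "la j" "rb j" "bd rb js" "expo la rb js" "set js" "Op la rb rg js" "rg j"
  proof
    show "set js \<subseteq> {1..<j}" using separated_range[OF s] Cons.prems by fastforce
    show "qvar ^ expo la rb js * tr (Op la rb rg js \<circ> W n w) =
      (if \<forall>i\<in>set js. \<not> up w i (Suc i) then tr (W n w) else 0)" if "bruhat_le n w v" for w
      using IH that by blast
    show "Op la rb rg js \<in> mon {1..<bd rb js}" using IH by blast
  qed (use Cons.prems in auto)
  have m: "Op la rb rg (j # js) \<in> mon {1..<bd rb (j # js)}"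
    using opr_mon by simp
  have t: "qvar ^ expo la rb (j # js) * tr (Op la rb rg (j # js) \<circ> W n w) =
      (if \<forall>i\<in>set (j # js). \<not> up w i (Suc i) then tr (W n w) else 0)" if "bruhat_le n w v" for w
    using step_trace[OF that] by simp
  show ?case using m t by blast
qed

text \<open>Evaluation of the expansion at \<open>id\<close> identifies the sum with the trace of
  the ordered product against \<open>T_w\<close>.\<close>

lemma Theta_sum_zero:
  assumes "separated n v la rb rg js" "bruhat_le n w v" "i \<in> set js" "up w i (Suc i)"
  shows "(\<Sum>Y\<in>Pow (Cs la rb js). cq ^ card Y * W n w delta (Theta la rb rg js Y)) = 0"
proof -
  have "(\<Sum>Y\<in>Pow (Cs la rb js). cq ^ card Y * W n w delta (id \<circ> Theta la rb rg js Y)) =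
      qvar ^ expo la rb js * Op la rb rg js (W n w delta) id"
    by (rule Op_eval[OF assms(1), symmetric]) (simp add: strict_mono_onI)
  also have "\<dots> = qvar ^ expo la rb js * tr (Op la rb rg js \<circ> W n w)" by (simp add: tr_def)
  also have "\<dots> = 0" using Op_trace[OF assms(1)] assms(2-4) by auto
  finally show ?thesis by simp
qed

end

text \<open>Rescaling by \<open>q^l(y)\<close> exchanges the normalizations \<open>(1, q)\<close>
  and \<open>(q, 1)\<close> of the generators.\<close>

lemma W_delta_eq:
  assumes "w \<in> Sym n" "y \<in> Sym n"
  shows "W n w delta y = qvar ^ ninv n y * eval_at (Rp n y w) qvar"
  using assms
proof (induction arbitrary: y rule: Sym_induct)
  case id
  have "Rp n y id = (if y = id then 1 else 0)"
    using id id_Sym by (simp only: Rp_def delta_def hopw_id id_apply simp_thms if_True)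
  then show "W n id delta y = qvar ^ ninv n y * eval_at (Rp n y id) qvar"
    by (cases "y = id") (simp_all only: hopw_id id_apply delta_def if_True if_False ninv_id eval_at_0 eval_at_1, simp_all)
next
  case (descent w i)
  let ?y = "y \<circ> adj i" and ?w = "w \<circ> adj i"
  note y = descent.prems and i = descent(2)
  have y': "?y \<in> Sym n" by (rule comp_Sym[OF y adj_Sym[OF i]])
  have IH: "W n ?w delta x = qvar ^ ninv n x * eval_at (Rp n x ?w) qvar" if "x \<in> Sym n" for x
    by (rule descent.IH[OF that])
  have e: "W n w delta y = T i (W n ?w delta) y" by (simp only: hopw_descent[OF descent(1-3)] comp_apply)
  consider "y (Suc i) < y i" "ninv n y = Suc (ninv n ?y)" | "y i < y (Suc i)" "ninv n ?y = Suc (ninv n y)"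
    using ninv_adj_cases[OF y i] by blast
  then show ?case
  proof cases
    case 1
    show ?thesis
      unfolding e T_down[OF 1(1)] IH[OF y'] Rp_right(1)[OF y descent(1-3) 1(1)] 1(2) by (simp add: mult.assoc)
  next
    case 2
    show ?thesis
      unfolding e T_up[OF 2(1)] IH[OF y'] IH[OF y] Rp_right(2)[OF y descent(1-3) 2(1)] 2(2)
      by (simp add: algebra_simps)
  qed
qed

section \<open>Products of two transpositions\<close>

definition transp :: "perm \<Rightarrow> bool" where
  "transp r \<longleftrightarrow> (\<exists>a b. a \<noteq> b \<and> r = transpose a b)"

lemma transpI: "a \<noteq> b \<Longrightarrow> transp (transpose a b)"
  by (auto simp: transp_def)

lemma transp_self: "transp r \<Longrightarrow> r \<circ> r = id"
  by (auto simp: transp_def)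

lemma transp_eq:
  assumes "transp r" "r e \<noteq> e"
  shows "r = transpose e (r e)"
proof -
  obtain a b where ab: "r = transpose a b" using assms(1) by (auto simp: transp_def)
  then have "e = a \<or> e = b" using assms(2) transpose_apply_other by metis
  then show ?thesis using ab by (auto simp: transpose_commute)
qed

lemma transp_eqI:
  assumes "transp r" "transp r'" "r e \<noteq> e" "r' e = r e"
  shows "r' = r"
proof -
  have "r' e \<noteq> e" using assms(3,4) by simp
  from transp_eq[OF assms(2) this] have "r' = transpose e (r e)" unfolding assms(4) .
  also have "\<dots> = r" by (rule transp_eq[OF assms(1,3), symmetric])
  finally show ?thesis .
qed

lemma transp_moved:
  assumes "transp r" "transp s" "s \<circ> r \<noteq> id" "r e \<noteq> e \<or> s e \<noteq> e"
  shows "(s \<circ> r) e \<noteq> e"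
proof
  assume f: "(s \<circ> r) e = e"
  have ss: "s (s k) = k" for k using transp_self[OF assms(2)] by (simp add: fun_eq_iff)
  have "s e = r e" using f ss[of "r e"] by simp
  then have "s = r" using assms(1,2,4) transp_eqI[of r s e] by metis
  then show False using assms(2,3) transp_self by simp
qed

text \<open>Transpositions that agree at one moved letter are equal.\<close>

lemma transp_fixed_collapse:
  assumes "transp r" "transp r'" "r \<circ> h = r'" "r e \<noteq> e" "h e = e"
  shows "h = id"
proof -
  have "r' e = r e" using assms(5) by (simp flip: assms(3))
  then have "r' = r" using transp_eqI[OF assms(1,2,4)] by simp
  then have "r \<circ> (r \<circ> h) = r \<circ> r" using assms(3) by simp
  then show ?thesis using transp_self[OF assms(1)] by (simp add: comp_assoc[symmetric])
qed

text \<open>The product is an involution, so a factor \<open>(e f)\<close> must carry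
  \<open>e\<close> to its image under the product; otherwise applying the product twice would lead
  from \<open>e\<close> to \<open>f\<close>.\<close>

lemma double_transp_factor:
  assumes d: "a \<noteq> b" "c \<noteq> d" "a \<noteq> c" "a \<noteq> d" "b \<noteq> c" "b \<noteq> d"
    and r: "transp r" "transp s" "s \<circ> r = transpose a b \<circ> transpose c d"
  shows "r = transpose a b \<or> r = transpose c d"
proof -
  let ?u = "transpose a b \<circ> transpose c d"
  have ss: "s (s k) = k" "r (r k) = k" for k
    using transp_self[OF r(2)] transp_self[OF r(1)] by (simp_all add: fun_eq_iff)
  obtain e f where ef: "e \<noteq> f" "r = transpose e f" using r(1) by (auto simp: transp_def)
  have ne: "?u \<noteq> id"
  proof
    assume "?u = id"
    then have "?u a = a" by simp
    then show False using d by simp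
  qed
  have "?u e \<noteq> e" using transp_moved[OF r(1,2)] ne r(3) ef by (metis transpose_apply_first)
  then have e: "e \<in> {a, b, c, d}" by (auto simp: transpose_def split: if_splits)
  have ue: "?u (?u e) = e" "?u e \<noteq> e" using e d by auto
  have uu: "?u k = s (r k)" for k using r(3) by (metis comp_apply)
  have 1: "?u e = s f" using uu[of e] ef by simp
  have 2: "?u f = s e" using uu[of f] ef by simp
  show ?thesis
  proof (cases "?u e = f")
    case True
    then show ?thesis using e d ef by (auto simp: transpose_commute)
  next
    case False
    let ?g = "?u e"
    have sf: "s f = ?g" "s ?g = f" using 1 ss(1)[of f] by simp_all
    have "r ?g = ?g" using False ue(2) ef by (simp add: transpose_apply_other)
    then have "?u ?g = f" using uu[of ?g] sf by simp
    then have "f = e" using ue by simp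
    then show ?thesis using ef by simp
  qed
qed

text \<open>If \<open>r\<close> and \<open>t\<close> are disjoint, the factors of \<open>g\<close>
  are forced. Otherwise \<open>g\<close> is a 3-cycle, and \<open>t'\<close> is one of the
  transpositions of its three letters; apart from \<open>t\<close>, both choices give one of the two
  orders.\<close>

lemma two_transp_factor:
  assumes t: "transp t" "transp t'" "t \<noteq> t'" and r: "transp r" "transp r'"
    and g: "g = r \<circ> t" "g = r' \<circ> t'" "g \<noteq> id"
  shows "g = t \<circ> t' \<or> g = t' \<circ> t"
proof -
  obtain a b where ab: "a \<noteq> b" "t = transpose a b" using t(1) by (auto simp: transp_def)
  obtain p q where pq: "p \<noteq> q" "r = transpose p q" using r(1) by (auto simp: transp_def)
  show ?thesis
  proof (cases "p \<noteq> a \<and> p \<noteq> b \<and> q \<noteq> a \<and> q \<noteq> b")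
    case True
    then have "t' = transpose p q \<or> t' = transpose a b"
      using double_transp_factor[OF pq(1) ab(1) _ _ _ _ t(2) r(2)] g ab pq by metis
    then show ?thesis using g(1) ab pq t(3) by auto
  next
    case False
    have *: ?thesis if x: "x \<noteq> y" "e \<noteq> x" "t = transpose x y" "r = transpose x e" for x y e
    proof -
      have ey: "e \<noteq> y" using that g(1,3) by auto
      have g': "g x = y" "g y = e" "g e = x" using that ey g(1) by auto
      have gf: "g k = k" if "k \<notin> {x, y, e}" for k
        using that x g(1) by (simp add: transpose_apply_other)
      obtain c d where cd: "c \<noteq> d" "t' = transpose c d" using t(2) by (auto simp: transp_def)
      have "g c \<noteq> c" "g d \<noteq> d" using transp_moved[OF t(2) r(2)] g cd by (metis transpose_apply_first transpose_apply_second)+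
      then have "c \<in> {x, y, e}" "d \<in> {x, y, e}" using gf by blast+
      then consider "t' = transpose x y" | "t' = transpose x e" | "t' = transpose y e"
        using cd by (auto simp: transpose_commute)
      then show ?thesis
      proof cases
        case 1
        then show ?thesis using t(3) x by simp
      next
        case 2
        then show ?thesis using g(1) x by simp
      next
        case 3
        have "g = t \<circ> t'"
          unfolding g(1) x(3,4) 3 using x(1,2) ey by (auto simp: fun_eq_iff transpose_def)
        then show ?thesis ..
      qed
    qed
    consider "p = a" | "p = b" | "q = a" | "q = b" using False by blast
    then show ?thesis
    proof cases
      case 1
      then show ?thesis using *[of a b q] ab pq by auto
    next
      case 2
      then show ?thesis using *[of b a q] ab pq by (auto simp: transpose_commute)
    next
      case 3
      then show ?thesis using *[of a b p] ab pq by (auto simp: transpose_commute)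
    next
      case 4
      then show ?thesis using *[of b a p] ab pq by (auto simp: transpose_commute)
    qed
  qed
qed

section \<open>Hypercubes as functions on finite sets\<close>

text \<open>A hypercube indexed by sets of its own atoms instead of sets of numbers, so that cubes
  over the same antichain can be compared vertex by vertex.\<close>

definition cube_on :: "nat \<Rightarrow> perm \<Rightarrow> perm set \<Rightarrow> (perm set \<Rightarrow> perm) \<Rightarrow> bool" where
  "cube_on n v M g \<longleftrightarrow> finite M \<and> inj_on g (Pow M) \<and> (\<forall>X. X \<subseteq> M \<longrightarrow> bruhat_le n (g X) v) \<and>
     (\<forall>X y. X \<subseteq> M \<longrightarrow> y \<in> M - X \<longrightarrow> (g X, g (insert y X)) \<in> bruhat_graph n) \<and> (\<forall>y\<in>M. g {y} = y)"

lemma cube_onD: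
  assumes "cube_on n v M g"
  shows "finite M" "inj_on g (Pow M)" "\<And>X. X \<subseteq> M \<Longrightarrow> bruhat_le n (g X) v"
    "\<And>X y. X \<subseteq> M \<Longrightarrow> y \<in> M \<Longrightarrow> y \<notin> X \<Longrightarrow> (g X, g (insert y X)) \<in> bruhat_graph n"
    "\<And>y. y \<in> M \<Longrightarrow> g {y} = y"
  using assms by (auto simp: cube_on_def)

lemma interval_id: "bruhat_interval n id v = {x. bruhat_le n x v}"
  by (auto simp: bruhat_interval_def dest: bruhat_le_Sym(1) intro!: bruhat_id_le)

lemma spanned_hypercube_cube_on:
  assumes "spanned_hypercube n id v x Y t H"
  shows "\<exists>g. cube_on n v Y g \<and> g {} = x \<and> g Y = t"
proof -
  obtain m f where h: "hypercube_in n id v m H" and c: "cube_iso m f H" and x: "f {} = x"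
    and t: "f {..<m} = t" and Y: "Y = {y. (x, y) \<in> snd H}"
    using assms by (auto simp: spanned_hypercube_def)
  have inj: "inj_on f (Pow {..<m})" and V: "fst H = f ` Pow {..<m}"
    and E: "snd H = {(f X, f (insert a X)) | X a. X \<subseteq> {..<m} \<and> a \<in> {..<m} - X}"
    using c by (auto simp: cube_iso_def bij_betw_def)
  have sub: "fst H \<subseteq> {x. bruhat_le n x v}" "snd H \<subseteq> bruhat_graph n"
    using h by (auto simp: hypercube_in_def interval_id interval_graph_def)
  have Y': "Y = (\<lambda>a. f {a}) ` {..<m}"
  proof (intro set_eqI iffI)
    fix y assume "y \<in> Y"
    then obtain X a where Xa: "x = f X" "y = f (insert a X)" "X \<subseteq> {..<m}" "a \<in> {..<m}" using Y E by auto
    have "X = {}" by (rule inj_onD[OF inj]) (use Xa x in auto)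
    then show "y \<in> (\<lambda>a. f {a}) ` {..<m}" using Xa by auto
  next
    fix y assume "y \<in> (\<lambda>a. f {a}) ` {..<m}"
    then obtain a where "a < m" "y = f {a}" by auto
    then have "(f {}, y) \<in> snd H" unfolding E by blast
    then show "y \<in> Y" using Y x by simp
  qed
  \<comment> \<open>Translates a set of atoms back into the numbers that index them in
    \<open>f\<close>.\<close>
  define P where "P = (\<lambda>X. {a. a < m \<and> f {a} \<in> X})"
  define g where "g = (\<lambda>X. f (P X))"
  have inj1: "f {a} = f {b} \<longleftrightarrow> a = b" if "a < m" "b < m" for a b
  proof
    assume "f {a} = f {b}"
    then have "{a} = {b}" by (rule inj_onD[OF inj]) (use that in auto)
    then show "a = b" by simp
  qed simp
  have Psub: "P X \<subseteq> {..<m}" for X by (auto simp: P_def)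
  have P1: "P {f {a}} = {a}" if "a < m" for a using inj1 that by (auto simp: P_def)
  have "inj_on g (Pow Y)"
  proof (rule inj_onI)
    fix A B assume AB: "A \<in> Pow Y" "B \<in> Pow Y" "g A = g B"
    have "P A = P B" by (rule inj_onD[OF inj]) (use AB Psub in \<open>auto simp: g_def\<close>)
    then have "(\<lambda>a. f {a}) ` P A = (\<lambda>a. f {a}) ` P B" by simp
    moreover have "(\<lambda>a. f {a}) ` P X = X" if "X \<in> Pow Y" for X using that Y' by (auto simp: P_def)
    ultimately show "A = B" using AB by metis
  qed
  moreover have "bruhat_le n (g X) v" for X
    using sub(1) V Psub[of X] unfolding g_def by blast
  moreover have "(g X, g (insert y X)) \<in> bruhat_graph n" if "X \<subseteq> Y" "y \<in> Y - X" for X y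
  proof -
    have "y \<in> (\<lambda>a. f {a}) ` {..<m}" using that(2) unfolding Y'[symmetric] by blast
    then obtain a where a: "a < m" "y = f {a}" by auto
    have "P (insert y X) = insert a (P X)" using a inj1 by (auto simp: P_def)
    moreover have "a \<notin> P X" using that a by (auto simp: P_def)
    ultimately have "(g X, g (insert y X)) \<in> snd H" unfolding g_def E using Psub[of X] a by auto
    then show ?thesis using sub(2) by blast
  qed
  moreover have "g {y} = y" if "y \<in> Y" for y using that Y' P1 by (auto simp: g_def)
  moreover have "finite Y" using Y' by simp
  moreover have "P {} = {}" by (simp add: P_def)
  moreover have "P Y = {..<m}" using Y' by (auto simp: P_def)
  ultimately show ?thesis using x t unfolding cube_on_def g_def by metis
qed

lemma diamond_spanned:
  assumes e: "(x, y) \<in> bruhat_graph n" "(x, y') \<in> bruhat_graph n"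
    "(y, z) \<in> bruhat_graph n" "(y', z) \<in> bruhat_graph n" and ne: "y \<noteq> y'" and z: "bruhat_le n z v"
  shows "\<exists>H. spanned_hypercube n id v x {y, y'} z H \<and> diamond_in n id v H \<and> fst H = {x, y, y', z}"
proof -
  define f where "f = (\<lambda>X :: nat set. if 0 \<in> X then (if 1 \<in> X then z else y) else (if 1 \<in> X then y' else x))"
  define E where "E = {(f X, f (insert a X)) | X a. X \<subseteq> {..<2} \<and> a \<in> {..<2} - X}"
  have two: "{..<2::nat} = {0, 1}" by auto
  have P: "Pow {..<2::nat} = {{}, {0}, {1}, {0, 1}}" unfolding two by (auto simp: Pow_insert)
  have ff: "f {} = x" "f {0} = y" "f {1} = y'" "f {0, 1} = z" by (simp_all add: f_def)
  have l: "ninv n x < ninv n y" "ninv n x < ninv n y'" "ninv n y < ninv n z" "ninv n y' < ninv n z"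
    using e bruhat_edge_less by blast+
  have dist: "x \<noteq> y" "x \<noteq> y'" "x \<noteq> z" "y \<noteq> z" "y' \<noteq> z" using l by auto
  have V: "f ` Pow {..<2} = {x, y, y', z}" unfolding P image_insert image_empty ff by blast
  have inj: "inj_on f (Pow {..<2})" unfolding P inj_on_def using dist ne by (auto simp: f_def)
  have E': "E = {(x, y), (x, y'), (y, z), (y', z)}"
  proof
    show "E \<subseteq> {(x, y), (x, y'), (y, z), (y', z)}"
    proof
      fix p assume "p \<in> E"
      then obtain X a where Xa: "p = (f X, f (insert a X))" "X \<in> Pow {..<2}" "a \<in> {..<2} - X"
        unfolding E_def by blast
      then have "X = {} \<or> X = {0} \<or> X = {1} \<or> X = {0, 1}" unfolding P by blast
      moreover have "a = 0 \<or> a = 1" using Xa(3) by auto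
      ultimately show "p \<in> {(x, y), (x, y'), (y, z), (y', z)}" using Xa by (auto simp: f_def)
    qed
    have mem: "(f X, f (insert a X)) \<in> E" if "X \<subseteq> {..<2}" "a \<in> {..<2} - X" for X a
      unfolding E_def using that by blast
    have "(f {}, f (insert 0 {})) \<in> E" "(f {}, f (insert 1 {})) \<in> E"
      "(f {0}, f (insert 1 {0})) \<in> E" "(f {1}, f (insert 0 {1})) \<in> E"
      by (rule mem; simp)+
    then show "{(x, y), (x, y'), (y, z), (y', z)} \<subseteq> E" by (simp add: f_def)
  qed
  have le: "bruhat_le n y v" "bruhat_le n y' v" "bruhat_le n x v"
    using e z bruhat_edge_le bruhat_trans by metis+
  have h: "hypercube_in n id v 2 (f ` Pow {..<2}, E)"
    unfolding hypercube_in_def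
  proof (intro conjI exI)
    show "fst (f ` Pow {..<2}, E) \<subseteq> bruhat_interval n id v"
      unfolding fst_conv V interval_id using le z by simp
    show "snd (f ` Pow {..<2}, E) \<subseteq> interval_graph n id v"
      unfolding snd_conv E' interval_graph_def interval_id using le z e by simp
    show "cube_iso 2 f (f ` Pow {..<2}, E)"
      unfolding cube_iso_def fst_conv snd_conv using inj by (simp add: bij_betw_def E_def)
  qed
  have "spanned_hypercube n id v x {y, y'} z (f ` Pow {..<2}, E)"
    unfolding spanned_hypercube_def
  proof (intro exI conjI)
    show "hypercube_in n id v 2 (f ` Pow {..<2}, E)" by (rule h)
    show "cube_iso 2 f (f ` Pow {..<2}, E)"
      unfolding cube_iso_def fst_conv snd_conv using inj by (simp add: bij_betw_def E_def)
    show "f {} = x" by (rule ff)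
    show "f {..<2} = z" unfolding two by (rule ff)
    show "{y, y'} = {y'. (x, y') \<in> snd (f ` Pow {..<2}, E)}"
      unfolding snd_conv E' using dist by auto
  qed
  then show ?thesis using h V by (metis fst_conv)
qed

lemma edge_transp:
  assumes "(x, y) \<in> bruhat_graph n"
  shows "\<exists>r. transp r \<and> y = r \<circ> x \<and> r = y \<circ> inv x"
proof -
  obtain c d where x: "x \<in> Sym n" and cd: "c < d" "y = transpose c d \<circ> x"
    using bruhat_edge_leftE[OF assms] by metis
  have "y \<circ> inv x = transpose c d"
    using cd permutes_inv_o(1)[of x] x by (simp add: comp_assoc)
  then show ?thesis using cd transpI[of c d] by auto
qed

text \<open>The two paths to the join of two atoms write its label as a product of two
  transpositions in two ways, which leaves only the two orders of the atoms.\<close>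

lemma cube_pair:
  assumes g: "cube_on n v M g" "t \<circ> x \<in> M" "t' \<circ> x \<in> M" "g {} = x" and t: "transp t" "transp t'" "t \<noteq> t'"
    and x: "x \<in> Sym n"
  shows "g {t \<circ> x, t' \<circ> x} = t \<circ> t' \<circ> x \<or> g {t \<circ> x, t' \<circ> x} = t' \<circ> t \<circ> x"
proof -
  let ?z = "g {t \<circ> x, t' \<circ> x}"
  have xx: "s \<circ> x \<circ> inv x = s" for s using permutes_inv_o(1)[of x] x by (simp add: comp_assoc)
  have xx': "s \<circ> inv x \<circ> x = s" for s using permutes_inv_o(2)[of x] x by (simp add: comp_assoc)
  have ne: "t \<circ> x \<noteq> t' \<circ> x" using xx t(3) by metis
  note c = cube_onD[OF g(1)]
  have "(g {t' \<circ> x}, g (insert (t \<circ> x) {t' \<circ> x})) \<in> bruhat_graph n"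
    by (rule c(4)) (use g ne in auto)
  then have "(t' \<circ> x, ?z) \<in> bruhat_graph n" by (simp only: c(5)[OF g(3)])
  then obtain r' where r': "transp r'" "?z = r' \<circ> (t' \<circ> x)" using edge_transp by blast
  have "(g {t \<circ> x}, g (insert (t' \<circ> x) {t \<circ> x})) \<in> bruhat_graph n"
    by (rule c(4)) (use g ne in auto)
  moreover have "{t' \<circ> x, t \<circ> x} = {t \<circ> x, t' \<circ> x}" by blast
  ultimately have "(t \<circ> x, ?z) \<in> bruhat_graph n" by (simp only: c(5)[OF g(2)])
  then obtain r where r: "transp r" "?z = r \<circ> (t \<circ> x)" using edge_transp by blast
  have "?z \<noteq> g {}"
  proof
    assume "?z = g {}"
    then have "{t \<circ> x, t' \<circ> x} = {}" by (rule inj_onD[OF c(2)]) (use g in auto)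
    then show False by simp
  qed
  then have n: "?z \<circ> inv x \<noteq> id" using g(4) xx'[of ?z] by (metis id_comp)
  have "?z \<circ> inv x = r \<circ> t" using r(2) xx[of "r \<circ> t"] by (simp only: comp_assoc)
  moreover have "?z \<circ> inv x = r' \<circ> t'" using r'(2) xx[of "r' \<circ> t'"] by (simp only: comp_assoc)
  ultimately
  have "?z \<circ> inv x = t \<circ> t' \<or> ?z \<circ> inv x = t' \<circ> t"
    using two_transp_factor[OF t r(1) r'(1) _ _ n] by blast
  then show ?thesis using xx'[of ?z] by metis
qed

section \<open>Hypercube decompositions of lower intervals\<close>

lemma up_transpose: "1 \<le> a \<Longrightarrow> up (transpose a b) a b"
  by (rule upI[of a]) auto

text \<open>For \<open>p < q\<close> the ranks of a transposition are 0 or 1, so the rank criterion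
  asks for a single covering arc in each direction.\<close>

lemma transpose_le_iff:
  assumes w: "w \<in> Sym n" and ab: "1 \<le> a" "a < b" "b \<le> n"
  shows "bruhat_le n (transpose a b) w \<longleftrightarrow> up w a b \<and> up (inv w) a b"
proof
  assume "bruhat_le n (transpose a b) w"
  then show "up w a b \<and> up (inv w) a b"
    using up_mono dn_mono up_transpose[OF ab(1)] by (metis inv_transpose_eq)
next
  assume u: "up w a b \<and> up (inv w) a b"
  have rk1: "rk (transpose a b) p q \<le> rk w' p q" if "up w' a b" "p < q" for w' p q
  proof (cases "a \<le> p \<and> q \<le> b")
    case True
    have "{k. 1 \<le> k \<and> k \<le> p \<and> q \<le> transpose a b k} \<subseteq> {a}"
      using ab that(2) by (auto simp: transpose_def split: if_splits)
    then have "rk (transpose a b) p q \<le> card {a}" unfolding rk_def by (intro card_mono) auto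
    moreover have "1 \<le> rk w' p q" using up_weaken[OF that(1)] True by (simp only: up_rk[symmetric])
    ultimately show ?thesis by simp
  next
    case False
    have "{k. 1 \<le> k \<and> k \<le> p \<and> q \<le> transpose a b k} = {}"
      using ab that(2) False by (auto simp: transpose_def split: if_splits)
    then show ?thesis by (simp only: rk_def card.empty)
  qed
  show "bruhat_le n (transpose a b) w"
    by (rule bruhat_leI) (use transpose_Sym w ab u rk1 in auto)
qed

text \<open>As many points cross \<open>i\<close> upwards as downwards.\<close>

lemma up_inv_Suc:
  assumes w: "w \<in> Sym n"
  shows "up (inv w) i (Suc i) \<longleftrightarrow> up w i (Suc i)"
  using rk_inv[OF w, of "Suc i" i] by (simp add: up_rk)

lemma transpose_le_transpose:
  assumes "1 \<le> c" "c \<le> a" "a < b" "b \<le> d" "d \<le> n"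
  shows "bruhat_le n (transpose a b) (transpose c d)"
  using assms transpose_Sym[of c n d] up_transpose[of c d]
  by (subst transpose_le_iff) (auto intro: up_weaken)

lemma incomparable_up: "up y a b \<Longrightarrow> \<not> up y' a b \<Longrightarrow> \<not> bruhat_le n y y'"
  using up_mono by blast

lemma incomparable_dn: "up (inv y) a b \<Longrightarrow> \<not> up (inv y') a b \<Longrightarrow> \<not> bruhat_le n y y'"
  using dn_mono by blast

lemma dn_iff:
  assumes "w \<in> Sym n"
  shows "up (inv w) a b \<longleftrightarrow> (\<exists>m. b \<le> m \<and> 1 \<le> w m \<and> w m \<le> a)"
  unfolding up_def using Sym_inv_apply[OF assms] by metis

lemma inv_eqI: "w \<in> Sym n \<Longrightarrow> w a = b \<Longrightarrow> inv w b = a"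
  using Sym_inv_apply(1) by blast

text \<open>The faces over \<open>t1, t2\<close> and \<open>t1, t3\<close> have distinct tops
  \<open>z\<close> and \<open>z'\<close> below a common vertex \<open>T\<close>. These tops agree at
  letters outside \<open>S\<close>, so an edge label from \<open>z\<close> moving such a letter
  would force \<open>z = z'\<close>. Hence the label transposes two letters of \<open>S\<close>,
  which can be enumerated.\<close>

lemma cube_triple:
  assumes g: "cube_on n v M g" "g {} = x" "x \<in> Sym n"
    and M: "t1 \<circ> x \<in> M" "t2 \<circ> x \<in> M" "t3 \<circ> x \<in> M"
    and t: "transp t1" "transp t2" "transp t3" "t1 \<noteq> t2" "t1 \<noteq> t3" "t2 \<noteq> t3"
    and S: "\<And>e. e \<notin> S \<Longrightarrow> t1 e = e \<and> t2 e = e \<and> t3 e = e"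
  shows "\<exists>z c d. (z = t1 \<circ> t2 \<circ> x \<or> z = t2 \<circ> t1 \<circ> x) \<and> bruhat_le n z v \<and> c \<in> S \<and> d \<in> S \<and> c < d \<and>
    inv z c < inv z d \<and> bruhat_le n (transpose c d \<circ> z) v"
proof -
  note cD = cube_onD[OF g(1)]
  have xx: "s \<circ> x \<circ> inv x = s" for s using permutes_inv_o(1)[of x] g(3) by (simp add: comp_assoc)
  have ne: "t1 \<circ> x \<noteq> t2 \<circ> x" "t1 \<circ> x \<noteq> t3 \<circ> x" "t2 \<circ> x \<noteq> t3 \<circ> x" using xx t(4-6) by metis+
  define z where "z = g {t1 \<circ> x, t2 \<circ> x}"
  define z' where "z' = g {t1 \<circ> x, t3 \<circ> x}"
  define T where "T = g {t1 \<circ> x, t2 \<circ> x, t3 \<circ> x}"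
  have z: "z = t1 \<circ> t2 \<circ> x \<or> z = t2 \<circ> t1 \<circ> x"
    unfolding z_def by (rule cube_pair[OF g(1) M(1,2) g(2) t(1,2,4) g(3)])
  have z': "z' = t1 \<circ> t3 \<circ> x \<or> z' = t3 \<circ> t1 \<circ> x"
    unfolding z'_def by (rule cube_pair[OF g(1) M(1,3) g(2) t(1,3,5) g(3)])
  have "z \<noteq> z'"
  proof
    assume "z = z'"
    then have "{t1 \<circ> x, t2 \<circ> x} = {t1 \<circ> x, t3 \<circ> x}"
      unfolding z_def z'_def by (rule inj_onD[OF cD(2)]) (use M in auto)
    then have "t2 \<circ> x \<in> {t1 \<circ> x, t3 \<circ> x}" by blast
    then show False using ne by (simp only: insert_iff empty_iff) metis
  qed
  have "insert (t3 \<circ> x) {t1 \<circ> x, t2 \<circ> x} = {t1 \<circ> x, t2 \<circ> x, t3 \<circ> x}"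
    "insert (t2 \<circ> x) {t1 \<circ> x, t3 \<circ> x} = {t1 \<circ> x, t2 \<circ> x, t3 \<circ> x}" by blast+
  then have e: "(z, T) \<in> bruhat_graph n" "(z', T) \<in> bruhat_graph n"
    using cD(4)[of "{t1 \<circ> x, t2 \<circ> x}" "t3 \<circ> x"] cD(4)[of "{t1 \<circ> x, t3 \<circ> x}" "t2 \<circ> x"] M ne
    unfolding z_def z'_def T_def by auto
  obtain c d where cd: "z \<in> Sym n" "c < d" "inv z c < inv z d" "T = transpose c d \<circ> z"
    using bruhat_edge_leftE[OF e(1)] by metis
  obtain r' where r': "transp r'" "T = r' \<circ> z'" using edge_transp[OF e(2)] by blast
  have z'n: "z' \<in> Sym n" using e(2) by (auto simp: bruhat_graph_def)
  define h where "h = z \<circ> inv z'"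
  have "transpose c d \<circ> h = r'"
  proof -
    have "transpose c d \<circ> h = (r' \<circ> z') \<circ> inv z'" unfolding h_def using cd(4) r'(2) by (simp only: comp_assoc)
    also have "\<dots> = r'" using permutes_inv_o(1)[of z'] z'n by (simp add: comp_assoc)
    finally show ?thesis .
  qed
  have hid: "h \<noteq> id"
  proof
    assume "h = id"
    then have "z \<circ> (inv z' \<circ> z') = z'" unfolding h_def comp_assoc[symmetric] by simp
    then show False using permutes_inv_o(2)[of z'] z'n \<open>z \<noteq> z'\<close> by simp
  qed
  have he: "h e = e" if "e \<notin> S" for e
  proof -
    have f: "t1 e = e" "t2 e = e" "t3 e = e" using S[OF that] by simp_all
    have "z (inv x e) = e" using z f Sym_inv_apply(2)[OF g(3), of e] by auto
    moreover have "z' (inv x e) = e" using z' f Sym_inv_apply(2)[OF g(3), of e] by auto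
    ultimately show ?thesis using Sym_inv_apply(1)[OF z'n, of "inv x e"] by (simp add: h_def)
  qed
  have "e \<in> S" if "e = c \<or> e = d" for e
  proof (rule ccontr)
    assume "e \<notin> S"
    have "transpose c d e \<noteq> e" using that cd(2) by auto
    then have "h = id"
      using transp_fixed_collapse[OF _ r'(1) \<open>transpose c d \<circ> h = r'\<close> _ he[OF \<open>e \<notin> S\<close>]] transpI[of c d] cd(2) by blast
    then show False using hid by simp
  qed
  moreover have "bruhat_le n z v" "bruhat_le n T v"
    unfolding z_def T_def by (rule cD(3), use M in simp)+
  ultimately show ?thesis using z cd by blast
qed

section \<open>Structure forced by diamond-closedness and hypercube clusters\<close>

locale hd =
  fixes n :: nat and v :: perm and I :: "perm set"
  assumes v: "v \<in> Sym n" and hd: "hypercube_decomposition n id v I"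
begin

lemma I_le: "x \<in> I \<Longrightarrow> bruhat_le n x v"
  using hd by (auto simp: hypercube_decomposition_def interval_id)

lemma I_down: "x \<in> I \<Longrightarrow> bruhat_le n y x \<Longrightarrow> y \<in> I"
  using hd by (auto simp: hypercube_decomposition_def interval_id intro: bruhat_trans)

lemma id_in_I: "id \<in> I"
  using hd by (auto simp: hypercube_decomposition_def interval_id intro!: bruhat_id_le dest: bruhat_le_Sym)

lemma outside_iff: "y \<in> outside_nbrs n id v I x \<longleftrightarrow> bruhat_le n y v \<and> y \<notin> I \<and> (x, y) \<in> bruhat_graph n"
  by (auto simp: outside_nbrs_def interval_id)

lemma cluster_unique:
  assumes "x \<in> I" "Y \<subseteq> outside_nbrs n id v I x" "bruhat_antichain n Y"
  shows "\<exists>!H. \<exists>t. spanned_hypercube n id v x Y t H"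
  using hd assms by (simp add: hypercube_decomposition_def hypercube_cluster_def)

lemma cluster_cube:
  assumes "x \<in> I" "Y \<subseteq> outside_nbrs n id v I x" "bruhat_antichain n Y"
  shows "\<exists>g. cube_on n v Y g \<and> g {} = x"
  using cluster_unique[OF assms] spanned_hypercube_cube_on by metis

lemma antichain_pair:
  "\<not> bruhat_le n y y' \<Longrightarrow> \<not> bruhat_le n y' y \<Longrightarrow> bruhat_antichain n {y, y'}"
  by (auto simp: bruhat_antichain_def)

text \<open>Different tops would give different hypercubes spanned by the same antichain.\<close>

lemma diamond_top_unique:
  assumes x: "x \<in> I" and y: "y \<in> outside_nbrs n id v I x" "y' \<in> outside_nbrs n id v I x"
    and ne: "\<not> bruhat_le n y y'" "\<not> bruhat_le n y' y"
    and z: "(y, z) \<in> bruhat_graph n" "(y', z) \<in> bruhat_graph n" "bruhat_le n z v"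
    and w: "(y, w) \<in> bruhat_graph n" "(y', w) \<in> bruhat_graph n" "bruhat_le n w v"
  shows "w = z"
proof -
  have e: "(x, y) \<in> bruhat_graph n" "(x, y') \<in> bruhat_graph n" using y by (simp_all add: outside_iff)
  have "y \<in> Sym n" using y(1) bruhat_le_Sym(1) unfolding outside_iff by blast
  then have yy: "y \<noteq> y'" using ne bruhat_refl by blast
  obtain H where H: "spanned_hypercube n id v x {y, y'} z H" "fst H = {x, y, y', z}"
    using diamond_spanned[OF e z(1,2) yy z(3)] by blast
  obtain K where K: "spanned_hypercube n id v x {y, y'} w K" "fst K = {x, y, y', w}"
    using diamond_spanned[OF e w(1,2) yy w(3)] by blast
  have "H = K" using cluster_unique[OF x _ antichain_pair[OF ne]] y H(1) K(1) by auto
  then have "w \<in> {x, y, y', z}" using H(2) K(2) by auto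
  then show ?thesis using w e bruhat_edge_less by (metis empty_iff insert_iff less_asym less_irrefl)
qed

lemma diamond_in_I:
  assumes e: "(x, y) \<in> bruhat_graph n" "(x, y') \<in> bruhat_graph n"
    "(y, z) \<in> bruhat_graph n" "(y', z) \<in> bruhat_graph n" and ne: "y \<noteq> y'" and z: "bruhat_le n z v"
    and I: "x \<in> I" "y \<in> I" "y' \<in> I"
  shows "z \<in> I"
proof -
  obtain H where H: "diamond_in n id v H" "fst H = {x, y, y', z}"
    using diamond_spanned[OF e ne z] by blast
  have "x \<noteq> y" "x \<noteq> y'" using e bruhat_edge_less by blast+
  then have "card {x, y, y'} = 3" using ne by simp
  moreover have "card {x, y, y'} \<le> card (fst H \<inter> I)"
    by (rule card_mono) (use H I in auto)
  ultimately have "card (fst H \<inter> I) \<ge> 3" by simp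
  then have "fst H \<subseteq> I" using hd H(1) unfolding hypercube_decomposition_def diamond_closed_def by blast
  then show ?thesis using H by simp
qed

text \<open>The separating indices: simple reflections below \<open>v\<close> but outside
  \<open>I\<close>. Avoiding them turns out to describe \<open>I\<close> completely.\<close>

definition D :: "nat set" where
  "D = {i \<in> {1..<n}. bruhat_le n (adj i) v \<and> adj i \<notin> I}"

lemma D_range: "i \<in> D \<Longrightarrow> 1 \<le> i \<and> i < n"
  by (auto simp: D_def)

lemma crossing_notin:
  assumes "i \<in> D" "w \<in> Sym n" "up w i (Suc i)"
  shows "w \<notin> I"
proof -
  have "bruhat_le n (adj i) w"
    using assms D_range[OF assms(1)] up_inv_Suc[OF assms(2)] by (subst transpose_le_iff) auto
  then show ?thesis using I_down assms(1) by (auto simp: D_def)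
qed

text \<open>Induction on the length by diamond-closedness. If \<open>x\<close> is neither
  \<open>id\<close> nor simple, it has a right and a left descent that are not the same reflection;
  removing one, the other or both gives a diamond below \<open>x\<close> with its lower three
  vertices in \<open>I\<close>.\<close>

lemma noncrossing_in:
  assumes "bruhat_le n x v" "\<And>i. i \<in> D \<Longrightarrow> \<not> up x i (Suc i)"
  shows "x \<in> I"
  using assms
proof (induction "ninv n x" arbitrary: x rule: less_induct)
  case less
  have x: "x \<in> Sym n" using less.prems(1) bruhat_le_Sym by blast
  have IH: "y \<in> I" if "bruhat_le n y x" "ninv n y < ninv n x" for y
    by (rule less.hyps[OF that(2)]) (use that less.prems bruhat_trans up_mono in blast)+
  show ?case
  proof (cases "x = id \<or> (\<exists>i\<in>{1..<n}. x = adj i)")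
    case True
    then show ?thesis
    proof
      assume "\<exists>i\<in>{1..<n}. x = adj i"
      then obtain i where i: "i \<in> {1..<n}" "x = adj i" by blast
      have "up x i (Suc i)" unfolding i(2) by (rule up_transpose) (use i in auto)
      then have "i \<notin> D" using less.prems(2) by blast
      then show ?thesis using i less.prems(1) by (auto simp: D_def)
    qed (use id_in_I in simp)
  next
    case False
    have ix: "inv x \<in> Sym n" by (rule inv_Sym[OF x])
    have xi: "x (inv x k) = k" "inv x (x k) = k" for k using Sym_inv_apply[OF x] by simp_all
    \<comment> \<open>Otherwise each right descent would be the same reflection as each left
      descent; stripping it off would leave no descent, and \<open>x\<close> would be
      simple.\<close>
    have "\<exists>i k. i \<in> {1..<n} \<and> x (Suc i) < x i \<and> k \<in> {1..<n} \<and> inv x (Suc k) < inv x k \<and> \<not> (x i = Suc k \<and> x (Suc i) = k)"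
    proof (rule ccontr)
      assume no: "\<not> ?thesis"
      obtain i where i: "i \<in> {1..<n}" "x (Suc i) < x i" using exists_descent[OF x] False by blast
      have "inv x \<noteq> id" using False xi by (metis id_apply ext)
      then obtain k where k: "k \<in> {1..<n}" "inv x (Suc k) < inv x k" using exists_descent[OF ix] by blast
      have ik: "x i = Suc k" "x (Suc i) = k" using no i k by blast+
      have uniq: "i' = i" if "i' \<in> {1..<n}" "x (Suc i') < x i'" for i'
      proof -
        have "x i' = Suc k" using no k that by blast
        then show ?thesis using ik Sym_inj[OF x] by metis
      qed
      have xadj: "x \<circ> adj i \<in> Sym n" by (rule comp_Sym[OF x adj_Sym[OF i(1)]])
      have "x \<circ> adj i = id"
      proof (rule ccontr)
        assume "x \<circ> adj i \<noteq> id"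
        then obtain l where l: "l \<in> {1..<n}" "(x \<circ> adj i) (Suc l) < (x \<circ> adj i) l"
          using exists_descent[OF xadj] by blast
        have li: "l \<noteq> i" using l(2) ik by auto
        consider "Suc l = i" | "l = Suc i" | "l \<noteq> Suc i" "Suc l \<noteq> i" by blast
        then show False
        proof cases
          case 1
          then have "k < x l" using l(2) ik by (simp add: transpose_apply_other)
          moreover have "x l \<noteq> Suc k" using ik(1) Sym_inj[OF x, of l i] li by metis
          ultimately have "x (Suc l) < x l" using ik 1 by simp
          then show False using uniq[OF l(1)] li by blast
        next
          case 2
          then have "x (Suc l) < Suc k" using l(2) ik by (simp add: transpose_apply_other)
          moreover have "x (Suc l) \<noteq> k" using ik(2) Sym_inj[OF x, of "Suc l" "Suc i"] 2 by simp
          ultimately have "x (Suc l) < x l" using ik 2 by simp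
          then show False using uniq[OF l(1)] li by blast
        next
          case 3
          then have "x (Suc l) < x l" using l(2) li by (simp add: transpose_apply_other)
          then show False using uniq[OF l(1)] li by blast
        qed
      qed
      then have "x = adj i" by (metis adj_adj id_comp)
      then show False using False i(1) by blast
    qed
    then obtain i k where i: "i \<in> {1..<n}" "x (Suc i) < x i" and k: "k \<in> {1..<n}" "inv x (Suc k) < inv x k"
      and ne: "\<not> (x i = Suc k \<and> x (Suc i) = k)" by blast
    define y where "y = x \<circ> adj i"
    define y' where "y' = adj k \<circ> x"
    define w where "w = adj k \<circ> x \<circ> adj i"
    have kk: "adj k \<circ> adj k \<circ> f = f" for f :: perm by (simp add: fun_eq_iff)
    have Sy: "y \<in> Sym n" "y' \<in> Sym n" "w \<in> Sym n"
      unfolding y_def y'_def w_def using x adj_Sym i(1) k(1) comp_Sym by metis+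
    have "(y, y \<circ> transpose i (Suc i)) \<in> bruhat_graph n"
      by (rule bruhat_edgeI[OF Sy(1)]) (use i in \<open>auto simp: y_def\<close>)
    then have e1: "(y, x) \<in> bruhat_graph n" by (simp add: y_def)
    have "inv y' = inv x \<circ> adj k" unfolding y'_def using Sym_bij[OF x] by (simp add: o_inv_distrib)
    then have "(y', adj k \<circ> y') \<in> bruhat_graph n"
      by (intro bruhat_edge_leftI[OF Sy(2)]) (use k in auto)
    then have e2: "(y', x) \<in> bruhat_graph n" by (simp only: y'_def comp_assoc[symmetric] kk)
    have "w i < w (Suc i)"
    proof -
      have "{x i, x (Suc i)} \<noteq> {k, Suc k}" using ne i(2) by (auto simp: doubleton_eq_iff)
      then have "adj k (x (Suc i)) < adj k (x i)" using i(2) by (auto simp: transpose_def)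
      then show ?thesis by (simp add: w_def)
    qed
    then have "(w, w \<circ> transpose i (Suc i)) \<in> bruhat_graph n"
      by (intro bruhat_edgeI[OF Sy(3)]) (use i in auto)
    then have e3: "(w, y') \<in> bruhat_graph n" by (simp add: w_def y'_def)
    have iw: "inv w = adj i \<circ> inv x \<circ> adj k"
      unfolding w_def using Sym_bij[OF x] by (simp add: o_inv_distrib bij_comp comp_assoc)
    have "inv w k < inv w (Suc k)"
    proof -
      have "\<not> (inv x (Suc k) = i \<and> inv x k = Suc i)" using ne xi by metis
      then have "adj i (inv x (Suc k)) < adj i (inv x k)" using k(2) by (auto simp: transpose_def)
      then show ?thesis by (simp add: iw)
    qed
    then have "(w, adj k \<circ> w) \<in> bruhat_graph n"
      by (intro bruhat_edge_leftI[OF Sy(3)]) (use k in auto)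
    then have e4: "(w, y) \<in> bruhat_graph n" by (simp only: w_def y_def comp_assoc[symmetric] kk)
    have yy: "y \<noteq> y'"
    proof
      assume "y = y'"
      then have "y i = y' i" by simp
      then have "x (Suc i) = adj k (x i)" by (simp add: y_def y'_def)
      then show False using ne i(2) by (auto simp: transpose_def split: if_splits)
    qed
    have lt: "ninv n y < ninv n x" "ninv n y' < ninv n x" "ninv n w < ninv n x"
      using e1 e2 e3 bruhat_edge_less less_trans by metis+
    have le: "bruhat_le n y x" "bruhat_le n y' x" "bruhat_le n w x"
      using e1 e2 e3 bruhat_edge_le bruhat_trans by metis+
    show ?thesis
      by (rule diamond_in_I[OF e4 e3 e1 e2 yy less.prems(1)]) (use IH le lt in blast)+
  qed
qed

lemma crossing_transpose_notin:
  assumes "i \<in> D" "1 \<le> a" "a \<le> i" "i < b" "b \<le> n"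
  shows "transpose a b \<notin> I"
proof (rule crossing_notin[OF assms(1)])
  show "transpose a b \<in> Sym n" by (rule transpose_Sym) (use assms in auto)
  show "up (transpose a b) i (Suc i)" using up_transpose[OF assms(2)] by (rule up_weaken) (use assms in auto)
qed

lemma transpose_outside:
  assumes "1 \<le> a" "a < b" "b \<le> n" "bruhat_le n (transpose a b) v" "transpose a b \<notin> I"
  shows "transpose a b \<in> outside_nbrs n id v I id"
  using bruhat_edgeI[OF id_Sym assms(1-3)] assms by (auto simp: outside_iff)

text \<open>Both products of \<open>(a b)\<close> and \<open>(b c)\<close> lie below
  \<open>(a c)\<close>, hence below \<open>v\<close>, and each closes a diamond over the same two
  atoms. Uniqueness in the cluster at \<open>id\<close> would make the transpositions
  commute.\<close>

lemma no_chain: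
  assumes abc: "1 \<le> a" "a < b" "b < c" "c \<le> n" and out: "transpose a b \<notin> I" "transpose b c \<notin> I"
  shows "\<not> bruhat_le n (transpose a c) v"
proof
  assume le: "bruhat_le n (transpose a c) v"
  let ?y = "transpose a b" and ?y' = "transpose b c"
  have S: "?y \<in> Sym n" "?y' \<in> Sym n" by (rule transpose_Sym; use abc in auto)+
  have "bruhat_le n ?y (transpose a c)" "bruhat_le n ?y' (transpose a c)"
    by (rule transpose_le_transpose; use abc in auto)+
  then have yv: "bruhat_le n ?y v" "bruhat_le n ?y' v" using le bruhat_trans by blast+
  have o: "?y \<in> outside_nbrs n id v I id" "?y' \<in> outside_nbrs n id v I id"
    by (rule transpose_outside; use abc yv out in simp)+
  have n1: "\<not> up ?y' a b" using abc by (auto simp: up_def transpose_def split: if_splits)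
  have n2: "\<not> up ?y b c" using abc by (auto simp: up_def transpose_def split: if_splits)
  have inc: "\<not> bruhat_le n ?y ?y'" "\<not> bruhat_le n ?y' ?y"
    using incomparable_up[OF up_transpose n1] incomparable_up[OF up_transpose n2] abc by auto
  have e: "(?y, ?y \<circ> ?y') \<in> bruhat_graph n" "(?y', ?y' \<circ> ?y) \<in> bruhat_graph n"
    by (rule bruhat_edgeI; use abc S in \<open>auto simp: transpose_apply_other\<close>)+
  have e': "(?y', ?y \<circ> ?y') \<in> bruhat_graph n" "(?y, ?y' \<circ> ?y) \<in> bruhat_graph n"
    by (rule bruhat_edge_leftI; use abc S in \<open>auto simp: transpose_apply_other\<close>)+
  have S2: "?y \<circ> ?y' \<in> Sym n" "?y' \<circ> ?y \<in> Sym n" using S comp_Sym by blast+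
  have "?y \<circ> ?y' \<circ> ?y = transpose a c" "?y' \<circ> ?y \<circ> ?y' = transpose a c"
    using abc by (auto simp: fun_eq_iff transpose_def)
  moreover have "bruhat_le n (?y \<circ> ?y') (?y \<circ> ?y' \<circ> ?y)" "bruhat_le n (?y' \<circ> ?y) (?y' \<circ> ?y \<circ> ?y')"
    by (rule bruhat_edge_le, rule bruhat_edgeI; use abc S2 in \<open>auto simp: transpose_apply_other\<close>)+
  ultimately have "bruhat_le n (?y \<circ> ?y') v" "bruhat_le n (?y' \<circ> ?y) v"
    using le bruhat_trans by metis+
  then have "?y' \<circ> ?y = ?y \<circ> ?y'"
    using diamond_top_unique[OF id_in_I o inc e(1) e'(1) _ e'(2) e(2)] by blast
  then have "(?y' \<circ> ?y) a = (?y \<circ> ?y') a" by simp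
  then show False using abc by (simp add: transpose_apply_other)
qed

lemma swap_le:
  assumes "bruhat_le n (w \<circ> transpose a b) v'" "w \<in> Sym n" "1 \<le> a" "a < b" "b \<le> n" "w a < w b"
  shows "bruhat_le n w v'"
  using bruhat_trans[OF bruhat_edge_le[OF bruhat_edgeI[OF assms(2-6)]] assms(1)] .

lemma antichain_triple:
  assumes "\<not> bruhat_le n a b" "\<not> bruhat_le n b a" "\<not> bruhat_le n a c" "\<not> bruhat_le n c a"
    "\<not> bruhat_le n b c" "\<not> bruhat_le n c b"
  shows "bruhat_antichain n {a, b, c}"
  using assms by (auto simp: bruhat_antichain_def)

text \<open>Let \<open>p, q, r, s\<close> be four consecutive letters around \<open>i\<close>. By
  \<open>no_chain\<close> the outer simple reflections lie in \<open>I\<close>, hence so does their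
  product \<open>x\<close>. The neighbours \<open>y1, y2, y3\<close> of \<open>x\<close> form an
  antichain outside \<open>I\<close> and should span a cube. But the face over \<open>y1, y2\<close>
  tops at the reversal of the four letters, from which no edge within these letters goes up.\<close>

lemma no_cover:
  assumes i: "i \<in> D"
  shows "\<not> (up v (i - 1) (i + 2) \<and> up (inv v) (i - 1) (i + 2))"
proof
  assume u: "up v (i - 1) (i + 2) \<and> up (inv v) (i - 1) (i + 2)"
  then obtain k where k: "1 \<le> k" "k \<le> i - 1" "i + 2 \<le> v k" unfolding up_def by blast
  define p q r s where "p = i - 1" and "q = i" and "r = i + 1" and "s = i + 2"
  have o: "p < q" "q < r" "r < s" "1 \<le> p" and oS: "q = Suc p" "r = Suc q" "s = Suc r"
    using k by (auto simp: p_def q_def r_def s_def)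
  have sn: "s \<le> n"
  proof (rule ccontr)
    assume "\<not> s \<le> n"
    then have "n < v k" using k(3) by (simp add: s_def)
    then have "n < k" using Sym_le_iff[OF v, of k] Sym_fix(1)[OF v, of k] by (cases "k \<le> n") auto
    then show False using k(2) D_range[OF i] by linarith
  qed
  have ps: "bruhat_le n (transpose p s) v"
    using u o sn by (subst transpose_le_iff[OF v]) (auto simp: p_def s_def)
  have le: "bruhat_le n (transpose a b) v" if "p \<le> a" "a < b" "b \<le> s" for a b
    by (rule bruhat_trans[OF transpose_le_transpose ps]) (use that o sn in auto)
  have outq: "transpose q r \<notin> I" using i by (auto simp: D_def q_def r_def)
  have in1: "transpose p q \<in> I" and in3: "transpose r s \<in> I"
    using no_chain[of p q r] no_chain[of q r s] outq le o sn by auto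
  define x where "x = transpose p q \<circ> transpose r s"
  have St: "transpose a b \<in> Sym n" if "p \<le> a" "a < b" "b \<le> s" for a b
    by (rule transpose_Sym) (use that o sn in auto)
  have xS: "x \<in> Sym n" unfolding x_def by (intro comp_Sym St) (use o in auto)
  have xv: "x p = q" "x q = p" "x r = s" "x s = r" using o by (auto simp: x_def transpose_apply_other)
  have ix: "inv x q = p" "inv x p = q" "inv x s = r" "inv x r = s" using xv inv_eqI[OF xS] by blast+
  define y1 y2 y3 where "y1 = transpose p r \<circ> x" and "y2 = transpose q s \<circ> x" and "y3 = transpose q r \<circ> x"
  have yS: "y1 \<in> Sym n" "y2 \<in> Sym n" "y3 \<in> Sym n"
    unfolding y1_def y2_def y3_def by (intro comp_Sym St xS; use o in simp)+
  have xo: "x m = m" if "m \<noteq> p" "m \<noteq> q" "m \<noteq> r" "m \<noteq> s" for m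
    using that by (simp add: x_def transpose_apply_other)
  have v1: "y1 p = q" "y1 q = r" "y1 r = s" "y1 s = p"
    and v2: "y2 p = s" "y2 q = p" "y2 r = q" "y2 s = r"
    and v3: "y3 p = r" "y3 q = p" "y3 r = s" "y3 s = q"
    using xv o by (auto simp: y1_def y2_def y3_def transpose_apply_other)
  have yo: "y1 m = m" "y2 m = m" "y3 m = m" if "m \<noteq> p" "m \<noteq> q" "m \<noteq> r" "m \<noteq> s" for m
    using xo that by (auto simp: y1_def y2_def y3_def transpose_apply_other)
  have e: "(x, y1) \<in> bruhat_graph n" "(x, y2) \<in> bruhat_graph n" "(x, y3) \<in> bruhat_graph n"
    unfolding y1_def y2_def y3_def by (rule bruhat_edge_leftI[OF xS]; use o sn ix in simp)+
  \<comment> \<open>Each of the three neighbours is joined to \<open>(p s)\<close> by two ascending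
    edges; the following two claims use the same argument.\<close>
  have y1v: "bruhat_le n y1 v"
  proof (rule swap_le[of y1 p q], rule swap_le[of _ p r])
    have "y1 \<circ> transpose p q \<circ> transpose p r = transpose p s"
      unfolding y1_def x_def using o by (auto simp: fun_eq_iff transpose_def)
    then show "bruhat_le n (y1 \<circ> transpose p q \<circ> transpose p r) v" using ps by simp
    show "y1 \<circ> transpose p q \<in> Sym n" by (intro comp_Sym yS St) (use o in auto)
  qed (use o sn v1 yS in \<open>auto simp: transpose_apply_other\<close>)
  have y2v: "bruhat_le n y2 v"
  proof (rule swap_le[of y2 q r], rule swap_le[of _ r s])
    have "y2 \<circ> transpose q r \<circ> transpose r s = transpose p s"
      unfolding y2_def x_def using o by (auto simp: fun_eq_iff transpose_def)
    then show "bruhat_le n (y2 \<circ> transpose q r \<circ> transpose r s) v" using ps by simp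
    show "y2 \<circ> transpose q r \<in> Sym n" by (intro comp_Sym yS St) (use o in auto)
  qed (use o sn v2 yS in \<open>auto simp: transpose_apply_other\<close>)
  have y3v: "bruhat_le n y3 v"
  proof (rule swap_le[of y3 p r], rule swap_le[of _ q s])
    have "y3 \<circ> transpose p r \<circ> transpose q s = transpose p s"
      unfolding y3_def x_def using o by (auto simp: fun_eq_iff transpose_def)
    then show "bruhat_le n (y3 \<circ> transpose p r \<circ> transpose q s) v" using ps by simp
    show "y3 \<circ> transpose p r \<in> Sym n" by (intro comp_Sym yS St) (use o in auto)
  qed (use o sn v3 yS in \<open>auto simp: transpose_apply_other\<close>)
  have xv': "bruhat_le n x v" by (rule bruhat_trans[OF bruhat_edge_le[OF e(1)] y1v])
  have xI: "x \<in> I"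
  proof (rule diamond_in_I[OF _ _ _ _ _ xv' id_in_I in1 in3])
    show "(id, transpose p q) \<in> bruhat_graph n" "(id, transpose r s) \<in> bruhat_graph n"
      using bruhat_edgeI[OF id_Sym, of p q] bruhat_edgeI[OF id_Sym, of r s] o sn by auto
    show "(transpose p q, x) \<in> bruhat_graph n" unfolding x_def
      by (rule bruhat_edgeI) (use o sn St[of p q] in \<open>auto simp: transpose_apply_other\<close>)
    show "(transpose r s, x) \<in> bruhat_graph n" unfolding x_def
      by (rule bruhat_edge_leftI) (use o sn St[of r s] in \<open>auto simp: transpose_apply_other\<close>)
    show "transpose p q \<noteq> transpose r s" using o by (simp add: transpose_eq_iff')
  qed
  have "q \<in> D" using i by (simp add: q_def)
  have "up y1 q (Suc q)" "up y2 q (Suc q)" "up y3 q (Suc q)"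
    using upI[of q q "Suc q" y1] upI[of p q "Suc q" y2] upI[of p q "Suc q" y3] o v1 v2 v3
    unfolding oS(2)[symmetric] by simp_all
  then have "y1 \<notin> I" "y2 \<notin> I" "y3 \<notin> I" using crossing_notin[OF \<open>q \<in> D\<close>] yS by blast+
  then have sub: "{y1, y2, y3} \<subseteq> outside_nbrs n id v I x"
    using e y1v y2v y3v by (simp add: outside_iff)
  have dec: "m = p \<or> m = q \<or> m = r \<or> m = s \<or> m < p \<or> s < m" for m using oS by linarith
  have nu: "\<not> up y1 p r" "\<not> up y3 p s"
    unfolding up_def using v1 v3 yo o dec by (metis less_irrefl not_le order.strict_trans1 order.strict_trans2 less_trans)+
  have nd: "\<not> up (inv y2) q s" "\<not> up (inv y3) p s"
    unfolding dn_iff[OF yS(2)] dn_iff[OF yS(3)] using v2 v3 yo o dec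
    by (metis less_irrefl not_le order.strict_trans1 order.strict_trans2 less_trans)+
  have U: "up y2 p s" "up y3 p r" using upI[of p p s y2] upI[of p p r y3] v2 v3 o by auto
  have Dn: "up (inv y1) p s" "up (inv y3) q s"
    unfolding dn_iff[OF yS(1)] dn_iff[OF yS(3)] using v1 v3 o by (intro exI[of _ s], simp)+
  have ant: "bruhat_antichain n {y1, y2, y3}"
  proof (rule antichain_triple)
    show "\<not> bruhat_le n y1 y2" by (rule incomparable_dn[OF Dn(1)]) (use nd(1) up_weaken o in auto)
    show "\<not> bruhat_le n y2 y1" by (rule incomparable_up[OF U(1)]) (use nu(1) up_weaken o in auto)
    show "\<not> bruhat_le n y1 y3" by (rule incomparable_dn[OF Dn(1) nd(2)])
    show "\<not> bruhat_le n y3 y1" by (rule incomparable_up[OF U(2) nu(1)])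
    show "\<not> bruhat_le n y2 y3" by (rule incomparable_up[OF U(1) nu(2)])
    show "\<not> bruhat_le n y3 y2" by (rule incomparable_dn[OF Dn(2) nd(1)])
  qed
  obtain g where g: "cube_on n v {y1, y2, y3} g" "g {} = x"
    using cluster_cube[OF xI sub ant] by blast
  have "\<exists>z c d. (z = transpose p r \<circ> transpose q s \<circ> x \<or> z = transpose q s \<circ> transpose p r \<circ> x) \<and>
      bruhat_le n z v \<and> c \<in> {p, q, r, s} \<and> d \<in> {p, q, r, s} \<and> c < d \<and>
      inv z c < inv z d \<and> bruhat_le n (transpose c d \<circ> z) v"
    by (rule cube_triple[OF g xS, where ?t3.0 = "transpose q r"])
      (use o in \<open>auto simp: y1_def y2_def y3_def transpose_eq_iff' transpose_apply_other intro!: transpI\<close>)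
  then obtain z c d where z: "z = transpose p r \<circ> transpose q s \<circ> x \<or> z = transpose q s \<circ> transpose p r \<circ> x"
    and zv: "bruhat_le n z v" and cd: "c \<in> {p, q, r, s}" "d \<in> {p, q, r, s}" "c < d" "inv z c < inv z d"
    by blast
  have zS: "z \<in> Sym n" using zv bruhat_le_Sym by blast
  have "z p = s" "z q = r" "z r = q" "z s = p" using z xv o by (auto simp: transpose_apply_other)
  then have "inv z s = p" "inv z r = q" "inv z q = r" "inv z p = s" using inv_eqI[OF zS] by blast+
  then show False using cd o by auto
qed

text \<open>The vertex is \<open>x = (q r)\<close>, which lies in \<open>I\<close> since
  \<open>q\<close> is not in \<open>D\<close>. As \<open>(p s)\<close> is not below
  \<open>v\<close>, an upward or a downward arc over \<open>p .. s\<close> is missing in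
  \<open>v\<close>. In either case three outside neighbours of \<open>x\<close> span a cube, and the
  only edge available from one of its faces to the top creates the missing arc.\<close>

lemma no_overlap:
  assumes o: "1 \<le> p" "p < q" "q < r" "r < s" and rq: "r = Suc q" and s: "s = Suc j"
    and D: "p \<in> D" "j \<in> D" "q \<notin> D"
    and pr: "bruhat_le n (transpose p r) v" and qs: "bruhat_le n (transpose q s) v"
    and nps: "\<not> bruhat_le n (transpose p s) v"
  shows False
proof -
  have sn: "s \<le> n" using D_range[OF D(2)] s by simp
  have St: "transpose a b \<in> Sym n" if "p \<le> a" "a < b" "b \<le> s" for a b
    by (rule transpose_Sym) (use that o sn in auto)
  define x where "x = transpose q r"
  have xS: "x \<in> Sym n" unfolding x_def by (rule St) (use o in auto)
  have xv: "x p = p" "x q = r" "x r = q" "x s = s" using o by (auto simp: x_def transpose_apply_other)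
  have ix: "inv x p = p" "inv x r = q" "inv x q = r" "inv x s = s" using xv inv_eqI[OF xS] by blast+
  have xle: "bruhat_le n x v"
    unfolding x_def by (rule bruhat_trans[OF transpose_le_transpose pr]) (use o sn in auto)
  have xI: "x \<in> I" using xle D(3) o sn rq unfolding D_def x_def by auto
  define y1 y2 y3 y4 where "y1 = transpose p q \<circ> x" and "y2 = transpose p r \<circ> x"
    and "y3 = transpose q s \<circ> x" and "y4 = transpose r s \<circ> x"
  have yS: "y1 \<in> Sym n" "y2 \<in> Sym n" "y3 \<in> Sym n" "y4 \<in> Sym n"
    unfolding y1_def y2_def y3_def y4_def by (intro comp_Sym St xS; use o in simp)+
  have v1: "y1 p = q" "y1 q = r" "y1 r = p" "y1 s = s"
    and v2: "y2 p = r" "y2 q = p" "y2 r = q" "y2 s = s"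
    and v3: "y3 p = p" "y3 q = r" "y3 r = s" "y3 s = q"
    and v4: "y4 p = p" "y4 q = s" "y4 r = q" "y4 s = r"
    using xv o by (auto simp: y1_def y2_def y3_def y4_def transpose_apply_other)
  have yo: "y1 m = m" "y2 m = m" "y3 m = m" "y4 m = m" if "m \<noteq> p" "m \<noteq> q" "m \<noteq> r" "m \<noteq> s" for m
    using that by (auto simp: x_def y1_def y2_def y3_def y4_def transpose_apply_other)
  have e: "(x, y1) \<in> bruhat_graph n" "(x, y2) \<in> bruhat_graph n" "(x, y3) \<in> bruhat_graph n" "(x, y4) \<in> bruhat_graph n"
    unfolding y1_def y2_def y3_def y4_def by (rule bruhat_edge_leftI[OF xS]; use o sn ix in simp)+
  have "y1 \<circ> transpose p q = transpose p r" "y2 \<circ> transpose q r = transpose p r"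
    "y3 \<circ> transpose q r = transpose q s" "y4 \<circ> transpose r s = transpose q s"
    unfolding y1_def y2_def y3_def y4_def x_def using o by (auto simp: fun_eq_iff transpose_def)
  then have yv: "bruhat_le n y1 v" "bruhat_le n y2 v" "bruhat_le n y3 v" "bruhat_le n y4 v"
    using swap_le[of y1 p q v] swap_le[of y2 q r v] swap_le[of y3 q r v] swap_le[of y4 r s v] pr qs yS v1 v2 v3 v4 o sn
    by auto
  have "up y1 p (Suc p)" "up y2 p (Suc p)" "up y3 j (Suc j)" "up y4 j (Suc j)"
    using upI[of p p "Suc p" y1] upI[of p p "Suc p" y2] upI[of r j "Suc j" y3] upI[of q j "Suc j" y4] o v1 v2 v3 v4
    by (simp_all add: s)
  then have "y1 \<notin> I" "y2 \<notin> I" "y3 \<notin> I" "y4 \<notin> I" using crossing_notin D yS by blast+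
  then have out: "y1 \<in> outside_nbrs n id v I x" "y2 \<in> outside_nbrs n id v I x"
    "y3 \<in> outside_nbrs n id v I x" "y4 \<in> outside_nbrs n id v I x"
    using e yv by (simp_all add: outside_iff)
  have notup: "\<not> up y a b" if "\<And>m. m \<le> a \<Longrightarrow> y m < b" for y :: perm and a b
    unfolding up_def using that by (meson not_le)
  have nu: "\<not> up y1 p r" "\<not> up y1 r s" "\<not> up y2 r s" "\<not> up y3 p q" "\<not> up y4 p q"
  proof -
    have b: "y1 m < r" if "m \<le> p" for m using v1 yo(1)[of m] o that by (cases "m = p") auto
    have c: "y1 m < s" "y2 m < s" if "m \<le> r" for m
    proof -
      have ms: "m \<noteq> s" using that o by simp
      show "y1 m < s"
      proof (cases "m = p \<or> m = q \<or> m = r")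
        case True
        then have "y1 m = q \<or> y1 m = r \<or> y1 m = p" using v1 by blast
        then show ?thesis using o by linarith
      qed (use yo(1)[of m] ms that o in simp)
      show "y2 m < s"
      proof (cases "m = p \<or> m = q \<or> m = r")
        case True
        then have "y2 m = q \<or> y2 m = r \<or> y2 m = p" using v2 by blast
        then show ?thesis using o by linarith
      qed (use yo(2)[of m] ms that o in simp)
    qed
    have d: "y3 m < q" "y4 m < q" if "m \<le> p" for m
    proof -
      have "m \<noteq> q" "m \<noteq> r" "m \<noteq> s" using that o by simp_all
      then show "y3 m < q" "y4 m < q" using yo(3,4)[of m] v3(1) v4(1) that o by (cases "m = p"; simp)+
    qed
    show "\<not> up y1 p r" "\<not> up y1 r s" "\<not> up y2 r s" "\<not> up y3 p q" "\<not> up y4 p q"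
      by (rule notup, erule b, rule notup, erule c, rule notup, erule c, rule notup, erule d, rule notup, erule d)
  qed
  have nu': "\<not> up y2 q s" "\<not> up y1 q s" using nu(2,3) up_weaken o by (meson less_imp_le order_refl)+
  have nd: "\<not> up (inv y2) p r"
  proof -
    have "y2 m \<le> p \<Longrightarrow> r \<le> m \<Longrightarrow> False" for m
      using v2 yo(2)[of m] o by (cases "m = r"; cases "m = s") auto
    then show ?thesis unfolding dn_iff[OF yS(2)] by blast
  qed
  have nd3: "\<not> up y4 p r" using nu(5) up_weaken[of y4 p r p q] o by auto
  have U: "up y1 p q" "up y2 p q" "up y2 p r" "up y3 r s" "up y4 q s"
    using upI[of p p q y1] upI[of p p q y2] upI[of p p r y2] upI[of r r s y3] upI[of q q s y4] v1 v2 v3 v4 o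
    by simp_all
  have Dn: "up (inv y1) p r" unfolding dn_iff[OF yS(1)] using v1 o by (intro exI[of _ r]) simp
  have i13: "\<not> bruhat_le n y1 y3" "\<not> bruhat_le n y3 y1"
    using incomparable_up[OF U(1) nu(4)] incomparable_up[OF U(4) nu(2)] by blast+
  have i12: "\<not> bruhat_le n y1 y2" "\<not> bruhat_le n y2 y1"
    using incomparable_dn[OF Dn nd] incomparable_up[OF U(3) nu(1)] by blast+
  have i23: "\<not> bruhat_le n y2 y3" "\<not> bruhat_le n y3 y2"
    using incomparable_up[OF U(2) nu(4)] incomparable_up[OF U(4) nu(3)] by blast+
  have i24: "\<not> bruhat_le n y2 y4" "\<not> bruhat_le n y4 y2"
    using incomparable_up[OF U(3) nd3] incomparable_up[OF U(5) nu'(1)] by blast+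
  have i14: "\<not> bruhat_le n y1 y4" "\<not> bruhat_le n y4 y1"
    using incomparable_up[OF U(1) nu(5)] incomparable_up[OF U(5) nu'(2)] by blast+
  \<comment> \<open>The failure of \<open>(p s) \<le> v\<close>, split into the two arcs; the
    missing one selects the cube used below.\<close>
  have FG: "\<not> (up v p s \<and> up (inv v) p s)"
    using nps o sn by (subst (asm) transpose_le_iff[OF v]) auto
  have not_up: "up z p s \<Longrightarrow> up v p s" "up (inv z) p s \<Longrightarrow> up (inv v) p s" if "bruhat_le n z v" for z
    using up_mono[OF that] dn_mono[OF that] by blast+
  have ps: "up z p s" if "z p = s" for z using upI[of p p s z] that o by simp
  have sp: "up (inv z) p s" if "z \<in> Sym n" "z s = p" for z
    unfolding dn_iff[OF that(1)] using that(2) o by (intro exI[of _ s]) simp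
  have tr: "transp (transpose p q)" "transp (transpose p r)" "transp (transpose q s)" "transp (transpose r s)"
    using o by (auto intro!: transpI)
  have FG': "up v p s \<or> up (inv v) p s"
  proof -
    obtain g where g: "cube_on n v {y1, y3} g" "g {} = x"
      using cluster_cube[OF xI _ antichain_pair[OF i13]] out by blast
    have z: "g {y1, y3} = transpose p q \<circ> transpose q s \<circ> x \<or> g {y1, y3} = transpose q s \<circ> transpose p q \<circ> x"
      unfolding y1_def y3_def
      by (rule cube_pair[OF g(1)]) (use g(2) tr xS o in \<open>auto simp: y1_def y3_def transpose_eq_iff'\<close>)
    have zv: "bruhat_le n (g {y1, y3}) v" using cube_onD(3)[OF g(1)] by blast
    have "g {y1, y3} s = p \<or> g {y1, y3} p = s"
      using z xv o by (auto simp: transpose_apply_other)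
    then show ?thesis using not_up[OF zv] ps sp zv bruhat_le_Sym by blast
  qed
  show False
  proof (cases "up v p s")
    case True
    then have G: "\<not> up (inv v) p s" using FG by blast
    obtain g where g: "cube_on n v {y1, y2, y3} g" "g {} = x"
      using cluster_cube[OF xI _ antichain_triple[OF i12 i13 i23]] out by blast
    have "\<exists>z c d. (z = transpose p q \<circ> transpose q s \<circ> x \<or> z = transpose q s \<circ> transpose p q \<circ> x) \<and>
        bruhat_le n z v \<and> c \<in> {p, q, r, s} \<and> d \<in> {p, q, r, s} \<and> c < d \<and>
        inv z c < inv z d \<and> bruhat_le n (transpose c d \<circ> z) v"
      by (rule cube_triple[OF g xS, where ?t3.0 = "transpose p r"])
        (use o tr in \<open>auto simp: y1_def y2_def y3_def transpose_eq_iff' transpose_apply_other\<close>)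
    then obtain z c d where z: "z = transpose p q \<circ> transpose q s \<circ> x \<or> z = transpose q s \<circ> transpose p q \<circ> x"
      and zv: "bruhat_le n z v" and cd: "c \<in> {p, q, r, s}" "d \<in> {p, q, r, s}" "c < d" "inv z c < inv z d"
      and T: "bruhat_le n (transpose c d \<circ> z) v" by blast
    have zS: "z \<in> Sym n" using zv bruhat_le_Sym by blast
    have "z s \<noteq> p" using sp[OF zS] not_up[OF zv] G by blast
    then have "z p = s" "z q = r" "z r = p" "z s = q" using z xv o by (auto simp: transpose_apply_other)
    then have "inv z s = p" "inv z r = q" "inv z p = r" "inv z q = s" using inv_eqI[OF zS] by blast+
    \<comment> \<open>This is the only pair of the four letters that \<open>inv z\<close> leaves in
      increasing order.\<close>
    then have "c = p" "d = q" using cd o by auto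
    then have "(transpose c d \<circ> z) s = p" using \<open>z s = q\<close> by simp
    then show False using sp not_up[OF T] G T bruhat_le_Sym by blast
  next
    case F: False
    obtain g where g: "cube_on n v {y1, y2, y4} g" "g {} = x"
      using cluster_cube[OF xI _ antichain_triple[OF i12 i14 i24]] out by blast
    have "\<exists>z c d. (z = transpose p r \<circ> transpose r s \<circ> x \<or> z = transpose r s \<circ> transpose p r \<circ> x) \<and>
        bruhat_le n z v \<and> c \<in> {p, q, r, s} \<and> d \<in> {p, q, r, s} \<and> c < d \<and>
        inv z c < inv z d \<and> bruhat_le n (transpose c d \<circ> z) v"
      by (rule cube_triple[OF g xS, where ?t3.0 = "transpose p q"])
        (use o tr in \<open>auto simp: y1_def y2_def y4_def transpose_eq_iff' transpose_apply_other\<close>)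
    then obtain z c d where z: "z = transpose p r \<circ> transpose r s \<circ> x \<or> z = transpose r s \<circ> transpose p r \<circ> x"
      and zv: "bruhat_le n z v" and cd: "c \<in> {p, q, r, s}" "d \<in> {p, q, r, s}" "c < d" "inv z c < inv z d"
      and T: "bruhat_le n (transpose c d \<circ> z) v" by blast
    have zS: "z \<in> Sym n" using zv bruhat_le_Sym by blast
    have "z p \<noteq> s" using ps[of z] not_up[OF zv] F by blast
    then have "z p = r" "z q = s" "z r = q" "z s = p" using z xv o by (auto simp: transpose_apply_other)
    then have "inv z r = p" "inv z s = q" "inv z q = r" "inv z p = s" using inv_eqI[OF zS] by blast+
    then have "c = r" "d = s" using cd o by auto
    then have "(transpose c d \<circ> z) p = s" using \<open>z p = r\<close> by simp
    then show False using ps not_up[OF T] F by blast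
  qed
qed

end

section \<open>Hypercubes above the identity\<close>

primrec oprod :: "perm list \<Rightarrow> perm" where
  "oprod [] = id"
| "oprod (x # xs) = x \<circ> oprod xs"

lemma oprod_append: "oprod (xs @ ys) = oprod xs \<circ> oprod ys"
  by (induction xs) (simp_all only: oprod.simps append.simps comp_assoc id_comp)

lemma oprod_preserves:
  assumes "\<And>t k. t \<in> set xs \<Longrightarrow> P k \<Longrightarrow> P (t k)" "P k"
  shows "P (oprod xs k)"
  using assms by (induction xs) auto

lemma oprod_moves:
  assumes "distinct xs" "t \<in> set xs" "t d \<noteq> d" "\<And>s. s \<in> set xs \<Longrightarrow> s \<noteq> t \<Longrightarrow> s d = d"
    "\<And>s. s \<in> set xs \<Longrightarrow> inj s"
  shows "oprod xs d \<noteq> d"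
  using assms
proof (induction xs)
  case (Cons y ys)
  show ?case
  proof (cases "y = t")
    case True
    have "oprod ys d = d"
      by (rule oprod_preserves[where P = "\<lambda>k. k = d"]) (use Cons.prems True in auto)
    then show ?thesis using True Cons.prems by simp
  next
    case False
    have "oprod ys d \<noteq> d" by (rule Cons.IH) (use Cons.prems False in auto)
    moreover have "y d = d" "inj y" using Cons.prems False by auto
    ultimately show ?thesis by (metis comp_apply oprod.simps(2) injD)
  qed
qed simp

lemma transp_conj:
  assumes "transp r" "transp s"
  shows "transp (s \<circ> r \<circ> s)"
proof -
  obtain a b where ab: "a \<noteq> b" "r = transpose a b" using assms(1) by (auto simp: transp_def)
  have s: "s \<circ> s = id" "bij s" using assms(2) by (auto simp: transp_def)
  then have "s a \<noteq> s b" using ab(1) bij_is_inj injD by metis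
  moreover have "s \<circ> r \<circ> s = transpose (s a) (s b)"
    using transpose_conj[OF s(2), of a b] s(1) unfolding ab(2) by (metis comp_assoc comp_id)
  ultimately show ?thesis by (simp add: transpI)
qed

text \<open>Deleting a factor inside a product amounts to multiplying by a conjugate of it, which is
  again a transposition.\<close>

lemma oprod_remove:
  assumes "distinct xs" "t \<in> set xs" "t \<in> Z" "\<And>s. s \<in> set xs \<Longrightarrow> transp s"
  shows "\<exists>r. transp r \<and> oprod (filter (\<lambda>s. s \<in> Z) xs) = r \<circ> oprod (filter (\<lambda>s. s \<in> Z - {t}) xs)"
  using assms
proof (induction xs)
  case (Cons y ys)
  show ?case
  proof (cases "y = t")
    case True
    have "filter (\<lambda>s. s \<in> Z - {t}) (y # ys) = filter (\<lambda>s. s \<in> Z) ys"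
      using True Cons.prems by (auto intro!: filter_cong)
    then show ?thesis using True Cons.prems by (intro exI[of _ t]) simp
  next
    case False
    have "\<exists>r. transp r \<and> oprod (filter (\<lambda>s. s \<in> Z) ys) = r \<circ> oprod (filter (\<lambda>s. s \<in> Z - {t}) ys)"
      by (rule Cons.IH) (use Cons.prems False in auto)
    then obtain r where r: "transp r" "oprod (filter (\<lambda>s. s \<in> Z) ys) = r \<circ> oprod (filter (\<lambda>s. s \<in> Z - {t}) ys)"
      by blast
    have y: "transp y" using Cons.prems by simp
    show ?thesis
    proof (cases "y \<in> Z")
      case True
      have "y \<circ> (r \<circ> f) = (y \<circ> r \<circ> y) \<circ> (y \<circ> f)" for f :: perm
        using transp_self[OF y] by (metis comp_assoc comp_id)
      then have "oprod (filter (\<lambda>s. s \<in> Z) (y # ys)) = (y \<circ> r \<circ> y) \<circ> oprod (filter (\<lambda>s. s \<in> Z - {t}) (y # ys))"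
        using True \<open>y \<noteq> t\<close> r(2) by (simp only: filter.simps if_True oprod.simps Diff_iff singleton_iff not_False_eq_True simp_thms)
      then show ?thesis using transp_conj[OF r(1) y] by blast
    next
      case no: False
      have "filter (\<lambda>s. s \<in> Z) (y # ys) = filter (\<lambda>s. s \<in> Z) ys"
        "filter (\<lambda>s. s \<in> Z - {t}) (y # ys) = filter (\<lambda>s. s \<in> Z - {t}) ys" using no by simp_all
      then show ?thesis using r by metis
    qed
  qed
qed simp

lemma transpose_leD:
  assumes "bruhat_le n (transpose a b) (transpose c d)" "1 \<le> a" "a < b" "c < d"
  shows "c \<le> a \<and> b \<le> d"
proof -
  have "up (transpose c d) a b" using up_mono[OF assms(1) up_transpose[OF assms(2)]] .
  then obtain k where k: "k \<le> a" "b \<le> transpose c d k" by (auto simp: up_def)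
  then have "k < transpose c d k" using assms by simp
  then have "k = c" using assms(4) by (auto simp: transpose_def split: if_splits)
  then show ?thesis using k by simp
qed

lemma CsetE:
  assumes "t \<in> Cset a j b" "a \<le> j" "j < b"
  obtains c d where "t = transpose c d" "a \<le> c" "c \<le> j" "j < d" "d \<le> b" "d = Suc j \<or> c = j"
proof -
  consider "t = adj j" | m where "m \<in> {a..<j}" "t = transpose m (Suc j)" | m where "m \<in> {j + 2..b}" "t = transpose j m"
    using assms(1) unfolding Cset_def by blast
  then show ?thesis
  proof cases
    case 1
    then show ?thesis using that[of j "Suc j"] assms by simp
  next
    case (2 m)
    then show ?thesis using that[of m "Suc j"] assms by simp
  next
    case (3 m)
    then show ?thesis using that[of j m] assms by simp
  qed
qed

lemma CsetI:
  assumes "a \<le> c" "c \<le> j" "j < d" "d \<le> b" "d = Suc j \<or> c = j"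
  shows "transpose c d \<in> Cset a j b"
proof -
  consider "c = j" "d = Suc j" | "c < j" "d = Suc j" | "c = j" "j + 2 \<le> d" using assms by linarith
  then show ?thesis using assms by cases (auto simp: Cset_def)
qed

text \<open>An antichain meets each leg of the hook at most once, and contains the corner only
  alone. So \<open>theta\<close> is a product of at most two factors in a fixed order, and passing
  to a subset means deleting factors.\<close>

lemma theta_list:
  assumes a: "1 \<le> a" "a \<le> j" "j < b" "b \<le> n" and M: "bruhat_antichain n M"
  shows "\<exists>xs. distinct xs \<and> set xs = M \<inter> Cset a j b \<and>
    (\<forall>Z. Z \<subseteq> M \<longrightarrow> theta a j b Z = oprod (filter (\<lambda>s. s \<in> Z) xs))"
proof -
  have L: "m = m'" if "m \<in> lft a j M" "m' \<in> lft a j M" "m \<le> m'" for m m'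
  proof -
    have "bruhat_le n (transpose m' (Suc j)) (transpose m (Suc j))"
      by (rule transpose_le_transpose) (use that a in \<open>auto simp: lft_def\<close>)
    then have "transpose m' (Suc j) = transpose m (Suc j)"
      using M that unfolding bruhat_antichain_def lft_def by blast
    then show ?thesis using that by (simp add: lft_def transpose_eq_iff')
  qed
  have R: "m = m'" if "m \<in> rgtm j b M" "m' \<in> rgtm j b M" "m \<le> m'" for m m'
  proof -
    have "bruhat_le n (transpose j m) (transpose j m')"
      by (rule transpose_le_transpose) (use that a in \<open>auto simp: rgtm_def\<close>)
    then have "transpose j m = transpose j m'"
      using M that unfolding bruhat_antichain_def rgtm_def by blast
    then show ?thesis using that by (simp add: rgtm_def transpose_eq_iff')
  qed
  have C: "M \<inter> Cset a j b = (if adj j \<in> M then {adj j} else {}) \<union>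
      ((\<lambda>m. transpose m (Suc j)) ` lft a j M \<union> transpose j ` rgtm j b M)"
    by (auto simp: Cset_def lft_def rgtm_def)
  show ?thesis
  proof (cases "adj j \<in> M")
    case True
    have no: "t = adj j" if "t \<in> M \<inter> Cset a j b" for t
    proof -
      have "t \<in> Cset a j b" using that by blast
      then obtain c d where "t = transpose c d" "a \<le> c" "c \<le> j" "j < d" "d \<le> b"
        using CsetE a by metis
      then have "bruhat_le n (adj j) t" using a by (auto intro!: transpose_le_transpose)
      then show ?thesis using M True that unfolding bruhat_antichain_def by blast
    qed
    have e: "lft a j M = {}" "rgtm j b M = {}"
      using no unfolding C by (force simp: lft_def rgtm_def transpose_eq_iff')+
    have "theta a j b Z = oprod (filter (\<lambda>s. s \<in> Z) [adj j])" if "Z \<subseteq> M" for Z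
    proof -
      have "lft a j Z = {}" "rgtm j b Z = {}" using e that by (auto simp: lft_def rgtm_def)
      then show ?thesis by (simp add: theta_def)
    qed
    then show ?thesis using True e C by (intro exI[of _ "[adj j]"]) auto
  next
    case False
    consider "lft a j M = {}" | m where "lft a j M = {m}" using L by (metis insertCI is_singletonI' is_singleton_def nle_le)
    then obtain ls where ls: "lft a j M = set ls" "length ls \<le> 1" by cases (auto intro: that[of "[]"] that[of "[_]"])
    consider "rgtm j b M = {}" | m where "rgtm j b M = {m}" using R by (metis insertCI is_singletonI' is_singleton_def nle_le)
    then obtain rs where rs: "rgtm j b M = set rs" "length rs \<le> 1" by cases (auto intro: that[of "[]"] that[of "[_]"])
    define xs where "xs = map (\<lambda>m. transpose m (Suc j)) ls @ map (transpose j) rs"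
    have lsr: "m < j" if "m \<in> set ls" for m using that unfolding ls(1)[symmetric] by (simp add: lft_def)
    have rsr: "j + 2 \<le> m" if "m \<in> set rs" for m using that unfolding rs(1)[symmetric] by (simp add: rgtm_def)
    have lse: "ls = [] \<or> (\<exists>m. ls = [m])" and rse: "rs = [] \<or> (\<exists>m. rs = [m])"
      using ls(2) rs(2) by (auto simp: le_Suc_eq length_Suc_conv)
    have "theta a j b Z = oprod (filter (\<lambda>s. s \<in> Z) xs)" if Z: "Z \<subseteq> M" for Z
    proof -
      have l: "lft a j Z = {m \<in> set ls. transpose m (Suc j) \<in> Z}"
        unfolding ls(1)[symmetric] using Z by (auto simp: lft_def)
      have r: "rgtm j b Z = {m \<in> set rs. transpose j m \<in> Z}"
        unfolding rs(1)[symmetric] using Z by (auto simp: rgtm_def)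
      have an: "adj j \<notin> Z" using False Z by blast
      have A: "tmin (lft a j Z) (Suc j) = oprod (filter (\<lambda>s. s \<in> Z) (map (\<lambda>m. transpose m (Suc j)) ls))"
      proof (cases "ls = []")
        case False
        then obtain m where "ls = [m]" using lse by blast
        moreover have "{x. x = m \<and> transpose x (Suc j) \<in> Z} = (if transpose m (Suc j) \<in> Z then {m} else {})" by auto
        ultimately show ?thesis unfolding l by (simp add: tmin_def)
      qed (simp add: l tmin_def)
      have B: "tmax (rgtm j b Z) j = oprod (filter (\<lambda>s. s \<in> Z) (map (transpose j) rs))"
      proof (cases "rs = []")
        case False
        then obtain m where "rs = [m]" using rse by blast
        moreover have "{x. x = m \<and> transpose j x \<in> Z} = (if transpose j m \<in> Z then {m} else {})" by auto
        ultimately show ?thesis unfolding r by (simp add: tmax_def)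
      qed (simp add: r tmax_def)
      have "theta a j b Z = tmin (lft a j Z) (Suc j) \<circ> tmax (rgtm j b Z) j"
        using an by (simp add: theta_def tmin_def tmax_def)
      then show ?thesis unfolding A B xs_def filter_append oprod_append .
    qed
    moreover have "distinct xs"
      using lse rse lsr rsr unfolding xs_def by (auto simp: transpose_eq_iff')
    moreover have "set xs = M \<inter> Cset a j b" unfolding C xs_def using False ls(1) rs(1) by auto
    ultimately show ?thesis by blast
  qed
qed

section \<open>Cubes over antichains and ordered products\<close>

context
  fixes n :: nat and v :: perm and la rb :: "nat \<Rightarrow> nat" and rg :: "nat \<Rightarrow> bool"
begin

lemma separated_le:
  "separated n v la rb rg js \<Longrightarrow> i \<in> set js \<Longrightarrow> j \<in> set js \<Longrightarrow> i < j \<Longrightarrow> rb i \<le> la j"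
proof (induction js)
  case (Cons k ks)
  have r: "i' < k \<and> rb i' \<le> la k" if "i' \<in> set ks" for i'
    using separated_range[of n v la rb rg ks i'] Cons.prems(1) that by auto
  show ?case using Cons r by force
qed simp

lemma separated_bound:
  "separated n v la rb rg js \<Longrightarrow> i \<in> set js \<Longrightarrow> 1 \<le> la i \<and> la i \<le> i \<and> i < rb i \<and> rb i \<le> n"
  by (induction js) auto

lemma Cs_Cset_disjoint:
  assumes "separated n v la rb rg (j # js)" "t \<in> Cset (la j) j (rb j)"
  shows "t \<notin> Cs la rb js"
proof
  assume t: "t \<in> Cs la rb js"
  have s: "separated n v la rb rg js" "bd rb js \<le> j" using assms(1) by auto
  have "t permutes {1..j}" by (rule permutes_subset[OF Cs_permutes[OF s(1) t]]) (use s in auto)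
  then show False using Cset_moves[OF assms(2)] by blast
qed

text \<open>One list for the whole antichain: the lists of the single hooks are concatenated on the
  side given by \<open>rg\<close>, and distinct hooks share no reflection.\<close>

lemma Theta_list:
  assumes "separated n v la rb rg js" "bruhat_antichain n M"
  shows "\<exists>xs. distinct xs \<and> set xs = M \<inter> Cs la rb js \<and>
    (\<forall>Z. Z \<subseteq> M \<longrightarrow> Theta la rb rg js Z = oprod (filter (\<lambda>s. s \<in> Z) xs))"
  using assms(1)
proof (induction js)
  case Nil
  have "Theta la rb rg [] Z = oprod (filter (\<lambda>s. s \<in> Z) [])" for Z by (simp only: Theta.simps filter.simps oprod.simps)
  then show "\<exists>xs. distinct xs \<and> set xs = M \<inter> Cs la rb [] \<and>
    (\<forall>Z. Z \<subseteq> M \<longrightarrow> Theta la rb rg [] Z = oprod (filter (\<lambda>s. s \<in> Z) xs))"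
    by (intro exI[of _ "[]"]) (simp only: distinct.simps Cs_def list.set, simp)
next
  case (Cons j js)
  have s: "separated n v la rb rg js" using Cons.prems by simp
  obtain xs where xs: "distinct xs" "set xs = M \<inter> Cs la rb js"
    "\<And>Z. Z \<subseteq> M \<Longrightarrow> Theta la rb rg js Z = oprod (filter (\<lambda>s. s \<in> Z) xs)" using Cons.IH[OF s] by blast
  have "1 \<le> la j" "la j \<le> j" "j < rb j" "rb j \<le> n" using Cons.prems by auto
  from theta_list[OF this assms(2)] obtain ys where ys: "distinct ys" "set ys = M \<inter> Cset (la j) j (rb j)"
    "\<And>Z. Z \<subseteq> M \<Longrightarrow> theta (la j) j (rb j) Z = oprod (filter (\<lambda>s. s \<in> Z) ys)" by blast
  have dis: "set xs \<inter> set ys = {}" using xs(2) ys(2) Cs_Cset_disjoint[OF Cons.prems] by blast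
  define zs where "zs = (if rg j then xs @ ys else ys @ xs)"
  have "distinct zs" using dis xs(1) ys(1) by (auto simp: zs_def)
  moreover have "set zs = M \<inter> Cs la rb (j # js)" using xs(2) ys(2) by (auto simp: zs_def Cs_def)
  moreover have "Theta la rb rg (j # js) Z = oprod (filter (\<lambda>s. s \<in> Z) zs)" if "Z \<subseteq> M" for Z
    by (cases "rg j") (simp_all only: Theta.simps xs(3)[OF that] ys(3)[OF that] zs_def if_True if_False filter_append oprod_append)
  ultimately show "\<exists>xs. distinct xs \<and> set xs = M \<inter> Cs la rb (j # js) \<and>
    (\<forall>Z. Z \<subseteq> M \<longrightarrow> Theta la rb rg (j # js) Z = oprod (filter (\<lambda>s. s \<in> Z) xs))" by blast
qed

lemma Theta_outside: "Y \<inter> Cs la rb js = {} \<Longrightarrow> Theta la rb rg js Y = id"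
proof (induction js)
  case Nil
  show "Theta la rb rg [] Y = id" by (simp only: Theta.simps)
next
  case (Cons j js)
  have "theta (la j) j (rb j) Y = theta (la j) j (rb j) {}"
    by (rule theta_cong) (use Cons.prems in \<open>auto simp: Cs_def\<close>)
  also have "\<dots> = id" by (simp add: theta_def lft_def rgtm_def)
  finally have "theta (la j) j (rb j) Y = id" .
  moreover have "Theta la rb rg js Y = id" by (rule Cons.IH) (use Cons.prems in \<open>auto simp: Cs_def\<close>)
  ultimately show "Theta la rb rg (j # js) Y = id" by (simp only: Theta.simps id_comp if_cancel)
qed

lemma antichain_singleton: "bruhat_antichain n {t}"
  by (simp add: bruhat_antichain_def)

lemma Theta_singleton:
  assumes "separated n v la rb rg js" "t \<in> Cs la rb js"
  shows "Theta la rb rg js {t} = t"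
proof -
  obtain xs where xs: "distinct xs" "set xs = {t} \<inter> Cs la rb js"
    "Theta la rb rg js {t} = oprod (filter (\<lambda>s. s \<in> {t}) xs)"
    using Theta_list[OF assms(1) antichain_singleton[of t]] by blast
  have "set xs = {t}" using xs(2) assms(2) by blast
  then have "xs = [t]" using xs(1) by (cases xs; cases "tl xs") auto
  then show ?thesis using xs(3) by simp
qed

lemma Theta_pair:
  assumes "separated n v la rb rg js" "i \<in> set js" "j \<in> set js" "i < j"
    "t \<in> Cset (la i) i (rb i)" "t' \<in> Cset (la j) j (rb j)"
  shows "Theta la rb rg js {t, t'} = (if rg j then t \<circ> t' else t' \<circ> t)"
  using assms(1-3)
proof (induction js)
  case (Cons k ks)
  have s: "separated n v la rb rg ks" and b: "1 \<le> la k" "la k \<le> k" "k < rb k" using Cons.prems by auto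
  have lt: "l < k" if "l \<in> set ks" for l using separated_range[OF s that] Cons.prems by auto
  show ?case
  proof (cases "j = k")
    case True
    then have i: "i \<in> set ks" using Cons.prems assms(4) by auto
    have t: "t \<in> Cs la rb ks" using i assms(5) by (auto simp: Cs_def)
    have t': "t' \<notin> Cs la rb ks" by (rule Cs_Cset_disjoint[OF Cons.prems(1)]) (use assms(6) True in simp)
    have tC: "t \<notin> Cset (la k) k (rb k)" using Cs_Cset_disjoint[OF Cons.prems(1)] t by blast
    have "Theta la rb rg ks {t, t'} = Theta la rb rg ks {t}"
      by (rule Theta_cong) (use t t' in auto)
    also have "\<dots> = t" by (rule Theta_singleton[OF s t])
    finally have 1: "Theta la rb rg ks {t, t'} = t" .
    have sk: "separated n v la rb rg [k]" using Cons.prems(1) by auto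
    have "theta (la k) k (rb k) {t, t'} = theta (la k) k (rb k) {t'}"
      by (rule theta_cong) (use tC assms(6) True in auto)
    also have "\<dots> = Theta la rb rg [k] {t'}" by (simp only: Theta.simps comp_id id_comp if_cancel)
    also have "\<dots> = t'" by (rule Theta_singleton[OF sk]) (use assms(6) True in \<open>simp add: Cs_def\<close>)
    finally have 2: "theta (la k) k (rb k) {t, t'} = t'" .
    show "Theta la rb rg (k # ks) {t, t'} = (if rg j then t \<circ> t' else t' \<circ> t)"
      by (simp only: Theta.simps 1 2 True)
  next
    case False
    then have j: "j \<in> set ks" using Cons.prems by auto
    then have i: "i \<in> set ks" using Cons.prems lt assms(4) by force
    have "t \<in> Cs la rb ks" "t' \<in> Cs la rb ks" using i j assms(5,6) by (auto simp: Cs_def)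
    then have n: "t \<notin> Cset (la k) k (rb k)" "t' \<notin> Cset (la k) k (rb k)"
      using Cs_Cset_disjoint[OF Cons.prems(1)] by blast+
    have "theta (la k) k (rb k) {t, t'} = theta (la k) k (rb k) {}"
      by (rule theta_cong) (use n in auto)
    also have "\<dots> = id" by (simp add: theta_def lft_def rgtm_def)
    finally have 1: "theta (la k) k (rb k) {t, t'} = id" .
    have IH: "Theta la rb rg ks {t, t'} = (if rg j then t \<circ> t' else t' \<circ> t)"
      by (rule Cons.IH[OF s i j])
    show "Theta la rb rg (k # ks) {t, t'} = (if rg j then t \<circ> t' else t' \<circ> t)"
      by (simp only: Theta.simps 1 IH id_comp comp_id if_cancel)
  qed
qed simp

text \<open>The top of a cube is forced by its facets once its dimension is at least three: if \<open>u\<close> is the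
  quotient of two candidates, then \<open>u = \<rho>\<^sub>t r\<^sub>t\<close> for each spanning reflection \<open>t\<close>, with distinct
  reflections \<open>r\<^sub>t\<close>; but a permutation that moves at least four letters has at most two such
  factorizations.\<close>

lemma cube_eq_Theta:
  assumes sep: "separated n v la rb rg js" and M: "M \<subseteq> Cs la rb js" "bruhat_antichain n M"
    and cube: "cube_on n v M g" "g {} = id"
    and ord: "\<And>i j. i \<in> set js \<Longrightarrow> j \<in> set js \<Longrightarrow> i < j \<Longrightarrow> rb i = la j \<Longrightarrow>
      (if rg j then \<not> up v i (Suc j) else \<not> up (inv v) i (Suc j))"
    and Z: "Z \<subseteq> M"
  shows "g Z = Theta la rb rg js Z"
proof -
  let ?Th = "Theta la rb rg js"
  note cD = cube_onD[OF cube(1)]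
  obtain xs where xs: "distinct xs" "set xs = M \<inter> Cs la rb js"
    "\<And>Z. Z \<subseteq> M \<Longrightarrow> ?Th Z = oprod (filter (\<lambda>s. s \<in> Z) xs)" using Theta_list[OF sep M(2)] by blast
  have xsM: "set xs = M" using xs(2) M(1) by blast
  define Q where "Q = (\<lambda>t (j, a, b). j \<in> set js \<and> t \<in> Cset (la j) j (rb j) \<and> t = transpose a b \<and>
    la j \<le> a \<and> a \<le> j \<and> j < b \<and> b \<le> rb j)"
  have "\<forall>t\<in>M. \<exists>p. Q t p"
  proof
    fix t assume "t \<in> M"
    then obtain j where j: "j \<in> set js" "t \<in> Cset (la j) j (rb j)" using M(1) by (auto simp: Cs_def)
    have "la j \<le> j" "j < rb j" using separated_bound[OF sep j(1)] by auto
    then obtain a b where "t = transpose a b" "la j \<le> a" "a \<le> j" "j < b" "b \<le> rb j"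
      using CsetE[OF j(2)] by metis
    then have "Q t (j, a, b)" using j by (simp add: Q_def)
    then show "\<exists>p. Q t p" ..
  qed
  from bchoice[OF this] obtain P where P: "\<forall>t\<in>M. Q t (P t)" ..
  define J where "J = (\<lambda>t. fst (P t))"
  define lo where "lo = (\<lambda>t. fst (snd (P t)))"
  define hi where "hi = (\<lambda>t. snd (snd (P t)))"
  have Jj: "J t \<in> set js" and JC: "t \<in> Cset (la (J t)) (J t) (rb (J t))" and te: "t = transpose (lo t) (hi t)"
    and b1: "la (J t) \<le> lo t" and b2: "lo t \<le> J t" and b3: "J t < hi t" and b4: "hi t \<le> rb (J t)" if "t \<in> M" for t
    using bspec[OF P that] unfolding Q_def J_def lo_def hi_def by (auto split: prod.splits)
  have bnd: "1 \<le> lo t" "lo t < hi t" "hi t \<le> n" if "t \<in> M" for t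
    using separated_bound[OF sep Jj[OF that]] b1[OF that] b2[OF that] b3[OF that] b4[OF that] by auto
  have fixd: "t d = d" if "t \<in> M" "d \<noteq> lo t" "d \<noteq> hi t" for t d
    by (subst te[OF that(1)]) (use that in \<open>simp add: transpose_apply_other\<close>)
  have movd: "t (lo t) = hi t" "t (hi t) = lo t" if "t \<in> M" for t
    by (subst te[OF that], simp)+
  have tr: "transp t" if "t \<in> M" for t
    using transpI[of "lo t" "hi t"] bnd[OF that] te[OF that] by auto
  \<comment> \<open>Nested reflections are comparable, so in an antichain lower and upper ends
    increase together.\<close>
  have tri: "lo t < lo t' \<and> hi t < hi t' \<or> lo t' < lo t \<and> hi t' < hi t" if "t \<in> M" "t' \<in> M" "t \<noteq> t'" for t t'
  proof (rule ccontr)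
    assume "\<not> ?thesis"
    then consider "lo t \<le> lo t'" "hi t' \<le> hi t" | "lo t' \<le> lo t" "hi t \<le> hi t'" by linarith
    then show False
    proof cases
      case 1
      then have "bruhat_le n (transpose (lo t') (hi t')) (transpose (lo t) (hi t))"
        using bnd that by (intro transpose_le_transpose) auto
      then show False using M(2) that te unfolding bruhat_antichain_def by metis
    next
      case 2
      then have "bruhat_le n (transpose (lo t) (hi t)) (transpose (lo t') (hi t'))"
        using bnd that by (intro transpose_le_transpose) auto
      then show False using M(2) that te unfolding bruhat_antichain_def by metis
    qed
  qed
  \<comment> \<open>Two spanning reflections meet end to end only at the common end letter of two
    touching hooks.\<close>
  have touch: "J s < J t \<and> rb (J s) = la (J t) \<and> hi s = la (J t)" if "s \<in> M" "t \<in> M" "hi s = lo t" for s t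
  proof -
    note B = b1[OF that(1)] b2[OF that(1)] b3[OF that(1)] b4[OF that(1)] b1[OF that(2)] b2[OF that(2)] b3[OF that(2)]
    have "J s < J t" using B that(3) by linarith
    then have "rb (J s) \<le> la (J t)" using separated_le[OF sep Jj[OF that(1)] Jj[OF that(2)]] by blast
    then show ?thesis using \<open>J s < J t\<close> B that(3) by linarith
  qed
  \<comment> \<open>No other spanning reflection passes over such a common letter.\<close>
  have straddle: "hi t' \<le> lo t \<or> lo t \<le> lo t'" if "s \<in> M" "t \<in> M" "hi s = lo t" "t' \<in> M" for s t t'
  proof -
    note B = b1[OF that(1)] b2[OF that(1)] b3[OF that(1)] b4[OF that(1)] b1[OF that(2)] b2[OF that(2)] b3[OF that(2)]
      b1[OF that(4)] b2[OF that(4)] b3[OF that(4)] b4[OF that(4)] touch[OF that(1-3)]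
    have le: "i < j \<Longrightarrow> rb i \<le> la j \<and> la j \<le> j \<and> i < rb i" if "i \<in> J ` M" "j \<in> J ` M" for i j
      using separated_le[OF sep] separated_bound[OF sep] Jj that by blast
    consider "J t' < J s" | "J t' = J s" | "J s < J t'" "J t' < J t" | "J t' = J t" | "J t < J t'" by linarith
    then show ?thesis
    proof cases
      case 1
      then have "rb (J t') \<le> la (J s)" using le that by blast
      then show ?thesis using B that(3) by linarith
    next
      case 2
      then have "rb (J t') = rb (J s)" by simp
      then show ?thesis using B that(3) by linarith
    next
      case 3
      then have "rb (J s) \<le> la (J t') \<and> la (J t') \<le> J t' \<and> J s < rb (J s)"
        "rb (J t') \<le> la (J t) \<and> la (J t) \<le> J t \<and> J t' < rb (J t')" using le that by blast+
      then show ?thesis using B that(3) by linarith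
    next
      case 4
      then have "la (J t') = la (J t)" by simp
      then show ?thesis using B that(3) by linarith
    next
      case 5
      then have "rb (J t) \<le> la (J t') \<and> la (J t') \<le> J t' \<and> J t < rb (J t)" using le that by blast
      then show ?thesis using B that(3) by linarith
    qed
  qed
  have setf: "set (filter (\<lambda>s. s \<in> Z) xs) = Z" if "Z \<subseteq> M" for Z using that xsM by auto
  have pres: "R (?Th Z k)" if "Z \<subseteq> M" "\<And>t k. t \<in> Z \<Longrightarrow> R k \<Longrightarrow> R (t k)" "R k" for Z R k
    unfolding xs(3)[OF that(1)] by (rule oprod_preserves) (use that setf in auto)
  have moves: "?Th Z d \<noteq> d" if "Z \<subseteq> M" "t \<in> Z" "t d \<noteq> d" "\<And>s. s \<in> Z \<Longrightarrow> s \<noteq> t \<Longrightarrow> s d = d" for Z t d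
    unfolding xs(3)[OF that(1)]
  proof (rule oprod_moves[of _ t])
    show "inj s" if "s \<in> set (filter (\<lambda>s. s \<in> Z) xs)" for s
    proof -
      have "s \<in> M" using that setf \<open>Z \<subseteq> M\<close> by auto
      then show ?thesis using te[of s] by (metis inj_transpose)
    qed
  qed (use that setf[OF that(1)] xs(1) in auto)
  have remove: "\<exists>r. transp r \<and> ?Th Z = r \<circ> ?Th (Z - {t})" if "Z \<subseteq> M" "t \<in> Z" for Z t
  proof -
    have "Z - {t} \<subseteq> M" using that by blast
    then show ?thesis unfolding xs(3)[OF that(1)] xs(3)[OF \<open>Z - {t} \<subseteq> M\<close>]
      by (intro oprod_remove xs(1)) (use that xsM tr in auto)
  qed
  have ThS: "?Th Z \<in> Sym n" for Z
  proof -
    have "?Th Z permutes {1..bd rb js}" by (rule Theta_permutes[OF sep])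
    moreover have "bd rb js \<le> n" using sep by (cases js) auto
    ultimately show ?thesis using permutes_subset[of "?Th Z" "{1..bd rb js}" "{1..n}"] by simp
  qed
  have canc: "a = b" if "a \<circ> ?Th Z = b \<circ> ?Th Z" for a b :: perm and Z
  proof -
    have "a \<circ> (?Th Z \<circ> inv (?Th Z)) = b \<circ> (?Th Z \<circ> inv (?Th Z))" using that by (metis comp_assoc)
    then show ?thesis using permutes_inv_o(1)[of "?Th Z"] ThS[of Z] by simp
  qed
  show ?thesis
    using Z
  proof (induction "card Z" arbitrary: Z rule: less_induct)
    case less
    note ZM = less.prems
    have finZ: "finite Z" using ZM cD(1) finite_subset by blast
    consider "card Z = 0" | "card Z = 1" | "card Z = 2" | "3 \<le> card Z" by linarith
    then show "g Z = ?Th Z"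
    proof cases
      case 1
      then have "Z = {}" using finZ by simp
      then show ?thesis using cube(2) Theta_outside[of "{}"] by simp
    next
      case 2
      then obtain t where t: "Z = {t}" by (auto simp: card_1_singleton_iff)
      then show ?thesis using cD(5) Theta_singleton[OF sep, of t] ZM M(1) by auto
    next
      case 3
      have main: ?thesis if tt: "t \<in> M" "t' \<in> M" "Z = {t, t'}" "lo t < lo t'" "hi t < hi t'" for t t'
      proof -
        have ne: "t \<noteq> t'" using tt by auto
        have gz: "g Z = t \<circ> t' \<or> g Z = t' \<circ> t"
          using cube_pair[OF cube(1), of t id t'] tt tr ne cube(2) id_Sym by simp
        have gv: "bruhat_le n (g Z) v" by (rule cD(3)[OF ZM])
        show ?thesis
        proof (cases "hi t = lo t'")
          case False
          have "transpose a b \<circ> transpose c d = transpose c d \<circ> transpose a b"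
            if "a \<noteq> c" "a \<noteq> d" "b \<noteq> c" "b \<noteq> d" for a b c d :: nat
            using that by (simp add: fun_eq_iff transpose_def)
          from this[of "lo t" "lo t'" "hi t'" "hi t"]
          have "transpose (lo t) (hi t) \<circ> transpose (lo t') (hi t') = transpose (lo t') (hi t') \<circ> transpose (lo t) (hi t)"
            using False tt(4,5) bnd(2)[OF tt(1)] bnd(2)[OF tt(2)] by simp
          then have "t \<circ> t' = t' \<circ> t" using te[OF tt(1)] te[OF tt(2)] by metis
          moreover have "?Th Z = t \<circ> t' \<or> ?Th Z = t' \<circ> t"
          proof -
            have "J t < J t' \<or> J t = J t' \<or> J t' < J t" by linarith
            then show ?thesis
            proof (elim disjE)
              assume "J t < J t'"
              then show ?thesis
                using Theta_pair[OF sep Jj[OF tt(1)] Jj[OF tt(2)] _ JC[OF tt(1)] JC[OF tt(2)]] tt(3) by auto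
            next
              assume "J t' < J t"
              then show ?thesis
                using Theta_pair[OF sep Jj[OF tt(2)] Jj[OF tt(1)] _ JC[OF tt(2)] JC[OF tt(1)]] tt(3)
                by (auto simp: insert_commute)
            next
              assume "J t = J t'"
              have fl: "set (filter (\<lambda>s. s \<in> Z) xs) = {t, t'}" "distinct (filter (\<lambda>s. s \<in> Z) xs)"
                using setf[OF ZM] tt(3) xs(1) by auto
              then have "length (filter (\<lambda>s. s \<in> Z) xs) = 2" using distinct_card[of "filter (\<lambda>s. s \<in> Z) xs"] ne by simp
              then obtain a b where ab: "filter (\<lambda>s. s \<in> Z) xs = [a, b]"
                by (auto simp: numeral_2_eq_2 length_Suc_conv)
              then have "a = t \<and> b = t' \<or> a = t' \<and> b = t" using fl by (auto simp: doubleton_eq_iff)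
              then show ?thesis unfolding xs(3)[OF ZM] ab by auto
            qed
          qed
          ultimately show ?thesis using gz by auto
        next
          case True
          note tc = touch[OF tt(1,2) True]
          have th: "?Th Z = (if rg (J t') then t \<circ> t' else t' \<circ> t)"
            unfolding tt(3) by (rule Theta_pair[OF sep Jj[OF tt(1)] Jj[OF tt(2)] _ JC[OF tt(1)] JC[OF tt(2)]]) (use tc in simp)
          \<comment> \<open>The two orders now differ. The wrong one would put an arc over
            \<open>J t .. J t' + 1\<close> into an element below \<open>v\<close>, which is exactly
            what \<open>ord\<close> excludes.\<close>
          have or: "if rg (J t') then \<not> up v (J t) (Suc (J t')) else \<not> up (inv v) (J t) (Suc (J t'))"
            by (rule ord) (use tc Jj tt in auto)
          have gS: "g Z \<in> Sym n" using gv bruhat_le_Sym by blast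
          show ?thesis
          proof (cases "rg (J t')")
            case rgt: True
            have "g Z \<noteq> t' \<circ> t"
            proof
              assume "g Z = t' \<circ> t"
              then have "g Z (lo t) = hi t'" using movd(1)[OF tt(1)] movd(1)[OF tt(2)] True by simp
              then have "up (g Z) (lo t) (hi t')" using bnd[OF tt(1)] by (intro upI[of "lo t"]) auto
              then have "up (g Z) (J t) (Suc (J t'))" by (rule up_weaken) (use b2[OF tt(1)] b3[OF tt(2)] in auto)
              then show False using up_mono[OF gv] or rgt by auto
            qed
            then show ?thesis using gz th rgt by simp
          next
            case rgf: False
            have "g Z \<noteq> t \<circ> t'"
            proof
              assume "g Z = t \<circ> t'"
              then have "g Z (hi t') = lo t" using movd(2)[OF tt(1)] movd(2)[OF tt(2)] True by simp
              then have "up (inv (g Z)) (J t) (Suc (J t'))"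
                unfolding dn_iff[OF gS] using b2[OF tt(1)] b3[OF tt(2)] bnd[OF tt(1)] by (intro exI[of _ "hi t'"]) auto
              then show False using dn_mono[OF gv] or rgf by auto
            qed
            then show ?thesis using gz th rgf by simp
          qed
        qed
      qed
      obtain t t' where tt: "Z = {t, t'}" "t \<noteq> t'" using 3 by (auto simp: card_2_iff)
      then have "t \<in> M" "t' \<in> M" using ZM by auto
      from tri[OF this tt(2)] show ?thesis
      proof
        assume "lo t < lo t' \<and> hi t < hi t'"
        then show ?thesis using main[OF \<open>t \<in> M\<close> \<open>t' \<in> M\<close>] tt by blast
      next
        assume "lo t' < lo t \<and> hi t' < hi t"
        moreover have "Z = {t', t}" using tt by blast
        ultimately show ?thesis using main[OF \<open>t' \<in> M\<close> \<open>t \<in> M\<close>] by blast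
      qed
    next
      case 4
      show ?thesis
      proof (rule ccontr)
        assume neq: "g Z \<noteq> ?Th Z"
        have subM: "Z - {t} \<subseteq> M" for t using ZM by blast
        have IH: "g (Z - {t}) = ?Th (Z - {t})" if "t \<in> Z" for t
          by (rule less.hyps[OF card_Diff1_less[OF finZ that] subM])
        \<comment> \<open>The quotient of the two candidate tops. Since all facets agree by
          induction, it is a product of two transpositions in one way for each \<open>t\<close> in
          \<open>Z\<close>.\<close>
        define u where "u = g Z \<circ> inv (?Th Z)"
        have uT: "u \<circ> ?Th Z = g Z"
          unfolding u_def using permutes_inv_o(2)[of "?Th Z"] ThS[of Z] by (simp add: comp_assoc)
        have uid: "u \<noteq> id" using uT neq by auto
        have "\<forall>t\<in>Z. \<exists>r. transp r \<and> ?Th Z = r \<circ> ?Th (Z - {t})" using remove[OF ZM] by blast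
        from bchoice[OF this] obtain r where r: "\<And>t. t \<in> Z \<Longrightarrow> transp (r t)" "\<And>t. t \<in> Z \<Longrightarrow> ?Th Z = r t \<circ> ?Th (Z - {t})"
          by blast
        have ex: "\<exists>s. transp s \<and> u = s \<circ> r t" if t: "t \<in> Z" for t
        proof -
          have "(g (Z - {t}), g (insert t (Z - {t}))) \<in> bruhat_graph n"
            by (rule cD(4)[OF subM]) (use t ZM in auto)
          moreover have "insert t (Z - {t}) = Z" using t by blast
          ultimately obtain s where s: "transp s" "g Z = s \<circ> ?Th (Z - {t})"
            using edge_transp IH[OF t] by metis
          have "u \<circ> r t \<circ> ?Th (Z - {t}) = s \<circ> ?Th (Z - {t})"
            using uT s(2) r(2)[OF t] by (simp only: comp_assoc)
          then have "u \<circ> r t = s" by (rule canc)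
          then have "u \<circ> (r t \<circ> r t) = s \<circ> r t" by (simp only: comp_assoc[symmetric])
          then show ?thesis using transp_self[OF r(1)[OF t]] s(1) by auto
        qed
        have rfix: "r t d = d" if "t \<in> Z" "u d = d" for t d
          using ex[OF that(1)] transp_moved[OF r(1)[OF that(1)]] uid that(2) by metis
        have ThD: "?Th (Z - {t}) (inv (?Th Z) d) = d" if "t \<in> Z" "u d = d" for t d
        proof -
          have "?Th Z (inv (?Th Z) d) = d" using Sym_inv_apply(2)[OF ThS[of Z]] .
          then have "r t (?Th (Z - {t}) (inv (?Th Z) d)) = d" using fun_cong[OF r(2)[OF that(1)], of "inv (?Th Z) d"] by simp
          then have "r t (r t (?Th (Z - {t}) (inv (?Th Z) d))) = d" using rfix[OF that] by simp
          then show ?thesis using fun_cong[OF transp_self[OF r(1)[OF that(1)]]] by simp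
        qed
        have ThI: "a = b" if "?Th Y a = ?Th Y b" for Y a b using that Sym_inj[OF ThS[of Y]] by blast
        have single: "u d \<noteq> d" if t: "t \<in> Z" "t d \<noteq> d" "\<And>s. s \<in> Z \<Longrightarrow> s \<noteq> t \<Longrightarrow> s d = d" for t d
        proof
          assume ud: "u d = d"
          have "?Th (Z - {t}) d = d"
            by (rule pres[OF subM, where R = "\<lambda>k. k = d"]) (use t in auto)
          then have "inv (?Th Z) d = d" using ThI ThD[OF t(1) ud] by metis
          then have "?Th Z d = d" using Sym_inv_apply(2)[OF ThS[of Z], of d] by metis
          moreover have "?Th Z d \<noteq> d" by (rule moves[OF ZM t(1,2)]) (use t(3) in blast)
          ultimately show False by blast
        qed
        have lom: "u (lo t) \<noteq> lo t" if t: "t \<in> Z" for t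
        proof (cases "\<exists>s\<in>Z. hi s = lo t")
          case False
          have tM: "t \<in> M" using t ZM by blast
          show ?thesis
          proof (rule single[OF t])
            show "t (lo t) \<noteq> lo t" using movd(1)[OF tM] bnd[OF tM] by simp
            fix s assume "s \<in> Z" "s \<noteq> t"
            then show "s (lo t) = lo t" using fixd[of s "lo t"] tri[of s t] tM ZM False by (metis less_irrefl subsetD)
          qed
        next
          case True
          then obtain s where s: "s \<in> Z" "hi s = lo t" by blast
          have tM: "t \<in> M" "s \<in> M" using t s ZM by auto
          have st: "s \<noteq> t" using s(2) bnd[OF tM(1)] by auto
          show ?thesis
          proof
            assume ud: "u (lo t) = lo t"
            \<comment> \<open>A letter shared by \<open>s\<close> and \<open>t\<close>. Without
              \<open>t\<close> the product preserves the letters above it, without \<open>s\<close>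
              those below it, so its preimage could only be the letter itself; but without
              \<open>t\<close>, the reflection \<open>s\<close> moves it.\<close>
            let ?d = "lo t" and ?k = "inv (?Th Z) (lo t)"
            have strad: "hi t' < ?d \<or> ?d \<le> lo t'" if "t' \<in> Z" "t' \<noteq> s" for t'
              using straddle[OF tM(2,1) s(2), of t'] tri[of t' s] that tM ZM s(2) by (metis nat_less_le subsetD)
            have strad': "hi t' \<le> ?d \<or> ?d < lo t'" if "t' \<in> Z" "t' \<noteq> t" for t'
              using straddle[OF tM(2,1) s(2), of t'] tri[of t' t] that tM ZM by (metis nat_less_le subsetD)
            have step: "t' k = k \<or> k = lo t' \<and> t' k = hi t' \<or> k = hi t' \<and> t' k = lo t'" if "t' \<in> M" for t' k
              using fixd[OF that, of k] movd[OF that] by blast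
            have "\<not> ?d < ?k"
            proof
              assume "?d < ?k"
              have "?d < ?Th (Z - {t}) ?k"
              proof (rule pres[OF subM, where R = "\<lambda>k. ?d < k"])
                fix t' k assume "t' \<in> Z - {t}" "?d < k"
                then show "?d < t' k" using strad'[of t'] step[of t' k] bnd[of t'] ZM by fastforce
              qed fact
              then show False using ThD[OF t ud] by simp
            qed
            moreover have "\<not> ?k < ?d"
            proof
              assume "?k < ?d"
              have "?Th (Z - {s}) ?k < ?d"
              proof (rule pres[OF subM, where R = "\<lambda>k. k < ?d"])
                fix t' k assume "t' \<in> Z - {s}" "k < ?d"
                then show "t' k < ?d" using strad[of t'] step[of t' k] bnd[of t'] ZM by fastforce
              qed fact
              then show False using ThD[OF s(1) ud] by simp
            qed
            ultimately have "?k = ?d" by simp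
            then have "?Th (Z - {t}) ?d = ?d" using ThD[OF t ud] by simp
            moreover have "?Th (Z - {t}) ?d \<noteq> ?d"
            proof (rule moves[OF subM, of s])
              show "s \<in> Z - {t}" using s st by simp
              show "s ?d \<noteq> ?d" using movd(2)[OF tM(2)] bnd[OF tM(2)] s(2) by simp
              fix s' assume s': "s' \<in> Z - {t}" "s' \<noteq> s"
              then have "s' \<in> M" "s' \<noteq> t" using ZM by auto
              then show "s' ?d = ?d"
                using fixd[of s' ?d] tri[of s' t] tri[of s' s] tM s' s(2) by (metis less_irrefl)
            qed
            ultimately show False by simp
          qed
        qed
        have Zne: "Z \<noteq> {}" using 4 by auto
        have "Max (hi ` Z) \<in> hi ` Z" by (rule Max_in) (use finZ Zne in auto)
        then obtain t1 where t1: "t1 \<in> Z" "hi t1 = Max (hi ` Z)" by auto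
        have t1M: "t1 \<in> M" using t1 ZM by blast
        have max: "hi s \<le> hi t1" if "s \<in> Z" for s unfolding t1(2) by (rule Max_ge) (use finZ that in auto)
        have lomax: "lo s < hi t1" if "s \<in> Z" for s using max[OF that] bnd(2)[of s] that ZM by (meson less_le_trans subsetD)
        have him: "u (hi t1) \<noteq> hi t1"
        proof (rule single[OF t1(1)])
          show "t1 (hi t1) \<noteq> hi t1" using movd(2)[OF t1M] bnd[OF t1M] by simp
          fix s assume s: "s \<in> Z" "s \<noteq> t1"
          then show "s (hi t1) = hi t1" using fixd[of s "hi t1"] tri[of s t1] t1M ZM lomax[OF s(1)] by (metis less_irrefl subsetD)
        qed
        obtain a b c d where ab: "a \<noteq> b" "c \<noteq> d" "r t1 = transpose c d" "u = transpose a b \<circ> transpose c d"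
          using ex[OF t1(1)] r(1)[OF t1(1)] unfolding transp_def by metis
        \<comment> \<open>All lower ends and the largest upper end are moved by \<open>u\<close>.
          With at least three reflections these are at least four letters, so the two transpositions
          composing \<open>u\<close> are disjoint.\<close>
        have "insert (hi t1) (lo ` Z) \<subseteq> {a, b, c, d}"
        proof -
          have "u e = e" if "e \<notin> {a, b, c, d}" for e using that ab(4) by (simp add: transpose_apply_other)
          then show ?thesis using lom him by blast
        qed
        then have "card (insert (hi t1) (lo ` Z)) \<le> card {a, b, c, d}" by (intro card_mono) auto
        moreover have "hi t1 \<notin> lo ` Z" using lomax by (metis imageE less_irrefl)
        then have "card (insert (hi t1) (lo ` Z)) = Suc (card (lo ` Z))"
          using finZ by (intro card_insert_disjoint) auto
        moreover have "card (lo ` Z) = card Z"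
        proof (rule card_image, rule inj_onI)
          fix s t assume "s \<in> Z" "t \<in> Z" "lo s = lo t"
          then show "s = t" using tri[of s t] ZM by auto
        qed
        ultimately have "4 \<le> card {a, b, c, d}" using 4 by simp
        then have dist: "a \<noteq> c" "a \<noteq> d" "b \<noteq> c" "b \<noteq> d" using ab(1,2) by (auto simp: card_insert_if split: if_splits)
        have "r t = transpose a b \<or> r t = transpose c d" if t: "t \<in> Z" for t
        proof -
          obtain s where s: "transp s" "u = s \<circ> r t" using ex[OF t] by blast
          show ?thesis by (rule double_transp_factor[OF ab(1,2) dist r(1)[OF t] s(1)]) (use s(2) ab(4) in simp)
        qed
        \<comment> \<open>Only two labels are possible, yet \<open>r t\<close> determines the facet
          \<open>g (Z - {t})\<close>, so different reflections need different labels.\<close>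
        then have "r ` Z \<subseteq> {transpose a b, transpose c d}" by blast
        then have "card (r ` Z) \<le> card {transpose a b, transpose c d}" by (intro card_mono) auto
        also have "\<dots> \<le> 2" by (simp add: card_insert_if)
        finally have "card (r ` Z) \<le> 2" .
        moreover have "card (r ` Z) = card Z"
        proof (rule card_image, rule inj_onI)
          fix s t assume st: "s \<in> Z" "t \<in> Z" "r s = r t"
          have "r s \<circ> ?Th Z = ?Th (Z - {s})" if "s \<in> Z" for s
            using r(2)[OF that] transp_self[OF r(1)[OF that]] by (metis comp_assoc id_comp)
          then have "g (Z - {s}) = g (Z - {t})" using st IH by metis
          then have "Z - {s} = Z - {t}" by (rule inj_onD[OF cD(2)]) (use ZM in auto)
          then show "s = t" using st by blast
        qed
        ultimately show False using 4 by simp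
      qed
    qed
  qed
qed

lemma Cs_crossing:
  assumes "separated n v la rb rg js" "j \<in> set js" "transpose c d \<in> Cs la rb js" "c \<le> j" "j < d"
  shows "transpose c d \<in> Cset (la j) j (rb j)" "la j \<le> c" "d \<le> rb j" "d = Suc j \<or> c = j"
proof -
  obtain k where k: "k \<in> set js" "transpose c d \<in> Cset (la k) k (rb k)" using assms(3) by (auto simp: Cs_def)
  have bk: "la k \<le> k" "k < rb k" using separated_bound[OF assms(1) k(1)] by auto
  obtain c' d' where cd: "transpose c d = transpose c' d'" "la k \<le> c'" "c' \<le> k" "k < d'" "d' \<le> rb k" "d' = Suc k \<or> c' = k"
    using CsetE[OF k(2) bk] by metis
  have "c = c' \<and> d = d'" using cd(1,3,4) assms(4,5) transpose_eq_iff'[of c d c' d'] by simp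
  then have e: "c' = c" "d' = d" by simp_all
  have bj: "la j \<le> j" "j < rb j" using separated_bound[OF assms(1,2)] by auto
  have kj: "k = j"
  proof (rule ccontr)
    assume "k \<noteq> j"
    then consider "k < j" | "j < k" by linarith
    then show False
    proof cases
      case 1
      then have "rb k \<le> la j" using separated_le[OF assms(1) k(1) assms(2)] by blast
      then show False using cd(5) e assms(5) bj by linarith
    next
      case 2
      then have "rb j \<le> la k" using separated_le[OF assms(1,2) k(1)] by blast
      then show False using cd(2) e assms(4) bj by linarith
    qed
  qed
  show "transpose c d \<in> Cset (la j) j (rb j)" using k(2) unfolding kj .
  show "la j \<le> c" "d \<le> rb j" "d = Suc j \<or> c = j" using cd(2,5,6) unfolding kj e .
qed

lemma Theta_cong':
  "(\<And>j. j \<in> set js \<Longrightarrow> theta (la j) j (rb j) Y = theta (la j) j (rb j) Y') \<Longrightarrow>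
    Theta la rb rg js Y = Theta la rb rg js Y'"
proof (induction js)
  case (Cons j js)
  have "Theta la rb rg js Y = Theta la rb rg js Y'" by (rule Cons.IH) (use Cons.prems in simp)
  moreover have "theta (la j) j (rb j) Y = theta (la j) j (rb j) Y'" by (rule Cons.prems) simp
  ultimately show "Theta la rb rg (j # js) Y = Theta la rb rg (j # js) Y'" by (simp only: Theta.simps)
qed (simp only: Theta.simps)

text \<open>Each factor depends only on the outermost members of its two legs. These are maximal in
  \<open>Y\<close>, because a larger reflection also crosses \<open>j\<close> and then belongs to
  the same hook.\<close>

lemma Theta_maximal:
  assumes sep: "separated n v la rb rg js" and Y: "Y \<subseteq> Cs la rb js"
  shows "Theta la rb rg js (bruhat_maximal n Y) = Theta la rb rg js Y"
proof (rule Theta_cong')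
  fix j assume j: "j \<in> set js"
  let ?M = "bruhat_maximal n Y"
  note b = separated_bound[OF sep j]
  have MY: "?M \<subseteq> Y" by (auto simp: bruhat_maximal_def)
  have maxI: "transpose c d \<in> ?M"
    if cd: "transpose c d \<in> Y" "1 \<le> c" "c \<le> j" "j < d"
      and only: "\<And>c' d'. transpose c' d' \<in> Y \<Longrightarrow> c' \<le> c \<Longrightarrow> d \<le> d' \<Longrightarrow> d' = Suc j \<or> c' = j \<Longrightarrow> c' = c \<and> d' = d" for c d
    unfolding bruhat_maximal_def
  proof (intro CollectI conjI notI)
    assume "\<exists>y'\<in>Y. bruhat_less n (transpose c d) y'"
    then obtain y where y: "y \<in> Y" "bruhat_le n (transpose c d) y" "transpose c d \<noteq> y"
      by (auto simp: bruhat_less_def)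
    obtain k where k: "k \<in> set js" "y \<in> Cset (la k) k (rb k)" using y(1) Y by (auto simp: Cs_def)
    have bk: "la k \<le> k" "k < rb k" using separated_bound[OF sep k(1)] by auto
    obtain c' d' where cd': "y = transpose c' d'" "c' < d'" using CsetE[OF k(2) bk] by (metis le_less_trans)
    have le: "c' \<le> c" "d \<le> d'" using transpose_leD[of n c d c' d'] y(2) cd cd' by auto
    have "d' = Suc j \<or> c' = j" using Cs_crossing(4)[OF sep j, of c' d'] y(1) Y cd' le cd by auto
    then have "c' = c \<and> d' = d" using only y(1) cd' le by blast
    then show False using y(3) cd'(1) by simp
  qed (rule cd(1))
  have finl: "finite (lft (la j) j Y)" "finite (rgtm j (rb j) Y)" by (simp_all add: lft_def rgtm_def)
  have L: "lft (la j) j ?M \<subseteq> lft (la j) j Y" and R: "rgtm j (rb j) ?M \<subseteq> rgtm j (rb j) Y"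
    using MY by (auto simp: lft_def rgtm_def)
  have crl: "m \<in> lft (la j) j Y" if "transpose m (Suc j) \<in> Y" "m < j" for m
    using Cs_crossing(2)[OF sep j, of m "Suc j"] that Y by (auto simp: lft_def)
  have crr: "m \<in> rgtm j (rb j) Y" if "transpose j m \<in> Y" "j + 2 \<le> m" for m
    using Cs_crossing(3)[OF sep j, of j m] that Y by (auto simp: rgtm_def)
  have Lmin: "tmin (lft (la j) j ?M) (Suc j) = tmin (lft (la j) j Y) (Suc j) \<and> (lft (la j) j ?M = {} \<longleftrightarrow> lft (la j) j Y = {})"
  proof (cases "lft (la j) j Y = {}")
    case True
    then show ?thesis using L by simp
  next
    case False
    let ?m = "Min (lft (la j) j Y)"
    have m: "?m \<in> lft (la j) j Y" using finl(1) False by simp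
    then have m': "la j \<le> ?m" "?m < j" "transpose ?m (Suc j) \<in> Y" unfolding lft_def by simp_all
    have "transpose ?m (Suc j) \<in> ?M"
    proof (rule maxI)
      fix c' d' assume *: "transpose c' d' \<in> Y" "c' \<le> ?m" "Suc j \<le> d'" "d' = Suc j \<or> c' = j"
      then have "d' = Suc j" "c' < j" using m' by auto
      then have "c' \<in> lft (la j) j Y" using crl * by blast
      then have "?m \<le> c'" using finl(1) by simp
      then show "c' = ?m \<and> d' = Suc j" using * \<open>d' = Suc j\<close> by simp
    qed (use m' b in auto)
    then have mM: "?m \<in> lft (la j) j ?M" using m' by (simp add: lft_def)
    moreover have "Min (lft (la j) j ?M) = ?m"
      by (rule Min_eqI) (use mM L finl finite_subset in auto)
    ultimately show ?thesis using False by (auto simp: tmin_def)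
  qed
  have Rmax: "tmax (rgtm j (rb j) ?M) j = tmax (rgtm j (rb j) Y) j \<and> (rgtm j (rb j) ?M = {} \<longleftrightarrow> rgtm j (rb j) Y = {})"
  proof (cases "rgtm j (rb j) Y = {}")
    case True
    then show ?thesis using R by simp
  next
    case False
    let ?m = "Max (rgtm j (rb j) Y)"
    have m: "?m \<in> rgtm j (rb j) Y" using finl(2) False by simp
    then have m': "j + 2 \<le> ?m" "?m \<le> rb j" "transpose j ?m \<in> Y" unfolding rgtm_def by simp_all
    have "transpose j ?m \<in> ?M"
    proof (rule maxI)
      fix c' d' assume *: "transpose c' d' \<in> Y" "c' \<le> j" "?m \<le> d'" "d' = Suc j \<or> c' = j"
      then have "c' = j" "j + 2 \<le> d'" using m' by auto
      then have "d' \<in> rgtm j (rb j) Y" using crr * by blast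
      then have "d' \<le> ?m" using finl(2) by simp
      then show "c' = j \<and> d' = ?m" using * \<open>c' = j\<close> by simp
    qed (use m' b in auto)
    then have mM: "?m \<in> rgtm j (rb j) ?M" using m' by (simp add: rgtm_def)
    moreover have "Max (rgtm j (rb j) ?M) = ?m"
      by (rule Max_eqI) (use mM R finl finite_subset in auto)
    ultimately show ?thesis using False by (auto simp: tmax_def)
  qed
  have "adj j \<in> ?M \<longleftrightarrow> adj j \<in> Y" if e: "lft (la j) j Y = {}" "rgtm j (rb j) Y = {}"
  proof
    assume a: "adj j \<in> Y"
    show "adj j \<in> ?M"
    proof (rule maxI[OF a])
      fix c' d' assume *: "transpose c' d' \<in> Y" "c' \<le> j" "Suc j \<le> d'" "d' = Suc j \<or> c' = j"
      show "c' = j \<and> d' = Suc j"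
      proof (rule ccontr)
        assume n: "\<not> ?thesis"
        then consider "c' < j" "d' = Suc j" | "c' = j" "j + 2 \<le> d'" using * by linarith
        then show False using crl[of c'] crr[of d'] * e by cases auto
      qed
    qed (use b in auto)
  qed (use MY in blast)
  then show "theta (la j) j (rb j) ?M = theta (la j) j (rb j) Y"
    unfolding theta_def using Lmin Rmax by auto
qed

end

section \<open>The expansion over the hypercube cluster at the identity\<close>

context hd
begin

definition rb :: "nat \<Rightarrow> nat" where
  "rb i = Max {b. i < b \<and> b \<le> n \<and> bruhat_le n (transpose i b) v}"

definition la :: "nat \<Rightarrow> nat" where
  "la j = Min {a. 1 \<le> a \<and> a \<le> j \<and> bruhat_le n (transpose a (Suc j)) v}"

text \<open>Records which order of two touching reflections remains below \<open>v\<close>; by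
  \<open>not_both\<close> and \<open>touching\<close> exactly one of the two arcs is present, so the
  choice is consistent.\<close>

definition rg :: "nat \<Rightarrow> bool" where
  "rg j \<longleftrightarrow> (\<exists>i\<in>D. i < j \<and> rb i = la j \<and> up (inv v) i (Suc j))"

definition js :: "nat list" where
  "js = rev (sorted_list_of_set D)"

lemma finite_D: "finite D"
  by (rule finite_subset[of _ "{..n}"]) (auto simp: D_def)

lemma rb_props:
  assumes "i \<in> D"
  shows "i < rb i" "rb i \<le> n" "bruhat_le n (transpose i (rb i)) v"
    "\<And>b. i < b \<Longrightarrow> b \<le> n \<Longrightarrow> bruhat_le n (transpose i b) v \<Longrightarrow> b \<le> rb i"
proof -
  let ?S = "{b. i < b \<and> b \<le> n \<and> bruhat_le n (transpose i b) v}"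
  have fin: "finite ?S" by (rule finite_subset[of _ "{..n}"]) auto
  have "Suc i \<in> ?S" using assms by (auto simp: D_def)
  then have "Max ?S \<in> ?S" using fin by (intro Max_in) auto
  then show "i < rb i" "rb i \<le> n" "bruhat_le n (transpose i (rb i)) v" by (simp_all add: rb_def)
  show "b \<le> rb i" if "i < b" "b \<le> n" "bruhat_le n (transpose i b) v" for b
    unfolding rb_def by (rule Max_ge[OF fin]) (use that in simp)
qed

lemma la_props:
  assumes "j \<in> D"
  shows "1 \<le> la j" "la j \<le> j" "bruhat_le n (transpose (la j) (Suc j)) v"
    "\<And>a. 1 \<le> a \<Longrightarrow> a \<le> j \<Longrightarrow> bruhat_le n (transpose a (Suc j)) v \<Longrightarrow> la j \<le> a"
proof -
  let ?S = "{a. 1 \<le> a \<and> a \<le> j \<and> bruhat_le n (transpose a (Suc j)) v}"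
  have fin: "finite ?S" by (rule finite_subset[of _ "{..j}"]) auto
  have "j \<in> ?S" using assms by (auto simp: D_def)
  then have "Min ?S \<in> ?S" using fin by (intro Min_in) auto
  then show "1 \<le> la j" "la j \<le> j" "bruhat_le n (transpose (la j) (Suc j)) v" by (simp_all add: la_def)
  show "la j \<le> a" if "1 \<le> a" "a \<le> j" "bruhat_le n (transpose a (Suc j)) v" for a
    unfolding la_def by (rule Min_le[OF fin]) (use that in simp)
qed

section \<open>Relative position of the hooks\<close>

lemma no_span:
  assumes "i \<in> D" "j \<in> D" "i < j"
  shows "\<not> bruhat_le n (transpose i (Suc j)) v"
  using no_chain[of i j "Suc j"] crossing_transpose_notin[OF assms(1), of i j]
    crossing_transpose_notin[OF assms(2), of j "Suc j"] D_range[OF assms(1)] D_range[OF assms(2)] assms(3)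
  by auto

text \<open>By transitivity it suffices to compare neighbouring indices of \<open>D\<close>. An
  overlap of their ranges is the configuration ruled out by \<open>no_overlap\<close>.\<close>

lemma rb_le_la:
  assumes "i \<in> D" "j \<in> D" "i < j"
  shows "rb i \<le> la j"
  using assms
proof (induction "j - i" arbitrary: i j rule: less_induct)
  case less
  note ri = rb_props[OF less.prems(1)] and lj = la_props[OF less.prems(2)]
  note Di = D_range[OF less.prems(1)] and Dj = D_range[OF less.prems(2)]
  show ?case
  proof (cases "\<exists>k\<in>D. i < k \<and> k < j")
    case True
    then obtain k where k: "k \<in> D" "i < k" "k < j" by blast
    have "rb i \<le> la k" by (rule less.hyps[OF _ less.prems(1) k(1,2)]) (use k in simp)
    moreover have "rb k \<le> la j" by (rule less.hyps[OF _ k(1) less.prems(2) k(3)]) (use k in simp)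
    ultimately show ?thesis using la_props(2)[OF k(1)] rb_props(1)[OF k(1)] by simp
  next
    case False
    show ?thesis
    proof (rule ccontr)
      assume "\<not> rb i \<le> la j"
      note nsp = no_span[OF less.prems]
      have 1: "i < la j"
      proof (rule ccontr)
        assume "\<not> i < la j"
        then have "bruhat_le n (transpose i (Suc j)) (transpose (la j) (Suc j))"
          using lj less.prems(3) Dj by (intro transpose_le_transpose) auto
        then show False using nsp bruhat_trans[OF _ lj(3)] by blast
      qed
      have 2: "rb i < Suc j"
      proof (rule ccontr)
        assume "\<not> rb i < Suc j"
        then have "bruhat_le n (transpose i (Suc j)) (transpose i (rb i))"
          using ri less.prems(3) Di by (intro transpose_le_transpose) auto
        then show False using nsp bruhat_trans[OF _ ri(3)] by blast
      qed
      \<comment> \<open>The letter before the end of the range of \<open>i\<close>. It lies strictly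
        between \<open>i\<close> and \<open>j\<close>, hence outside \<open>D\<close>, as
        \<open>no_overlap\<close> requires.\<close>
      define q where "q = rb i - 1"
      have q: "rb i = Suc q" "la j \<le> q" using \<open>\<not> rb i \<le> la j\<close> by (auto simp: q_def)
      have qD: "q \<notin> D" using False 1 2 q by auto
      have "bruhat_le n (transpose q (Suc j)) (transpose (la j) (Suc j))"
        using lj q 2 Dj by (intro transpose_le_transpose) auto
      then have qs: "bruhat_le n (transpose q (Suc j)) v" using bruhat_trans[OF _ lj(3)] by blast
      show False
        by (rule no_overlap[of i q "rb i" "Suc j" j]) (use Di 1 2 q qD qs ri nsp less.prems in auto)
    qed
  qed
qed

lemma not_both:
  assumes "i \<in> D" "j \<in> D" "i < j"
  shows "\<not> (up v i (Suc j) \<and> up (inv v) i (Suc j))"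
  using no_span[OF assms] transpose_le_iff[OF v, of i "Suc j"] D_range[OF assms(1)] D_range[OF assms(2)] assms(3)
  by auto

text \<open>The longest reflections of the two hooks form an antichain, and the top of their diamond
  is one of the two products; either product contains one of the arcs.\<close>

lemma touching:
  assumes "i \<in> D" "j \<in> D" "i < j" "rb i = la j"
  shows "up v i (Suc j) \<or> up (inv v) i (Suc j)"
proof -
  define b where "b = rb i"
  note ri = rb_props[OF assms(1), folded b_def] and lj = la_props[OF assms(2), folded assms(4), folded b_def]
  note Di = D_range[OF assms(1)] and Dj = D_range[OF assms(2)]
  let ?t = "transpose i b" and ?t' = "transpose b (Suc j)"
  have out: "?t \<in> outside_nbrs n id v I id" "?t' \<in> outside_nbrs n id v I id"
  proof -
    show "?t \<in> outside_nbrs n id v I id"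
      by (rule transpose_outside) (use ri Di crossing_transpose_notin[OF assms(1), of i b] in auto)
    show "?t' \<in> outside_nbrs n id v I id"
      by (rule transpose_outside) (use lj Dj crossing_transpose_notin[OF assms(2), of b "Suc j"] in auto)
  qed
  have inc: "\<not> bruhat_le n ?t ?t'" "\<not> bruhat_le n ?t' ?t"
    using transpose_leD[of n i b b "Suc j"] transpose_leD[of n b "Suc j" i b] ri lj Di by auto
  obtain g where g: "cube_on n v {?t, ?t'} g" "g {} = id"
    using cluster_cube[OF id_in_I _ antichain_pair[OF inc]] out by blast
  have z: "g {?t, ?t'} = ?t \<circ> ?t' \<or> g {?t, ?t'} = ?t' \<circ> ?t"
    using cube_pair[OF g(1), of ?t id ?t'] g(2) id_Sym transpI[of i b] transpI[of b "Suc j"] ri lj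
    by (simp add: transpose_eq_iff')
  have zv: "bruhat_le n (g {?t, ?t'}) v" by (rule cube_onD(3)[OF g(1)]) simp
  have zS: "g {?t, ?t'} \<in> Sym n" using zv bruhat_le_Sym by blast
  from z show ?thesis
  proof
    assume "g {?t, ?t'} = ?t \<circ> ?t'"
    then have "g {?t, ?t'} (Suc j) = i" by simp
    then have "up (inv (g {?t, ?t'})) i (Suc j)" unfolding dn_iff[OF zS] using Di by (intro exI[of _ "Suc j"]) simp
    then show ?thesis using dn_mono[OF zv] by blast
  next
    assume "g {?t, ?t'} = ?t' \<circ> ?t"
    then have "g {?t, ?t'} i = Suc j" by simp
    then have "up (g {?t, ?t'}) i (Suc j)" using Di by (intro upI[of i]) simp_all
    then show ?thesis using up_mono[OF zv] by blast
  qed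
qed

lemma rg_touching:
  assumes "i \<in> D" "j \<in> D" "i < j" "rb i = la j"
  shows "rg j \<longleftrightarrow> up (inv v) i (Suc j)"
proof
  assume "rg j"
  then obtain k where k: "k \<in> D" "k < j" "rb k = la j" "up (inv v) k (Suc j)" by (auto simp: rg_def)
  have "k = i"
  proof (rule ccontr)
    assume "k \<noteq> i"
    then consider "k < i" | "i < k" by linarith
    then show False
    proof cases
      case 1
      then show False
        using rb_le_la[OF k(1) assms(1)] la_props(2)[OF assms(1)] rb_props(1)[OF assms(1)] k(3) assms(4) by simp
    next
      case 2
      then show False
        using rb_le_la[OF assms(1) k(1)] la_props(2)[OF k(1)] rb_props(1)[OF k(1)] k(3) assms(4) by simp
    qed
  qed
  then show "up (inv v) i (Suc j)" using k by simp
qed (use assms in \<open>auto simp: rg_def\<close>)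

lemma up_le_n: "up w a c \<Longrightarrow> w \<in> Sym n \<Longrightarrow> a \<le> n \<Longrightarrow> c \<le> n"
  unfolding up_def using Sym_range(2) by (meson order_trans)

lemma separated_D:
  assumes "sorted_wrt (>) L" "set L \<subseteq> D"
  shows "separated n v la rb rg L"
  using assms
proof (induction L)
  case (Cons j L)
  have j: "j \<in> D" and s: "separated n v la rb rg L" using Cons by auto
  note lj = la_props[OF j] and rj = rb_props[OF j] and Dj = D_range[OF j]
  have A1: "la j \<le> c" if "1 \<le> c" "c \<le> j" "up v c (Suc j)" "up (inv v) c (Suc j)" for c
    by (rule lj(4)) (use that Dj transpose_le_iff[OF v, of c "Suc j"] in auto)
  have A2: "c \<le> rb j" if "j < c" "up v j c" "up (inv v) j c" for c
  proof -
    have "c \<le> n" by (rule up_le_n[OF that(2) v]) (use Dj in simp)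
    then show ?thesis using rj(4) that Dj transpose_le_iff[OF v, of j c] by auto
  qed
  have T: "bd rb L \<le> la j \<and> (bd rb L < la j \<or> (\<exists>i. 1 \<le> i \<and> i < la j \<and>
      (if rg j then up (inv v) i (Suc j) \<and> \<not> up v i (Suc j) else up v i (Suc j) \<and> \<not> up (inv v) i (Suc j))))"
  proof (cases L)
    case Nil
    then show ?thesis using lj by simp
  next
    case (Cons i L')
    then have i: "i \<in> D" "i < j" using Cons.prems by auto
    have le: "rb i \<le> la j" by (rule rb_le_la[OF i(1) j i(2)])
    show ?thesis
    proof (cases "rb i = la j")
      case True
      have "1 \<le> i" "i < la j" using D_range[OF i(1)] rb_props(1)[OF i(1)] True by auto
      then show ?thesis
        using not_both[OF i(1) j i(2)] touching[OF i(1) j i(2) True] rg_touching[OF i(1) j i(2) True] le Cons by auto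
    qed (use le Cons in simp)
  qed
  show ?case
    unfolding separated.simps using s lj(1,2) rj(1,2) A1 A2 T no_cover[OF j] by blast
qed simp

lemma set_js: "set js = D"
  using finite_D by (simp add: js_def)

lemma sep: "separated n v la rb rg js"
  by (rule separated_D) (use set_js finite_D in \<open>auto simp: js_def sorted_wrt_rev\<close>)

text \<open>A reflection outside \<open>I\<close> crosses some \<open>i\<close> in \<open>D\<close>.
  By \<open>no_cover\<close> it ends at \<open>i+1\<close> or starts at \<open>i\<close>, and the
  extremal choice of \<open>la\<close> and \<open>rb\<close> places it in the hook of
  \<open>i\<close>.\<close>

lemma outside_eq: "outside_nbrs n id v I id = Cs la rb js"
proof (intro set_eqI iffI)
  fix t assume "t \<in> outside_nbrs n id v I id"
  then have t: "bruhat_le n t v" "t \<notin> I" "(id, t) \<in> bruhat_graph n" by (simp_all add: outside_iff)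
  obtain a b where ab: "1 \<le> a" "a < b" "b \<le> n" "t = transpose a b"
    using bruhat_edgeE[OF t(3)] by (metis id_comp)
  obtain i where i: "i \<in> D" "up t i (Suc i)" using noncrossing_in[OF t(1)] t(2) by blast
  have ai: "a \<le> i" "i < b"
  proof -
    obtain k where k: "k \<le> i" "Suc i \<le> transpose a b k" using i(2) ab(4) by (auto simp: up_def)
    then have "k < transpose a b k" by simp
    then have "k = a" using ab(2) by (auto simp: transpose_def split: if_splits)
    then show "a \<le> i" "i < b" using k by auto
  qed
  have v': "up v a b" "up (inv v) a b" using transpose_le_iff[OF v ab(1-3)] t(1) ab(4) by auto
  have "b = Suc i \<or> a = i"
  proof (rule ccontr)
    assume "\<not> ?thesis"
    then have "a \<le> i - 1" "i + 2 \<le> b" using ai by auto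
    then show False using no_cover[OF i(1)] v' up_weaken by blast
  qed
  moreover have "la i \<le> a"
  proof (cases "a = i")
    case True
    then show ?thesis using la_props(2)[OF i(1)] by simp
  next
    case False
    then show ?thesis using calculation la_props(4)[OF i(1), of a] ab ai t(1) by auto
  qed
  moreover have "b \<le> rb i"
  proof (cases "b = Suc i")
    case True
    then show ?thesis using rb_props(1)[OF i(1)] by simp
  next
    case False
    then show ?thesis using \<open>b = Suc i \<or> a = i\<close> rb_props(4)[OF i(1), of b] ab ai t(1) by auto
  qed
  ultimately have "t \<in> Cset (la i) i (rb i)" unfolding ab(4) using ai by (intro CsetI) auto
  then show "t \<in> Cs la rb js" unfolding Cs_def set_js using i(1) by blast
next
  fix t assume "t \<in> Cs la rb js"
  then obtain i where i: "i \<in> D" "t \<in> Cset (la i) i (rb i)" unfolding Cs_def set_js by blast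
  note li = la_props[OF i(1)] and ri = rb_props[OF i(1)] and Di = D_range[OF i(1)]
  obtain a b where ab: "t = transpose a b" "la i \<le> a" "a \<le> i" "i < b" "b \<le> rb i" "b = Suc i \<or> a = i"
    using CsetE[OF i(2) li(2) ri(1)] by metis
  have "bruhat_le n t v"
  proof (cases "b = Suc i")
    case True
    have "bruhat_le n t (transpose (la i) (Suc i))"
      unfolding ab(1) True by (rule transpose_le_transpose) (use ab li Di in auto)
    then show ?thesis by (rule bruhat_trans[OF _ li(3)])
  next
    case False
    then have "bruhat_le n t (transpose i (rb i))"
      unfolding ab(1) by (intro transpose_le_transpose) (use ab ri Di in auto)
    then show ?thesis by (rule bruhat_trans[OF _ ri(3)])
  qed
  then show "t \<in> outside_nbrs n id v I id"
    unfolding ab(1)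
    by (intro transpose_outside crossing_transpose_notin[OF i(1)]) (use ab li ri Di in auto)
qed

lemma cube_le:
  assumes "cube_on n v M g" "t \<in> M"
  shows "bruhat_le n t (g M)"
proof -
  note cD = cube_onD[OF assms(1)]
  have "bruhat_le n t (g (insert t X))" if "finite X" "X \<subseteq> M" for X
    using that
  proof (induction rule: finite_induct)
    case empty
    show ?case using cD(5)[OF assms(2)] bruhat_refl bruhat_le_Sym(1)[OF cD(3)[of "{t}"]] assms(2) by simp
  next
    case (insert x X)
    then have IH: "bruhat_le n t (g (insert t X))" by simp
    show ?case
    proof (cases "x = t")
      case False
      then have "(g (insert t X), g (insert x (insert t X))) \<in> bruhat_graph n"
        using insert assms(2) by (intro cD(4)) auto
      then show ?thesis using bruhat_trans[OF IH bruhat_edge_le] by (simp add: insert_commute)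
    qed (use IH in simp)
  qed
  from this[OF cD(1) subset_refl] show ?thesis using assms(2) by (simp add: insert_absorb)
qed

text \<open>Every cube over the maximal elements has the explicit top, which settles the definite
  description. The order condition required for this comes from \<open>rg_touching\<close> and
  \<open>not_both\<close>.\<close>

lemma cluster_top_eq:
  assumes Y: "Y \<subseteq> outside_nbrs n id v I id"
  shows "cluster_top n id v id Y = Theta la rb rg js Y" (is "_ = ?t")
    and "bruhat_le n (Theta la rb rg js Y) v" and "Y \<noteq> {} \<Longrightarrow> Theta la rb rg js Y \<notin> I"
proof -
  let ?M = "bruhat_maximal n Y"
  have MY: "?M \<subseteq> Y" by (auto simp: bruhat_maximal_def)
  have ac: "bruhat_antichain n ?M"
    unfolding bruhat_antichain_def bruhat_maximal_def bruhat_less_def by blast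
  have MC: "?M \<subseteq> Cs la rb js" and YC: "Y \<subseteq> Cs la rb js" using MY Y outside_eq by auto
  have ord: "if rg j then \<not> up v i (Suc j) else \<not> up (inv v) i (Suc j)"
    if "i \<in> set js" "j \<in> set js" "i < j" "rb i = la j" for i j
    using that not_both[of i j] rg_touching[of i j] unfolding set_js by auto
  have top: "g ?M = Theta la rb rg js Y" if "cube_on n v ?M g" "g {} = id" for g
  proof -
    have "g ?M = Theta la rb rg js ?M" by (rule cube_eq_Theta[OF sep MC ac that ord subset_refl])
    also have "\<dots> = Theta la rb rg js Y" by (rule Theta_maximal[OF sep YC])
    finally show ?thesis .
  qed
  obtain H t where H: "spanned_hypercube n id v id ?M t H"
    using cluster_unique[OF id_in_I _ ac] MY Y by blast
  obtain g where g: "cube_on n v ?M g" "g {} = id" "g ?M = t"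
    using spanned_hypercube_cube_on[OF H] by blast
  show "cluster_top n id v id Y = ?t"
    unfolding cluster_top_def
  proof (rule the_equality)
    have "t = ?t" using g(3) top[OF g(1,2)] by simp
    then show "\<exists>H. spanned_hypercube n id v id ?M ?t H" using H by blast
    fix t' assume "\<exists>H. spanned_hypercube n id v id ?M t' H"
    then obtain K where "spanned_hypercube n id v id ?M t' K" ..
    from spanned_hypercube_cube_on[OF this] show "t' = ?t" using top by blast
  qed
  show "bruhat_le n ?t v" using cube_onD(3)[OF g(1) subset_refl] top[OF g(1,2)] by simp
  assume "Y \<noteq> {}"
  \<comment> \<open>A member of greatest length is maximal. The top lies above it, and it is not in
    the lower set \<open>I\<close>.\<close>
  have finY: "finite Y" using finite_subset[OF YC] by (simp add: Cs_def finite_Cset)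
  have "Max (ninv n ` Y) \<in> ninv n ` Y" by (rule Max_in) (use finY \<open>Y \<noteq> {}\<close> in auto)
  then obtain y where y: "y \<in> Y" "ninv n y = Max (ninv n ` Y)" by auto
  have "\<not> bruhat_less n y y'" if "y' \<in> Y" for y'
  proof -
    have "ninv n y' \<le> ninv n y" unfolding y(2) by (rule Max_ge) (use finY that in auto)
    then show ?thesis using bruhat_less_ninv by (meson not_less)
  qed
  then have y: "y \<in> ?M" using y(1) by (auto simp: bruhat_maximal_def)
  then have "y \<notin> I" using MY Y by (auto simp: outside_iff)
  then show "?t \<notin> I" using cube_le[OF g(1) y] top[OF g(1,2)] I_down by metis
qed

text \<open>Expanding each \<open>P\<close> at a cube top by \<open>KL_bar\<close> and exchanging
  the sums reduces the claim to the coefficient of every \<open>P_{x,v}\<close>.\<close>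

lemma cluster_expansion:
  "qvar ^ len2 n id v * eval_at (KL_poly n id v) (inverse qvar) - eval_at (KL_poly n id v) qvar
     = N_term n id v I + Q_term n id v I"
proof -
  let ?S = "{x. bruhat_le n x v}" and ?C = "Cs la rb js"
  define P where "P = (\<lambda>x. eval_at (KL_poly n x v) qvar)"
  define R where "R = (\<lambda>u x. eval_at (Rp n u x) qvar)"
  have finS: "finite ?S" by (rule finite_subset[OF _ finite_Sym[of n]]) (auto dest: bruhat_le_Sym)
  have finC: "finite ?C" by (simp add: Cs_def finite_Cset)
  have IS: "I \<subseteq> ?S" using I_le by blast
  have idv: "bruhat_le n id v" by (rule bruhat_id_le[OF v])
  have len: "len2 n id v = ninv n v" using len2_eq[OF idv] by simp
  have bar: "qvar ^ ninv n v * eval_at (KL_poly n y v) (inverse qvar) = (\<Sum>x\<in>?S. W n x delta y * P x)"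
    if y: "bruhat_le n y v" for y
  proof -
    have "(\<Sum>x | bruhat_le n y x \<and> bruhat_le n x v. R y x * P x) = (\<Sum>x\<in>?S. R y x * P x)"
    proof (rule sum.mono_neutral_left[OF finS])
      show "\<forall>x\<in>?S - {x. bruhat_le n y x \<and> bruhat_le n x v}. R y x * P x = 0"
      proof
        fix x assume "x \<in> ?S - {x. bruhat_le n y x \<and> bruhat_le n x v}"
        then have "\<not> bruhat_le n y x" by blast
        then show "R y x * P x = 0" by (simp add: R_def Rp_zero)
      qed
    qed auto
    then have "qvar ^ ninv n v * eval_at (KL_poly n y v) (inverse qvar) = (\<Sum>x\<in>?S. qvar ^ ninv n y * (R y x * P x))"
      using KL_bar[OF y] unfolding R_def P_def by (simp only: sum_distrib_left)
    also have "\<dots> = (\<Sum>x\<in>?S. W n x delta y * P x)"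
    proof (rule sum.cong[OF refl])
      fix x assume "x \<in> ?S"
      then have "x \<in> Sym n" "y \<in> Sym n" using bruhat_le_Sym(1) y by blast+
      then show "qvar ^ ninv n y * (R y x * P x) = W n x delta y * P x"
        by (simp only: W_delta_eq R_def mult.assoc)
    qed
    finally show ?thesis .
  qed
  have Wid: "W n x delta id = R id x" if "x \<in> ?S" for x
  proof -
    have "x \<in> Sym n" using that bruhat_le_Sym(1) by blast
    from W_delta_eq[OF this id_Sym] show ?thesis unfolding R_def by (simp only: ninv_id power_0 mult_1_left)
  qed
  have idS: "id \<in> ?S" using idv by simp
  have "qvar ^ ninv n v * eval_at (KL_poly n id v) (inverse qvar) = (\<Sum>x\<in>?S. R id x * P x)"
    unfolding bar[OF idv] by (rule sum.cong[OF refl]) (simp only: Wid)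
  also have "\<dots> = R id id * P id + (\<Sum>x\<in>?S - {id}. R id x * P x)"
    by (rule sum.remove[OF finS idS])
  also have "R id id = 1" unfolding R_def Rp_self[OF id_Sym] by simp
  finally have L: "qvar ^ ninv n v * eval_at (KL_poly n id v) (inverse qvar) - P id = (\<Sum>x\<in>?S - {id}. R id x * P x)"
    by (simp only: mult_1_left add_diff_cancel_left')
  have "?S - {id} = (I - {id}) \<union> (?S - I)" using IS id_in_I by blast
  then have split: "(\<Sum>x\<in>?S - {id}. R id x * P x) = (\<Sum>x\<in>I - {id}. R id x * P x) + (\<Sum>x\<in>?S - I. R id x * P x)"
    using finS finite_subset[OF IS finS] by (simp only:) (rule sum.union_disjoint, auto)
  have N: "N_term n id v I = (\<Sum>x\<in>I - {id}. R id x * P x)"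
    unfolding N_term_def R_poly_eq R_def P_def ..
  let ?Y = "{Y. Y \<noteq> {} \<and> Y \<subseteq> ?C}"
  have YP: "Pow ?C = insert {} ?Y" "{} \<notin> ?Y" "finite ?Y" using finC by auto
  define f where "f = (\<lambda>x Y. cq ^ card Y * W n x delta (Theta la rb rg js Y))"
  \<comment> \<open>For \<open>x\<close> in \<open>I\<close> no top of a nonempty \<open>Y\<close>
    lies below \<open>x\<close>, so all terms vanish. For \<open>x\<close> outside \<open>I\<close>
    the trace argument kills the sum over all subsets, and the empty subset accounts for
    \<open>R id x\<close>.\<close>
  have inner: "(\<Sum>Y\<in>?Y. f x Y) = (if x \<in> I then 0 else - R id x)" if x: "x \<in> ?S" for x
  proof (cases "x \<in> I")
    case True
    have "f x Y = 0" if "Y \<in> ?Y" for Y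
    proof -
      have Y: "Y \<subseteq> outside_nbrs n id v I id" "Y \<noteq> {}" using that outside_eq by auto
      note t = cluster_top_eq(2,3)[OF Y(1)]
      have "\<not> bruhat_le n (Theta la rb rg js Y) x" using t(2)[OF Y(2)] I_down True by blast
      then have "Rp n (Theta la rb rg js Y) x = 0" by (rule Rp_zero)
      moreover have "x \<in> Sym n" "Theta la rb rg js Y \<in> Sym n" using x t(1) bruhat_le_Sym(1) by blast+
      ultimately show ?thesis unfolding f_def by (simp only: W_delta_eq eval_at_0 mult_zero_right)
    qed
    then show ?thesis using True by simp
  next
    case False
    obtain i where i: "i \<in> D" "up x i (Suc i)" using noncrossing_in[of x] False x by blast
    have "(\<Sum>Y\<in>Pow ?C. f x Y) = 0"
      unfolding f_def by (rule Theta_sum_zero[OF sep _ _ i(2)]) (use x i set_js in auto)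
    moreover have "f x {} = R id x"
      unfolding f_def using Theta_outside[of "{}" la rb js rg] Wid[OF x] by simp
    ultimately show ?thesis using False YP by (simp add: add_eq_0_iff2)
  qed
  have "Q_term n id v I = - (qvar ^ ninv n v) * (\<Sum>Y\<in>?Y. cq ^ card Y *
      eval_at (KL_poly n (cluster_top n id v id Y) v) (inverse qvar))"
    unfolding Q_term_def outside_eq len ..
  also have "\<dots> = - (\<Sum>Y\<in>?Y. cq ^ card Y * (qvar ^ ninv n v *
      eval_at (KL_poly n (cluster_top n id v id Y) v) (inverse qvar)))"
    by (simp only: sum_distrib_left mult.left_commute mult_minus_left sum_negf)
  also have "(\<Sum>Y\<in>?Y. cq ^ card Y * (qvar ^ ninv n v *
      eval_at (KL_poly n (cluster_top n id v id Y) v) (inverse qvar))) = (\<Sum>Y\<in>?Y. \<Sum>x\<in>?S. f x Y * P x)"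
  proof (rule sum.cong[OF refl])
    fix Y assume "Y \<in> ?Y"
    then have Y: "Y \<subseteq> outside_nbrs n id v I id" using outside_eq by auto
    show "cq ^ card Y * (qvar ^ ninv n v * eval_at (KL_poly n (cluster_top n id v id Y) v) (inverse qvar)) =
        (\<Sum>x\<in>?S. f x Y * P x)"
      unfolding cluster_top_eq(1)[OF Y] bar[OF cluster_top_eq(2)[OF Y]] f_def
      by (simp only: sum_distrib_left mult.assoc)
  qed
  also have "\<dots> = (\<Sum>x\<in>?S. (\<Sum>Y\<in>?Y. f x Y) * P x)"
    by (subst sum.swap) (simp only: sum_distrib_right)
  also have "\<dots> = (\<Sum>x\<in>?S. if x \<in> I then 0 else - (R id x * P x))"
    by (rule sum.cong[OF refl]) (simp add: inner)
  also have "\<dots> = (\<Sum>x\<in>?S - I. - (R id x * P x))"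
    by (rule sum.mono_neutral_cong_right[OF finS]) auto
  finally have Q: "Q_term n id v I = (\<Sum>x\<in>?S - I. R id x * P x)" by (simp only: sum_negf minus_minus)
  have "eval_at (KL_poly n id v) qvar = P id" unfolding P_def ..
  then show ?thesis unfolding len N Q split[symmetric] L[symmetric] by (simp only:)
qed

end

theorem theorem1p3:
  fixes n :: nat and v :: perm and I :: "perm set"
  assumes "v \<in> Sym n"
    and "hypercube_decomposition n id v I"
  shows "qvar ^ len2 n id v * eval_at (KL_poly n id v) (inverse qvar)
           - eval_at (KL_poly n id v) qvar
         = N_term n id v I + Q_term n id v I"
proof -
  interpret hd n v I by unfold_locales (fact assms)+
  show ?thesis by (rule cluster_expansion)
qed

end
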